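(* For every $\alpha>0$ there exists a universal differentiability set $E\subseteq\mathbb{R}^2$ with the following property. There exist a Lipschitz function $h:\mathbb{R}^2\to\mathbb{R}$ and a double sided cone $\widehat{C}\subseteq S^1$ of width at most $\alpha$ such that the set of points $z\in E$ for which there is at least one direction $v\in S^1\setminus\widehat{C}$ in which $h$ has a directional derivative at $z$ is contained in a purely unrectifiable set.
   Context: A set $E\subseteq\mathbb{R}^2$ is a universal differentiability set if every Lipschitz function $f:\mathbb{R}^2\to\mathbb{R}$ has a point of differentiability in $E$. For $w\in S^1$ and $\beta\in[0,1]$, the double sided cone around $w$ of width $\beta$ is $\widehat{C}(w,\beta)=\{v\in S^1: |\langle v,w\rangle|\ge 1-\beta\}$. The function $h$ has a directional derivative at $z$ in direction $v$ if the (two-sided) limit $\lim_{t\to0}(h(z+tv)-h(z))/t$ exists. A $\mathcal{C}^1$ curve is a $\mathcal{C}^1$ mapping $\gamma:I\to\mathbb{R}^2$ from a closed bounded interval $I$ with $|\gamma'(t)|=1$ for all $t\in I$. A Borel set $P\subseteq\mathbb{R}^2$ is purely unrectifiable if $\gamma^{-1}(P)$ has Lebesgue measure zero for every $\mathcal{C}^1$ curve $\gamma$. *)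

theory Defs
  imports "HOL-Analysis.Analysis"
begin

definition lipschitz_function :: "(real^2 \<Rightarrow> real) \<Rightarrow> bool" where
  "lipschitz_function f \<longleftrightarrow> (\<exists>L. L-lipschitz_on UNIV f)"

definition universal_differentiability_set :: "(real^2) set \<Rightarrow> bool" where
  "universal_differentiability_set E \<longleftrightarrow>
     (\<forall>f :: real^2 \<Rightarrow> real. lipschitz_function f \<longrightarrow> (\<exists>x\<in>E. f differentiable (at x)))"

definition double_cone :: "real^2 \<Rightarrow> real \<Rightarrow> (real^2) set" where
  "double_cone w \<beta> = {v \<in> sphere 0 1. \<bar>v \<bullet> w\<bar> \<ge> 1 - \<beta>}"

definition has_directional_derivative :: "(real^2 \<Rightarrow> real) \<Rightarrow> real^2 \<Rightarrow> real^2 \<Rightarrow> bool" where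
  "has_directional_derivative h z v \<longleftrightarrow>
     (\<exists>l. ((\<lambda>t::real. (h (z + t *\<^sub>R v) - h z) / t) \<longlongrightarrow> l) (at 0))"

(* Derivatives are taken within the interval, hence one-sided at the endpoints, so that
   the values of \<gamma> outside {a..b} are irrelevant (unlike in C1_differentiable_on). *)
definition C1_curve :: "real \<Rightarrow> real \<Rightarrow> (real \<Rightarrow> real^2) \<Rightarrow> bool" where
  "C1_curve a b \<gamma> \<longleftrightarrow> a < b \<and>
     (\<exists>\<gamma>'. (\<forall>t\<in>{a..b}. (\<gamma> has_vector_derivative \<gamma>' t) (at t within {a..b})) \<and>
           continuous_on {a..b} \<gamma>' \<and> (\<forall>t\<in>{a..b}. norm (\<gamma>' t) = 1))"

definition purely_unrectifiable :: "(real^2) set \<Rightarrow> bool" where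
  "purely_unrectifiable P \<longleftrightarrow> P \<in> sets borel \<and>
     (\<forall>a b \<gamma>. C1_curve a b \<gamma> \<longrightarrow> {t \<in> {a..b}. \<gamma> t \<in> P} \<in> null_sets lebesgue)"

end

theory Submission
  imports Defs "HOL-Analysis.Analysis"
begin

text \<open>
  The set \<open>E\<close> is an intersection of countably many open neighbourhoods of the rational lines
  \<open>y = a * x + b\<close> with small \<open>\<bar>a\<bar>\<close>. It is a universal differentiability set by the argument of Preiss:
  almost maximize the derivative along such lines, penalizing changes of direction, while shrinking
  balls force the limit point into all neighbourhoods. If the function were not differentiable there, a
  slightly tilted path would produce a larger derivative.

  The function is a sum of infinitely many waves of rapidly decreasing width across the rational lines. A point
  of \<open>E\<close> is hit by infinitely many waves, and each of them changes the difference quotient in every direction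
  transversal to the line by a fixed amount, so there is no directional derivative outside the cone. To keep the
  function Lipschitz, a wave is switched off where the accumulated gradient \<open>(p, q)\<close> is too large. Each wave
  changes \<open>(p, q)\<close> by a multiple of the normal of its line, and \<open>q\<close> oscillates in \<open>[0, 1]\<close>, so \<open>p\<close> could
  grow because of the varying slopes. The set where this happens is purely unrectifiable: a steep curve is hit by
  infinitely many waves only on a null set by the lemma of Borel and Cantelli, and along a flat curve of slope
  \<open>m\<close> an energy estimate shows that \<open>p + q * m\<close> is small in the mean square.
\<close>

section \<open>Lipschitz functions on the line\<close>

text \<open>The energy estimate for one family of waves leaves a positive remainder. The exceptional
  set asks for a large \<open>p\<close> infinitely often at every label, so \<open>j\<close> may be
  chosen after the curve and the tolerance. Outside that set some label has a moderate
  \<open>p\<close> from some step on, and one such label destroys the directional derivatives,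
  because at the two scales compared at a hit all other waves cancel or are negligible.

  A second obstacle is that the energy controls each fixed step, while the exceptional set is a
  limit superior. The sum of the waves of one label is Lipschitz along the curve, hence
  differentiable at almost every time, which makes \<open>p + q * m\<close> converge. Being large
  infinitely often thus becomes being large from some step on, and this Chebyshev's inequality can
  measure. The oscillation of the slope enters squared times the length, so it disappears under
  subdivision of the curve.\<close>

lemma bilipschitz_density:
  fixes F :: "real \<Rightarrow> real"
  assumes c: "c > 0" and lo: "\<And>x y. x \<le> y \<Longrightarrow> c * (y - x) \<le> F y - F x"
    and up: "\<And>x y. x \<le> y \<Longrightarrow> F y - F x \<le> C * (y - x)"
  obtains \<rho> :: "real \<Rightarrow> real" where "\<And>a b. a \<le> b \<Longrightarrow> (\<rho> has_integral (F b - F a)) {a..b}"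
proof -
  have sm: "strict_mono F"
  proof (rule strict_monoI)
    fix x y :: real assume "x < y"
    then show "F x < F y" using lo[of x y] c mult_pos_pos[of c "y - x"] by linarith
  qed
  have C: "C > 0" using lo[of 0 1] up[of 0 1] c by simp
  have lipF: "\<bar>F y - F x\<bar> \<le> C * \<bar>y - x\<bar>" for x y
  proof -
    have *: "\<bar>F v - F u\<bar> \<le> C * \<bar>v - u\<bar>" if "u \<le> v" for u v
    proof -
      have "0 \<le> c * (v - u)" using that c by simp
      then show ?thesis using lo[OF that] up[OF that] that by simp
    qed
    show ?thesis using *[of x y] *[of y x] by (cases "x \<le> y") (auto simp: abs_minus_commute)
  qed
  have contF: "continuous_on UNIV F"
    by (rule lipschitz_on_continuous_on[of C]) (use C lipF in \<open>auto simp: lipschitz_on_def dist_real_def\<close>)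
  have surjF: "\<exists>x. F x = y" for y
  proof -
    define r where "r = (\<bar>y\<bar> + \<bar>F 0\<bar>) / c"
    have r0: "r \<ge> 0" using c by (simp add: r_def)
    have cr: "c * r = \<bar>y\<bar> + \<bar>F 0\<bar>" using c by (simp add: r_def)
    have "y \<le> F r" using lo[of 0 r] cr r0 by simp
    moreover have "F (- r) \<le> y" using lo[of "- r" 0] cr r0 by simp
    ultimately show ?thesis
      using IVT'[of F "- r" y r] r0 continuous_on_subset[OF contF] by auto
  qed
  define G where "G = inv F"
  have injF: "inj F" using sm strict_mono_imp_inj_on by blast
  have FG: "F (G y) = y" for y unfolding G_def using surjF by (metis f_inv_into_f rangeI)
  have GF: "G (F x) = x" for x unfolding G_def using injF by simp
  have smG: "mono G" by (metis FG monoI linorder_le_less_linear nless_le order.asym sm strict_mono_less)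
  have Gm: "G \<in> borel_measurable borel" using smG by (simp add: borel_measurable_mono)
  \<comment> \<open>This measure gives \<open>{a..b}\<close> the length of
    \<open>{F a..F b}\<close>, so its density is the wanted \<open>\<rho>\<close>. The preimage of a
    null set under \<open>G\<close> is its image under \<open>F\<close>, which is null because
    \<open>F\<close> is Lipschitz; hence the Radon-Nikodym theorem applies.\<close>
  define N where "N = distr lborel borel G"
  have Nac: "absolutely_continuous lborel N"
    unfolding absolutely_continuous_def
  proof
    fix A :: "real set" assume A: "A \<in> null_sets lborel"
    then have Ab: "A \<in> sets borel" by auto
    have negA: "negligible A" using A by (simp add: negligible_iff_null_sets null_sets_completionI)
    have img: "G -` A = F ` A" using FG GF by (auto simp: image_iff) (metis FG)
    have "negligible (F ` A)"
    proof (rule negligible_locally_Lipschitz_image[OF _ negA])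
      fix x assume "x \<in> A"
      show "\<exists>T B. open T \<and> x \<in> T \<and> (\<forall>y\<in>A \<inter> T. norm (F y - F x) \<le> B * norm (y - x))"
        using lipF by (intro exI[of _ UNIV] exI[of _ C]) auto
    qed simp
    then have "G -` A \<in> null_sets lborel"
      using img measurable_sets[OF Gm Ab] by (simp add: negligible_iff_null_sets null_sets_completion_iff)
    then show "A \<in> null_sets N" using Ab Gm by (auto simp: N_def null_sets_distr_iff)
  qed
  obtain f where f: "f \<in> borel_measurable lborel" "density lborel f = N"
    using sigma_finite_measure.Radon_Nikodym[OF sigma_finite_lborel Nac] by (auto simp: N_def)
  have emN: "(\<integral>\<^sup>+x\<in>{a..b}. f x \<partial>lborel) = ennreal (F b - F a)" if "a \<le> b" for a b
  proof -
    have pre: "G -` {a..b} = {F a..F b}"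
      using FG GF smG by (auto simp: mono_def) (metis FG sm strict_mono_less_eq)+
    have "(\<integral>\<^sup>+x\<in>{a..b}. f x \<partial>lborel) = emeasure (density lborel f) {a..b}"
      using f by (subst emeasure_density) auto
    also have "\<dots> = emeasure lborel (G -` {a..b})" using f(2) Gm by (simp add: N_def emeasure_distr)
    also have "\<dots> = ennreal (F b - F a)"
      using that sm by (simp add: pre strict_mono_less_eq)
    finally show ?thesis .
  qed
  define \<rho> where "\<rho> = (\<lambda>x. enn2real (f x))"
  have \<rho>m: "\<rho> \<in> borel_measurable borel" unfolding \<rho>_def using f(1) by simp
  show ?thesis
  proof (rule that[of \<rho>])
    fix a b :: real assume ab: "a \<le> b"
    have Fab: "F a \<le> F b" using sm ab by (simp add: strict_mono_less_eq)
    have "AE x in lborel. f x * indicator {a..b} x \<noteq> \<infinity>"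
      by (rule nn_integral_noteq_infinite) (use f(1) emN[OF ab] in auto)
    then have "(\<integral>\<^sup>+x. ennreal (\<rho> x * indicator {a..b} x) \<partial>lborel) = (\<integral>\<^sup>+x\<in>{a..b}. f x \<partial>lborel)"
      by (intro nn_integral_cong_AE) (auto simp: \<rho>_def indicator_def less_top)
    then have "(\<integral>\<^sup>+x. ennreal (\<rho> x * indicator {a..b} x) \<partial>lborel) = ennreal (F b - F a)"
      using emN[OF ab] by simp
    then have "((\<lambda>x. \<rho> x * indicator {a..b} x) has_integral (F b - F a)) UNIV"
      by (intro nn_integral_has_integral) (use \<rho>m Fab in \<open>auto simp: \<rho>_def\<close>)
    moreover have "(\<lambda>x. \<rho> x * indicator {a..b} x) = (\<lambda>x. if x \<in> {a..b} then \<rho> x else 0)"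
      by (auto simp: indicator_def)
    ultimately show "(\<rho> has_integral (F b - F a)) {a..b}"
      by (simp only: has_integral_restrict_UNIV)
  qed
qed

text \<open>Lebesgue's differentiation theorem on the boxes \<open>cbox x (x + h)\<close> sees only
  points to the right of \<open>x\<close>. The left derivative is recovered in the next lemma from
  the reflected function.\<close>

lemma integral_right_derivative_ae:
  fixes \<rho> g :: "real \<Rightarrow> real"
  assumes I: "\<And>a b. a \<le> b \<Longrightarrow> (\<rho> has_integral (g b - g a)) {a..b}"
  obtains N where "negligible N" "\<And>x. x \<notin> N \<Longrightarrow> (g has_real_derivative \<rho> x) (at_right x)"
proof -
  have "\<rho> integrable_on cbox a b" for a b
    using I[of a b] by (cases "a \<le> b") (auto simp: integrable_on_def)
  from integrable_ccontinuous_explicit[OF this]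
  obtain N where N: "negligible N" and
    q: "\<And>x e. \<lbrakk>x \<notin> N; 0 < e\<rbrakk> \<Longrightarrow> \<exists>d>0. \<forall>h. 0 < h \<and> h < d \<longrightarrow>
          norm (integral (cbox x (x + h *\<^sub>R One)) \<rho> /\<^sub>R h ^ DIM(real) - \<rho> x) < e" by metis
  show ?thesis
  proof (rule that[OF N])
    fix x assume x: "x \<notin> N"
    have "((\<lambda>y. (g y - g x) / (y - x)) \<longlongrightarrow> \<rho> x) (at_right x)"
    proof (rule tendstoI)
      fix e :: real assume "e > 0"
      from q[OF x this] obtain d where d: "d > 0"
        "\<And>h. 0 < h \<and> h < d \<Longrightarrow> norm (integral {x..x+h} \<rho> /\<^sub>R h - \<rho> x) < e" by auto
      have "dist ((g y - g x) / (y - x)) (\<rho> x) < e" if "x < y" "y < x + d" for y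
        using d(2)[of "y - x"] that integral_unique[OF I[of x y]]
        by (simp add: dist_real_def divide_inverse mult.commute)
      then show "\<forall>\<^sub>F y in at_right x. dist ((g y - g x) / (y - x)) (\<rho> x) < e"
        unfolding eventually_at_right_field using d(1) by (intro exI[of _ "x + d"]) auto
    qed
    then show "(g has_real_derivative \<rho> x) (at_right x)"
      by (simp add: has_field_derivative_iff)
  qed
qed

text \<open>Adding \<open>(L + 1) * x\<close> makes \<open>g\<close> bi-Lipschitz, so that it is the
  integral of a density; differentiating for \<open>g\<close> and for its reflection gives the two
  one-sided derivatives. On the exceptional set \<open>\<rho>\<close> is put to 0, so that the bound
  \<open>L\<close> holds at every point.\<close>

lemma lipschitz_real_derivative:
  fixes g :: "real \<Rightarrow> real"
  assumes lip: "\<And>x y. \<bar>g y - g x\<bar> \<le> L * \<bar>y - x\<bar>"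
  obtains \<rho> N where "\<And>a b. a \<le> b \<Longrightarrow> (\<rho> has_integral (g b - g a)) {a..b}"
    "\<And>x. \<bar>\<rho> x\<bar> \<le> L" "negligible N" "\<And>x. x \<notin> N \<Longrightarrow> (g has_real_derivative \<rho> x) (at x)"
proof -
  have L: "L \<ge> 0" using lip[of 0 1] by simp
  define F where "F = (\<lambda>x. g x + (L + 1) * x)"
  have lip': "g y - g x \<le> L * (y - x)" "g x - g y \<le> L * (y - x)" if "x \<le> y" for x y
    using lip[of y x] that by (auto simp: abs_le_iff)
  obtain r where r: "\<And>a b. a \<le> b \<Longrightarrow> (r has_integral (F b - F a)) {a..b}"
  proof (rule bilipschitz_density[of 1 F "2*L+1"])
    fix x y :: real assume "x \<le> y"
    then show "1 * (y - x) \<le> F y - F x" "F y - F x \<le> (2*L+1) * (y - x)"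
      using lip'[of x y] by (auto simp: F_def algebra_simps)
  qed auto
  define s where "s = (\<lambda>x. r x - (L + 1))"
  have s: "(s has_integral (g b - g a)) {a..b}" if "a \<le> b" for a b
  proof -
    have "((\<lambda>x. L + 1) has_integral (b - a) * (L + 1)) {a..b}"
      using has_integral_const_real[of "L+1" a b] that by simp
    from has_integral_diff[OF r[OF that] this] show ?thesis
      unfolding s_def by (simp add: F_def algebra_simps)
  qed
  obtain N1 where N1: "negligible N1" "\<And>x. x \<notin> N1 \<Longrightarrow> (g has_real_derivative s x) (at_right x)"
    using integral_right_derivative_ae[OF s] by blast
  have s': "((\<lambda>x. - s (- x)) has_integral (g (- b) - g (- a))) {a..b}" if "a \<le> b" for a b
    using s[of "-b" "-a"] that
    by (subst has_integral_reflect_real[symmetric]) (auto simp: has_integral_neg_iff dest: has_integral_neg)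
  obtain N2 where N2: "negligible N2"
      "\<And>x. x \<notin> N2 \<Longrightarrow> ((\<lambda>x. g (- x)) has_real_derivative - s (- x)) (at_right x)"
    using integral_right_derivative_ae[of "\<lambda>x. - s (- x)" "\<lambda>x. g (- x)"] s' by blast
  define N where "N = N1 \<union> uminus ` N2"
  have "negligible (uminus ` N2)"
  proof (rule negligible_locally_Lipschitz_image[OF _ N2(1)])
    show "\<exists>T B. open T \<and> x \<in> T \<and> (\<forall>y\<in>N2 \<inter> T. norm (- y - - x) \<le> B * norm (y - x))" for x
      by (intro exI[of _ UNIV] exI[of _ 1]) auto
  qed simp
  then have N: "negligible N" unfolding N_def using N1(1) by auto
  have der: "(g has_real_derivative s x) (at x)" if "x \<notin> N" for x
  proof -
    have 1: "(g has_real_derivative s x) (at_right x)" using that N1 by (auto simp: N_def)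
    have "-x \<notin> N2" using that by (auto simp: N_def) (metis add.inverse_inverse imageI)
    from N2(2)[OF this] have *: "((\<lambda>x. g (- x)) has_real_derivative - s x) (at_right (-x))" by simp
    have "(g has_real_derivative s x) (at_left x)"
    proof -
      have "((\<lambda>y. (g (- y) - g x) / (y + x)) \<longlongrightarrow> - s x) (at_right (-x))"
        using * by (simp add: has_field_derivative_iff)
      then have "((\<lambda>y. (g (- (- y)) - g x) / (- y + x)) \<longlongrightarrow> - s x) (at_left x)"
        unfolding at_left_minus[of x] filterlim_filtermap by simp
      then have "((\<lambda>y. - ((g y - g x) / (- y + x))) \<longlongrightarrow> - (- s x)) (at_left x)"
        by (intro tendsto_minus) simp
      moreover have "(\<lambda>y. - ((g y - g x) / (- y + x))) = (\<lambda>y. (g y - g x) / (y - x))"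
        by (rule ext) (metis minus_diff_eq minus_divide_right add.commute uminus_add_conv_diff)
      ultimately show ?thesis by (simp add: has_field_derivative_iff)
    qed
    with 1 show ?thesis
      unfolding has_field_derivative_iff using filterlim_split_at by blast
  qed
  have bd: "\<bar>s x\<bar> \<le> L" if "x \<notin> N" for x
  proof -
    have "((\<lambda>y. (g y - g x) / (y - x)) \<longlongrightarrow> s x) (at x)"
      using der[OF that] by (simp add: has_field_derivative_iff)
    then have "((\<lambda>y. \<bar>(g y - g x) / (y - x)\<bar>) \<longlongrightarrow> \<bar>s x\<bar>) (at x)" by (rule tendsto_rabs)
    then show ?thesis
    proof (rule tendsto_upperbound)
      show "\<forall>\<^sub>F y in at x. \<bar>(g y - g x) / (y - x)\<bar> \<le> L"
        using lip by (intro always_eventually) (auto simp: abs_divide divide_simps L)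
    qed simp
  qed
  define \<rho> where "\<rho> = (\<lambda>x. if x \<in> N then 0 else s x)"
  show ?thesis
  proof (rule that[of \<rho> N])
    show "(\<rho> has_integral (g b - g a)) {a..b}" if "a \<le> b" for a b
      by (rule has_integral_spike[OF N _ s[OF that]]) (auto simp: \<rho>_def)
  qed (use bd L der N in \<open>auto simp: \<rho>_def\<close>)
qed

text \<open>The weak type inequality for the Hardy-Littlewood maximal function. A point
  \<open>s\<close> of \<open>S\<close> carries a ball of radius \<open>\<bar>t\<bar>\<close> on
  which the integral of \<open>\<bar>\<rho>\<bar>\<close> is at least
  \<open>\<mu> * \<bar>t\<bar>\<close>. Vitali's lemma selects disjoint balls whose fivefold
  enlargements, of length \<open>10 * \<bar>t\<bar>\<close>, cover \<open>S\<close>; the bound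
  \<open>B\<close> on \<open>g\<close> is what bounds the radii.\<close>

lemma weak_type_maximal:
  fixes g \<rho> :: "real \<Rightarrow> real"
  assumes hi: "\<And>a b. a \<le> b \<Longrightarrow> (\<rho> has_integral (g b - g a)) {a..b}"
    and ai: "\<rho> absolutely_integrable_on UNIV"
    and bd: "\<And>x. \<bar>g x\<bar> \<le> B" and mu: "\<mu> > 0"
  defines "S \<equiv> {s. \<exists>t. \<bar>g (s + t) - g s\<bar> > \<mu> * \<bar>t\<bar>}"
  shows "S \<in> lmeasurable" "measure lebesgue S \<le> 10 / \<mu> * integral UNIV (\<lambda>x. \<bar>\<rho> x\<bar>)"
proof -
  let ?V = "integral UNIV (\<lambda>x. \<bar>\<rho> x\<bar>)"
  have ai': "\<rho> absolutely_integrable_on A" if "A \<in> sets lebesgue" for A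
    by (rule set_integrable_subset[OF ai that]) auto
  have absint: "(\<lambda>x. \<bar>\<rho> x\<bar>) integrable_on A" if "A \<in> sets lebesgue" for A
    using ai'[OF that] by (simp add: absolutely_integrable_on_def)
  have gle: "\<bar>g b - g a\<bar> \<le> integral {a..b} (\<lambda>x. \<bar>\<rho> x\<bar>)" if "a \<le> b" for a b
  proof -
    have "norm (integral {a..b} \<rho>) \<le> integral {a..b} (\<lambda>x. \<bar>\<rho> x\<bar>)"
      by (rule integral_norm_bound_integral) (use hi[OF that] absint in \<open>auto simp: integrable_on_def\<close>)
    then show ?thesis using integral_unique[OF hi[OF that]] by simp
  qed
  have contg: "continuous_on UNIV g"
  proof -
    have "continuous_on {a..b} g" for a b
    proof (cases "a \<le> b")
      case True
      have "continuous_on {a..b} (\<lambda>x. integral {a..x} \<rho>)"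
        by (rule indefinite_integral_continuous_1) (use hi[OF True] in \<open>auto simp: integrable_on_def\<close>)
      then have "continuous_on {a..b} (\<lambda>x. g a + integral {a..x} \<rho>)" by (intro continuous_intros)
      then show ?thesis
        by (rule continuous_on_eq) (use integral_unique[OF hi] in auto)
    qed auto
    then have "continuous (at x) g" for x
      using continuous_on_interior[of "{x-1..x+1}" g x] by simp
    then show ?thesis by (simp add: continuous_at_imp_continuous_on)
  qed
  have "open S"
  proof -
    have "S = (\<Union>t. {s. \<bar>g (s + t) - g s\<bar> > \<mu> * \<bar>t\<bar>})" by (auto simp: S_def)
    moreover have "open {s. \<bar>g (s + t) - g s\<bar> > \<mu> * \<bar>t\<bar>}" for t
      by (intro open_Collect_less continuous_intros continuous_on_compose2[OF contg]) auto
    ultimately show ?thesis by auto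
  qed
  then have Sm: "S \<in> sets lebesgue" by simp
  define t where "t s = (SOME t. \<bar>g (s + t) - g s\<bar> > \<mu> * \<bar>t\<bar>)" for s
  have t: "\<bar>g (s + t s) - g s\<bar> > \<mu> * \<bar>t s\<bar>" if "s \<in> S" for s
    unfolding t_def using that by (auto simp: S_def intro: someI_ex)
  have tpos: "0 < \<bar>t s\<bar> \<and> \<bar>t s\<bar> \<le> 2 * B / \<mu>" if "s \<in> S" for s
    using t[OF that] bd[of "s + t s"] bd[of s] mu by (auto simp: field_simps)
  have tint: "\<mu> * \<bar>t s\<bar> \<le> integral (cball s \<bar>t s\<bar>) (\<lambda>x. \<bar>\<rho> x\<bar>)" if "s \<in> S" for s
  proof -
    have "\<bar>g (s + t s) - g s\<bar> \<le> integral {min s (s + t s)..max s (s + t s)} (\<lambda>x. \<bar>\<rho> x\<bar>)"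
      using gle[of s "s + t s"] gle[of "s + t s" s] by (cases "t s \<ge> 0") (auto simp: abs_minus_commute)
    also have "\<dots> \<le> integral (cball s \<bar>t s\<bar>) (\<lambda>x. \<bar>\<rho> x\<bar>)"
      by (intro integral_subset_le absint) (auto simp: dist_real_def)
    finally show ?thesis using t[OF that] by simp
  qed
  obtain C where C: "countable C" "C \<subseteq> S"
     "pairwise (\<lambda>i j. disjnt (cball i \<bar>t i\<bar>) (cball j \<bar>t j\<bar>)) C"
     "S \<subseteq> (\<Union>i\<in>C. cball i (5 * \<bar>t i\<bar>))"
    by (rule Vitali_covering_lemma_cballs[where S = S and K = S and a = "\<lambda>x. x" and r = "\<lambda>s. \<bar>t s\<bar>" and B = "2 * B / \<mu>"]) (use tpos in auto)
  have fin: "measure lebesgue (\<Union>i\<in>F. cball i (5 * \<bar>t i\<bar>)) \<le> 10 / \<mu> * ?V"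
    if F: "F \<subseteq> C" "finite F" for F
  proof -
    have "measure lebesgue (\<Union>i\<in>F. cball i (5 * \<bar>t i\<bar>)) \<le> (\<Sum>i\<in>F. measure lebesgue (cball i (5 * \<bar>t i\<bar>)))"
      using F by (intro measure_UNION_le) auto
    also have "\<dots> = (\<Sum>i\<in>F. 10 * \<bar>t i\<bar>)" by (simp add: cball_eq_atLeastAtMost)
    also have "\<dots> \<le> (\<Sum>i\<in>F. 10 / \<mu> * integral (cball i \<bar>t i\<bar>) (\<lambda>x. \<bar>\<rho> x\<bar>))"
    proof (rule sum_mono)
      fix i assume "i \<in> F"
      then have "i \<in> S" using F C by auto
      from tint[OF this] mu show "10 * \<bar>t i\<bar> \<le> 10 / \<mu> * integral (cball i \<bar>t i\<bar>) (\<lambda>x. \<bar>\<rho> x\<bar>)"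
        by (simp add: field_simps)
    qed
    also have "\<dots> = 10 / \<mu> * (\<Sum>i\<in>F. integral (cball i \<bar>t i\<bar>) (\<lambda>x. \<bar>\<rho> x\<bar>))"
      by (simp add: sum_distrib_left)
    also have "(\<Sum>i\<in>F. integral (cball i \<bar>t i\<bar>) (\<lambda>x. \<bar>\<rho> x\<bar>)) = integral (\<Union>i\<in>F. cball i \<bar>t i\<bar>) (\<lambda>x. \<bar>\<rho> x\<bar>)"
    proof -
      have "((\<lambda>x. \<bar>\<rho> x\<bar>) has_integral (\<Sum>i\<in>F. integral (cball i \<bar>t i\<bar>) (\<lambda>x. \<bar>\<rho> x\<bar>))) (\<Union>i\<in>F. cball i \<bar>t i\<bar>)"
      proof (rule has_integral_UN)
        show "pairwise (\<lambda>i i'. negligible (cball i \<bar>t i\<bar> \<inter> cball i' \<bar>t i'\<bar>)) F"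
          using pairwise_subset[OF C(3) F(1)] by (auto simp: pairwise_def disjnt_def)
      qed (use F absint in \<open>auto simp: integrable_integral\<close>)
      then show ?thesis by (rule integral_unique[symmetric])
    qed
    also have "\<dots> \<le> ?V"
      by (intro integral_subset_le absint) (use F in auto)
    finally show ?thesis using mu by (simp add: divide_right_mono mult_left_mono)
  qed
  have U: "(\<Union>i\<in>C. cball i (5 * \<bar>t i\<bar>)) \<in> lmeasurable"
       "measure lebesgue (\<Union>i\<in>C. cball i (5 * \<bar>t i\<bar>)) \<le> 10 / \<mu> * ?V"
    using fmeasurable_UN_bound[OF C(1) _ fin] measure_UN_bound[OF C(1) _ fin] by auto
  show "S \<in> lmeasurable" using fmeasurableI2[OF U(1) C(4) Sm] .
  show "measure lebesgue S \<le> 10 / \<mu> * ?V"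
    using measure_mono_fmeasurable[OF C(4) Sm U(1)] U(2) by linarith
qed

text \<open>Otherwise, at almost every point outside \<open>S\<close> where the derivative exceeds
  \<open>\<eta>\<close>, it would be less than \<open>(M / K)^2\<close> with \<open>M\<close> the
  largest difference quotient there. The weak type inequality, summed over dyadic levels of
  \<open>M\<close>, bounds the integral of this majorant by \<open>V / 8\<close>, where
  \<open>V\<close> is the total variation. But the positive part of the derivative has integral
  \<open>V / 2\<close>, which is at least \<open>\<bar>g \<xi>\<bar>\<close>.\<close>

lemma steep_point:
  fixes g :: "real \<Rightarrow> real"
  assumes lip: "\<And>x y. \<bar>g y - g x\<bar> \<le> L * \<bar>y - x\<bar>" and L: "L > 0"
    and zero: "\<And>s. \<bar>s\<bar> \<ge> R \<Longrightarrow> g s = 0" and R: "R > 0" and eta: "\<eta> > 0"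
    and K: "K > 0" "K\<^sup>2 \<ge> 320 * L"
    and S: "S \<in> lmeasurable" and xi: "\<bar>g \<xi>\<bar> > 8 * \<eta> * R + 2 * L * measure lebesgue S"
  obtains s D where "s \<notin> S" "\<bar>s\<bar> < R" "(g has_real_derivative D) (at s)" "D > \<eta>"
    "\<And>t. \<bar>g (s + t) - g s\<bar> \<le> K * sqrt D * \<bar>t\<bar>"
proof (rule ccontr)
  assume "\<not> thesis"
  with that have no: "\<And>s D. \<lbrakk>s \<notin> S; \<bar>s\<bar> < R; (g has_real_derivative D) (at s); D > \<eta>\<rbrakk>
      \<Longrightarrow> \<exists>t. \<bar>g (s + t) - g s\<bar> > K * sqrt D * \<bar>t\<bar>"
    by (meson not_le)
  obtain r N where r: "\<And>a b. a \<le> b \<Longrightarrow> (r has_integral (g b - g a)) {a..b}"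
    "\<And>x. \<bar>r x\<bar> \<le> L" "negligible N" "\<And>x. x \<notin> N \<Longrightarrow> (g has_real_derivative r x) (at x)"
    by (rule lipschitz_real_derivative[of g L]) (use lip in blast)+
  define \<rho> where "\<rho> = (\<lambda>x. if \<bar>x\<bar> \<le> R then r x else 0)"
  have out: "r x = 0" if "\<bar>x\<bar> > R" "x \<notin> N" for x
  proof -
    have "((\<lambda>x. 0) has_real_derivative r x) (at x)"
    proof (rule DERIV_cong_ev[THEN iffD1, OF refl _ refl r(4)[OF that(2)]])
      have "open {x::real. \<bar>x\<bar> > R}" by (intro open_Collect_less continuous_intros)
      then show "\<forall>\<^sub>F x in nhds x. g x = 0"
        using that zero by (auto simp: eventually_nhds intro!: exI[of _ "{x. \<bar>x\<bar> > R}"])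
    qed
    then show ?thesis using DERIV_unique[OF _ DERIV_const[of 0]] by blast
  qed
  have hi: "(\<rho> has_integral (g b - g a)) {a..b}" if "a \<le> b" for a b
    by (rule has_integral_spike[OF r(3) _ r(1)[OF that]]) (use out in \<open>auto simp: \<rho>_def\<close>)
  have "r absolutely_integrable_on {-R..R}"
    by (rule absolutely_integrable_integrable_bound[where g="\<lambda>_. L"])
       (use r(1)[of "-R" R] r(2) R in \<open>auto simp: integrable_on_def intro: integrable_const_ivl\<close>)
  then have ai: "\<rho> absolutely_integrable_on UNIV"
  proof -
    assume "r absolutely_integrable_on {-R..R}"
    then have "(\<lambda>x. if x \<in> {-R..R} then r x else 0) absolutely_integrable_on UNIV"
      by (simp only: absolutely_integrable_restrict_UNIV)
    moreover have "(\<lambda>x. if x \<in> {-R..R} then r x else 0) = \<rho>" by (auto simp: \<rho>_def abs_le_iff)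
    ultimately show ?thesis by simp
  qed
  define V where "V = integral UNIV (\<lambda>x. \<bar>\<rho> x\<bar>)"
  have absint: "(\<lambda>x. \<bar>\<rho> x\<bar>) integrable_on UNIV" using ai by (simp add: absolutely_integrable_on_def)
  have hU: "(\<rho> has_integral 0) UNIV"
  proof -
    have "((\<lambda>x. if x \<in> {-R..R} then \<rho> x else 0) has_integral (g R - g (-R))) UNIV"
      using hi[of "-R" R] R by (simp only: has_integral_restrict_UNIV)
    moreover have "(\<lambda>x. if x \<in> {-R..R} then \<rho> x else 0) = \<rho>" by (auto simp: \<rho>_def abs_le_iff)
    ultimately show ?thesis using zero[of R] zero[of "-R"] R by simp
  qed
  \<comment> \<open>The derivative has integral 0, so its positive part accounts for exactly half of
    the total variation.\<close>
  have half: "((\<lambda>x. (\<bar>\<rho> x\<bar> + \<rho> x) / 2) has_integral (V / 2)) UNIV"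
    using has_integral_divide[OF has_integral_add[OF integrable_integral[OF absint] hU], of 2] by (simp add: V_def)
  have gV: "\<bar>g \<xi>\<bar> \<le> V / 2"
  proof (cases "\<bar>\<xi>\<bar> < R")
    case False then show ?thesis using zero[of \<xi>] absint by (simp add: V_def integral_nonneg)
  next
    case True
    have *: "g b - g a \<le> V / 2" if "a \<le> b" for a b
    proof -
      have "g b - g a \<le> integral {a..b} (\<lambda>x. (\<bar>\<rho> x\<bar> + \<rho> x) / 2)"
        using hi[OF that] has_integral_integrable[OF half]
        by (intro has_integral_le[OF hi[OF that] integrable_integral])
           (auto intro: integrable_on_subinterval)
      also have "\<dots> \<le> integral UNIV (\<lambda>x. (\<bar>\<rho> x\<bar> + \<rho> x) / 2)"
        using has_integral_integrable[OF half]
        by (intro integral_subset_le) (auto intro: integrable_on_subinterval)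
      finally show ?thesis using integral_unique[OF half] by simp
    qed
    have "-R \<le> \<xi>" "\<xi> \<le> R" using True by auto
    then show ?thesis using *[of "-R" \<xi>] *[of \<xi> R] zero[of R] zero[of "-R"] R by (auto intro!: abs_leI)
  qed
  define B where "B i = {s. \<exists>t. \<bar>g (s + t) - g s\<bar> > L / 2 ^ (Suc i) * \<bar>t\<bar>}" for i :: nat
  have gbd: "\<bar>g x\<bar> \<le> L * R" for x
  proof (cases "\<bar>x\<bar> < R")
    case True
    then show ?thesis using lip[of x R] lip[of x "-R"] zero[of R] zero[of "-R"] R L
      by (cases "x \<ge> 0") (auto simp: abs_if algebra_simps split: if_splits intro: order_trans)
  qed (use zero L R in auto)
  have Bm: "B i \<in> lmeasurable" "measure lebesgue (B i) \<le> 10 / (L / 2 ^ Suc i) * V" for i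
    unfolding B_def V_def using weak_type_maximal[OF hi ai gbd, of "L / 2 ^ Suc i"] L by auto
  \<comment> \<open>From level \<open>I\<close> on the bound for the derivative falls below
    \<open>\<eta>\<close>, so finitely many dyadic levels cover all points in question.\<close>
  obtain I where I: "L\<^sup>2 / K\<^sup>2 / 4 ^ Suc I < \<eta>"
  proof -
    obtain n where "L\<^sup>2 / K\<^sup>2 / \<eta> < 4 ^ n" using real_arch_pow[of 4] by auto
    also have "(4::real) ^ n \<le> 4 ^ Suc n" by simp
    finally have "L\<^sup>2 / K\<^sup>2 < 4 ^ Suc n * \<eta>" using eta pos_divide_less_eq by blast
    then have "L\<^sup>2 / K\<^sup>2 / 4 ^ Suc n < \<eta>"
      by (subst pos_divide_less_eq) (simp_all add: mult.commute)
    then show ?thesis by (rule that)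
  qed
  define c where "c i = L\<^sup>2 / K\<^sup>2 / 4 ^ i" for i :: nat
  have cpos: "c i \<ge> 0" for i by (simp add: c_def)
  \<comment> \<open>A majorant of the positive part of the derivative: \<open>\<eta>\<close> where
    the derivative is small, \<open>L\<close> on the excluded set, and
    \<open>c i = (L / 2 ^ i)^2 / K^2\<close> where the critical quotient \<open>K * sqrt D\<close>
    lies between \<open>L / 2 ^ Suc i\<close> and \<open>L / 2 ^ i\<close>.\<close>
  define G where "G = (\<lambda>s. indicator {-R..R} s * \<eta> + indicator S s * L + (\<Sum>i\<le>I. indicator (B i) s * c i))"
  define W where "W = 2 * R * \<eta> + measure lebesgue S * L + (\<Sum>i\<le>I. measure lebesgue (B i) * c i)"
  have ind: "(indicat_real A has_integral measure lebesgue A) UNIV" if "A \<in> lmeasurable" for A :: "real set"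
    using that lmeasurable_iff_has_integral[of A] by blast
  have GW: "(G has_integral W) UNIV"
    unfolding G_def W_def
    using ind[of "{-R..R}"] R
    by (intro has_integral_add has_integral_sum has_integral_mult_left ind Bm S) auto
  have key: "(\<bar>\<rho> s\<bar> + \<rho> s) / 2 \<le> G s" if s: "s \<notin> N \<union> {-R, R}" for s
  proof (cases "\<bar>s\<bar> < R")
    case False
    then have "\<rho> s = 0" using s by (auto simp: \<rho>_def abs_if split: if_splits)
    then show ?thesis using eta L cpos unfolding G_def by (auto intro!: add_nonneg_nonneg sum_nonneg)
  next
    case True
    have rs: "\<rho> s = r s" using True by (simp add: \<rho>_def)
    have sumn: "0 \<le> (\<Sum>i\<le>I. indicator (B i) s * c i)" using cpos by (auto intro!: sum_nonneg)
    have Geq: "G s = \<eta> + indicator S s * L + (\<Sum>i\<le>I. indicator (B i) s * c i)"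
    proof -
      have "s \<in> {-R..R}" using True by auto
      then show ?thesis by (simp add: G_def)
    qed
    show ?thesis
    proof (cases "s \<in> S \<or> r s \<le> \<eta>")
      case True
      have i0: "0 \<le> indicator S s * L" using L by simp
      show ?thesis
      proof (cases "s \<in> S")
        case True
        then have "indicator S s * L = L" by simp
        moreover have "(\<bar>\<rho> s\<bar> + \<rho> s) / 2 \<le> L" using r(2)[of s] rs by simp
        ultimately show ?thesis using Geq sumn eta by linarith
      next
        case False
        then have "r s \<le> \<eta>" using True by simp
        then have "(\<bar>\<rho> s\<bar> + \<rho> s) / 2 \<le> \<eta>" using rs eta by simp
        then show ?thesis using Geq sumn i0 by linarith
      qed
    next
      case False
      then have D: "r s > \<eta>" "s \<notin> S" by auto
      obtain t where t: "\<bar>g (s + t) - g s\<bar> > K * sqrt (r s) * \<bar>t\<bar>"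
        using no[OF D(2) True r(4) D(1)] s by auto
      define m where "m = K * sqrt (r s)"
      have m2: "m\<^sup>2 = K\<^sup>2 * r s" using D eta by (simp add: m_def power_mult_distrib)
      have mpos: "m > 0" using D eta K by (simp add: m_def)
      have t0: "\<bar>t\<bar> > 0" using t by auto
      have "m < L"
      proof -
        have "m * \<bar>t\<bar> < L * \<bar>t\<bar>" using t lip[of "s + t" s] by (simp add: m_def)
        then show ?thesis using t0 by simp
      qed
      have "L / 2 ^ Suc I < m"
      proof (rule ccontr)
        assume "\<not> ?thesis"
        then have "m\<^sup>2 \<le> (L / 2 ^ Suc I)\<^sup>2" using mpos by (intro power_mono) auto
        then have "K\<^sup>2 * r s \<le> L\<^sup>2 / 4 ^ Suc I"
          using m2 by (simp add: power_divide power_mult_distrib power2_eq_square flip: power_mult_distrib)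
        then have "r s \<le> L\<^sup>2 / K\<^sup>2 / 4 ^ Suc I" using K by (simp add: field_simps)
        then show False using I D by linarith
      qed
      define i where "i = (LEAST i. L / 2 ^ Suc i < m)"
      have i1: "L / 2 ^ Suc i < m" unfolding i_def by (rule LeastI) fact
      have iI: "i \<le> I" unfolding i_def by (rule Least_le) fact
      have "m \<le> L / 2 ^ i"
      proof (cases i)
        case 0 then show ?thesis using \<open>m < L\<close> by simp
      next
        case (Suc k)
        then have "\<not> L / 2 ^ Suc k < m" using not_less_Least[of k "\<lambda>i. L / 2 ^ Suc i < m"] by (simp add: i_def)
        then show ?thesis using Suc by simp
      qed
      then have "m\<^sup>2 \<le> (L / 2 ^ i)\<^sup>2" using mpos by (intro power_mono) auto
      then have "K\<^sup>2 * r s \<le> L\<^sup>2 / 4 ^ i"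
        using m2 by (simp add: power_divide power_mult_distrib power2_eq_square flip: power_mult_distrib)
      then have rc: "r s \<le> c i" using K by (simp add: c_def field_simps)
      have "L / 2 ^ Suc i * \<bar>t\<bar> < \<bar>g (s + t) - g s\<bar>"
        using t i1 t0 by (simp add: m_def) (metis (no_types) mult_strict_right_mono order.strict_trans t0 times_divide_eq_left zero_less_abs_iff)
      then have "s \<in> B i" unfolding B_def by auto
      then have "c i \<le> (\<Sum>i\<le>I. indicator (B i) s * c i)"
        using member_le_sum[of i "{..I}" "\<lambda>i. indicator (B i) s * c i"] iI cpos by auto
      moreover have "0 \<le> indicator S s * L" using L by simp
      moreover have "(\<bar>\<rho> s\<bar> + \<rho> s) / 2 = r s" using rs D eta by simp
      ultimately show ?thesis using Geq rc eta by linarith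
    qed
  qed
  have "((\<lambda>s. if s \<in> N \<union> {-R, R} then G s else (\<bar>\<rho> s\<bar> + \<rho> s) / 2) has_integral (V / 2)) UNIV"
    by (rule has_integral_spike[OF _ _ half, of "N \<union> {-R, R}"]) (use r(3) in auto)
  from has_integral_le[OF this GW] have VW: "V / 2 \<le> W"
    using key by (auto split: if_splits)
  have V0: "V \<ge> 0" unfolding V_def by (rule integral_nonneg[OF absint]) auto
  have "(\<Sum>i\<le>I. measure lebesgue (B i) * c i) \<le> (\<Sum>i\<le>I. V / 16 * (1/2) ^ i)"
  proof (rule sum_mono)
    fix i
    have "measure lebesgue (B i) * c i \<le> 10 / (L / 2 ^ Suc i) * V * c i"
      using Bm(2)[of i] cpos[of i] by (rule mult_right_mono)
    also have "\<dots> = 20 * L / K\<^sup>2 * V * (1/2) ^ i"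
    proof -
      have "(4::real) ^ i = 2 ^ i * 2 ^ i" by (simp flip: power_mult_distrib)
      then show ?thesis using L by (simp add: c_def power2_eq_square field_simps)
    qed
    \<comment> \<open>Here \<open>320 * L \<le> K^2\<close> enters; the geometric series then gives
      \<open>V / 8\<close> in total.\<close>
    also have "\<dots> \<le> V / 16 * (1/2) ^ i"
    proof -
      have "20 * L / K\<^sup>2 \<le> 1 / 16" using K by (simp add: field_simps)
      then have "20 * L / K\<^sup>2 * V \<le> 1 / 16 * V" using V0 by (intro mult_right_mono) auto
      then show ?thesis by (intro mult_right_mono) auto
    qed
    finally show "measure lebesgue (B i) * c i \<le> V / 16 * (1/2) ^ i" .
  qed
  also have "\<dots> = V / 16 * (\<Sum>i\<le>I. (1/2) ^ i)" by (simp add: sum_distrib_left)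
  also have "\<dots> \<le> V / 16 * 2"
  proof (intro mult_left_mono)
    have "(\<Sum>i\<le>I. (1/2::real) ^ i) = 2 - (1/2) ^ I"
      by (induction I) auto
    then show "(\<Sum>i\<le>I. (1/2::real) ^ i) \<le> 2" by simp
  qed (use V0 in auto)
  finally have "V / 2 \<le> 2 * R * \<eta> + measure lebesgue S * L + V / 8"
    using VW by (simp add: W_def)
  moreover have "\<eta> * R > 0" "0 \<le> L * measure lebesgue S" using eta R L by auto
  ultimately have "V / 2 \<le> 8 * \<eta> * R + 2 * L * measure lebesgue S"
    by (simp add: mult.commute mult.assoc mult.left_commute)
  then show False using xi gV by simp
qed

lemma steep_point_interval:
  fixes g :: "real \<Rightarrow> real"
  assumes lip: "\<And>x y. \<bar>g y - g x\<bar> \<le> L * \<bar>y - x\<bar>" and L: "L > 0"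
    and zero: "\<And>s. s \<le> A \<or> B \<le> s \<Longrightarrow> g s = 0" and AB: "A < B" and eta: "\<eta> > 0"
    and K: "K > 0" "K\<^sup>2 \<ge> 320 * L"
    and S: "S \<in> lmeasurable" and xi: "\<bar>g \<xi>\<bar> > 4 * \<eta> * (B - A) + 2 * L * measure lebesgue S"
  obtains s D where "s \<notin> S" "A < s" "s < B" "(g has_real_derivative D) (at s)" "D > \<eta>"
    "\<And>t. \<bar>g (s + t) - g s\<bar> \<le> K * sqrt D * \<bar>t\<bar>"
proof -
  define m where "m = (A + B) / 2"
  define h where "h = (\<lambda>s. g (m + s))"
  have meas: "(+) (- m) ` S \<in> lmeasurable" "measure lebesgue ((+) (- m) ` S) = measure lebesgue S"
    by (rule measurable_translation[OF S], rule measure_translation)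
  have lip': "\<bar>h y - h x\<bar> \<le> L * \<bar>y - x\<bar>" for x y
    using lip[of "m + y" "m + x"] by (simp add: h_def)
  have zero': "h s = 0" if "(B - A) / 2 \<le> \<bar>s\<bar>" for s
    unfolding h_def by (rule zero) (use that in \<open>auto simp: m_def abs_if field_simps split: if_splits\<close>)
  have xi': "\<bar>h (\<xi> - m)\<bar> > 8 * \<eta> * ((B - A) / 2) + 2 * L * measure lebesgue ((+) (- m) ` S)"
    using xi meas by (simp add: h_def)
  obtain s D where s: "s \<notin> (+) (- m) ` S" "\<bar>s\<bar> < (B - A) / 2" "(h has_real_derivative D) (at s)" "D > \<eta>"
    "\<And>t. \<bar>h (s + t) - h s\<bar> \<le> K * sqrt D * \<bar>t\<bar>"
    by (rule steep_point[OF lip' L zero' _ eta K meas(1) xi']) (use AB in auto)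
  show ?thesis
  proof (rule that[of "m + s" D])
    show "m + s \<notin> S" using s(1) by (metis image_eqI add_minus_cancel minus_add_cancel)
    show "A < m + s" "m + s < B" using s(2) by (auto simp: m_def abs_less_iff field_simps)
    show "(g has_real_derivative D) (at (m + s))"
    proof -
      have "(\<lambda>x. g (x + m)) = h" by (auto simp: h_def add.commute)
      then show ?thesis using DERIV_shift[of g D s m] s(3) by (simp only: add.commute)
    qed
    show "\<bar>g (m + s + t) - g (m + s)\<bar> \<le> K * sqrt D * \<bar>t\<bar>" for t
      using s(5)[of t] by (simp add: h_def add.assoc)
  qed (fact s(4))
qed

section \<open>Differentiability of Lipschitz functions near rational lines\<close>

lemma max_min_lipschitz:
  fixes a b c d :: real
  shows "\<bar>max 0 (min a b) - max 0 (min c d)\<bar> \<le> max \<bar>a - c\<bar> \<bar>b - d\<bar>"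
proof -
  have "\<bar>max 0 u - max 0 v\<bar> \<le> \<bar>u - v\<bar>" for u v :: real by auto
  moreover have "\<bar>min a b - min c d\<bar> \<le> max \<bar>a - c\<bar> \<bar>b - d\<bar>" by linarith
  ultimately show ?thesis by (rule order_trans)
qed

text \<open>If \<open>F\<close> is far from its linearization \<open>0\<close> at \<open>(u, \<tau>)\<close>, follow the graph of a flat tent whose
  apex is \<open>(u, \<tau>)\<close>. The values at its ends are negligible, so along one of the two sides \<open>F\<close> has a
  positive derivative at a point where the increments are controlled by the square root of that derivative.\<close>

lemma steeper_line_pos:
  fixes F :: "real \<Rightarrow> real \<Rightarrow> real" and \<Lambda> :: "(real \<times> real) set"
  assumes lip: "\<And>s \<tau> s' \<tau>'. \<bar>F s \<tau> - F s' \<tau>'\<bar> \<le> L * (\<bar>s - s'\<bar> + \<bar>\<tau> - \<tau>'\<bar>)" and L: "L \<ge> 1"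
    and F0: "F 0 0 = 0" and dF: "((\<lambda>s. F s 0) has_real_derivative 0) (at 0)"
    and eps: "0 < \<epsilon>" "\<epsilon> \<le> 1"
    and gap: "\<And>\<rho>. \<rho> > 0 \<Longrightarrow> \<exists>u \<tau>. \<tau> > 0 \<and> \<bar>u\<bar> + \<bar>\<tau>\<bar> < \<rho> \<and> \<bar>F u \<tau>\<bar> > \<epsilon> * (\<bar>u\<bar> + \<bar>\<tau>\<bar>)"
    and delta: "0 < \<delta>" "\<delta> \<le> 1 / 4" and r: "r > 0"
    and dense: "\<And>m c \<eta>. \<bar>m\<bar> \<le> 2 * \<delta> \<Longrightarrow> \<eta> > 0 \<Longrightarrow> \<exists>m' c'. (m', c') \<in> \<Lambda> \<and> \<bar>m' - m\<bar> < \<eta> \<and> \<bar>c' - c\<bar> < \<eta>"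
  obtains s \<tau> m c D where "(m, c) \<in> \<Lambda>" "\<tau> = m * s + c" "\<bar>m\<bar> \<le> 2 * \<delta>" "\<bar>s\<bar> + \<bar>\<tau>\<bar> < r"
    "((\<lambda>t. F (s + t) (\<tau> + m * t)) has_real_derivative D) (at 0)" "D \<ge> \<epsilon> * \<delta> / 100"
    "\<And>t. \<bar>F (s + t) \<tau> - F s \<tau> - F t 0\<bar> \<le> (60 * L * sqrt D + 8 * L * \<delta>) * \<bar>t\<bar>"
proof -
  \<comment> \<open>\<open>\<theta>\<close> measures how flat \<open>F\<close> is on the axis below
    the scale \<open>s0\<close>, and \<open>\<kappa>\<close> which fraction of \<open>R\<close> is
    cut off at both ends of the tent. The relation
    \<open>\<theta> = \<kappa> * \<delta> / 20\<close> makes the error \<open>\<theta> * R\<close>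
    at most \<open>\<delta> * \<bar>t\<bar> / 20\<close> for every step \<open>t\<close> that leaves
    the tent.\<close>
  define \<theta> where "\<theta> = \<epsilon> * \<delta>\<^sup>2 / (1600 * L)"
  define \<kappa> where "\<kappa> = \<epsilon> * \<delta> / (80 * L)"
  have ed: "\<epsilon> * \<delta> > 0" "\<epsilon> * \<delta> \<le> 1/4" using eps delta mult_mono[of \<epsilon> 1 \<delta> "1/4"] by auto
  have th0: "\<theta> > 0" using eps delta L by (simp add: \<theta>_def)
  have kap0: "\<kappa> > 0" "\<kappa> \<le> 1/320" using ed L by (auto simp: \<kappa>_def field_simps)
  have thk: "\<theta> = \<kappa> * \<delta> / 20" by (simp add: \<theta>_def \<kappa>_def power2_eq_square)
  have th1: "\<theta> \<le> \<epsilon> * \<delta> / 6400"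
  proof -
    have "\<theta> = \<epsilon> * \<delta> * (\<delta> / (1600 * L))" by (simp add: \<theta>_def power2_eq_square)
    also have "\<dots> \<le> \<epsilon> * \<delta> * (1 / 6400)" using ed delta L by (intro mult_left_mono) (auto simp: field_simps)
    finally show ?thesis by simp
  qed
  have th2: "\<theta> \<le> \<delta> / 6400"
  proof -
    have "\<epsilon> * \<delta> \<le> 1 * \<delta>" using eps delta by (intro mult_right_mono) auto
    then show ?thesis using th1 by simp
  qed
  obtain s0 where s0: "s0 > 0" "\<And>s. \<bar>s\<bar> \<le> s0 \<Longrightarrow> \<bar>F s 0\<bar> \<le> \<theta> * \<bar>s\<bar>"
  proof -
    have "(\<lambda>h. (F h 0 - F 0 0) / h) \<midarrow>0\<rightarrow> 0" using dF by (simp add: DERIV_def)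
    from LIM_D[OF this th0] obtain d where "d > 0"
      "\<forall>x. x \<noteq> 0 \<and> norm (x - 0) < d \<longrightarrow> norm ((F x 0 - F 0 0) / x - 0) < \<theta>" by blast
    then have d: "d > 0" "\<And>h. h \<noteq> 0 \<Longrightarrow> \<bar>h\<bar> < d \<Longrightarrow> \<bar>F h 0 / h\<bar> < \<theta>"
      using F0 by auto
    show ?thesis
    proof (rule that[of "d / 2"])
      fix s assume "\<bar>s\<bar> \<le> d / 2"
      then show "\<bar>F s 0\<bar> \<le> \<theta> * \<bar>s\<bar>"
        using d(1) d(2)[of s] F0 by (cases "s = 0") (auto simp: abs_divide divide_simps split: if_splits)
    qed (use d in auto)
  qed
  \<comment> \<open>The three bounds keep the tent well below the scale \<open>s0\<close>, make
    \<open>L * R\<close> small against \<open>\<delta> * \<bar>t\<bar>\<close> when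
    \<open>\<bar>t\<bar> > s0 / 2\<close>, and put the tent inside the ball of radius
    \<open>r\<close>.\<close>
  define R0 where "R0 = min (s0 / 8) (min (\<delta> * s0 / (32 * L)) (r / 8))"
  have R0: "R0 > 0" using s0 delta L r by (simp add: R0_def)
  obtain u \<tau>0 where gapu: "\<tau>0 > 0" "\<bar>u\<bar> + \<bar>\<tau>0\<bar> < \<delta> * R0" "\<bar>F u \<tau>0\<bar> > \<epsilon> * (\<bar>u\<bar> + \<bar>\<tau>0\<bar>)"
    using gap[of "\<delta> * R0"] delta R0 by auto
  define N where "N = \<bar>u\<bar> + \<bar>\<tau>0\<bar>"
  define R where "R = N / \<delta>"
  have N0: "N > 0" using gapu by (simp add: N_def)
  have R: "R > 0" "R < R0" "N = \<delta> * R" using N0 delta gapu by (auto simp: R_def N_def field_simps)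
  have RR: "8 * R < s0" "32 * L * R < \<delta> * s0" "8 * R < r"
    using R(2) L by (auto simp: R0_def field_simps)
  have NR: "N \<le> R / 4" using R delta mult_right_mono[of \<delta> "1/4" R] by simp
  have uN: "\<bar>u\<bar> \<le> N" "\<tau>0 \<le> N" using gapu by (auto simp: N_def)
  have uR: "R + u \<ge> 3/4 * R" "R - u \<ge> 3/4 * R" using uN NR by auto
  \<comment> \<open>Slopes of the segments from \<open>(- R, 0)\<close> to the apex
    \<open>(u, \<tau>0)\<close> and from there to \<open>(R, 0)\<close>. As the apex has height at
    most \<open>N = \<delta> * R\<close> and \<open>\<bar>u\<bar> \<le> R / 4\<close>, both are of
    size at most \<open>4/3 * \<delta>\<close>.\<close>
  define M1 where "M1 = \<tau>0 / (R + u)"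
  define M2 where "M2 = - \<tau>0 / (R - u)"
  have M1b: "0 < M1" "M1 \<le> 4/3 * \<delta>"
  proof -
    show "0 < M1" using gapu uR R by (simp add: M1_def)
    have "M1 \<le> N / (3/4 * R)" unfolding M1_def using uN uR R gapu by (intro frac_le) auto
    then show "M1 \<le> 4/3 * \<delta>" using R by simp
  qed
  have M2b: "M2 < 0" "- M2 \<le> 4/3 * \<delta>"
  proof -
    show "M2 < 0" using gapu uR R by (simp add: M2_def)
    have "- M2 \<le> N / (3/4 * R)" unfolding M2_def minus_divide_left[symmetric] minus_minus
      using uN uR R gapu by (intro frac_le) auto
    then show "- M2 \<le> 4/3 * \<delta>" using R by simp
  qed
  \<comment> \<open>tolerance for replacing the two segments by admissible lines\<close>
  define \<eta>0 where "\<eta>0 = min (min (M1 / 8) (- M2 / 8)) (min (\<delta> / 2) (min (R * M1 / 8) (min (- R * M2 / 8)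
      (min (\<epsilon> * N / (16 * L)) (\<epsilon> * N / (16 * L * R))))))"
  have e0: "\<eta>0 > 0" unfolding \<eta>0_def using M1b M2b R eps N0 L delta
    by (simp add: divide_pos_pos mult_neg_pos mult_pos_neg)
  have e0b: "\<eta>0 \<le> M1 / 8" "\<eta>0 \<le> - M2 / 8" "\<eta>0 \<le> \<delta> / 2" "\<eta>0 \<le> R * M1 / 8" "\<eta>0 \<le> - R * M2 / 8"
     "\<eta>0 \<le> \<epsilon> * N / (16 * L)" "\<eta>0 \<le> \<epsilon> * N / (16 * L * R)"
    unfolding \<eta>0_def by (simp_all only: min.coboundedI1 min.coboundedI2 order_refl)
  obtain m1 c1 where l1: "(m1, c1) \<in> \<Lambda>" "\<bar>m1 - M1\<bar> < \<eta>0" "\<bar>c1 - M1 * R\<bar> < \<eta>0"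
    using dense[of M1 \<eta>0 "M1 * R"] M1b e0 by auto
  obtain m2 c2 where l2: "(m2, c2) \<in> \<Lambda>" "\<bar>m2 - M2\<bar> < \<eta>0" "\<bar>c2 - (- M2 * R)\<bar> < \<eta>0"
    using dense[of M2 \<eta>0 "- M2 * R"] M2b e0 by auto
  have m1: "0 < m1" "m1 \<le> 2 * \<delta>" "7/8 * M1 \<le> m1" "m1 \<le> 9/8 * M1" using l1 e0b M1b by (auto simp: abs_less_iff)
  have m2: "m2 < 0" "- m2 \<le> 2 * \<delta>" "- m2 \<ge> 7/8 * - M2" "- m2 \<le> 9/8 * - M2" using l2 e0b M2b by (auto simp: abs_less_iff)
  have c1: "7/8 * (M1 * R) \<le> c1" "c1 \<le> 9/8 * (M1 * R)"
    using l1(3) e0b(4) by (auto simp: abs_less_iff mult.commute)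
  have c2: "7/8 * (- M2 * R) \<le> c2" "c2 \<le> 9/8 * (- M2 * R)"
    using l2(3) e0b(5) by (auto simp: abs_less_iff mult.commute)
  have MR: "0 < M1 * R" "0 < - M2 * R" using M1b M2b R by (auto simp: mult_neg_pos)
  define A where "A = - c1 / m1"
  define B where "B = c2 / (- m2)"
  have mR: "7/8 * M1 * R \<le> m1 * R" "m1 * R \<le> 9/8 * M1 * R" "7/8 * - M2 * R \<le> - m2 * R" "- m2 * R \<le> 9/8 * - M2 * R"
    using m1 m2 R by (auto intro!: mult_right_mono simp del: mult_minus_left)
  have A: "- 2 * R \<le> A" "A \<le> - R / 2"
  proof -
    have "c1 \<le> 2 * (m1 * R)" "m1 * R / 2 \<le> c1" using c1 mR MR by linarith+
    then show "- 2 * R \<le> A" "A \<le> - R / 2" using m1 by (auto simp: A_def field_simps)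
  qed
  have B: "B \<le> 2 * R" "R / 2 \<le> B"
  proof -
    have "c2 \<le> 2 * (- m2 * R)" "- m2 * R / 2 \<le> c2" using c2 mR MR by linarith+
    then show "B \<le> 2 * R" "R / 2 \<le> B" using m2 by (auto simp: B_def field_simps)
  qed
  have AB: "A < B" using A B R by linarith
  define off where "off s = max 0 (min (m1 * s + c1) (m2 * s + c2))" for s
  have off0: "off s = 0" if "s \<le> A \<or> B \<le> s" for s
    using that m1 m2 by (auto simp: off_def A_def B_def field_simps max_def min_def)
  have offlip: "\<bar>off s - off s'\<bar> \<le> 2 * \<delta> * \<bar>s - s'\<bar>" for s s'
  proof -
    have *: "\<bar>(m * s + c) - (m * s' + c)\<bar> \<le> 2 * \<delta> * \<bar>s - s'\<bar>" if "\<bar>m\<bar> \<le> 2 * \<delta>" for m c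
      using mult_right_mono[OF that, of "\<bar>s - s'\<bar>"] by (simp add: abs_mult[symmetric] algebra_simps)
    have "\<bar>off s - off s'\<bar> \<le> max \<bar>(m1 * s + c1) - (m1 * s' + c1)\<bar> \<bar>(m2 * s + c2) - (m2 * s' + c2)\<bar>"
      unfolding off_def by (rule max_min_lipschitz)
    also have "\<dots> \<le> 2 * \<delta> * \<bar>s - s'\<bar>"
      by (intro max.boundedI *) (use m1 m2 in auto)
    finally show ?thesis .
  qed
  have offb: "\<bar>off s\<bar> \<le> 4 * \<delta> * R" if "A \<le> s" "s \<le> B" for s
  proof (cases "s \<le> 0")
    case True
    have "\<bar>off s\<bar> \<le> 2 * \<delta> * \<bar>s - A\<bar>" using offlip[of s A] off0[of A] by simp
    also have "\<dots> \<le> 2 * \<delta> * (2 * R)" using that A True delta by (intro mult_left_mono) auto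
    finally show ?thesis by simp
  next
    case False
    have "\<bar>off s\<bar> \<le> 2 * \<delta> * \<bar>s - B\<bar>" using offlip[of s B] off0[of B] by simp
    also have "\<dots> \<le> 2 * \<delta> * (2 * R)" using that B False delta by (intro mult_left_mono) auto
    finally show ?thesis by simp
  qed
  have offu: "\<bar>off u - \<tau>0\<bar> \<le> \<epsilon> * N / (4 * L)"
  proof -
    have ne: "R + u \<noteq> 0" "R - u \<noteq> 0" using uR R by linarith+
    have "M1 * (R + u) = \<tau>0" "M2 * (R - u) = - \<tau>0" using ne by (simp_all add: M1_def M2_def)
    then have 1: "M1 * u + M1 * R = \<tau>0" and 2: "M2 * u + - M2 * R = \<tau>0"
      by (simp_all add: algebra_simps)
    have uRR: "\<bar>u\<bar> \<le> R" using uN(1) NR R(1) by linarith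
    have b: "\<eta>0 * \<bar>u\<bar> \<le> \<epsilon> * N / (16 * L)"
    proof -
      have "\<eta>0 * \<bar>u\<bar> \<le> \<epsilon> * N / (16 * L * R) * R" using e0b(7) uRR e0 by (intro mult_mono) auto
      then show ?thesis using R by simp
    qed
    have *: "\<bar>(m * u + c) - (M * u + C)\<bar> \<le> \<epsilon> * N / (8 * L)" if "\<bar>m - M\<bar> < \<eta>0" "\<bar>c - C\<bar> < \<eta>0" for m c M C
    proof -
      have "\<bar>(m * u + c) - (M * u + C)\<bar> \<le> \<bar>m - M\<bar> * \<bar>u\<bar> + \<bar>c - C\<bar>"
        by (simp add: abs_mult[symmetric] algebra_simps)
      also have "\<bar>m - M\<bar> * \<bar>u\<bar> \<le> \<eta>0 * \<bar>u\<bar>" using that by (intro mult_right_mono) auto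
      finally show ?thesis using b e0b(6) that by simp
    qed
    have "\<epsilon> * N / (8 * L) \<le> \<epsilon> * N / (4 * L)" using eps N0 L by (simp add: field_simps)
    moreover have "\<bar>off u - max 0 (min \<tau>0 \<tau>0)\<bar> \<le> max \<bar>m1 * u + c1 - \<tau>0\<bar> \<bar>m2 * u + c2 - \<tau>0\<bar>"
      unfolding off_def by (rule max_min_lipschitz)
    ultimately show ?thesis
      using *[OF l1(2,3)] *[OF l2(2,3)] gapu(1) unfolding 1 2 by simp
  qed
  \<comment> \<open>Subtracting the chord \<open>lin\<close> makes the function along the tent
    vanish at both ends, so that it extends by zero to the whole line.\<close>
  define \<beta> where "\<beta> = (F B 0 - F A 0) / (B - A)"
  define lin where "lin s = F A 0 + \<beta> * (s - A)" for s
  have FA: "\<bar>F A 0\<bar> \<le> 2 * \<theta> * R" "\<bar>F B 0\<bar> \<le> 2 * \<theta> * R"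
  proof -
    have "\<bar>A\<bar> \<le> 2 * R" "\<bar>B\<bar> \<le> 2 * R" using A B R by auto
    then have "\<theta> * \<bar>A\<bar> \<le> \<theta> * (2 * R)" "\<theta> * \<bar>B\<bar> \<le> \<theta> * (2 * R)" "\<bar>A\<bar> \<le> s0" "\<bar>B\<bar> \<le> s0"
      using RR(1) R(1) th0 by (auto intro!: mult_left_mono)
    then show "\<bar>F A 0\<bar> \<le> 2 * \<theta> * R" "\<bar>F B 0\<bar> \<le> 2 * \<theta> * R"
      using s0(2)[of A] s0(2)[of B] by (simp_all add: mult.assoc mult.left_commute)
  qed
  have linB: "lin B = F B 0" using AB by (simp add: lin_def \<beta>_def)
  have betab: "\<bar>\<beta>\<bar> \<le> 4 * \<theta>"
  proof -
    have "\<bar>F B 0 - F A 0\<bar> \<le> 4 * \<theta> * (B - A)"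
    proof -
      have "4 * \<theta> * R \<le> 4 * \<theta> * (B - A)" using A B R th0 by (intro mult_left_mono) auto
      then show ?thesis using FA by linarith
    qed
    then show ?thesis using AB by (simp add: \<beta>_def abs_divide pos_divide_le_eq)
  qed
  have linb: "\<bar>lin s\<bar> \<le> 18 * \<theta> * R" if "A \<le> s" "s \<le> B" for s
  proof -
    have "\<bar>\<beta> * (s - A)\<bar> \<le> 4 * \<theta> * (4 * R)"
      unfolding abs_mult using betab that A B R th0 by (intro mult_mono) auto
    then show ?thesis unfolding lin_def using FA by linarith
  qed
  define h where "h s = (if A \<le> s \<and> s \<le> B then F s (off s) - lin s else 0)" for s
  have hA: "h A = 0" "h B = 0" using AB off0[of A] off0[of B] linB by (auto simp: h_def lin_def)
  have h_in: "\<bar>h s - h s'\<bar> \<le> 4 * L * \<bar>s - s'\<bar>" if "A \<le> s" "s \<le> B" "A \<le> s'" "s' \<le> B" for s s'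
  proof -
    have "\<bar>F s (off s) - F s' (off s')\<bar> \<le> L * (\<bar>s - s'\<bar> + \<bar>off s - off s'\<bar>)" by (rule lip)
    also have "\<dots> \<le> L * (\<bar>s - s'\<bar> + 1/2 * \<bar>s - s'\<bar>)"
    proof -
      have "2 * \<delta> * \<bar>s - s'\<bar> \<le> 1/2 * \<bar>s - s'\<bar>" using delta by (intro mult_right_mono) auto
      then show ?thesis using offlip[of s s'] L by (intro mult_left_mono) auto
    qed
    finally have 1: "\<bar>F s (off s) - F s' (off s')\<bar> \<le> 3/2 * L * \<bar>s - s'\<bar>" by simp
    have "\<bar>lin s - lin s'\<bar> = \<bar>\<beta>\<bar> * \<bar>s - s'\<bar>" by (simp add: lin_def abs_mult[symmetric] algebra_simps)
    also have "\<dots> \<le> L * \<bar>s - s'\<bar>" using betab th2 delta L by (intro mult_right_mono) auto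
    finally have 2: "\<bar>lin s - lin s'\<bar> \<le> L * \<bar>s - s'\<bar>" .
    have "h s - h s' = (F s (off s) - F s' (off s')) - (lin s - lin s')" using that by (simp add: h_def)
    then have "\<bar>h s - h s'\<bar> \<le> 3/2 * L * \<bar>s - s'\<bar> + L * \<bar>s - s'\<bar>"
      using 1 2 by linarith
    also have "\<dots> \<le> 4 * L * \<bar>s - s'\<bar>"
      using mult_nonneg_nonneg[of L "\<bar>s - s'\<bar>"] L by simp
    finally show ?thesis .
  qed
  have hlip: "\<bar>h s' - h s\<bar> \<le> 4 * L * \<bar>s' - s\<bar>" for s s'
  proof -
    define cl where "cl s = max A (min B s)" for s
    have hcl: "h s = h (cl s)" for s using hA AB by (auto simp: h_def cl_def max_def min_def)
    have "\<bar>h s' - h s\<bar> = \<bar>h (cl s') - h (cl s)\<bar>" using hcl[of s] hcl[of s'] by simp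
    also have "\<bar>h (cl s') - h (cl s)\<bar> \<le> 4 * L * \<bar>cl s' - cl s\<bar>"
      using AB by (intro h_in) (auto simp: cl_def)
    also have "\<dots> \<le> 4 * L * \<bar>s' - s\<bar>"
      using L by (intro mult_left_mono) (auto simp: cl_def max_def min_def abs_if)
    finally show ?thesis .
  qed
  have hu: "\<bar>h u\<bar> \<ge> 7/10 * (\<epsilon> * N)"
  proof -
    have Au: "A \<le> u" "u \<le> B" using A B uN NR by auto
    have "\<bar>F u (off u) - F u \<tau>0\<bar> \<le> L * (\<epsilon> * N / (4 * L))"
      using lip[of u "off u" u \<tau>0] offu L mult_left_mono[OF offu, of L] by simp
    then have 1: "\<bar>F u (off u) - F u \<tau>0\<bar> \<le> \<epsilon> * N / 4" using L by simp
    have "18 * \<theta> * R \<le> 18 * (\<epsilon> * \<delta> / 6400) * R"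
    proof (rule mult_right_mono)
      show "18 * \<theta> \<le> 18 * (\<epsilon> * \<delta> / 6400)" using th1 by linarith
    qed (use R(1) in simp)
    also have "\<dots> = 18 / 6400 * (\<epsilon> * N)" using R(3) by simp
    also have "\<dots> \<le> \<epsilon> * N / 100" using eps N0 by simp
    finally have "18 * \<theta> * R \<le> \<epsilon> * N / 100" .
    moreover have "0 \<le> \<epsilon> * N" using eps N0 by simp
    ultimately have "\<bar>F u (off u) - lin u\<bar> \<ge> 7/10 * (\<epsilon> * N)"
      using 1 linb[OF Au] gapu(3)[folded N_def] by linarith
    then show ?thesis using Au by (simp add: h_def)
  qed
  \<comment> \<open>The ends are excluded so that a step from \<open>s\<close> out of the tent has
    length at least \<open>\<kappa> * R\<close>. The single point is where the two lines cross and
    \<open>off\<close> fails to be affine.\<close>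
  define S where "S = ({A..A + \<kappa> * R} \<union> {B - \<kappa> * R..B}) \<union> {(c2 - c1) / (m1 - m2)}"
  have Sm: "S \<in> lmeasurable" "measure lebesgue S \<le> 2 * \<kappa> * R"
  proof -
    show "S \<in> lmeasurable" unfolding S_def
      by (intro fmeasurable.Un negligible_imp_measurable[OF negligible_sing]) auto
    have "measure lebesgue S \<le> measure lebesgue ({A..A + \<kappa> * R} \<union> {B - \<kappa> * R..B}) + measure lebesgue {(c2 - c1) / (m1 - m2)}"
      unfolding S_def by (rule measure_Un_le) auto
    also have "measure lebesgue ({A..A + \<kappa> * R} \<union> {B - \<kappa> * R..B}) \<le>
       measure lebesgue {A..A + \<kappa> * R} + measure lebesgue {B - \<kappa> * R..B}" by (rule measure_Un_le) auto
    finally show "measure lebesgue S \<le> 2 * \<kappa> * R" using kap0 R(1) by (simp add: ac_simps)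
  qed
  \<comment> \<open>The budget: since \<open>\<epsilon> * \<delta> * R = \<epsilon> * N\<close>, the
    slope \<open>\<eta>\<close> uses up \<open>2/5\<close> and the excluded set \<open>1/5\<close>
    of \<open>\<epsilon> * N\<close>, while \<open>\<bar>h u\<bar>\<close> is at least
    \<open>7/10\<close> of it.\<close>
  define \<eta> where "\<eta> = \<epsilon> * \<delta> / 40"
  have eta: "\<eta> > 0" using ed by (simp add: \<eta>_def)
  have big: "\<bar>h u\<bar> > 4 * \<eta> * (B - A) + 2 * (4 * L) * measure lebesgue S"
  proof -
    have "4 * \<eta> * (B - A) \<le> 4 * \<eta> * (4 * R)" using eta A B by (intro mult_left_mono) auto
    moreover have "4 * \<eta> * (4 * R) = 2/5 * (\<epsilon> * N)" using R by (simp add: \<eta>_def)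
    moreover have "2 * (4 * L) * measure lebesgue S \<le> 2 * (4 * L) * (2 * \<kappa> * R)"
      using Sm L by (intro mult_left_mono) auto
    moreover have "2 * (4 * L) * (2 * \<kappa> * R) = 1/5 * (\<epsilon> * N)" using R L by (simp add: \<kappa>_def)
    moreover have "\<epsilon> * N > 0" using eps N0 by simp
    ultimately show ?thesis using hu by linarith
  qed
  have zeroh: "h s = 0" if "s \<le> A \<or> B \<le> s" for s
    using that hA by (cases "s = A \<or> s = B") (auto simp: h_def)
  have sqL: "320 * (4 * L) \<le> (40 * L)\<^sup>2" using L mult_mono[of 1 L 1 L] by (simp add: power2_eq_square)
  obtain s D where s: "s \<notin> S" "A < s" "s < B" "(h has_real_derivative D) (at s)" "D > \<eta>"
    "\<And>t. \<bar>h (s + t) - h s\<bar> \<le> 40 * L * sqrt D * \<bar>t\<bar>"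
    by (rule steep_point_interval[of h "4 * L" A B \<eta> "40 * L" S u, OF hlip _ zeroh AB eta _ sqL Sm(1) big])
       (use L in auto)
  have far: "\<kappa> * R < s - A" "\<kappa> * R < B - s" using s(1-3) by (auto simp: S_def)
  have ln: "\<exists>m c. (m, c) \<in> \<Lambda> \<and> \<bar>m\<bar> \<le> 2 * \<delta> \<and> (\<forall>\<^sub>F x in nhds s. off x = m * x + c)"
  proof -
    have pos: "m1 * s + c1 > 0" "m2 * s + c2 > 0"
      using s(2,3) m1 m2 by (auto simp: A_def B_def field_simps)
    have ne: "m1 * s + c1 \<noteq> m2 * s + c2"
    proof
      assume "m1 * s + c1 = m2 * s + c2"
      then have "s = (c2 - c1) / (m1 - m2)" using m1 m2 by (simp add: field_simps)
      then show False using s(1) by (simp add: S_def)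
    qed
    have t1: "((\<lambda>x. m1 * x + c1) \<longlongrightarrow> m1 * s + c1) (nhds s)" "((\<lambda>x. m2 * x + c2) \<longlongrightarrow> m2 * s + c2) (nhds s)"
      by (auto intro!: tendsto_intros filterlim_ident)
    have p1: "\<forall>\<^sub>F x in nhds s. m1 * x + c1 > 0" "\<forall>\<^sub>F x in nhds s. m2 * x + c2 > 0"
      using order_tendstoD(1)[OF t1(1) pos(1)] order_tendstoD(1)[OF t1(2) pos(2)] by auto
    show ?thesis
    proof (cases "m1 * s + c1 < m2 * s + c2")
      case True
      have "((\<lambda>x. (m2 * x + c2) - (m1 * x + c1)) \<longlongrightarrow> (m2 * s + c2) - (m1 * s + c1)) (nhds s)"
        by (intro tendsto_diff t1)
      from order_tendstoD(1)[OF this, of 0] True have "\<forall>\<^sub>F x in nhds s. (m2 * x + c2) - (m1 * x + c1) > 0" by simp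
      with p1 have "\<forall>\<^sub>F x in nhds s. off x = m1 * x + c1"
        by eventually_elim (auto simp: off_def)
      then show ?thesis using l1(1) m1 by force
    next
      case False
      have "((\<lambda>x. (m1 * x + c1) - (m2 * x + c2)) \<longlongrightarrow> (m1 * s + c1) - (m2 * s + c2)) (nhds s)"
        by (intro tendsto_diff t1)
      from order_tendstoD(1)[OF this, of 0] False ne have "\<forall>\<^sub>F x in nhds s. (m1 * x + c1) - (m2 * x + c2) > 0" by simp
      with p1 have "\<forall>\<^sub>F x in nhds s. off x = m2 * x + c2"
        by eventually_elim (auto simp: off_def)
      then show ?thesis using l2(1) m2 by force
    qed
  qed
  then obtain m c where mc: "(m, c) \<in> \<Lambda>" "\<bar>m\<bar> \<le> 2 * \<delta>" "\<forall>\<^sub>F x in nhds s. off x = m * x + c" by blast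
  define \<tau> where "\<tau> = m * s + c"
  have offs: "off s = \<tau>" using eventually_nhds_x_imp_x[OF mc(3)] by (simp add: \<tau>_def)
  have ev: "\<forall>\<^sub>F x in nhds s. h x = F x (m * x + c) - lin x"
  proof -
    have "\<forall>\<^sub>F x in nhds s. x \<in> {A<..<B}" using s by (intro eventually_nhds_in_open) auto
    with mc(3) show ?thesis by eventually_elim (auto simp: h_def)
  qed
  have dF': "((\<lambda>x. F x (m * x + c)) has_real_derivative (D + \<beta>)) (at s)"
  proof -
    have "(lin has_real_derivative \<beta>) (at s)" unfolding lin_def by (auto intro!: derivative_eq_intros)
    from DERIV_add[OF s(4) this] have "((\<lambda>x. h x + lin x) has_real_derivative D + \<beta>) (at s)" .
    then show ?thesis
      by (rule DERIV_cong_ev[OF refl _ refl, THEN iffD1, rotated]) (use ev in \<open>eventually_elim, auto\<close>)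
  qed
  have dFt: "((\<lambda>t. F (s + t) (\<tau> + m * t)) has_real_derivative (D + \<beta>)) (at 0)"
  proof -
    have "((\<lambda>x. F (x + s) (m * (x + s) + c)) has_real_derivative (D + \<beta>)) (at 0)"
      using dF' DERIV_shift[of "\<lambda>x. F x (m * x + c)" "D + \<beta>" 0 s] by simp
    moreover have "(\<lambda>x. F (x + s) (m * (x + s) + c)) = (\<lambda>t. F (s + t) (\<tau> + m * t))"
      by (auto simp: \<tau>_def algebra_simps)
    ultimately show ?thesis by simp
  qed
  \<comment> \<open>The derivative of \<open>F\<close> along the line is \<open>D + \<beta>\<close>.
    As \<open>\<beta>\<close> is small against \<open>D\<close>, passing to it costs a factor
    \<open>3/2\<close> outside the root, which turns \<open>40\<close> into
    \<open>60\<close>.\<close>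
  have Dlow: "D \<le> 9/4 * (D + \<beta>)" "D + \<beta> \<ge> \<epsilon> * \<delta> / 100"
    using betab th1 s(5) ed by (auto simp: \<eta>_def abs_le_iff)
  have sq: "40 * L * sqrt D \<le> 60 * L * sqrt (D + \<beta>)"
  proof -
    have "sqrt D \<le> sqrt ((3/2)\<^sup>2 * (D + \<beta>))" using Dlow by (simp add: power2_eq_square)
    also have "\<dots> = 3/2 * sqrt (D + \<beta>)" by (subst real_sqrt_mult) simp
    finally show ?thesis using L by (simp add: field_simps)
  qed
  have stau: "\<bar>s\<bar> \<le> 2 * R" "\<bar>\<tau>\<bar> \<le> R"
  proof -
    show "\<bar>s\<bar> \<le> 2 * R" using s A B by auto
    have "\<bar>\<tau>\<bar> \<le> 4 * \<delta> * R" using offb[of s] s offs by simp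
    also have "\<dots> \<le> 1 * R" using delta R by (intro mult_right_mono) auto
    finally show "\<bar>\<tau>\<bar> \<le> R" by simp
  qed
  have inc: "\<bar>F (s + t) \<tau> - F s \<tau> - F t 0\<bar> \<le> (60 * L * sqrt (D + \<beta>) + 8 * L * \<delta>) * \<bar>t\<bar>" for t
  proof -
    have offt: "\<bar>F (s + t) \<tau> - F (s + t) (off (s + t))\<bar> \<le> 2 * L * \<delta> * \<bar>t\<bar>"
    proof -
      have "\<bar>F (s + t) \<tau> - F (s + t) (off (s + t))\<bar> \<le> L * \<bar>off s - off (s + t)\<bar>"
        using lip[of "s + t" \<tau> "s + t" "off (s + t)"] by (simp add: offs)
      also have "\<dots> \<le> L * (2 * \<delta> * \<bar>t\<bar>)" using offlip[of s "s + t"] L by (intro mult_left_mono) auto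
      finally show ?thesis by simp
    qed
    have hs: "\<bar>h (s + t) - h s\<bar> \<le> 60 * L * sqrt (D + \<beta>) * \<bar>t\<bar>"
      by (rule order_trans[OF s(6) mult_right_mono[OF sq]]) simp
    have sn: "0 \<le> 60 * L * sqrt (D + \<beta>) * \<bar>t\<bar>" using L Dlow ed by (intro mult_nonneg_nonneg) auto
    have tht: "\<theta> * \<bar>t\<bar> \<le> \<delta> * \<bar>t\<bar> / 6400" using mult_right_mono[OF th2, of "\<bar>t\<bar>"] by simp
    have dL: "\<delta> * \<bar>t\<bar> \<le> L * \<delta> * \<bar>t\<bar>" using L delta mult_right_mono[of 1 L "\<delta> * \<bar>t\<bar>"] by simp
    have dt0: "0 \<le> \<delta> * \<bar>t\<bar>" using delta by simp
    have goal: "?thesis" if "\<bar>F (s + t) \<tau> - F s \<tau> - F t 0\<bar> \<le> 60 * L * sqrt (D + \<beta>) * \<bar>t\<bar> + 2 * L * \<delta> * \<bar>t\<bar> + 6 * (\<delta> * \<bar>t\<bar>)"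
      using that dL by (simp add: distrib_right)
    \<comment> \<open>Inside the tent the increments of \<open>h\<close> decide. Outside it the tent
      coincides with the axis, and all errors are small against
      \<open>\<delta> * \<bar>t\<bar>\<close>. For \<open>\<bar>t\<bar> > s0 / 2\<close> it is
      enough that \<open>(s, \<tau>)\<close> is close to the origin.\<close>
    consider "A \<le> s + t" "s + t \<le> B" | "s + t < A \<or> B < s + t" "\<bar>t\<bar> \<le> s0 / 2" | "\<bar>t\<bar> > s0 / 2" by linarith
    then show ?thesis
    proof cases
      case 1
      have "\<bar>t\<bar> \<le> s0" using 1 s A B RR R by auto
      then have Ft: "\<bar>F t 0\<bar> \<le> \<theta> * \<bar>t\<bar>" by (rule s0(2))
      have "F (s + t) (off (s + t)) - F s \<tau> = h (s + t) - h s + \<beta> * t"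
        using 1 s offs by (simp add: h_def lin_def algebra_simps)
      moreover have "\<bar>\<beta> * t\<bar> \<le> 4 * \<theta> * \<bar>t\<bar>" unfolding abs_mult using betab by (intro mult_right_mono) auto
      ultimately show ?thesis using offt hs Ft tht dt0 by (intro goal) linarith
    next
      case 2
      have tk: "\<kappa> * R \<le> \<bar>t\<bar>" using 2 far by auto
      have thR: "\<theta> * R \<le> \<delta> * \<bar>t\<bar> / 20"
      proof -
        have "\<theta> * R = \<delta> / 20 * (\<kappa> * R)" by (simp add: thk)
        also have "\<dots> \<le> \<delta> / 20 * \<bar>t\<bar>" using tk delta by (intro mult_left_mono) auto
        finally show ?thesis by simp
      qed
      have Ft: "\<bar>F t 0\<bar> \<le> \<theta> * \<bar>t\<bar>" using 2 s0 by (intro s0(2)) auto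
      have "\<bar>s + t\<bar> \<le> s0" using 2 stau RR s0 by auto
      then have "\<bar>F (s + t) 0\<bar> \<le> \<theta> * \<bar>s + t\<bar>" by (rule s0(2))
      also have "\<dots> \<le> \<theta> * (2 * R + \<bar>t\<bar>)" using stau th0 by (intro mult_left_mono) auto
      finally have F1: "\<bar>F (s + t) 0\<bar> \<le> 2 * (\<theta> * R) + \<theta> * \<bar>t\<bar>" by (simp add: algebra_simps)
      have "off (s + t) = 0" using 2 off0 by auto
      moreover have "F s \<tau> = h s + lin s" using s offs by (simp add: h_def)
      moreover have "h (s + t) = 0" using 2 zeroh by auto
      moreover have "\<bar>lin s\<bar> \<le> 18 * (\<theta> * R)" using linb[of s] s by simp
      ultimately show ?thesis using offt hs Ft F1 thR tht dt0 by (intro goal) (simp, linarith)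
    next
      case 3
      have "\<bar>F (s + t) \<tau> - F t 0\<bar> \<le> L * (\<bar>s\<bar> + \<bar>\<tau>\<bar>)" using lip[of "s + t" \<tau> t 0] by simp
      moreover have "\<bar>F s \<tau>\<bar> \<le> L * (\<bar>s\<bar> + \<bar>\<tau>\<bar>)" using lip[of s \<tau> 0 0] F0 by simp
      moreover have "L * (\<bar>s\<bar> + \<bar>\<tau>\<bar>) \<le> L * (3 * R)" using stau L by (intro mult_left_mono) auto
      moreover have "6 * (L * R) \<le> \<delta> * \<bar>t\<bar>"
      proof -
        have "0 < L * R" using R(1) L by simp
        then have "6 * (L * R) \<le> \<delta> * s0 / 2" using RR(2) by linarith
        also have "\<dots> \<le> \<delta> * \<bar>t\<bar>" using 3 delta by simp
        finally show ?thesis .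
      qed
      moreover have "0 \<le> 2 * L * \<delta> * \<bar>t\<bar>" using L delta by simp
      ultimately show ?thesis using sn dt0 by (intro goal) linarith
    qed
  qed
  show ?thesis
    by (rule that[OF mc(1) \<tau>_def mc(2) _ dFt Dlow(2) inc]) (use stau RR R in auto)
qed

section \<open>Stages of almost maximal directional derivative\<close>

lemma geometric_limit:
  fixes a :: "nat \<Rightarrow> real"
  assumes "\<And>n. n \<ge> 1 \<Longrightarrow> \<bar>a (Suc n) - a n\<bar> \<le> c / 2 ^ n"
  obtains l where "a \<longlonglongrightarrow> l" "\<And>n. n \<ge> 1 \<Longrightarrow> \<bar>l - a n\<bar> \<le> 2 * c / 2 ^ n"
proof -
  have *: "\<bar>a (n + k) - a n\<bar> \<le> 2 * c / 2 ^ n - 2 * c / 2 ^ (n + k)" if "n \<ge> 1" for n k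
  proof (induction k)
    case (Suc k)
    have "\<bar>a (n + Suc k) - a n\<bar> \<le> \<bar>a (Suc (n + k)) - a (n + k)\<bar> + \<bar>a (n + k) - a n\<bar>" by simp
    also have "\<dots> \<le> c / 2 ^ (n + k) + (2 * c / 2 ^ n - 2 * c / 2 ^ (n + k))"
      using assms[of "n + k"] that Suc by (intro add_mono) auto
    also have "\<dots> = 2 * c / 2 ^ n - 2 * c / 2 ^ (n + Suc k)" by (simp add: field_simps)
    finally show ?case .
  qed simp
  have "0 \<le> c / 2 ^ 1" using order_trans[OF abs_ge_zero assms[of 1]] by simp
  then have c0: "c \<ge> 0" by simp
  have b: "\<bar>a m - a n\<bar> \<le> 2 * c / 2 ^ n" if "n \<ge> 1" "m \<ge> n" for m n
  proof -
    have "0 \<le> 2 * c / 2 ^ m" using c0 by simp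
    then show ?thesis using *[OF that(1), of "m - n"] that by simp
  qed
  have "Cauchy a"
  proof (rule CauchyI')
    fix e :: real assume e: "e > 0"
    obtain n where n: "4 * c / e < 2 ^ n" using real_arch_pow[of 2 "4 * c / e"] by auto
    have n': "2 * c / 2 ^ Suc n < e / 2"
    proof -
      have "4 * c < 2 ^ n * e" using n e by (simp add: divide_less_eq)
      then show ?thesis using e by (simp add: field_simps) (use e in \<open>smt (verit) mult_pos_pos zero_less_power\<close>)
    qed
    have "dist (a m) (a k) < e" if "m \<ge> Suc n" "k > m" for m k
    proof -
      have "\<bar>a m - a (Suc n)\<bar> \<le> 2 * c / 2 ^ Suc n" "\<bar>a k - a (Suc n)\<bar> \<le> 2 * c / 2 ^ Suc n"
        using b[of "Suc n" m] b[of "Suc n" k] that by auto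
      then show ?thesis using n' unfolding dist_real_def by linarith
    qed
    then show "\<exists>M. \<forall>m\<ge>M. \<forall>n>m. dist (a m) (a n) < e" by blast
  qed
  then obtain l where l: "a \<longlonglongrightarrow> l" using convergent_eq_Cauchy convergent_def by blast
  show ?thesis
  proof (rule that[OF l])
    fix n :: nat assume n: "n \<ge> 1"
    have "(\<lambda>m. \<bar>a m - a n\<bar>) \<longlonglongrightarrow> \<bar>l - a n\<bar>" by (intro tendsto_intros l)
    then show "\<bar>l - a n\<bar> \<le> 2 * c / 2 ^ n"
      by (rule LIMSEQ_le_const2) (use b n in auto)
  qed
qed

text \<open>A stage consists of a point \<open>(sx, sy)\<close>, the slope \<open>se\<close> of a line through it, the derivative
  \<open>sp\<close> of the function along that line, a scale \<open>st\<close> below which this derivative is seen, the radius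
  \<open>sr\<close> of the ball to which later stages are confined, and a penalty \<open>sq\<close> on slopes. The penalty
  forces the slopes of the almost maximizing stages to converge.\<close>

datatype stage = Stage (sx: real) (sy: real) (se: real) (sp: real) (st: real) (sr: real) (sq: "real \<Rightarrow> real")

text \<open>Stage \<open>Suc n\<close> is maximal up to \<open>slack^2 / 8 ^ Suc n\<close>, so that
  the quadratic penalty moves later slopes by amounts of order \<open>slack / 2 ^ n\<close>. The
  value is chosen with \<open>1100 * slack = 1 / 64\<close>, which keeps the square roots of the
  gains in the increment bounds below \<open>1 / 2 ^ n\<close>.\<close>

definition slack :: real where "slack = 1 / 70400"

definition gain :: "stage \<Rightarrow> real \<Rightarrow> real \<Rightarrow> real" where
  "gain s e p = (p - sq s e) - (sp s - sq s (se s))"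

text \<open>The condition \<open>16 * L \<le> b0^2\<close> is reached by scaling the function. It
  keeps the slopes off the boundary of the admissible range: the derivative can increase by at most
  \<open>4 * L\<close>, so the penalty \<open>e^2\<close> of stage 0 confines all later slopes to
  \<open>\<bar>e\<bar> \<le> b0 / 2\<close>.\<close>

locale preiss_setting =
  fixes f :: "real \<Rightarrow> real \<Rightarrow> real" and L b0 :: real and G :: "nat \<Rightarrow> (real \<times> real) set"
  assumes lip: "\<And>x y x' y'. \<bar>f x y - f x' y'\<bar> \<le> L * (\<bar>x - x'\<bar> + \<bar>y - y'\<bar>)"
    and L: "0 < L" "16 * L \<le> b0\<^sup>2" and b0: "0 < b0" "b0 \<le> 1"
    and openG: "\<And>k. open (G k)"
    and GL: "\<And>a b k x. a \<in> \<rat> \<Longrightarrow> b \<in> \<rat> \<Longrightarrow> \<bar>a\<bar> < b0 \<Longrightarrow> (x, a * x + b) \<in> G k"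
begin

definition on_rational_line :: "real \<Rightarrow> real \<Rightarrow> real \<Rightarrow> real \<Rightarrow> bool" where
  "on_rational_line x y e p \<longleftrightarrow> e \<in> \<rat> \<and> y - e * x \<in> \<rat> \<and> \<bar>e\<bar> < b0 \<and>
     ((\<lambda>t. f (x + t) (y + e * t)) has_real_derivative p) (at 0)"

text \<open>The last condition is the core of the method: below the scale of the stage, increments
  in the old direction must resemble \<open>sp s * h\<close>, with a tolerance that grows like the
  square root of the gain. This is the control that \<open>steep_point\<close> provides. That
  \<open>\<kappa>\<close> is strictly below \<open>16 / 2 ^ n\<close> leaves room to move the base
  point.\<close>

definition candidate :: "nat \<Rightarrow> stage \<Rightarrow> real \<Rightarrow> real \<Rightarrow> real \<Rightarrow> real \<Rightarrow> bool" where
  "candidate n s x y e p \<longleftrightarrow> on_rational_line x y e p \<and> \<bar>x - sx s\<bar> + \<bar>y - sy s\<bar> < sr s \<and> 0 \<le> gain s e p \<and>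
     (\<exists>\<kappa><16 / 2 ^ n. \<forall>h. \<bar>h\<bar> \<le> st s \<longrightarrow>
        \<bar>f (x + h) (y + se s * h) - f x y - sp s * h\<bar> \<le> (\<kappa> + 1100 * sqrt (gain s e p)) * \<bar>h\<bar>)"

definition good_stage :: "nat \<Rightarrow> stage \<Rightarrow> bool" where
  "good_stage n s \<longleftrightarrow> on_rational_line (sx s) (sy s) (se s) (sp s) \<and> st s > 0 \<and> sr s > 0 \<and> (\<forall>e. sq s e \<ge> 0) \<and>
     (\<forall>h. \<bar>h\<bar> \<le> st s \<longrightarrow> \<bar>f (sx s + h) (sy s + se s * h) - f (sx s) (sy s) - sp s * h\<bar> \<le> 8 / 2 ^ n * \<bar>h\<bar>)"

text \<open>The last clause records the increments at scales between \<open>st s'\<close> and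
  \<open>st s\<close>, uniformly over the new ball. A candidate for \<open>s'\<close> inherits it,
  and below \<open>st s'\<close> its own condition takes over; so, if slope and derivative change
  little, it is a candidate for \<open>s\<close> as well.\<close>

definition next_stage :: "nat \<Rightarrow> stage \<Rightarrow> stage \<Rightarrow> bool" where
  "next_stage n s s' \<longleftrightarrow> candidate n s (sx s') (sy s') (se s') (sp s') \<and>
     (\<forall>x y e p. candidate n s x y e p \<longrightarrow> gain s e p \<le> gain s (se s') (sp s') + slack\<^sup>2 / 8 ^ Suc n) \<and>
     sq s' = (\<lambda>e. sq s e + (e - se s')\<^sup>2 / 2 ^ Suc n) \<and>
     (\<forall>x y. \<bar>x - sx s'\<bar> + \<bar>y - sy s'\<bar> \<le> sr s' \<longrightarrow> \<bar>x - sx s\<bar> + \<bar>y - sy s\<bar> < sr s \<and> (x, y) \<in> G n) \<and>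
     sr s' \<le> sr s / 2 \<and>
     (\<exists>\<kappa><16 / 2 ^ n. \<forall>x y h. \<bar>x - sx s'\<bar> + \<bar>y - sy s'\<bar> \<le> sr s' \<longrightarrow> st s' \<le> \<bar>h\<bar> \<longrightarrow> \<bar>h\<bar> \<le> st s \<longrightarrow>
        \<bar>f (x + h) (y + se s * h) - f x y - sp s * h\<bar> \<le> (\<kappa> + 1100 * sqrt (gain s (se s') (sp s'))) * \<bar>h\<bar>)"

lemma L_le: "L \<le> 1 / 16"
proof -
  have "b0\<^sup>2 \<le> 1" using b0 by (simp add: power_le_one)
  then show ?thesis using L by linarith
qed

lemma on_rational_line_slope: assumes "on_rational_line x y e p" shows "\<bar>p\<bar> \<le> 2 * L"
proof -
  let ?g = "\<lambda>t. f (x + t) (y + e * t)"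
  have "(\<lambda>h. (?g (0 + h) - ?g 0) / h) \<midarrow>0\<rightarrow> p" using assms unfolding on_rational_line_def DERIV_def by simp
  then have "(\<lambda>h. \<bar>(?g (0 + h) - ?g 0) / h\<bar>) \<midarrow>0\<rightarrow> \<bar>p\<bar>" by (rule tendsto_rabs)
  then show ?thesis
  proof (rule tendsto_upperbound)
    have "\<bar>(?g (0 + h) - ?g 0) / h\<bar> \<le> 2 * L" for h
    proof -
      have "\<bar>?g (0 + h) - ?g 0\<bar> \<le> L * (\<bar>h\<bar> + \<bar>e\<bar> * \<bar>h\<bar>)"
        using lip[of "x + h" "y + e * h" x y] by (simp add: abs_mult)
      also have "\<dots> \<le> L * (\<bar>h\<bar> + 1 * \<bar>h\<bar>)"
        using assms b0 L unfolding on_rational_line_def by (intro mult_left_mono add_left_mono mult_right_mono) auto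
      finally have "\<bar>?g (0 + h) - ?g 0\<bar> \<le> 2 * L * \<bar>h\<bar>" by simp
      then show ?thesis using L by (cases "h = 0") (auto simp: abs_divide pos_divide_le_eq)
    qed
    then show "\<forall>\<^sub>F h in at 0. \<bar>(?g (0 + h) - ?g 0) / h\<bar> \<le> 2 * L" by (intro always_eventually) auto
  qed simp
qed

lemma derivative_scale:
  assumes "((\<lambda>t. f (x + t) (y + e * t)) has_real_derivative p) (at 0)" "c > 0"
  obtains t where "t > 0" "\<And>h. \<bar>h\<bar> \<le> t \<Longrightarrow> \<bar>f (x + h) (y + e * h) - f x y - p * h\<bar> \<le> c * \<bar>h\<bar>"
proof -
  let ?g = "\<lambda>t. f (x + t) (y + e * t)"
  have "(\<lambda>h. (?g (0 + h) - ?g 0) / h) \<midarrow>0\<rightarrow> p" using assms(1) unfolding DERIV_def .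
  from LIM_D[OF this assms(2)] obtain d where d: "d > 0"
    "\<forall>h. h \<noteq> 0 \<and> norm (h - 0) < d \<longrightarrow> norm ((?g (0 + h) - ?g 0) / h - p) < c" by blast
  show ?thesis
  proof (rule that[of "d / 2"])
    fix h assume h: "\<bar>h\<bar> \<le> d / 2"
    show "\<bar>f (x + h) (y + e * h) - f x y - p * h\<bar> \<le> c * \<bar>h\<bar>"
    proof (cases "h = 0")
      case False
      then have "\<bar>(f (x + h) (y + e * h) - f x y) / h - p\<bar> < c" using d h by auto
      moreover have "(f (x + h) (y + e * h) - f x y) / h - p = (f (x + h) (y + e * h) - f x y - p * h) / h"
        using False by (simp add: field_simps)
      ultimately show ?thesis using False by (simp add: abs_divide pos_divide_less_eq)
    qed simp
  qed (use d in auto)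
qed

lemma open_box:
  fixes U :: "(real \<times> real) set"
  assumes "open U" "(x, y) \<in> U"
  obtains \<rho> where "\<rho> > 0" "\<And>x' y'. \<bar>x' - x\<bar> + \<bar>y' - y\<bar> < \<rho> \<Longrightarrow> (x', y') \<in> U"
proof -
  obtain \<rho> where r: "\<rho> > 0" "\<And>w. dist w (x, y) < \<rho> \<Longrightarrow> w \<in> U" using assms open_dist by metis
  show ?thesis
  proof (rule that[OF r(1)])
    fix x' y' assume *: "\<bar>x' - x\<bar> + \<bar>y' - y\<bar> < \<rho>"
    have "dist (x', y') (x, y) \<le> \<bar>x' - x\<bar> + \<bar>y' - y\<bar>"
      by (simp add: dist_Pair_Pair dist_real_def sqrt_sum_squares_le_sum_abs)
    then show "(x', y') \<in> U" using r(2) * by auto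
  qed
qed

lemma candidate_self: assumes "good_stage n s" shows "candidate n s (sx s) (sy s) (se s) (sp s)"
  using assms unfolding candidate_def good_stage_def gain_def
  by (auto intro!: exI[of _ "8 / 2 ^ n"] simp: divide_strict_right_mono)

lemma next_exists:
  assumes s: "good_stage n s"
  shows "\<exists>s'. good_stage (Suc n) s' \<and> next_stage n s s'"
proof -
  define V where "V = {v. \<exists>x y e p. candidate n s x y e p \<and> v = gain s e p}"
  have ne: "V \<noteq> {}" using candidate_self[OF s] unfolding V_def by blast
  have bdd: "bdd_above V"
  proof (rule bdd_aboveI)
    fix v assume "v \<in> V"
    then obtain x y e p where "candidate n s x y e p" "v = gain s e p" unfolding V_def by blast
    then show "v \<le> 2 * L - (sp s - sq s (se s))"
      using on_rational_line_slope[of x y e p] s unfolding candidate_def good_stage_def gain_def by (smt (verit))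
  qed
  have "Sup V - slack\<^sup>2 / 8 ^ Suc n < Sup V" by (simp add: slack_def)
  then obtain v where v: "v \<in> V" "Sup V - slack\<^sup>2 / 8 ^ Suc n < v" using less_cSup_iff[OF ne bdd] by blast
  then obtain x y e p where c: "candidate n s x y e p" "v = gain s e p" unfolding V_def by blast
  have sup: "gain s e' p' \<le> gain s e p + slack\<^sup>2 / 8 ^ Suc n" if "candidate n s x' y' e' p'" for x' y' e' p'
  proof -
    have "gain s e' p' \<in> V" using that unfolding V_def by blast
    then have "gain s e' p' \<le> Sup V" by (rule cSup_upper[OF _ bdd])
    then show ?thesis using v c by simp
  qed
  have on: "on_rational_line x y e p" using c by (simp add: candidate_def)
  obtain t where t: "t > 0" "\<And>h. \<bar>h\<bar> \<le> t \<Longrightarrow> \<bar>f (x + h) (y + e * h) - f x y - p * h\<bar> \<le> 8 / 2 ^ Suc n * \<bar>h\<bar>"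
    by (rule derivative_scale[of x y e p "8 / 2 ^ Suc n"]) (use on in \<open>auto simp: on_rational_line_def\<close>)
  obtain \<kappa>0 where k0: "\<kappa>0 < 16 / 2 ^ n" "\<And>h. \<bar>h\<bar> \<le> st s \<Longrightarrow>
        \<bar>f (x + h) (y + se s * h) - f x y - sp s * h\<bar> \<le> (\<kappa>0 + 1100 * sqrt (gain s e p)) * \<bar>h\<bar>"
    using c unfolding candidate_def by blast
  have "(x, y) \<in> G n" using GL[of e "y - e * x" x n] on by (simp add: on_rational_line_def)
  then obtain \<rho> where rho: "\<rho> > 0" "\<And>x' y'. \<bar>x' - x\<bar> + \<bar>y' - y\<bar> < \<rho> \<Longrightarrow> (x', y') \<in> G n"
    using open_box[OF openG] by metis
  define d where "d = sr s - (\<bar>x - sx s\<bar> + \<bar>y - sy s\<bar>)"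
  have d: "d > 0" using c by (simp add: d_def candidate_def)
  \<comment> \<open>The last term pays for moving the base point: a shift by \<open>r\<close>
    changes each of the two values of \<open>f\<close> by at most \<open>r / 16\<close>, and at
    scales \<open>\<bar>h\<bar> \<ge> t\<close> this is covered by half of the room
    \<open>16 / 2 ^ n - \<kappa>0\<close>.\<close>
  define r where "r = min (min (d / 2) (\<rho> / 2)) (min (sr s / 2) ((16 / 2 ^ n - \<kappa>0) / 2 * t))"
  have r: "r > 0" "r \<le> d / 2" "r \<le> \<rho> / 2" "r \<le> sr s / 2" "r \<le> (16 / 2 ^ n - \<kappa>0) / 2 * t"
  proof -
    show "r > 0" using d rho s t k0 by (auto simp: r_def good_stage_def)
  qed (simp_all only: r_def min.coboundedI1 min.coboundedI2 order_refl)
  define s' where "s' = Stage x y e p t r (\<lambda>a. sq s a + (a - e)\<^sup>2 / 2 ^ Suc n)"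
  have "good_stage (Suc n) s'"
    using s on t r unfolding good_stage_def s'_def by auto
  moreover have "next_stage n s s'"
    unfolding next_stage_def
  proof (intro conjI)
    show "candidate n s (sx s') (sy s') (se s') (sp s')" using c by (simp add: s'_def)
    show "\<forall>x y e p. candidate n s x y e p \<longrightarrow> gain s e p \<le> gain s (se s') (sp s') + slack\<^sup>2 / 8 ^ Suc n"
      using sup by (simp add: s'_def)
    show "sq s' = (\<lambda>e. sq s e + (e - se s')\<^sup>2 / 2 ^ Suc n)" by (simp add: s'_def)
    show "\<forall>x y. \<bar>x - sx s'\<bar> + \<bar>y - sy s'\<bar> \<le> sr s' \<longrightarrow> \<bar>x - sx s\<bar> + \<bar>y - sy s\<bar> < sr s \<and> (x, y) \<in> G n"
    proof (intro allI impI)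
      fix x' y' assume "\<bar>x' - sx s'\<bar> + \<bar>y' - sy s'\<bar> \<le> sr s'"
      then have *: "\<bar>x' - x\<bar> + \<bar>y' - y\<bar> \<le> r" by (simp add: s'_def)
      show "\<bar>x' - sx s\<bar> + \<bar>y' - sy s\<bar> < sr s \<and> (x', y') \<in> G n"
        using * r d rho(1) rho(2)[of x' y'] unfolding d_def by auto
    qed
    show "sr s' \<le> sr s / 2" using r by (simp add: s'_def)
    show "\<exists>\<kappa><16 / 2 ^ n. \<forall>x y h. \<bar>x - sx s'\<bar> + \<bar>y - sy s'\<bar> \<le> sr s' \<longrightarrow> st s' \<le> \<bar>h\<bar> \<longrightarrow> \<bar>h\<bar> \<le> st s \<longrightarrow>
        \<bar>f (x + h) (y + se s * h) - f x y - sp s * h\<bar> \<le> (\<kappa> + 1100 * sqrt (gain s (se s') (sp s'))) * \<bar>h\<bar>"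
    proof (intro exI[of _ "(\<kappa>0 + 16 / 2 ^ n) / 2"] conjI allI impI)
      show "(\<kappa>0 + 16 / 2 ^ n) / 2 < 16 / 2 ^ n" using k0 by simp
      fix x' y' h assume a: "\<bar>x' - sx s'\<bar> + \<bar>y' - sy s'\<bar> \<le> sr s'" "st s' \<le> \<bar>h\<bar>" "\<bar>h\<bar> \<le> st s"
      have xy: "\<bar>x' - x\<bar> + \<bar>y' - y\<bar> \<le> r" using a by (simp add: s'_def)
      have Lr: "L * (\<bar>x' - x\<bar> + \<bar>y' - y\<bar>) \<le> 1/16 * r" using xy L_le L r by (intro mult_mono) auto
      have 1: "\<bar>f (x' + h) (y' + se s * h) - f (x + h) (y + se s * h)\<bar> \<le> 1/16 * r"
        using lip[of "x' + h" "y' + se s * h" "x + h" "y + se s * h"] Lr by simp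
      have 2: "\<bar>f x' y' - f x y\<bar> \<le> 1/16 * r" using lip[of x' y' x y] Lr by simp
      have "(16 / 2 ^ n - \<kappa>0) / 2 * t \<le> (16 / 2 ^ n - \<kappa>0) / 2 * \<bar>h\<bar>"
        using a(2) k0(1) by (intro mult_left_mono) (auto simp: s'_def)
      then have "r \<le> (16 / 2 ^ n - \<kappa>0) / 2 * \<bar>h\<bar>" using r(5) by linarith
      then have "\<bar>f (x' + h) (y' + se s * h) - f x' y' - sp s * h\<bar> \<le> (\<kappa>0 + 1100 * sqrt (gain s e p)) * \<bar>h\<bar> + (16 / 2 ^ n - \<kappa>0) / 2 * \<bar>h\<bar>"
        using 1 2 k0(2)[OF a(3)] r(1) by linarith
      also have "\<dots> = ((\<kappa>0 + 16 / 2 ^ n) / 2 + 1100 * sqrt (gain s e p)) * \<bar>h\<bar>" by (simp add: field_simps)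
      finally show "\<bar>f (x' + h) (y' + se s * h) - f x' y' - sp s * h\<bar> \<le>
          ((\<kappa>0 + 16 / 2 ^ n) / 2 + 1100 * sqrt (gain s (se s') (sp s'))) * \<bar>h\<bar>" by (simp add: s'_def)
    qed
  qed
  ultimately show ?thesis by blast
qed

lemma start_exists: "\<exists>s. good_stage 0 s \<and> sq s = (\<lambda>e. e\<^sup>2) \<and> se s = 0 \<and> sr s = 1"
proof -
  have "\<bar>f y 0 - f x 0\<bar> \<le> L * \<bar>y - x\<bar>" for x y using lip[of y 0 x 0] by simp
  then obtain \<rho> N where r: "negligible N" "\<And>x. x \<notin> N \<Longrightarrow> ((\<lambda>x. f x 0) has_real_derivative \<rho> x) (at x)"
    by (rule lipschitz_real_derivative[of "\<lambda>x. f x 0" L]) blast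
  have "N \<noteq> UNIV" using r(1) non_negligible_UNIV by blast
  then obtain x where x: "x \<notin> N" by blast
  have "((\<lambda>t. f (x + t) 0) has_real_derivative \<rho> x) (at 0)"
    using DERIV_shift[of "\<lambda>x. f x 0" "\<rho> x" 0 x] r(2)[OF x] by (simp add: add.commute)
  then have on: "on_rational_line x 0 0 (\<rho> x)" using b0 by (simp add: on_rational_line_def)
  obtain t where t: "t > 0" "\<And>h. \<bar>h\<bar> \<le> t \<Longrightarrow> \<bar>f (x + h) (0 + 0 * h) - f x 0 - \<rho> x * h\<bar> \<le> 8 * \<bar>h\<bar>"
    by (rule derivative_scale[of x 0 0 "\<rho> x" 8]) (use on in \<open>auto simp: on_rational_line_def\<close>)
  show ?thesis
    by (intro exI[of _ "Stage x 0 0 (\<rho> x) t 1 (\<lambda>e. e\<^sup>2)"]) (use on t in \<open>auto simp: good_stage_def\<close>)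
qed

lemma stages_exist:
  obtains s where "\<And>n. good_stage n (s n)" "\<And>n. next_stage n (s n) (s (Suc n))"
    "sq (s 0) = (\<lambda>e. e\<^sup>2)" "se (s 0) = 0" "sr (s 0) = 1"
proof -
  obtain s0 where s0: "good_stage 0 s0" "sq s0 = (\<lambda>e. e\<^sup>2)" "se s0 = 0" "sr s0 = 1" using start_exists by blast
  have "\<exists>s. \<forall>n. (good_stage n (s n) \<and> (n = 0 \<longrightarrow> s n = s0)) \<and> next_stage n (s n) (s (Suc n))"
    by (rule dependent_nat_choice) (use s0 next_exists in auto)
  then obtain s where "\<forall>n. (good_stage n (s n) \<and> (n = 0 \<longrightarrow> s n = s0)) \<and> next_stage n (s n) (s (Suc n))" by blast
  then show ?thesis using s0 that[of s] by auto
qed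

end

text \<open>Close to the origin the axis is free of bad points because the derivative along it is 0.
  So if the bad points do not approach the origin from above, they do so from below, and the
  reflection \<open>\<tau> \<mapsto> - \<tau>\<close> leads back to the previous case.\<close>

lemma steeper_line:
  fixes F :: "real \<Rightarrow> real \<Rightarrow> real" and \<Lambda> :: "(real \<times> real) set"
  assumes lip: "\<And>s \<tau> s' \<tau>'. \<bar>F s \<tau> - F s' \<tau>'\<bar> \<le> L * (\<bar>s - s'\<bar> + \<bar>\<tau> - \<tau>'\<bar>)" and L: "L \<ge> 1"
    and F0: "F 0 0 = 0" and dF: "((\<lambda>s. F s 0) has_real_derivative 0) (at 0)"
    and eps: "0 < \<epsilon>" "\<epsilon> \<le> 1"
    and gap: "\<And>\<rho>. \<rho> > 0 \<Longrightarrow> \<exists>u \<tau>. \<bar>u\<bar> + \<bar>\<tau>\<bar> < \<rho> \<and> \<bar>F u \<tau>\<bar> > \<epsilon> * (\<bar>u\<bar> + \<bar>\<tau>\<bar>)"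
    and delta: "0 < \<delta>" "\<delta> \<le> 1 / 4" and r: "r > 0"
    and dense: "\<And>m c \<eta>. \<bar>m\<bar> \<le> 2 * \<delta> \<Longrightarrow> \<eta> > 0 \<Longrightarrow> \<exists>m' c'. (m', c') \<in> \<Lambda> \<and> \<bar>m' - m\<bar> < \<eta> \<and> \<bar>c' - c\<bar> < \<eta>"
  obtains s \<tau> m c D where "(m, c) \<in> \<Lambda>" "\<tau> = m * s + c" "\<bar>m\<bar> \<le> 2 * \<delta>" "\<bar>s\<bar> + \<bar>\<tau>\<bar> < r"
    "((\<lambda>t. F (s + t) (\<tau> + m * t)) has_real_derivative D) (at 0)" "D \<ge> \<epsilon> * \<delta> / 100"
    "\<And>t. \<bar>F (s + t) \<tau> - F s \<tau> - F t 0\<bar> \<le> (60 * L * sqrt D + 8 * L * \<delta>) * \<bar>t\<bar>"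
proof (cases "\<forall>\<rho>>0. \<exists>u \<tau>. \<tau> > 0 \<and> \<bar>u\<bar> + \<bar>\<tau>\<bar> < \<rho> \<and> \<bar>F u \<tau>\<bar> > \<epsilon> * (\<bar>u\<bar> + \<bar>\<tau>\<bar>)")
  case True
  show ?thesis
    by (rule steeper_line_pos[of F L \<epsilon> \<delta> r \<Lambda>, OF lip L F0 dF eps _ delta r dense that]) (use True in blast)+
next
  case False
  then obtain \<rho>1 where r1: "\<rho>1 > 0" "\<And>u \<tau>. \<tau> > 0 \<Longrightarrow> \<bar>u\<bar> + \<bar>\<tau>\<bar> < \<rho>1 \<Longrightarrow> \<bar>F u \<tau>\<bar> \<le> \<epsilon> * (\<bar>u\<bar> + \<bar>\<tau>\<bar>)"
    by (meson not_le)
  obtain \<rho>2 where r2: "\<rho>2 > 0" "\<And>u. \<bar>u\<bar> < \<rho>2 \<Longrightarrow> \<bar>F u 0\<bar> \<le> \<epsilon> * \<bar>u\<bar>"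
  proof -
    have "(\<lambda>h. (F (0 + h) 0 - F 0 0) / h) \<midarrow>0\<rightarrow> 0" using dF unfolding DERIV_def .
    from LIM_D[OF this eps(1)] obtain d where d: "d > 0"
      "\<forall>h. h \<noteq> 0 \<and> norm (h - 0) < d \<longrightarrow> norm ((F (0 + h) 0 - F 0 0) / h - 0) < \<epsilon>" by blast
    show ?thesis
    proof (rule that[OF d(1)])
      fix u assume "\<bar>u\<bar> < d"
      then show "\<bar>F u 0\<bar> \<le> \<epsilon> * \<bar>u\<bar>"
        using d(2) F0 by (cases "u = 0") (auto simp: abs_divide pos_divide_less_eq intro: less_imp_le)
    qed
  qed
  define F' where "F' s \<tau> = F s (- \<tau>)" for s \<tau>
  define \<Lambda>' where "\<Lambda>' = {(m, c). (- m, - c) \<in> \<Lambda>}"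
  have lip': "\<bar>F' s \<tau> - F' s' \<tau>'\<bar> \<le> L * (\<bar>s - s'\<bar> + \<bar>\<tau> - \<tau>'\<bar>)" for s \<tau> s' \<tau>'
    using lip[of s "-\<tau>" s' "-\<tau>'"] by (simp add: F'_def abs_minus_commute)
  have gap': "\<exists>u \<tau>. \<tau> > 0 \<and> \<bar>u\<bar> + \<bar>\<tau>\<bar> < \<rho> \<and> \<bar>F' u \<tau>\<bar> > \<epsilon> * (\<bar>u\<bar> + \<bar>\<tau>\<bar>)" if "\<rho> > 0" for \<rho>
  proof -
    have "min \<rho> (min \<rho>1 \<rho>2) > 0" using that r1 r2 by simp
    from gap[OF this] obtain u \<tau> where u: "\<bar>u\<bar> + \<bar>\<tau>\<bar> < min \<rho> (min \<rho>1 \<rho>2)" "\<bar>F u \<tau>\<bar> > \<epsilon> * (\<bar>u\<bar> + \<bar>\<tau>\<bar>)"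
      by blast
    have "\<not> \<tau> > 0" using r1(2)[of \<tau> u] u by auto
    moreover have "\<tau> \<noteq> 0" using r2(2)[of u] u by auto
    ultimately show ?thesis using u by (intro exI[of _ u] exI[of _ "-\<tau>"]) (auto simp: F'_def)
  qed
  have dense': "\<exists>m' c'. (m', c') \<in> \<Lambda>' \<and> \<bar>m' - m\<bar> < \<eta> \<and> \<bar>c' - c\<bar> < \<eta>" if "\<bar>m\<bar> \<le> 2 * \<delta>" "\<eta> > 0" for m c \<eta>
  proof -
    have "\<bar>- m\<bar> \<le> 2 * \<delta>" using that by simp
    from dense[OF this that(2), where c = "-c"]
    obtain m' c' where "(m', c') \<in> \<Lambda>" "\<bar>m' - - m\<bar> < \<eta>" "\<bar>c' - - c\<bar> < \<eta>" by blast
    then show ?thesis by (intro exI[of _ "-m'"] exI[of _ "-c'"]) (auto simp: \<Lambda>'_def)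
  qed
  obtain s \<tau> m c D where *: "(m, c) \<in> \<Lambda>'" "\<tau> = m * s + c" "\<bar>m\<bar> \<le> 2 * \<delta>" "\<bar>s\<bar> + \<bar>\<tau>\<bar> < r"
    "((\<lambda>t. F' (s + t) (\<tau> + m * t)) has_real_derivative D) (at 0)" "D \<ge> \<epsilon> * \<delta> / 100"
    "\<And>t. \<bar>F' (s + t) \<tau> - F' s \<tau> - F' t 0\<bar> \<le> (60 * L * sqrt D + 8 * L * \<delta>) * \<bar>t\<bar>"
    by (rule steeper_line_pos[of F' L \<epsilon> \<delta> r \<Lambda>', OF lip' L _ _ eps gap' delta r dense'])
       (use F0 dF in \<open>auto simp: F'_def\<close>)
  show ?thesis
  proof (rule that[of "-m" "-c" "-\<tau>" s D])
    show "((\<lambda>t. F (s + t) (- \<tau> + - m * t)) has_real_derivative D) (at 0)"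
      using *(5) by (simp add: F'_def)
    show "\<bar>F (s + t) (- \<tau>) - F s (- \<tau>) - F t 0\<bar> \<le> (60 * L * sqrt D + 8 * L * \<delta>) * \<bar>t\<bar>" for t
      using *(7)[of t] by (simp add: F'_def)
  qed (use * in \<open>auto simp: \<Lambda>'_def\<close>)
qed

section \<open>Differentiability at the limit of the stages\<close>

lemma sum_half_powers: "(\<Sum>k\<le>n. 1 / 2 ^ k :: real) = 2 - 1 / 2 ^ n"
  by (induction n) (auto simp: field_simps)

context preiss_setting
begin

lemma lipschitz_tendsto:
  assumes "(a \<longlonglongrightarrow> x)" "(b \<longlonglongrightarrow> y)" shows "(\<lambda>m. f (a m) (b m)) \<longlonglongrightarrow> f x y"
proof (rule LIM_zero_cancel, rule tendsto_rabs_zero_cancel)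
  have "(\<lambda>m. L * (\<bar>a m - x\<bar> + \<bar>b m - y\<bar>)) \<longlonglongrightarrow> L * (\<bar>x - x\<bar> + \<bar>y - y\<bar>)"
    by (intro tendsto_intros assms)
  then have *: "(\<lambda>m. L * (\<bar>a m - x\<bar> + \<bar>b m - y\<bar>)) \<longlonglongrightarrow> 0" by simp
  show "(\<lambda>m. \<bar>f (a m) (b m) - f x y\<bar>) \<longlonglongrightarrow> 0"
    by (rule tendsto_sandwich[OF _ _ tendsto_const *]) (use lip in auto)
qed

lemma rational_line_near:
  assumes "\<bar>e + m\<bar> < b0" "\<eta> > 0"
  shows "\<exists>m' c'. e + m' \<in> \<rat> \<and> y + c' - (e + m') * x \<in> \<rat> \<and> \<bar>e + m'\<bar> < b0 \<and> \<bar>m' - m\<bar> < \<eta> \<and> \<bar>c' - c\<bar> < \<eta>"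
proof -
  define lo where "lo = max (e + m - \<eta>) (- b0)"
  define hi where "hi = min (e + m + \<eta>) b0"
  have "lo < hi" using assms b0 by (auto simp: lo_def hi_def)
  from Rats_dense_in_real[OF this] obtain q where q: "q \<in> \<rat>" "lo < q" "q < hi" by blast
  obtain b where b: "b \<in> \<rat>" "y + c - q * x - \<eta> < b" "b < y + c - q * x + \<eta>"
    using Rats_dense_in_real[of "y + c - q * x - \<eta>" "y + c - q * x + \<eta>"] assms by auto
  show ?thesis
    by (intro exI[of _ "q - e"] exI[of _ "b - y + q * x"])
       (use q b in \<open>auto simp: lo_def hi_def abs_less_iff\<close>)
qed

text \<open>Maximality of the derivative minus the penalty dictates the gradient at the limit point:
  the derivative in direction \<open>(1, e + m)\<close> should be \<open>p + Q * m\<close> to first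
  order, with \<open>Q\<close> the slope of the limiting penalty at \<open>e\<close>, so the
  gradient is \<open>(p - Q * e, Q)\<close>. If the remainder is not small,
  \<open>steeper_line\<close> finds a rational line on which the penalized derivative is larger by
  at least \<open>D / 2\<close>. That line is a candidate, and \<open>D / 2\<close> exceeds the
  slack of the stage.\<close>

lemma differentiability_point:
  "\<exists>x y P Q. (\<forall>n. (x, y) \<in> G n) \<and>
     (\<forall>\<epsilon>>0. \<exists>\<rho>>0. \<forall>u v. \<bar>u\<bar> + \<bar>v\<bar> < \<rho> \<longrightarrow> \<bar>f (x + u) (y + v) - f x y - P * u - Q * v\<bar> \<le> \<epsilon> * (\<bar>u\<bar> + \<bar>v\<bar>))"
proof -
  obtain s where gs: "\<And>n. good_stage n (s n)" and nx: "\<And>n. next_stage n (s n) (s (Suc n))"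
    and q0: "sq (s 0) = (\<lambda>e. e\<^sup>2)" and e00: "se (s 0) = 0" and r00: "sr (s 0) = 1"
    using stages_exist by blast
  define X Y E P T R q where "X n = sx (s n)" and "Y n = sy (s n)" and "E n = se (s n)" and "P n = sp (s n)"
    and "T n = st (s n)" and "R n = sr (s n)" and "q n = sq (s n)" for n
  note dfs = X_def Y_def E_def P_def T_def R_def q_def
  have onlE: "on_rational_line (X n) (Y n) (E n) (P n)" for n using gs[of n] by (simp add: good_stage_def dfs)
  have Eb: "\<bar>E n\<bar> < b0" "\<bar>E n\<bar> \<le> 1" for n using onlE[of n] b0 by (auto simp: on_rational_line_def)
  have Pb: "\<bar>P n\<bar> \<le> 2 * L" for n using on_rational_line_slope[OF onlE[of n]] .
  have L16: "L \<le> 1/16" by (rule L_le)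
  have Tpos: "T n > 0" "R n > 0" for n using gs[of n] by (auto simp: good_stage_def dfs)
  have gdef: "gain (s n) e p = (p - q n e) - (P n - q n (E n))" for n e p by (simp add: gain_def dfs)
  have qS: "q (Suc n) e = q n e + (e - E (Suc n))\<^sup>2 / 2 ^ Suc n" for n e
    using nx[of n] by (simp add: next_stage_def dfs)
  have qform: "q n e = (\<Sum>k\<le>n. (e - E k)\<^sup>2 / 2 ^ k)" for n e
  proof (induction n)
    case 0 then show ?case using q0 e00 by (simp add: dfs)
  qed (simp add: qS)
  have qlip: "\<bar>q n e - q n e'\<bar> \<le> 8 * \<bar>e - e'\<bar>" if "\<bar>e\<bar> \<le> 1" "\<bar>e'\<bar> \<le> 1" for n e e'
  proof -
    have "q n e - q n e' = (\<Sum>k\<le>n. ((e - E k)\<^sup>2 - (e' - E k)\<^sup>2) / 2 ^ k)"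
      by (simp add: qform sum_subtractf diff_divide_distrib)
    also have "\<bar>\<dots>\<bar> \<le> (\<Sum>k\<le>n. 4 * \<bar>e - e'\<bar> * (1 / 2 ^ k))"
    proof (rule order_trans[OF sum_abs sum_mono])
      fix k
      have "(e - E k)\<^sup>2 - (e' - E k)\<^sup>2 = (e - e') * (e + e' - 2 * E k)" by (simp add: power2_eq_square algebra_simps)
      moreover have "\<bar>e + e' - 2 * E k\<bar> \<le> 4" using that Eb(2)[of k] by linarith
      ultimately have "\<bar>(e - E k)\<^sup>2 - (e' - E k)\<^sup>2\<bar> \<le> \<bar>e - e'\<bar> * 4" by (simp add: abs_mult mult_left_mono)
      then show "\<bar>((e - E k)\<^sup>2 - (e' - E k)\<^sup>2) / 2 ^ k\<bar> \<le> 4 * \<bar>e - e'\<bar> * (1 / 2 ^ k)"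
        by (simp add: abs_divide divide_right_mono mult.commute)
    qed
    also have "\<dots> = 4 * \<bar>e - e'\<bar> * (2 - 1 / 2 ^ n)" by (simp only: sum_distrib_left[symmetric] sum_half_powers)
    also have "\<dots> \<le> 4 * \<bar>e - e'\<bar> * 2" by (intro mult_left_mono) auto
    finally show ?thesis by simp
  qed
  have qmono: "q n e \<le> q (Suc n) e" for n e by (simp add: qS)
  have qown: "q (Suc n) (E (Suc n)) = q n (E (Suc n))" for n by (simp add: qS)
  have cnx: "candidate n (s n) (X (Suc n)) (Y (Suc n)) (E (Suc n)) (P (Suc n))" for n
    using nx[of n] by (simp add: next_stage_def dfs)
  have sup: "gain (s n) e p \<le> gain (s n) (E (Suc n)) (P (Suc n)) + slack\<^sup>2 / 8 ^ Suc n"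
    if "candidate n (s n) x y e p" for n x y e p using nx[of n] that by (auto simp: next_stage_def dfs)
  have inb: "\<bar>x - X n\<bar> + \<bar>y - Y n\<bar> < R n" "(x, y) \<in> G n" if "\<bar>x - X (Suc n)\<bar> + \<bar>y - Y (Suc n)\<bar> \<le> R (Suc n)" for n x y
    using nx[of n] that by (auto simp: next_stage_def dfs)
  have transfer: "\<exists>\<kappa><16 / 2 ^ n. \<forall>x y h. \<bar>x - X (Suc n)\<bar> + \<bar>y - Y (Suc n)\<bar> \<le> R (Suc n) \<longrightarrow> T (Suc n) \<le> \<bar>h\<bar> \<longrightarrow> \<bar>h\<bar> \<le> T n \<longrightarrow>
        \<bar>f (x + h) (y + E n * h) - f x y - P n * h\<bar> \<le> (\<kappa> + 1100 * sqrt (gain (s n) (E (Suc n)) (P (Suc n)))) * \<bar>h\<bar>" for n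
    using nx[of n] unfolding next_stage_def dfs by blast
  have gain0: "0 \<le> gain (s n) (E (Suc n)) (P (Suc n))" for n using cnx[of n] by (simp add: candidate_def)
  \<comment> \<open>The tolerance \<open>8 / 2 ^ n\<close> of stage \<open>Suc n\<close> and the
    change \<open>7 / 2 ^ n\<close> of direction and derivative together stay below
    \<open>16 / 2 ^ n\<close>.\<close>
  have sub: "candidate n (s n) x y e p" if small: "L * \<bar>E (Suc n) - E n\<bar> + \<bar>P (Suc n) - P n\<bar> \<le> 7 / 2 ^ n"
    and c: "candidate (Suc n) (s (Suc n)) x y e p" for n x y e p
  proof -
    have on: "on_rational_line x y e p" and rr: "\<bar>x - X (Suc n)\<bar> + \<bar>y - Y (Suc n)\<bar> < R (Suc n)"
      and g0: "0 \<le> gain (s (Suc n)) e p" using c by (auto simp: candidate_def dfs)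
    have g1: "gain (s (Suc n)) e p \<le> gain (s n) e p" "gain (s n) (E (Suc n)) (P (Suc n)) \<le> gain (s n) e p"
      using g0 gain0[of n] qmono[of n e] qown[of n] unfolding gdef by linarith+
    obtain \<kappa>1 where k1: "\<kappa>1 < 16 / 2 ^ Suc n" "\<And>h. \<bar>h\<bar> \<le> T (Suc n) \<Longrightarrow>
        \<bar>f (x + h) (y + E (Suc n) * h) - f x y - P (Suc n) * h\<bar> \<le> (\<kappa>1 + 1100 * sqrt (gain (s (Suc n)) e p)) * \<bar>h\<bar>"
      using c unfolding candidate_def dfs by blast
    obtain \<kappa>2 where k2: "\<kappa>2 < 16 / 2 ^ n" "\<And>x y h. \<bar>x - X (Suc n)\<bar> + \<bar>y - Y (Suc n)\<bar> \<le> R (Suc n) \<Longrightarrow> T (Suc n) \<le> \<bar>h\<bar> \<Longrightarrow> \<bar>h\<bar> \<le> T n \<Longrightarrow>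
        \<bar>f (x + h) (y + E n * h) - f x y - P n * h\<bar> \<le> (\<kappa>2 + 1100 * sqrt (gain (s n) (E (Suc n)) (P (Suc n)))) * \<bar>h\<bar>"
      using transfer[of n] by blast
    have "\<exists>\<kappa><16 / 2 ^ n. \<forall>h. \<bar>h\<bar> \<le> T n \<longrightarrow>
        \<bar>f (x + h) (y + E n * h) - f x y - P n * h\<bar> \<le> (\<kappa> + 1100 * sqrt (gain (s n) e p)) * \<bar>h\<bar>"
    proof (intro exI[of _ "max \<kappa>2 (\<kappa>1 + 7 / 2 ^ n)"] conjI allI impI)
      have "\<kappa>1 + 7 / 2 ^ n < 8 / 2 ^ n + 7 / 2 ^ n" using k1(1) by simp
      also have "\<dots> < 16 / 2 ^ n" by (simp add: add_divide_distrib[symmetric] divide_strict_right_mono)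
      finally show "max \<kappa>2 (\<kappa>1 + 7 / 2 ^ n) < 16 / 2 ^ n" using k2(1) by simp
      fix h :: real assume h: "\<bar>h\<bar> \<le> T n"
      show "\<bar>f (x + h) (y + E n * h) - f x y - P n * h\<bar> \<le> (max \<kappa>2 (\<kappa>1 + 7 / 2 ^ n) + 1100 * sqrt (gain (s n) e p)) * \<bar>h\<bar>"
      proof (cases "T (Suc n) \<le> \<bar>h\<bar>")
        case True
        have "\<bar>f (x + h) (y + E n * h) - f x y - P n * h\<bar> \<le> (\<kappa>2 + 1100 * sqrt (gain (s n) (E (Suc n)) (P (Suc n)))) * \<bar>h\<bar>"
          using k2(2) rr True h by simp
        also have "\<dots> \<le> (max \<kappa>2 (\<kappa>1 + 7 / 2 ^ n) + 1100 * sqrt (gain (s n) e p)) * \<bar>h\<bar>"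
          using g1 by (intro mult_right_mono add_mono mult_left_mono real_sqrt_le_mono) auto
        finally show ?thesis .
      next
        case False
        have 1: "\<bar>f (x + h) (y + E n * h) - f (x + h) (y + E (Suc n) * h)\<bar> \<le> L * \<bar>E (Suc n) - E n\<bar> * \<bar>h\<bar>"
          using lip[of "x + h" "y + E n * h" "x + h" "y + E (Suc n) * h"]
          by (simp add: left_diff_distrib[symmetric] abs_mult abs_minus_commute)
        have 2: "\<bar>P (Suc n) * h - P n * h\<bar> = \<bar>P (Suc n) - P n\<bar> * \<bar>h\<bar>"
          by (simp add: left_diff_distrib[symmetric] abs_mult)
        have 3: "\<bar>f (x + h) (y + E (Suc n) * h) - f x y - P (Suc n) * h\<bar> \<le> (\<kappa>1 + 1100 * sqrt (gain (s (Suc n)) e p)) * \<bar>h\<bar>"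
          using k1(2) False by simp
        have "\<bar>f (x + h) (y + E n * h) - f x y - P n * h\<bar> \<le>
           L * \<bar>E (Suc n) - E n\<bar> * \<bar>h\<bar> + \<bar>P (Suc n) - P n\<bar> * \<bar>h\<bar> + (\<kappa>1 + 1100 * sqrt (gain (s (Suc n)) e p)) * \<bar>h\<bar>"
          using 1 2 3 by linarith
        also have "\<dots> = (L * \<bar>E (Suc n) - E n\<bar> + \<bar>P (Suc n) - P n\<bar> + \<kappa>1 + 1100 * sqrt (gain (s (Suc n)) e p)) * \<bar>h\<bar>"
          by (simp add: algebra_simps)
        also have "\<dots> \<le> (max \<kappa>2 (\<kappa>1 + 7 / 2 ^ n) + 1100 * sqrt (gain (s n) e p)) * \<bar>h\<bar>"
        proof (rule mult_right_mono)
          have "sqrt (gain (s (Suc n)) e p) \<le> sqrt (gain (s n) e p)" using g1 by simp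
          then show "L * \<bar>E (Suc n) - E n\<bar> + \<bar>P (Suc n) - P n\<bar> + \<kappa>1 + 1100 * sqrt (gain (s (Suc n)) e p)
              \<le> max \<kappa>2 (\<kappa>1 + 7 / 2 ^ n) + 1100 * sqrt (gain (s n) e p)" using small by linarith
        qed simp
        finally show ?thesis .
      qed
    qed
    then show ?thesis
      unfolding candidate_def using on inb(1)[of x n y] rr g0 g1 by (auto simp: dfs)
  qed
  \<comment> \<open>Nesting of candidates rests on small moves, and small moves rest on nesting,
    hence a joint induction. Stage 1 may be far from stage 0, which is why the finer bounds start at
    \<open>n = 1\<close>.\<close>
  have small: "L * \<bar>E (Suc n) - E n\<bar> + \<bar>P (Suc n) - P n\<bar> \<le> 7 / 2 ^ n \<and>
      (n \<ge> 1 \<longrightarrow> \<bar>E (Suc n) - E n\<bar> \<le> slack / 2 ^ n \<and> \<bar>P (Suc n) - P n\<bar> \<le> 9 * slack / 2 ^ n)" for n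
  proof (induction n)
    case 0
    have "L * \<bar>E (Suc 0) - E 0\<bar> \<le> 1/16 * 2" using L16 L Eb(2)[of 0] Eb(2)[of "Suc 0"] by (intro mult_mono) auto
    moreover have "\<bar>P (Suc 0) - P 0\<bar> \<le> 1" using Pb[of 0] Pb[of "Suc 0"] L16 by linarith
    ultimately show ?case by simp
  next
    case (Suc m)
    let ?n = "Suc m"
    have c: "candidate m (s m) (X (Suc ?n)) (Y (Suc ?n)) (E (Suc ?n)) (P (Suc ?n))"
      using sub[of m] Suc cnx[of ?n] by blast
    have g: "gain (s m) (E (Suc ?n)) (P (Suc ?n)) \<le> gain (s m) (E ?n) (P ?n) + slack\<^sup>2 / 8 ^ ?n" by (rule sup[OF c])
    \<comment> \<open>A nonnegative gain over stage \<open>?n\<close> includes the penalty added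
      there, whereas stage \<open>?n\<close> was almost maximal before that penalty. The two facts
      together bound the square of the change of slope.\<close>
    have g': "(E (Suc ?n) - E ?n)\<^sup>2 / 2 ^ ?n \<le> gain (s m) (E (Suc ?n)) (P (Suc ?n)) - gain (s m) (E ?n) (P ?n)"
      using gain0[of ?n] qS[of m "E (Suc ?n)"] qown[of m] unfolding gdef by linarith
    have "(E (Suc ?n) - E ?n)\<^sup>2 / 2 ^ ?n \<le> slack\<^sup>2 / 8 ^ ?n" using g g' by linarith
    then have "(E (Suc ?n) - E ?n)\<^sup>2 \<le> slack\<^sup>2 / 8 ^ ?n * 2 ^ ?n" by (simp only: pos_divide_le_eq zero_less_power zero_less_numeral)
    also have "slack\<^sup>2 / 8 ^ ?n * 2 ^ ?n = (slack / 2 ^ ?n)\<^sup>2"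
    proof -
      have "(8::real) ^ ?n = 2 ^ ?n * 2 ^ ?n * 2 ^ ?n" by (simp only: power_mult_distrib[symmetric]) simp
      then show ?thesis by (simp only: power2_eq_square) (simp add: field_simps)
    qed
    finally have dE: "\<bar>E (Suc ?n) - E ?n\<bar> \<le> slack / 2 ^ ?n"
      by (metis abs_le_square_iff abs_of_nonneg divide_nonneg_pos slack_def zero_le_divide_1_iff zero_le_numeral zero_less_numeral zero_less_power)
    have om8: "slack\<^sup>2 / 8 ^ ?n \<le> slack / 2 ^ ?n"
    proof -
      have "(2::real) ^ ?n \<le> 8 ^ ?n" by (rule power_mono) auto
      moreover have "slack\<^sup>2 \<le> slack" "0 < slack" by (auto simp: slack_def power2_eq_square)
      ultimately show ?thesis by (intro frac_le) auto
    qed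
    have "0 \<le> (E (Suc ?n) - E ?n)\<^sup>2 / 2 ^ ?n" by simp
    then have "\<bar>gain (s m) (E (Suc ?n)) (P (Suc ?n)) - gain (s m) (E ?n) (P ?n)\<bar> \<le> slack / 2 ^ ?n"
      using g g' om8 by linarith
    moreover have "\<bar>q m (E (Suc ?n)) - q m (E ?n)\<bar> \<le> 8 * (slack / 2 ^ ?n)"
      using qlip[of "E (Suc ?n)" "E ?n" m] Eb(2) dE by fastforce
    moreover have "9 * slack / 2 ^ ?n = slack / 2 ^ ?n + 8 * (slack / 2 ^ ?n)" by simp
    ultimately have dP: "\<bar>P (Suc ?n) - P ?n\<bar> \<le> 9 * slack / 2 ^ ?n" unfolding gdef by linarith
    have "L * \<bar>E (Suc ?n) - E ?n\<bar> \<le> 1 * (slack / 2 ^ ?n)" using L16 L dE by (intro mult_mono) auto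
    then have "L * \<bar>E (Suc ?n) - E ?n\<bar> + \<bar>P (Suc ?n) - P ?n\<bar> \<le> 10 * slack / 2 ^ ?n" using dP by simp
    also have "\<dots> \<le> 7 / 2 ^ ?n" by (intro divide_right_mono) (auto simp: slack_def)
    finally show ?case using dE dP by blast
  qed
  have chain: "candidate n (s n) x y e p" if "candidate (n + k) (s (n + k)) x y e p" for n k x y e p
    using that by (induction k) (use sub small in auto)
  have cm: "candidate n (s n) (X m) (Y m) (E m) (P m)" if "n < m" for n m
    using chain[of n "m - Suc n"] cnx[of "m - 1"] that by (cases m) auto
  have Rb: "R n \<le> 1 / 2 ^ n" for n
  proof (induction n)
    case 0 then show ?case using r00 by (simp add: dfs)
  next
    case (Suc n)
    have "R (Suc n) \<le> R n / 2" using nx[of n] by (simp add: next_stage_def dfs)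
    then show ?case using Suc by simp
  qed
  have XY: "\<bar>X m - X n\<bar> + \<bar>Y m - Y n\<bar> \<le> R n" if "n \<le> m" for n m
    using cm[of n m] that Tpos[of n] by (cases "n = m") (auto simp: candidate_def dfs)
  have "\<bar>X (Suc n) - X n\<bar> \<le> 1 / 2 ^ n" "\<bar>Y (Suc n) - Y n\<bar> \<le> 1 / 2 ^ n" for n using XY[of n "Suc n"] Rb[of n] by auto
  then obtain x y where xl: "X \<longlonglongrightarrow> x" and yl: "Y \<longlonglongrightarrow> y"
    using geometric_limit[of X 1] geometric_limit[of Y 1] by metis
  have lc: "\<bar>x - X n\<bar> + \<bar>y - Y n\<bar> \<le> R n" for n
  proof (rule LIMSEQ_le_const2)
    show "(\<lambda>m. \<bar>X m - X n\<bar> + \<bar>Y m - Y n\<bar>) \<longlonglongrightarrow> \<bar>x - X n\<bar> + \<bar>y - Y n\<bar>" by (intro tendsto_intros xl yl)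
  qed (use XY in blast)
  have lco: "\<bar>x - X n\<bar> + \<bar>y - Y n\<bar> < R n" and inG: "(x, y) \<in> G n" for n using inb[OF lc[of "Suc n"]] by auto
  obtain e where el: "E \<longlonglongrightarrow> e" "\<And>n. n \<ge> 1 \<Longrightarrow> \<bar>e - E n\<bar> \<le> 2 * slack / 2 ^ n"
    using geometric_limit[of E slack] small by blast
  obtain p where pl: "P \<longlonglongrightarrow> p" "\<And>n. n \<ge> 1 \<Longrightarrow> \<bar>p - P n\<bar> \<le> 2 * (9 * slack) / 2 ^ n"
    using geometric_limit[of P "9 * slack"] small by blast
  have eb: "\<bar>e\<bar> \<le> b0 / 2"
  proof -
    have "\<bar>E n\<bar> \<le> b0 / 2" if "n \<ge> 1" for n
    proof -
      have "0 \<le> gain (s 0) (E n) (P n)" using cm[of 0 n] that by (simp add: candidate_def)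
      then have "(E n)\<^sup>2 \<le> P n - P 0" using q0 e00 unfolding gdef by (simp add: dfs)
      also have "\<dots> \<le> 4 * L" using Pb[of n] Pb[of 0] by linarith
      also have "\<dots> \<le> (b0 / 2)\<^sup>2" using L by (simp add: power_divide)
      finally show ?thesis using b0 by (metis abs_le_square_iff abs_of_nonneg divide_nonneg_pos less_imp_le zero_less_numeral)
    qed
    then show ?thesis by (intro LIMSEQ_le_const2[OF tendsto_rabs[OF el(1)]]) blast
  qed
  have pb: "\<bar>p\<bar> \<le> 2 * L" by (intro LIMSEQ_le_const2[OF tendsto_rabs[OF pl(1)]]) (use Pb in blast)
  have lim_inc: "\<bar>f (x + h) (y + E n * h) - f x y - P n * h\<bar> \<le> (17 / 2 ^ n) * \<bar>h\<bar>" if n: "n \<ge> 1" and h: "\<bar>h\<bar> \<le> T n" for n h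
  proof (rule LIMSEQ_le_const2)
    show "(\<lambda>m. \<bar>f (X m + h) (Y m + E n * h) - f (X m) (Y m) - P n * h\<bar>) \<longlonglongrightarrow> \<bar>f (x + h) (y + E n * h) - f x y - P n * h\<bar>"
      by (intro tendsto_intros lipschitz_tendsto xl yl)
    show "\<exists>N. \<forall>m\<ge>N. \<bar>f (X m + h) (Y m + E n * h) - f (X m) (Y m) - P n * h\<bar> \<le> 17 / 2 ^ n * \<bar>h\<bar>"
    proof (intro exI[of _ "Suc n"] allI impI)
      fix m assume m: "Suc n \<le> m"
      obtain k where k: "n = Suc k" using n by (cases n) auto
      have c: "candidate n (s n) (X m) (Y m) (E m) (P m)" "candidate k (s k) (X m) (Y m) (E m) (P m)" using cm m k by auto
      obtain \<kappa> where kk: "\<kappa> < 16 / 2 ^ n" "\<bar>f (X m + h) (Y m + E n * h) - f (X m) (Y m) - P n * h\<bar> \<le> (\<kappa> + 1100 * sqrt (gain (s n) (E m) (P m))) * \<bar>h\<bar>"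
        using c(1) h unfolding candidate_def dfs by blast
      have "gain (s n) (E m) (P m) \<le> slack\<^sup>2 / 8 ^ n"
        using sup[OF c(2)] qmono[of k "E m"] qown[of k] unfolding gdef k by linarith
      also have "\<dots> \<le> (slack / 2 ^ n)\<^sup>2"
      proof -
        have "(2 ^ n)\<^sup>2 \<le> (8::real) ^ n" by (simp add: power2_eq_square power_mult_distrib[symmetric] power_mono)
        then show ?thesis unfolding power_divide by (intro divide_left_mono) auto
      qed
      finally have "sqrt (gain (s n) (E m) (P m)) \<le> slack / 2 ^ n"
        by (intro real_le_lsqrt) (auto simp: slack_def)
      then have "\<kappa> + 1100 * sqrt (gain (s n) (E m) (P m)) \<le> 16 / 2 ^ n + 1100 * (slack / 2 ^ n)" using kk(1) by linarith
      also have "\<dots> = (16 + 1100 * slack) / 2 ^ n" by (simp add: add_divide_distrib)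
      also have "\<dots> \<le> 17 / 2 ^ n" by (intro divide_right_mono) (auto simp: slack_def)
      finally show "\<bar>f (X m + h) (Y m + E n * h) - f (X m) (Y m) - P n * h\<bar> \<le> 17 / 2 ^ n * \<bar>h\<bar>"
        using kk(2) mult_right_mono[of "\<kappa> + 1100 * sqrt (gain (s n) (E m) (P m))" "17 / 2 ^ n" "\<bar>h\<bar>"] by simp
    qed
  qed
  have lim_e: "\<bar>f (x + h) (y + e * h) - f x y - p * h\<bar> \<le> (17 / 2 ^ n + 20 * slack / 2 ^ n) * \<bar>h\<bar>" if n: "n \<ge> 1" and h: "\<bar>h\<bar> \<le> T n" for n h
  proof -
    have "\<bar>f (x + h) (y + e * h) - f (x + h) (y + E n * h)\<bar> \<le> L * (\<bar>e - E n\<bar> * \<bar>h\<bar>)"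
      using lip[of "x + h" "y + e * h" "x + h" "y + E n * h"] by (simp add: left_diff_distrib[symmetric] abs_mult)
    also have "\<dots> \<le> 1 * ((2 * slack / 2 ^ n) * \<bar>h\<bar>)" using el(2)[OF n] L L16 by (intro mult_mono) auto
    finally have 1: "\<bar>f (x + h) (y + e * h) - f (x + h) (y + E n * h)\<bar> \<le> (2 * slack / 2 ^ n) * \<bar>h\<bar>" by simp
    have 2: "\<bar>p * h - P n * h\<bar> \<le> (2 * (9 * slack) / 2 ^ n) * \<bar>h\<bar>"
      unfolding left_diff_distrib[symmetric] abs_mult using pl(2)[OF n] by (intro mult_right_mono) auto
    have "\<bar>f (x + h) (y + e * h) - f x y - p * h\<bar> \<le> (2 * slack / 2 ^ n) * \<bar>h\<bar> + (2 * (9 * slack) / 2 ^ n) * \<bar>h\<bar> + (17 / 2 ^ n) * \<bar>h\<bar>"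
      using 1 2 lim_inc[OF n h] by linarith
    also have "\<dots> = (17 / 2 ^ n + 20 * slack / 2 ^ n) * \<bar>h\<bar>" by (simp add: field_simps)
    finally show ?thesis .
  qed
  \<comment> \<open>The derivative of \<open>q n\<close> at \<open>e\<close>; its limit
    \<open>Q\<close> becomes the \<open>y\<close>-component of the gradient.\<close>
  define Qn where "Qn n = (\<Sum>k\<le>n. 2 * (e - E k) / 2 ^ k)" for n
  have eE: "\<bar>e - E k\<bar> \<le> 2" for k using eb b0 Eb(2)[of k] by linarith
  have "\<bar>Qn (Suc n) - Qn n\<bar> \<le> 2 / 2 ^ n" for n
    using eE[of "Suc n"] by (simp add: Qn_def abs_divide abs_mult field_simps)
  then obtain Q where Ql: "\<And>n. n \<ge> 1 \<Longrightarrow> \<bar>Q - Qn n\<bar> \<le> 2 * 2 / 2 ^ n"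
    using geometric_limit[of Qn 2] by blast
  have Qb: "\<bar>Q\<bar> \<le> 8"
  proof -
    have "Qn 1 = 2 * (e - E 0) + (e - E 1)" by (simp add: Qn_def)
    moreover have "\<bar>Q - Qn 1\<bar> \<le> 2" using Ql[of 1] by simp
    ultimately show ?thesis using eE[of 0] eE[of 1] by argo
  qed
  have qexp: "q n (e + m) \<le> q n e + Qn n * m + 2 * m\<^sup>2" for n m
  proof -
    have "q n (e + m) = (\<Sum>k\<le>n. (e - E k)\<^sup>2 / 2 ^ k + 2 * (e - E k) / 2 ^ k * m + m\<^sup>2 * (1 / 2 ^ k))"
      unfolding qform by (rule sum.cong) (auto simp: power2_eq_square field_simps)
    also have "\<dots> = q n e + Qn n * m + m\<^sup>2 * (2 - 1 / 2 ^ n)"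
      by (simp add: sum.distrib qform Qn_def sum_distrib_right sum_half_powers[symmetric] sum_distrib_left)
    also have "m\<^sup>2 * (2 - 1 / 2 ^ n) \<le> m\<^sup>2 * 2" by (intro mult_left_mono) auto
    finally show ?thesis by simp
  qed
  \<comment> \<open>Hence an improvement over the limit values is also an improvement over stage
    \<open>Suc n\<close>.\<close>
  have lim_gain: "P (Suc n) - q n (E (Suc n)) \<le> p - q n e" for n
  proof (rule LIMSEQ_le_const)
    have "(\<lambda>m. q n (E m)) \<longlonglongrightarrow> q n e" unfolding qform by (intro tendsto_intros el(1)) auto
    then show "(\<lambda>m. P m - q n (E m)) \<longlonglongrightarrow> p - q n e" by (intro tendsto_intros pl(1))
    show "\<exists>N. \<forall>m\<ge>N. P (Suc n) - q n (E (Suc n)) \<le> P m - q n (E m)"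
    proof (intro exI[of _ "Suc (Suc n)"] allI impI)
      fix m assume "Suc (Suc n) \<le> m"
      then have "0 \<le> gain (s (Suc n)) (E m) (P m)" using cm[of "Suc n" m] by (simp add: candidate_def)
      then show "P (Suc n) - q n (E (Suc n)) \<le> P m - q n (E m)"
        using qmono[of n "E m"] qown[of n] unfolding gdef by linarith
    qed
  qed
  have diff: "\<exists>\<rho>>0. \<forall>u v. \<bar>u\<bar> + \<bar>v\<bar> < \<rho> \<longrightarrow> \<bar>f (x + u) (y + v) - f x y - (p - Q * e) * u - Q * v\<bar> \<le> \<epsilon> * (\<bar>u\<bar> + \<bar>v\<bar>)"
    if eps: "\<epsilon> > 0" "\<epsilon> \<le> 1" for \<epsilon>
  proof (rule ccontr)
    assume "\<not> ?thesis"
    then have gap0: "\<And>\<rho>. \<rho> > 0 \<Longrightarrow> \<exists>u v. \<bar>u\<bar> + \<bar>v\<bar> < \<rho> \<and> \<bar>f (x + u) (y + v) - f x y - (p - Q * e) * u - Q * v\<bar> > \<epsilon> * (\<bar>u\<bar> + \<bar>v\<bar>)"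
      by (meson not_le)
    define F where "F a \<tau> = f (x + a) (y + e * a + \<tau>) - f x y - p * a - Q * \<tau>" for a \<tau>
    have lipF: "\<bar>F a \<tau> - F a' \<tau>'\<bar> \<le> 12 * (\<bar>a - a'\<bar> + \<bar>\<tau> - \<tau>'\<bar>)" for a \<tau> a' \<tau>'
    proof -
      have "\<bar>f (x + a) (y + e * a + \<tau>) - f (x + a') (y + e * a' + \<tau>')\<bar> \<le> L * (\<bar>a - a'\<bar> + \<bar>e * (a - a') + (\<tau> - \<tau>')\<bar>)"
        using lip[of "x + a" "y + e * a + \<tau>" "x + a'" "y + e * a' + \<tau>'"] by (simp add: algebra_simps)
      also have "\<dots> \<le> 1 * (\<bar>a - a'\<bar> + (1 * \<bar>a - a'\<bar> + \<bar>\<tau> - \<tau>'\<bar>))"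
      proof (rule mult_mono)
        have "\<bar>e * (a - a')\<bar> \<le> 1 * \<bar>a - a'\<bar>" unfolding abs_mult using eb b0 by (intro mult_right_mono) auto
        then show "\<bar>a - a'\<bar> + \<bar>e * (a - a') + (\<tau> - \<tau>')\<bar> \<le> \<bar>a - a'\<bar> + (1 * \<bar>a - a'\<bar> + \<bar>\<tau> - \<tau>'\<bar>)" by linarith
      qed (use L L16 in auto)
      finally have 1: "\<bar>f (x + a) (y + e * a + \<tau>) - f (x + a') (y + e * a' + \<tau>')\<bar> \<le> 2 * \<bar>a - a'\<bar> + \<bar>\<tau> - \<tau>'\<bar>" by simp
      have 2: "\<bar>p * a - p * a'\<bar> \<le> 1 * \<bar>a - a'\<bar>"
        unfolding right_diff_distrib[symmetric] abs_mult using pb L16 by (intro mult_right_mono) auto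
      have 3: "\<bar>Q * \<tau> - Q * \<tau>'\<bar> \<le> 8 * \<bar>\<tau> - \<tau>'\<bar>"
        unfolding right_diff_distrib[symmetric] abs_mult using Qb by (intro mult_right_mono) auto
      have "\<bar>F a \<tau> - F a' \<tau>'\<bar> \<le> \<bar>f (x + a) (y + e * a + \<tau>) - f (x + a') (y + e * a' + \<tau>')\<bar>
          + \<bar>p * a - p * a'\<bar> + \<bar>Q * \<tau> - Q * \<tau>'\<bar>" unfolding F_def by linarith
      also have "\<dots> \<le> (2 * \<bar>a - a'\<bar> + \<bar>\<tau> - \<tau>'\<bar>) + 1 * \<bar>a - a'\<bar> + 8 * \<bar>\<tau> - \<tau>'\<bar>"
        by (intro add_mono 1 2 3)
      also have "\<dots> \<le> 12 * (\<bar>a - a'\<bar> + \<bar>\<tau> - \<tau>'\<bar>)"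
        by simp
      finally show ?thesis .
    qed
    have F0: "F 0 0 = 0" by (simp add: F_def)
    have F0h: "\<bar>F h 0\<bar> \<le> (17 / 2 ^ n + 20 * slack / 2 ^ n) * \<bar>h\<bar>" if "n \<ge> 1" "\<bar>h\<bar> \<le> T n" for n and h :: real
      using lim_e[OF that] by (simp add: F_def)
    have dF: "((\<lambda>a. F a 0) has_real_derivative 0) (at 0)"
      unfolding DERIV_def
    proof (rule LIM_I)
      fix r :: real assume r: "r > 0"
      obtain n0 where n0: "18 / r < 2 ^ n0" using real_arch_pow[of 2 "18 / r"] by auto
      define n where "n = Suc n0"
      have "18 / r < 2 ^ n" using n0 by (simp add: n_def) (smt (verit) zero_less_power)
      then have rn: "18 / 2 ^ n < r" using r by (simp add: field_simps)
      have c: "17 / 2 ^ n + 20 * slack / 2 ^ n \<le> 18 / 2 ^ n"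
        unfolding add_divide_distrib[symmetric] by (intro divide_right_mono) (auto simp: slack_def)
      show "\<exists>s>0. \<forall>h. h \<noteq> 0 \<and> norm (h - 0) < s \<longrightarrow> norm ((F (0 + h) 0 - F 0 0) / h - 0) < r"
      proof (intro exI[of _ "T n"] conjI allI impI)
        fix h :: real assume h: "h \<noteq> 0 \<and> norm (h - 0) < T n"
        have "\<bar>F h 0\<bar> \<le> (18 / 2 ^ n) * \<bar>h\<bar>"
          using F0h[of n h] h mult_right_mono[OF c, of "\<bar>h\<bar>"] by (auto simp: n_def)
        then have "\<bar>F h 0 / h\<bar> \<le> 18 / 2 ^ n" using h by (simp add: abs_divide divide_le_eq)
        then show "norm ((F (0 + h) 0 - F 0 0) / h - 0) < r" using rn F0 by simp
      qed (use Tpos in auto)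
    qed
    define \<epsilon>' where "\<epsilon>' = \<epsilon> / 2"
    have eps': "0 < \<epsilon>'" "\<epsilon>' \<le> 1" using eps by (auto simp: \<epsilon>'_def)
    have gap: "\<exists>u \<tau>. \<bar>u\<bar> + \<bar>\<tau>\<bar> < \<rho> \<and> \<bar>F u \<tau>\<bar> > \<epsilon>' * (\<bar>u\<bar> + \<bar>\<tau>\<bar>)" if rp: "\<rho> > 0" for \<rho>
    proof -
      obtain u v where uv: "\<bar>u\<bar> + \<bar>v\<bar> < \<rho> / 2" "\<bar>f (x + u) (y + v) - f x y - (p - Q * e) * u - Q * v\<bar> > \<epsilon> * (\<bar>u\<bar> + \<bar>v\<bar>)"
        using gap0[of "\<rho> / 2"] half_gt_zero[OF rp] by blast
      have "\<bar>e * u\<bar> \<le> 1 * \<bar>u\<bar>" unfolding abs_mult using eb b0 by (intro mult_right_mono) auto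
      then have le: "\<bar>u\<bar> + \<bar>v - e * u\<bar> \<le> 2 * (\<bar>u\<bar> + \<bar>v\<bar>)" using abs_triangle_ineq4[of v "e * u"] abs_ge_zero[of v] unfolding mult_1 distrib_left mult_2 by (rule_tac order_trans[OF add_left_mono[of _ "\<bar>v\<bar> + \<bar>u\<bar>"]]) simp_all
      have "F u (v - e * u) = f (x + u) (y + v) - f x y - (p - Q * e) * u - Q * v" by (simp add: F_def algebra_simps)
      moreover have "\<epsilon>' * (\<bar>u\<bar> + \<bar>v - e * u\<bar>) \<le> \<epsilon> * (\<bar>u\<bar> + \<bar>v\<bar>)"
        using mult_left_mono[OF le, of \<epsilon>'] eps' by (simp add: \<epsilon>'_def)
      ultimately show ?thesis using uv le by (intro exI[of _ u] exI[of _ "v - e * u"]) auto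
    qed
    obtain n0 where n0: "max (1800 / \<epsilon>') (1 / b0) < 2 ^ n0" using real_arch_pow[of 2 "max (1800 / \<epsilon>') (1 / b0)"] by auto
    define n where "n = Suc n0"
    have n1: "n \<ge> 1" by (simp add: n_def)
    have n2: "1800 / \<epsilon>' < 2 ^ n" "1 / b0 < 2 ^ n" using n0 by (auto simp: n_def) (smt (verit) zero_less_power)+
    have n3: "1800 / 2 ^ n < \<epsilon>'" "1 / 2 ^ n < b0" using n2 eps' b0 by (auto simp: field_simps)
    \<comment> \<open>The tilt is of order \<open>1 / 2 ^ n\<close>. It is small enough for the
      increment error \<open>96 * \<delta>\<close> to fit into \<open>11 / 2 ^ n\<close>, and for
      the errors from \<open>Qn n\<close> in place of \<open>Q\<close> and from
      \<open>2 * m^2\<close> to stay below half of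
      \<open>D \<ge> \<epsilon>' * \<delta> / 100\<close> when
      \<open>1800 / 2 ^ n < \<epsilon>'\<close>. It is large enough for \<open>D / 2\<close> to
      exceed \<open>slack^2 / 8 ^ Suc n\<close>.\<close>
    define \<delta> :: real where "\<delta> = 1 / (200 * 2 ^ n)"
    have d: "0 < \<delta>" "\<delta> \<le> 1/4" "2 * \<delta> < b0 / 2"
    proof -
      have "(1::real) \<le> 2 ^ n" by simp
      have "\<delta> \<le> 1 / 200" by (simp add: \<delta>_def field_simps)
      then show "\<delta> \<le> 1/4" by simp
      show "0 < \<delta>" by (simp add: \<delta>_def)
      show "2 * \<delta> < b0 / 2" using n3(2) b0 by (simp add: \<delta>_def)
    qed
    define r where "r = (R (Suc n) - (\<bar>x - X (Suc n)\<bar> + \<bar>y - Y (Suc n)\<bar>)) / 2"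
    have r: "r > 0" using lco[of "Suc n"] by (simp add: r_def)
    define \<Lambda> where "\<Lambda> = {(m, c). e + m \<in> \<rat> \<and> y + c - (e + m) * x \<in> \<rat> \<and> \<bar>e + m\<bar> < b0}"
    have dense: "\<exists>m' c'. (m', c') \<in> \<Lambda> \<and> \<bar>m' - m\<bar> < \<eta> \<and> \<bar>c' - c\<bar> < \<eta>" if "\<bar>m\<bar> \<le> 2 * \<delta>" "\<eta> > 0" for m c \<eta>
    proof -
      have "\<bar>e + m\<bar> < b0" using that eb d by linarith
      from rational_line_near[OF this that(2)] show ?thesis unfolding \<Lambda>_def by blast
    qed
    obtain a \<tau> m c D where imp: "(m, c) \<in> \<Lambda>" "\<tau> = m * a + c" "\<bar>m\<bar> \<le> 2 * \<delta>" "\<bar>a\<bar> + \<bar>\<tau>\<bar> < r"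
      "((\<lambda>t. F (a + t) (\<tau> + m * t)) has_real_derivative D) (at 0)" "D \<ge> \<epsilon>' * \<delta> / 100"
      "\<And>t. \<bar>F (a + t) \<tau> - F a \<tau> - F t 0\<bar> \<le> (60 * 12 * sqrt D + 8 * 12 * \<delta>) * \<bar>t\<bar>"
      by (rule steeper_line[of F 12 \<epsilon>' \<delta> r \<Lambda>, OF lipF _ F0 dF eps' gap d(1,2) r dense]) auto
    define x' y' e' p' where "x' = x + a" and "y' = y + e * a + \<tau>" and "e' = e + m" and "p' = D + p + Q * m"
    have on: "on_rational_line x' y' e' p'"
      unfolding on_rational_line_def
    proof (intro conjI)
      show "e' \<in> \<rat>" "\<bar>e'\<bar> < b0" using imp(1) by (auto simp: \<Lambda>_def e'_def)
      have "y' - e' * x' = y + c - (e + m) * x" using imp(2) by (simp add: x'_def y'_def e'_def algebra_simps)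
      then show "y' - e' * x' \<in> \<rat>" using imp(1) by (simp add: \<Lambda>_def)
      have "((\<lambda>t. F (a + t) (\<tau> + m * t) + (f x y + p * (a + t) + Q * (\<tau> + m * t))) has_real_derivative D + (p + Q * m)) (at 0)"
        by (intro DERIV_add imp(5)) (auto intro!: derivative_eq_intros)
      moreover have "(\<lambda>t. F (a + t) (\<tau> + m * t) + (f x y + p * (a + t) + Q * (\<tau> + m * t))) = (\<lambda>t. f (x' + t) (y' + e' * t))"
        by (auto simp: F_def x'_def y'_def e'_def algebra_simps)
      ultimately show "((\<lambda>t. f (x' + t) (y' + e' * t)) has_real_derivative p') (at 0)"
        by (simp add: p'_def add.assoc)
    qed
    have D0: "D > 0" using imp(6) mult_pos_pos[OF eps'(1) d(1)] by linarith
    have big: "D / 2 \<le> (p' - q n e') - (p - q n e)"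
    proof -
      have "\<bar>(Q - Qn n) * m\<bar> \<le> (2 * 2 / 2 ^ n) * (2 * \<delta>)" unfolding abs_mult using Ql[OF n1] imp(3) by (intro mult_mono) auto
      moreover have "2 * m\<^sup>2 \<le> 8 * (\<delta> * \<delta>)"
      proof -
        have "m\<^sup>2 \<le> (2 * \<delta>)\<^sup>2" using imp(3) by (metis abs_ge_zero power2_abs power_mono)
        then show ?thesis by (simp add: power2_eq_square)
      qed
      moreover have "8 * (\<delta> * \<delta>) = 1/25 * (\<delta> / 2 ^ n)" by (simp add: \<delta>_def)
      moreover have "9 * (\<delta> / 2 ^ n) \<le> \<epsilon>' * \<delta> / 200"
        using mult_right_mono[of "1800 / 2 ^ n" \<epsilon>' "\<delta> / 200"] n3(1) d(1) by simp
      moreover have "0 \<le> \<delta> / 2 ^ n" using d by simp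
      ultimately have "\<bar>(Q - Qn n) * m\<bar> + 2 * m\<^sup>2 \<le> D / 2" using imp(6) by simp
      moreover have "- ((Q - Qn n) * m) \<le> \<bar>(Q - Qn n) * m\<bar>" by (rule abs_ge_minus_self)
      ultimately show ?thesis using qexp[of n m] unfolding p'_def e'_def left_diff_distrib by linarith
    qed
    have G1: "D / 2 \<le> gain (s n) e' p' - gain (s n) (E (Suc n)) (P (Suc n))"
      using big lim_gain[of n] unfolding gdef by linarith
    then have Gp: "gain (s n) (E (Suc n)) (P (Suc n)) \<le> gain (s n) e' p'" "D / 2 \<le> gain (s n) e' p'"
      using gain0[of n] D0 by linarith+
    have near: "\<bar>x' - X (Suc n)\<bar> + \<bar>y' - Y (Suc n)\<bar> \<le> R (Suc n)"
    proof -
      have "\<bar>e * a\<bar> \<le> 1 * \<bar>a\<bar>" unfolding abs_mult using eb b0 by (intro mult_right_mono) auto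
      then have "\<bar>e * a\<bar> \<le> \<bar>a\<bar>" by simp
      moreover have "\<bar>x + a - X (Suc n)\<bar> \<le> \<bar>x - X (Suc n)\<bar> + \<bar>a\<bar>"
        using abs_triangle_ineq[of "x - X (Suc n)" a] by (simp add: algebra_simps)
      moreover have "\<bar>y + e * a + \<tau> - Y (Suc n)\<bar> \<le> \<bar>y - Y (Suc n)\<bar> + (\<bar>e * a\<bar> + \<bar>\<tau>\<bar>)"
        using abs_triangle_ineq[of "y - Y (Suc n)" "e * a + \<tau>"] abs_triangle_ineq[of "e * a" \<tau>] by (simp add: algebra_simps)
      moreover have "2 * (\<bar>a\<bar> + \<bar>\<tau>\<bar>) \<le> R (Suc n) - (\<bar>x - X (Suc n)\<bar> + \<bar>y - Y (Suc n)\<bar>)" using imp(4) unfolding r_def by simp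
      moreover have "A + B \<le> r0" if "\<beta> \<le> \<alpha>" "A \<le> s1 + \<alpha>" "B \<le> s2 + (\<beta> + \<gamma>)" "2 * (\<alpha> + \<gamma>) \<le> r0 - (s1 + s2)" "0 \<le> \<gamma>"
        for A B \<alpha> \<beta> \<gamma> s1 s2 r0 :: real using that by argo
      ultimately show ?thesis unfolding x'_def y'_def using abs_ge_zero[of \<tau>] by blast
    qed
    have "candidate n (s n) x' y' e' p'"
      unfolding candidate_def
    proof (intro conjI)
      show "on_rational_line x' y' e' p'" by fact
      show "\<bar>x' - sx (s n)\<bar> + \<bar>y' - sy (s n)\<bar> < sr (s n)" using inb(1)[OF near] by (simp add: dfs)
      show "0 \<le> gain (s n) e' p'" using Gp D0 by linarith
      obtain \<kappa>2 where k2: "\<kappa>2 < 16 / 2 ^ n" "\<And>x y h. \<bar>x - X (Suc n)\<bar> + \<bar>y - Y (Suc n)\<bar> \<le> R (Suc n) \<Longrightarrow> T (Suc n) \<le> \<bar>h\<bar> \<Longrightarrow> \<bar>h\<bar> \<le> T n \<Longrightarrow>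
          \<bar>f (x + h) (y + E n * h) - f x y - P n * h\<bar> \<le> (\<kappa>2 + 1100 * sqrt (gain (s n) (E (Suc n)) (P (Suc n)))) * \<bar>h\<bar>"
        using transfer[of n] by blast
      show "\<exists>\<kappa><16 / 2 ^ n. \<forall>h. \<bar>h\<bar> \<le> st (s n) \<longrightarrow>
        \<bar>f (x' + h) (y' + se (s n) * h) - f x' y' - sp (s n) * h\<bar> \<le> (\<kappa> + 1100 * sqrt (gain (s n) e' p')) * \<bar>h\<bar>"
        unfolding T_def[symmetric] E_def[symmetric] P_def[symmetric]
      proof (intro exI[of _ "max \<kappa>2 (11 / 2 ^ n)"] conjI allI impI)
        show "max \<kappa>2 (11 / 2 ^ n) < 16 / 2 ^ n" using k2(1) by (simp add: divide_strict_right_mono)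
        fix h :: real assume h: "\<bar>h\<bar> \<le> T n"
        show "\<bar>f (x' + h) (y' + E n * h) - f x' y' - P n * h\<bar> \<le> (max \<kappa>2 (11 / 2 ^ n) + 1100 * sqrt (gain (s n) e' p')) * \<bar>h\<bar>"
        proof (cases "T (Suc n) \<le> \<bar>h\<bar>")
          case True
          have "\<bar>f (x' + h) (y' + E n * h) - f x' y' - P n * h\<bar> \<le> (\<kappa>2 + 1100 * sqrt (gain (s n) (E (Suc n)) (P (Suc n)))) * \<bar>h\<bar>"
            by (rule k2(2)[OF near True h])
          also have "\<dots> \<le> (max \<kappa>2 (11 / 2 ^ n) + 1100 * sqrt (gain (s n) e' p')) * \<bar>h\<bar>"
            using Gp by (intro mult_right_mono add_mono mult_left_mono real_sqrt_le_mono) auto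
          finally show ?thesis .
        next
          case False
          have 1: "\<bar>f (x' + h) (y' + E n * h) - f (x' + h) (y' + e * h)\<bar> \<le> (2 * slack / 2 ^ n) * \<bar>h\<bar>"
          proof -
            have "\<bar>f (x' + h) (y' + E n * h) - f (x' + h) (y' + e * h)\<bar> \<le> L * (\<bar>e - E n\<bar> * \<bar>h\<bar>)"
              using lip[of "x' + h" "y' + E n * h" "x' + h" "y' + e * h"] by (simp add: left_diff_distrib[symmetric] abs_mult abs_minus_commute)
            also have "\<dots> \<le> 1 * ((2 * slack / 2 ^ n) * \<bar>h\<bar>)" using el(2)[OF n1] L L16 by (intro mult_mono) auto
            finally show ?thesis by simp
          qed
          have 2: "\<bar>p * h - P n * h\<bar> \<le> (2 * (9 * slack) / 2 ^ n) * \<bar>h\<bar>"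
            unfolding left_diff_distrib[symmetric] abs_mult using pl(2)[OF n1] by (intro mult_right_mono) auto
          have "f (x' + h) (y' + e * h) - f x' y' - p * h = F (a + h) \<tau> - F a \<tau>"
            by (simp add: F_def x'_def y'_def algebra_simps)
          moreover have "\<bar>F h 0\<bar> \<le> (17 / 2 ^ Suc n + 20 * slack / 2 ^ Suc n) * \<bar>h\<bar>" using False by (intro F0h) auto
          ultimately have 3: "\<bar>f (x' + h) (y' + e * h) - f x' y' - p * h\<bar> \<le>
              (17 / 2 ^ Suc n + 20 * slack / 2 ^ Suc n) * \<bar>h\<bar> + (60 * 12 * sqrt D + 8 * 12 * \<delta>) * \<bar>h\<bar>"
            using imp(7)[of h] by linarith
          have "\<bar>f (x' + h) (y' + E n * h) - f x' y' - P n * h\<bar> \<le> (2 * slack / 2 ^ n) * \<bar>h\<bar> + (2 * (9 * slack) / 2 ^ n) * \<bar>h\<bar> +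
              ((17 / 2 ^ Suc n + 20 * slack / 2 ^ Suc n) * \<bar>h\<bar> + (60 * 12 * sqrt D + 8 * 12 * \<delta>) * \<bar>h\<bar>)"
            using 1 2 3 by linarith
          also have "\<dots> = (2 * slack / 2 ^ n + 2 * (9 * slack) / 2 ^ n + 17 / 2 ^ Suc n + 20 * slack / 2 ^ Suc n + 60 * 12 * sqrt D + 8 * 12 * \<delta>) * \<bar>h\<bar>"
            by (simp add: algebra_simps)
          also have "\<dots> \<le> (max \<kappa>2 (11 / 2 ^ n) + 1100 * sqrt (gain (s n) e' p')) * \<bar>h\<bar>"
          proof (rule mult_right_mono)
            have "2 * slack / 2 ^ n + 2 * (9 * slack) / 2 ^ n + 17 / 2 ^ Suc n + 20 * slack / 2 ^ Suc n + 8 * 12 * \<delta> = (30 * slack + 17/2 + 96/200) / 2 ^ n"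
              by (simp add: \<delta>_def field_simps)
            also have "\<dots> \<le> 11 / 2 ^ n" by (intro divide_right_mono) (auto simp: slack_def)
            finally have A: "2 * slack / 2 ^ n + 2 * (9 * slack) / 2 ^ n + 17 / 2 ^ Suc n + 20 * slack / 2 ^ Suc n + 8 * 12 * \<delta> \<le> 11 / 2 ^ n" .
            \<comment> \<open>\<open>D\<close> is at most twice the gain, so
              \<open>720 * sqrt D\<close> is at most \<open>1080\<close> times the root of the gain:
              this is the origin of the constant \<open>1100\<close> in
              \<open>candidate\<close>.\<close>
            have "sqrt D \<le> sqrt ((3/2)\<^sup>2 * gain (s n) e' p')" using Gp(2) D0 by (intro real_sqrt_le_mono) (simp add: power2_eq_square)
            also have "\<dots> = 3/2 * sqrt (gain (s n) e' p')" by (subst real_sqrt_mult) simp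
            finally have B: "60 * 12 * sqrt D \<le> 1080 * sqrt (gain (s n) e' p')" by simp
            have "0 \<le> sqrt (gain (s n) e' p')" using Gp D0 by simp
            then show "2 * slack / 2 ^ n + 2 * (9 * slack) / 2 ^ n + 17 / 2 ^ Suc n + 20 * slack / 2 ^ Suc n + 60 * 12 * sqrt D + 8 * 12 * \<delta>
               \<le> max \<kappa>2 (11 / 2 ^ n) + 1100 * sqrt (gain (s n) e' p')" using A B by linarith
          qed simp
          finally show ?thesis .
        qed
      qed
    qed
    from sup[OF this] have "D / 2 \<le> slack\<^sup>2 / 8 ^ Suc n" using G1 by linarith
    moreover have "slack\<^sup>2 / 8 ^ Suc n < \<epsilon>' * \<delta> / 200"
    proof -
      have "slack\<^sup>2 / 8 ^ Suc n \<le> slack\<^sup>2 / (2 ^ n * 2 ^ n)"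
      proof -
        have "2 ^ n * 2 ^ n \<le> (8::real) ^ n" by (simp add: power_mult_distrib[symmetric] power_mono)
        also have "\<dots> \<le> 8 ^ Suc n" by simp
        finally show ?thesis by (intro divide_left_mono) auto
      qed
      also have "\<dots> < 9 / 200 * (1 / (2 ^ n * 2 ^ n))"
        unfolding divide_inverse[of "slack\<^sup>2"] inverse_eq_divide by (rule mult_strict_right_mono) (auto simp: slack_def power2_eq_square)
      also have "\<dots> = (1800 / 2 ^ n) * (\<delta> / 200)" by (simp add: \<delta>_def)
      also have "\<dots> \<le> \<epsilon>' * (\<delta> / 200)" using n3(1) d(1) by (intro mult_right_mono) auto
      finally show ?thesis by simp
    qed
    ultimately show False using imp(6) by linarith
  qed
  have "\<exists>\<rho>>0. \<forall>u v. \<bar>u\<bar> + \<bar>v\<bar> < \<rho> \<longrightarrow> \<bar>f (x + u) (y + v) - f x y - (p - Q * e) * u - Q * v\<bar> \<le> \<epsilon> * (\<bar>u\<bar> + \<bar>v\<bar>)"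
    if e0: "\<epsilon> > 0" for \<epsilon>
  proof -
    have "0 < min \<epsilon> 1" "min \<epsilon> 1 \<le> 1" using e0 by auto
    from diff[OF this] obtain \<rho> where rho: "\<rho> > 0" "\<And>u v. \<bar>u\<bar> + \<bar>v\<bar> < \<rho> \<Longrightarrow>
       \<bar>f (x + u) (y + v) - f x y - (p - Q * e) * u - Q * v\<bar> \<le> min \<epsilon> 1 * (\<bar>u\<bar> + \<bar>v\<bar>)" by blast
    have "min \<epsilon> 1 * (\<bar>u\<bar> + \<bar>v\<bar>) \<le> \<epsilon> * (\<bar>u\<bar> + \<bar>v\<bar>)" for u v :: real by (intro mult_right_mono) auto
    then show ?thesis using rho by (meson order_trans)
  qed
  then show ?thesis using inG by blast
qed

end

section \<open>Functions with second-order bounds\<close>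

text \<open>Bounded functions with bounded, Lipschitz gradient, encoded by their Taylor remainder.
  One constant for everything makes the class easy to carry through sums, products and compositions,
  and it is the only information on earlier steps that the choice of the next wave uses.\<close>

definition quad :: "real \<Rightarrow> (real \<Rightarrow> real \<Rightarrow> real) \<Rightarrow> (real \<Rightarrow> real \<Rightarrow> real) \<Rightarrow> (real \<Rightarrow> real \<Rightarrow> real) \<Rightarrow> bool" where
  "quad B F Fx Fy \<longleftrightarrow> (\<forall>x y. \<bar>F x y\<bar> \<le> B \<and> \<bar>Fx x y\<bar> \<le> B \<and> \<bar>Fy x y\<bar> \<le> B) \<and>
     (\<forall>x y u v. \<bar>F (x + u) (y + v) - F x y - Fx x y * u - Fy x y * v\<bar> \<le> B * (\<bar>u\<bar> + \<bar>v\<bar>)\<^sup>2)"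

lemma quadI:
  assumes "\<And>x y. \<bar>F x y\<bar> \<le> B" "\<And>x y. \<bar>Fx x y\<bar> \<le> B" "\<And>x y. \<bar>Fy x y\<bar> \<le> B"
    "\<And>x y u v. \<bar>F (x + u) (y + v) - F x y - Fx x y * u - Fy x y * v\<bar> \<le> B * (\<bar>u\<bar> + \<bar>v\<bar>)\<^sup>2"
  shows "quad B F Fx Fy"
  using assms by (simp add: quad_def)

lemma quadD:
  assumes "quad B F Fx Fy"
  shows "\<bar>F x y\<bar> \<le> B" "\<bar>Fx x y\<bar> \<le> B" "\<bar>Fy x y\<bar> \<le> B"
    "\<bar>F (x + u) (y + v) - F x y - Fx x y * u - Fy x y * v\<bar> \<le> B * (\<bar>u\<bar> + \<bar>v\<bar>)\<^sup>2"
  using assms by (auto simp: quad_def)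

lemma quad_nonneg: "quad B F Fx Fy \<Longrightarrow> 0 \<le> B"
  using quadD(1)[of B F Fx Fy 0 0] by linarith

lemma quad_mono:
  assumes "quad B F Fx Fy" "B \<le> C" shows "quad C F Fx Fy"
proof (rule quadI)
  show "\<bar>F x y\<bar> \<le> C" "\<bar>Fx x y\<bar> \<le> C" "\<bar>Fy x y\<bar> \<le> C" for x y
    using quadD(1-3)[OF assms(1), of x y] assms(2) by linarith+
  show "\<bar>F (x + u) (y + v) - F x y - Fx x y * u - Fy x y * v\<bar> \<le> C * (\<bar>u\<bar> + \<bar>v\<bar>)\<^sup>2" for x y u v
    by (rule order_trans[OF quadD(4)[OF assms(1)] mult_right_mono[OF assms(2)]]) simp
qed

lemma abs_le_sum3:
  fixes d r s :: real
  assumes "\<bar>d - r - s\<bar> \<le> c" "\<bar>r\<bar> \<le> c1" "\<bar>s\<bar> \<le> c2"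
  shows "\<bar>d\<bar> \<le> c + c1 + c2"
  using assms by linarith

lemma quad_lipschitz:
  assumes q: "quad B F Fx Fy"
  shows "\<bar>F (x + u) (y + v) - F x y\<bar> \<le> 3 * B * (\<bar>u\<bar> + \<bar>v\<bar>)"
proof -
  let ?w = "\<bar>u\<bar> + \<bar>v\<bar>"
  have B: "B \<ge> 0" by (rule quad_nonneg[OF q])
  show ?thesis
  proof (cases "?w \<le> 1")
    case True
    have uv: "\<bar>Fx x y * u\<bar> \<le> B * \<bar>u\<bar>" "\<bar>Fy x y * v\<bar> \<le> B * \<bar>v\<bar>"
      unfolding abs_mult using quadD(2,3)[OF q] by (auto intro!: mult_right_mono)
    note abs_le_sum3[OF quadD(4)[OF q, of x u y v] uv]
    moreover have "B * ?w\<^sup>2 \<le> B * ?w"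
      using True B mult_left_mono[of ?w 1 ?w] by (intro mult_left_mono) (auto simp: power2_eq_square)
    moreover have "B * ?w = B * \<bar>u\<bar> + B * \<bar>v\<bar>" "3 * B * ?w = 3 * (B * ?w)" "0 \<le> B * ?w" using B by (simp_all add: distrib_left)
    ultimately show ?thesis by linarith
  next
    case False
    have "\<bar>F (x + u) (y + v) - F x y\<bar> \<le> 2 * B"
      using quadD(1)[OF q, of "x + u" "y + v"] quadD(1)[OF q, of x y] by linarith
    also have "\<dots> \<le> 2 * B * ?w" using False B mult_left_mono[of 1 ?w "2 * B"] by simp
    also have "\<dots> \<le> 3 * B * ?w" using B by (intro mult_right_mono) auto
    finally show ?thesis .
  qed
qed

lemma quad_const: "quad \<bar>c\<bar> (\<lambda>x y. c) (\<lambda>x y. 0) (\<lambda>x y. 0)"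
  by (rule quadI) auto

lemma quad_add:
  assumes F: "quad B F Fx Fy" and G: "quad C G Gx Gy"
  shows "quad (B + C) (\<lambda>x y. F x y + G x y) (\<lambda>x y. Fx x y + Gx x y) (\<lambda>x y. Fy x y + Gy x y)"
proof (rule quadI)
  show "\<bar>F x y + G x y\<bar> \<le> B + C" "\<bar>Fx x y + Gx x y\<bar> \<le> B + C" "\<bar>Fy x y + Gy x y\<bar> \<le> B + C" for x y
    using quadD(1-3)[OF F, of x y] quadD(1-3)[OF G, of x y] by linarith+
  fix x y u v :: real
  have "F (x + u) (y + v) + G (x + u) (y + v) - (F x y + G x y) - (Fx x y + Gx x y) * u - (Fy x y + Gy x y) * v
     = (F (x + u) (y + v) - F x y - Fx x y * u - Fy x y * v) + (G (x + u) (y + v) - G x y - Gx x y * u - Gy x y * v)"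
    by (simp add: algebra_simps)
  then show "\<bar>F (x + u) (y + v) + G (x + u) (y + v) - (F x y + G x y) - (Fx x y + Gx x y) * u - (Fy x y + Gy x y) * v\<bar>
     \<le> (B + C) * (\<bar>u\<bar> + \<bar>v\<bar>)\<^sup>2"
    unfolding distrib_right[of B C]
    by (simp only:) (rule order_trans[OF abs_triangle_ineq add_mono[OF quadD(4)[OF F] quadD(4)[OF G]]])
qed

lemma quad_mult:
  assumes F: "quad B F Fx Fy" and G: "quad C G Gx Gy"
  shows "quad (11 * B * C) (\<lambda>x y. F x y * G x y) (\<lambda>x y. Fx x y * G x y + F x y * Gx x y) (\<lambda>x y. Fy x y * G x y + F x y * Gy x y)"
proof (rule quadI)
  have B: "B \<ge> 0" and C: "C \<ge> 0" using quad_nonneg F G by auto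
  have bb: "\<bar>a * b\<bar> \<le> B * C" if "\<bar>a\<bar> \<le> B" "\<bar>b\<bar> \<le> C" for a b
    unfolding abs_mult using that B by (intro mult_mono) auto
  have BC: "0 \<le> B * C" using B C by simp
  have k: "X \<le> B * C \<Longrightarrow> X \<le> 11 * B * C" "X \<le> 2 * (B * C) \<Longrightarrow> X \<le> 11 * B * C" for X
    using BC by linarith+
  show "\<bar>F x y * G x y\<bar> \<le> 11 * B * C" for x y
    by (rule k(1), rule bb) (use quadD(1)[OF F] quadD(1)[OF G] in auto)
  show "\<bar>Fx x y * G x y + F x y * Gx x y\<bar> \<le> 11 * B * C" for x y
    using bb[OF quadD(2)[OF F, of x y] quadD(1)[OF G, of x y]] bb[OF quadD(1)[OF F, of x y] quadD(2)[OF G, of x y]]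
    by (intro k(2)) linarith
  show "\<bar>Fy x y * G x y + F x y * Gy x y\<bar> \<le> 11 * B * C" for x y
    using bb[OF quadD(3)[OF F, of x y] quadD(1)[OF G, of x y]] bb[OF quadD(1)[OF F, of x y] quadD(3)[OF G, of x y]]
    by (intro k(2)) linarith
  fix x y u v :: real
  let ?w = "\<bar>u\<bar> + \<bar>v\<bar>"
  define F' where "F' = F (x + u) (y + v)"
  define G' where "G' = G (x + u) (y + v)"
  define f where "f = F' - F x y - Fx x y * u - Fy x y * v"
  define g where "g = G' - G x y - Gx x y * u - Gy x y * v"
  have fb: "\<bar>f\<bar> \<le> B * ?w\<^sup>2" and gb: "\<bar>g\<bar> \<le> C * ?w\<^sup>2"
    using quadD(4)[OF F, of x u y v] quadD(4)[OF G, of x u y v] by (auto simp: f_def g_def F'_def G'_def)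
  have Fd: "\<bar>F' - F x y\<bar> \<le> 3 * B * ?w" and Gd: "\<bar>G' - G x y\<bar> \<le> 3 * C * ?w"
    using quad_lipschitz[OF F, of x u y v] quad_lipschitz[OF G, of x u y v] by (auto simp: F'_def G'_def)
  have eq: "F' * G' - F x y * G x y - (Fx x y * G x y + F x y * Gx x y) * u - (Fy x y * G x y + F x y * Gy x y) * v
     = f * G x y + F x y * g + (F' - F x y) * (G' - G x y)"
    by (simp add: f_def g_def algebra_simps)
  have "\<bar>f * G x y\<bar> \<le> B * ?w\<^sup>2 * C" unfolding abs_mult using fb quadD(1)[OF G, of x y] B by (intro mult_mono) auto
  moreover have "\<bar>F x y * g\<bar> \<le> B * (C * ?w\<^sup>2)" unfolding abs_mult using gb quadD(1)[OF F, of x y] B by (intro mult_mono) auto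
  moreover have "\<bar>(F' - F x y) * (G' - G x y)\<bar> \<le> (3 * B * ?w) * (3 * C * ?w)"
    unfolding abs_mult using Fd Gd B by (intro mult_mono) auto
  moreover have "B * ?w\<^sup>2 * C = B * C * ?w\<^sup>2" "B * (C * ?w\<^sup>2) = B * C * ?w\<^sup>2" "(3 * B * ?w) * (3 * C * ?w) = 9 * (B * C * ?w\<^sup>2)"
    "11 * B * C * ?w\<^sup>2 = 11 * (B * C * ?w\<^sup>2)"
    by (simp_all add: power2_eq_square)
  ultimately show "\<bar>F (x + u) (y + v) * G (x + u) (y + v) - F x y * G x y - (Fx x y * G x y + F x y * Gx x y) * u - (Fy x y * G x y + F x y * Gy x y) * v\<bar>
     \<le> 11 * B * C * ?w\<^sup>2"
    unfolding F'_def[symmetric] G'_def[symmetric] eq by linarith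
qed

lemma quad_comp:
  assumes F: "quad B F Fx Fy" and K: "\<And>s. \<bar>s\<bar> \<le> B \<Longrightarrow> \<bar>g s\<bar> \<le> K" "\<And>s. \<bar>s\<bar> \<le> B \<Longrightarrow> \<bar>g' s\<bar> \<le> K"
    and r: "\<And>s h. \<bar>s\<bar> \<le> B \<Longrightarrow> \<bar>g (s + h) - g s - g' s * h\<bar> \<le> K * h\<^sup>2"
  shows "quad (K + K * B + 9 * K * B\<^sup>2) (\<lambda>x y. g (F x y)) (\<lambda>x y. g' (F x y) * Fx x y) (\<lambda>x y. g' (F x y) * Fy x y)"
proof (rule quadI)
  have B: "B \<ge> 0" using quad_nonneg F by auto
  have K0: "K \<ge> 0" using K(1)[of 0] B by linarith
  have KB: "0 \<le> K * B" "0 \<le> 9 * K * B\<^sup>2" using K0 B by auto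
  show "\<bar>g (F x y)\<bar> \<le> K + K * B + 9 * K * B\<^sup>2" for x y
    using K(1)[OF quadD(1)[OF F, of x y]] KB by linarith
  show "\<bar>g' (F x y) * Fx x y\<bar> \<le> K + K * B + 9 * K * B\<^sup>2" for x y
  proof -
    have "\<bar>g' (F x y) * Fx x y\<bar> \<le> K * B" unfolding abs_mult
      using K(2)[OF quadD(1)[OF F, of x y]] quadD(2)[OF F, of x y] K0 by (intro mult_mono) auto
    then show ?thesis using KB K0 by linarith
  qed
  show "\<bar>g' (F x y) * Fy x y\<bar> \<le> K + K * B + 9 * K * B\<^sup>2" for x y
  proof -
    have "\<bar>g' (F x y) * Fy x y\<bar> \<le> K * B" unfolding abs_mult
      using K(2)[OF quadD(1)[OF F, of x y]] quadD(3)[OF F, of x y] K0 by (intro mult_mono) auto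
    then show ?thesis using KB K0 by linarith
  qed
  fix x y u v :: real
  let ?w = "\<bar>u\<bar> + \<bar>v\<bar>"
  define d where "d = F (x + u) (y + v) - F x y"
  have d: "\<bar>d\<bar> \<le> 3 * B * ?w" using quad_lipschitz[OF F, of x u y v] by (simp add: d_def)
  have "\<bar>g (F x y + d) - g (F x y) - g' (F x y) * d\<bar> \<le> K * d\<^sup>2" by (rule r[OF quadD(1)[OF F]])
  moreover have "d\<^sup>2 \<le> (3 * B * ?w)\<^sup>2" using d by (metis abs_ge_zero power2_abs power_mono)
  then have "K * d\<^sup>2 \<le> K * (3 * B * ?w)\<^sup>2" using K0 by (rule mult_left_mono)
  moreover have "K * (3 * B * ?w)\<^sup>2 = 9 * K * B\<^sup>2 * ?w\<^sup>2" by (simp add: power_mult_distrib)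
  moreover have "\<bar>g' (F x y) * (d - Fx x y * u - Fy x y * v)\<bar> \<le> K * (B * ?w\<^sup>2)"
    unfolding abs_mult using K(2)[OF quadD(1)[OF F, of x y]] quadD(4)[OF F, of x u y v] K0
    by (intro mult_mono) (auto simp: d_def)
  moreover have "g' (F x y) * (d - Fx x y * u - Fy x y * v) = g' (F x y) * d - g' (F x y) * Fx x y * u - g' (F x y) * Fy x y * v"
    by (simp add: algebra_simps)
  moreover have "0 \<le> K * ?w\<^sup>2" using K0 by simp
  moreover have "(K + K * B + 9 * K * B\<^sup>2) * ?w\<^sup>2 = K * ?w\<^sup>2 + K * (B * ?w\<^sup>2) + 9 * K * B\<^sup>2 * ?w\<^sup>2" by (simp add: algebra_simps)
  moreover have "F (x + u) (y + v) = F x y + d" by (simp add: d_def)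
  ultimately show "\<bar>g (F (x + u) (y + v)) - g (F x y) - g' (F x y) * Fx x y * u - g' (F x y) * Fy x y * v\<bar>
    \<le> (K + K * B + 9 * K * B\<^sup>2) * ?w\<^sup>2" by (simp only:) linarith
qed

section \<open>The wave profile and the cut-off\<close>

lemma tanh_MVT:
  fixes a b :: real
  assumes "a < b"
  obtains z where "a < z" "z < b" "tanh b - tanh a = (b - a) * (1 - (tanh z)\<^sup>2)"
proof -
  have "(tanh has_real_derivative (1 - (tanh x)\<^sup>2)) (at x)" for x :: real
    by (rule derivative_eq_intros refl | simp)+
  then show ?thesis using MVT2[OF assms, of tanh "\<lambda>z. 1 - (tanh z)\<^sup>2"] that by blast
qed

lemma tanh_square: "0 \<le> 1 - (tanh z)\<^sup>2" "1 - (tanh z)\<^sup>2 \<le> 1" for z :: real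
proof -
  have "\<bar>tanh z\<bar> \<le> 1" using tanh_real_bounds[of z] by auto
  then have "(tanh z)\<^sup>2 \<le> 1" by (simp add: abs_square_le_1)
  then show "0 \<le> 1 - (tanh z)\<^sup>2" "1 - (tanh z)\<^sup>2 \<le> 1" by simp_all
qed

lemma tanh_lipschitz: "\<bar>tanh b - tanh a\<bar> \<le> \<bar>b - a\<bar>" for a b :: real
proof -
  have *: "\<bar>tanh b - tanh a\<bar> \<le> \<bar>b - a\<bar>" if ab: "a < b" for a b :: real
  proof -
    obtain z where z: "tanh b - tanh a = (b - a) * (1 - (tanh z)\<^sup>2)" using tanh_MVT[OF ab] by blast
    have "\<bar>b - a\<bar> * \<bar>1 - (tanh z)\<^sup>2\<bar> \<le> \<bar>b - a\<bar> * 1" using tanh_square[of z] by (intro mult_left_mono) auto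
    then show ?thesis unfolding z abs_mult by simp
  qed
  show ?thesis using *[of a b] *[of b a] by (cases a b rule: linorder_cases) (auto simp: abs_minus_commute)
qed

lemma tanh_abs: "\<bar>tanh a\<bar> \<le> \<bar>a\<bar>" "\<bar>tanh a\<bar> \<le> 1" for a :: real
  using tanh_lipschitz[of a 0] tanh_real_bounds[of a] by auto

lemma tanh_remainder: "\<bar>tanh (s + h) - tanh s - (1 - (tanh s)\<^sup>2) * h\<bar> \<le> 2 * h\<^sup>2" for s h :: real
proof -
  have *: "\<bar>tanh b - tanh a - (1 - (tanh c)\<^sup>2) * (b - a)\<bar> \<le> 2 * (b - a)\<^sup>2" if ab: "a < b" and c: "c = a \<or> c = b" for a b c :: real
  proof -
    obtain z where z: "a < z" "z < b" "tanh b - tanh a = (b - a) * (1 - (tanh z)\<^sup>2)" using tanh_MVT[OF ab] by blast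
    have "tanh b - tanh a - (1 - (tanh c)\<^sup>2) * (b - a) = (b - a) * ((tanh c - tanh z) * (tanh c + tanh z))"
      unfolding z(3) by (simp add: power2_eq_square algebra_simps)
    moreover have "\<bar>(tanh c - tanh z) * (tanh c + tanh z)\<bar> \<le> (b - a) * 2"
      unfolding abs_mult
    proof (rule mult_mono)
      show "\<bar>tanh c - tanh z\<bar> \<le> b - a" using tanh_lipschitz[of c z] z c by auto
      show "\<bar>tanh c + tanh z\<bar> \<le> 2" using tanh_abs(2)[of c] tanh_abs(2)[of z] by linarith
    qed (use ab in auto)
    then have "(b - a) * \<bar>(tanh c - tanh z) * (tanh c + tanh z)\<bar> \<le> (b - a) * ((b - a) * 2)"
      using ab by (intro mult_left_mono) auto
    ultimately show ?thesis using ab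
      by (simp add: abs_mult power2_eq_square)
  qed
  show ?thesis
  proof (cases h "0::real" rule: linorder_cases)
    case less
    have "\<bar>tanh s - tanh (s + h) - (1 - (tanh s)\<^sup>2) * (s - (s + h))\<bar> \<le> 2 * (s - (s + h))\<^sup>2"
      using less by (intro *) auto
    moreover have "tanh s - tanh (s + h) - (1 - (tanh s)\<^sup>2) * (s - (s + h)) = - (tanh (s + h) - tanh s - (1 - (tanh s)\<^sup>2) * h)"
      by (simp add: algebra_simps)
    ultimately show ?thesis by (simp only: abs_minus_cancel) (simp add: power2_eq_square)
  next
    case greater
    then show ?thesis using *[of s "s + h" s] by simp
  qed simp
qed

lemma quad_tanh_line:
  assumes "\<epsilon> > 0" "\<bar>a\<bar> \<le> 1"
  shows "quad (1 + 1 / \<epsilon> + 2 / \<epsilon>\<^sup>2) (\<lambda>x y. tanh ((y - a * x - b) / \<epsilon>))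
    (\<lambda>x y. - a * (1 - (tanh ((y - a * x - b) / \<epsilon>))\<^sup>2) / \<epsilon>) (\<lambda>x y. (1 - (tanh ((y - a * x - b) / \<epsilon>))\<^sup>2) / \<epsilon>)"
proof (rule quadI)
  have e: "0 \<le> 1 / \<epsilon>" "0 \<le> 2 / \<epsilon>\<^sup>2" using assms by auto
  note s = tanh_square
  have 1: "\<bar>(1 - (tanh z)\<^sup>2) / \<epsilon>\<bar> \<le> 1 / \<epsilon>" for z :: real
    using s[of z] assms by (simp add: abs_divide divide_right_mono)
  fix x y u v :: real
  show "\<bar>tanh ((y - a * x - b) / \<epsilon>)\<bar> \<le> 1 + 1 / \<epsilon> + 2 / \<epsilon>\<^sup>2" using tanh_abs(2) e by (meson add_increasing2 order_trans)
  show "\<bar>(1 - (tanh ((y - a * x - b) / \<epsilon>))\<^sup>2) / \<epsilon>\<bar> \<le> 1 + 1 / \<epsilon> + 2 / \<epsilon>\<^sup>2"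
    using 1[of "(y - a * x - b) / \<epsilon>"] e by linarith
  have "\<bar>- a * (1 - (tanh ((y - a * x - b) / \<epsilon>))\<^sup>2) / \<epsilon>\<bar> = \<bar>a\<bar> * \<bar>(1 - (tanh ((y - a * x - b) / \<epsilon>))\<^sup>2) / \<epsilon>\<bar>"
    by (simp add: abs_mult abs_divide)
  also have "\<dots> \<le> 1 * (1 / \<epsilon>)" using assms 1 by (intro mult_mono) auto
  finally show "\<bar>- a * (1 - (tanh ((y - a * x - b) / \<epsilon>))\<^sup>2) / \<epsilon>\<bar> \<le> 1 + 1 / \<epsilon> + 2 / \<epsilon>\<^sup>2" using e by linarith
  define z where "z = (y - a * x - b) / \<epsilon>"
  define h where "h = (v - a * u) / \<epsilon>"
  have zh: "(y + v - a * (x + u) - b) / \<epsilon> = z + h" by (simp add: z_def h_def add_divide_distrib[symmetric] algebra_simps)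
  have "\<bar>v - a * u\<bar> \<le> \<bar>u\<bar> + \<bar>v\<bar>"
  proof -
    have "\<bar>a * u\<bar> \<le> 1 * \<bar>u\<bar>" unfolding abs_mult using assms by (intro mult_right_mono) auto
    then show ?thesis by linarith
  qed
  then have "(v - a * u)\<^sup>2 \<le> (\<bar>u\<bar> + \<bar>v\<bar>)\<^sup>2" by (metis abs_ge_zero power2_abs power_mono)
  then have "2 * h\<^sup>2 \<le> 2 / \<epsilon>\<^sup>2 * (\<bar>u\<bar> + \<bar>v\<bar>)\<^sup>2" by (simp add: h_def power_divide divide_right_mono)
  moreover have "2 / \<epsilon>\<^sup>2 * (\<bar>u\<bar> + \<bar>v\<bar>)\<^sup>2 \<le> (1 + 1 / \<epsilon> + 2 / \<epsilon>\<^sup>2) * (\<bar>u\<bar> + \<bar>v\<bar>)\<^sup>2" using e by (intro mult_right_mono) auto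
  moreover have "tanh (z + h) - tanh z - - a * (1 - (tanh z)\<^sup>2) / \<epsilon> * u - (1 - (tanh z)\<^sup>2) / \<epsilon> * v = tanh (z + h) - tanh z - (1 - (tanh z)\<^sup>2) * h"
    using assms by (simp add: h_def field_simps)
  ultimately show "\<bar>tanh ((y + v - a * (x + u) - b) / \<epsilon>) - tanh ((y - a * x - b) / \<epsilon>) -
        - a * (1 - (tanh ((y - a * x - b) / \<epsilon>))\<^sup>2) / \<epsilon> * u - (1 - (tanh ((y - a * x - b) / \<epsilon>))\<^sup>2) / \<epsilon> * v\<bar>
       \<le> (1 + 1 / \<epsilon> + 2 / \<epsilon>\<^sup>2) * (\<bar>u\<bar> + \<bar>v\<bar>)\<^sup>2"
    unfolding zh z_def[symmetric] using tanh_remainder[of z h] by linarith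
qed

text \<open>Squaring the positive part gives a cut-off that vanishes for
  \<open>\<bar>p\<bar> \<ge> 2\<close> and still has a Lipschitz derivative, as \<open>quad\<close>
  demands.\<close>

definition chi :: "real \<Rightarrow> real" where "chi p = (max 0 (4 - p\<^sup>2))\<^sup>2 / 16"

lemma chi_bounds: "0 \<le> chi p" "chi p \<le> 1"
proof -
  have "(max 0 (4 - p\<^sup>2))\<^sup>2 \<le> 4\<^sup>2" by (rule power_mono) auto
  then show "chi p \<le> 1" by (simp add: chi_def)
qed (simp add: chi_def)

lemma chi_zero: "\<bar>p\<bar> \<ge> 2 \<Longrightarrow> chi p = 0"
proof -
  assume "\<bar>p\<bar> \<ge> 2"
  then have "2\<^sup>2 \<le> \<bar>p\<bar>\<^sup>2" by (intro power_mono) auto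
  then show "chi p = 0" by (simp add: chi_def max_def)
qed

lemma chi_lower: "\<bar>p\<bar> \<le> 15 / 8 \<Longrightarrow> chi p \<ge> 1 / 100"
proof -
  assume "\<bar>p\<bar> \<le> 15 / 8"
  then have "\<bar>p\<bar>\<^sup>2 \<le> (15/8)\<^sup>2" by (intro power_mono) auto
  then have "31 / 64 \<le> 4 - p\<^sup>2" by (simp add: power2_eq_square)
  then have "(31/64)\<^sup>2 \<le> (max 0 (4 - p\<^sup>2))\<^sup>2" by (intro power_mono) auto
  then show ?thesis by (simp add: chi_def power2_eq_square)
qed

lemma quad_chi:
  assumes F: "quad B F Fx Fy"
  shows "\<exists>C Kx Ky. quad C (\<lambda>x y. chi (F x y)) Kx Ky"
proof -
  let ?G = "\<lambda>x y. 4 + (-1) * (F x y * F x y)"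
  obtain C Gx Gy where G: "quad C ?G Gx Gy"
    using quad_add[OF quad_const[of 4] quad_mult[OF quad_const[of "-1"] quad_mult[OF F F]]] by blast
  have C: "C \<ge> 0" by (rule quad_nonneg[OF G])
  have "quad ((1 + C + C\<^sup>2) + (1 + C + C\<^sup>2) * C + 9 * (1 + C + C\<^sup>2) * C\<^sup>2) (\<lambda>x y. (max 0 (?G x y))\<^sup>2 / 16)
    (\<lambda>x y. max 0 (?G x y) / 8 * Gx x y) (\<lambda>x y. max 0 (?G x y) / 8 * Gy x y)"
  proof (rule quad_comp[OF G, where g = "\<lambda>s. (max 0 s)\<^sup>2 / 16" and g' = "\<lambda>s. max 0 s / 8"])
    fix s :: real assume s: "\<bar>s\<bar> \<le> C"
    have "(max 0 s)\<^sup>2 \<le> C\<^sup>2" using s by (intro power_mono) auto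
    moreover have "0 \<le> (max 0 s)\<^sup>2" by simp
    ultimately show "\<bar>(max 0 s)\<^sup>2 / 16\<bar> \<le> 1 + C + C\<^sup>2" using C by linarith
    show "\<bar>max 0 s / 8\<bar> \<le> 1 + C + C\<^sup>2" using s C by (auto simp: max_def add_nonneg_nonneg intro: add_increasing2)
    fix h :: real
    have "\<bar>(max 0 (s + h))\<^sup>2 - (max 0 s)\<^sup>2 - 2 * max 0 s * h\<bar> \<le> h\<^sup>2"
    proof (cases "s \<ge> 0"; cases "s + h \<ge> 0")
      assume "s \<ge> 0" "s + h \<ge> 0"
      then show ?thesis by (simp add: power2_eq_square algebra_simps)
    next
      assume a: "s \<ge> 0" "\<not> s + h \<ge> 0"
      have "- s\<^sup>2 - 2 * s * h = h\<^sup>2 - (s + h)\<^sup>2" by (simp add: power2_eq_square algebra_simps)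
      moreover have "\<bar>s + h\<bar> \<le> \<bar>h\<bar>" using a by linarith
      then have "(s + h)\<^sup>2 \<le> h\<^sup>2" by (simp add: abs_le_square_iff)
      moreover have "0 \<le> (s + h)\<^sup>2" by simp
      ultimately show ?thesis using a by (simp add: max_def)
    next
      assume a: "\<not> s \<ge> 0" "s + h \<ge> 0"
      then have "(s + h)\<^sup>2 \<le> h\<^sup>2" by (intro power_mono) auto
      then show ?thesis using a by (simp add: max_def)
    qed (simp add: max_def)
    moreover have "(max 0 (s + h))\<^sup>2 / 16 - (max 0 s)\<^sup>2 / 16 - max 0 s / 8 * h = ((max 0 (s + h))\<^sup>2 - (max 0 s)\<^sup>2 - 2 * max 0 s * h) / 16"
      by (simp add: field_simps)
    moreover have "h\<^sup>2 / 16 \<le> (1 + C + C\<^sup>2) * h\<^sup>2"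
      using C mult_right_mono[of "1/16" "1 + C + C\<^sup>2" "h\<^sup>2"] by (auto intro: add_increasing2)
    ultimately show "\<bar>(max 0 (s + h))\<^sup>2 / 16 - (max 0 s)\<^sup>2 / 16 - max 0 s / 8 * h\<bar> \<le> (1 + C + C\<^sup>2) * h\<^sup>2"
      by (simp only: abs_divide) simp
  qed
  moreover have "(\<lambda>x y. (max 0 (?G x y))\<^sup>2 / 16) = (\<lambda>x y. chi (F x y))"
    by (simp add: chi_def power2_eq_square)
  ultimately show ?thesis by metis
qed

lemma quad_derivative:
  assumes q: "quad B F Fx Fy"
    and x: "(x has_real_derivative x') (at t within S)" and y: "(y has_real_derivative y') (at t within S)"
  shows "((\<lambda>t. F (x t) (y t)) has_real_derivative (Fx (x t) (y t) * x' + Fy (x t) (y t) * y')) (at t within S)"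
  unfolding has_field_derivative_iff
proof -
  define dx where "dx r = (x r - x t) / (r - t)" for r
  define dy where "dy r = (y r - y t) / (r - t)" for r
  have lx: "(dx \<longlongrightarrow> x') (at t within S)" "(dy \<longlongrightarrow> y') (at t within S)"
    using x y unfolding has_field_derivative_iff dx_def dy_def by auto
  have main: "((\<lambda>r. Fx (x t) (y t) * dx r + Fy (x t) (y t) * dy r) \<longlongrightarrow> Fx (x t) (y t) * x' + Fy (x t) (y t) * y') (at t within S)"
    by (intro tendsto_intros lx)
  have "((\<lambda>r. B * ((\<bar>dx r\<bar> + \<bar>dy r\<bar>)\<^sup>2 * \<bar>r - t\<bar>)) \<longlongrightarrow> B * ((\<bar>x'\<bar> + \<bar>y'\<bar>)\<^sup>2 * \<bar>t - t\<bar>)) (at t within S)"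
    by (intro tendsto_intros lx)
  then have z: "((\<lambda>r. B * ((\<bar>dx r\<bar> + \<bar>dy r\<bar>)\<^sup>2 * \<bar>r - t\<bar>)) \<longlongrightarrow> 0) (at t within S)" by simp
  have bound: "\<bar>(F (x r) (y r) - F (x t) (y t)) / (r - t) - (Fx (x t) (y t) * dx r + Fy (x t) (y t) * dy r)\<bar>
     \<le> B * ((\<bar>dx r\<bar> + \<bar>dy r\<bar>)\<^sup>2 * \<bar>r - t\<bar>)" if "r \<noteq> t" for r
  proof -
    have e: "x r = x t + dx r * (r - t)" "y r = y t + dy r * (r - t)" using that by (auto simp: dx_def dy_def)
    have "\<bar>F (x r) (y r) - F (x t) (y t) - Fx (x t) (y t) * (dx r * (r - t)) - Fy (x t) (y t) * (dy r * (r - t))\<bar>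
       \<le> B * (\<bar>dx r * (r - t)\<bar> + \<bar>dy r * (r - t)\<bar>)\<^sup>2"
      using quadD(4)[OF q, of "x t" "dx r * (r - t)" "y t" "dy r * (r - t)"] unfolding e[symmetric] .
    also have "\<dots> = B * ((\<bar>dx r\<bar> + \<bar>dy r\<bar>)\<^sup>2 * \<bar>r - t\<bar>) * \<bar>r - t\<bar>"
      unfolding abs_mult distrib_right[symmetric] power_mult_distrib
      by (simp only: power2_eq_square[of "\<bar>r - t\<bar>"] mult.assoc)
    finally have "\<bar>F (x r) (y r) - F (x t) (y t) - Fx (x t) (y t) * (dx r * (r - t)) - Fy (x t) (y t) * (dy r * (r - t))\<bar> / \<bar>r - t\<bar>
       \<le> B * ((\<bar>dx r\<bar> + \<bar>dy r\<bar>)\<^sup>2 * \<bar>r - t\<bar>)" using that by (simp add: pos_divide_le_eq)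
    moreover have "(F (x r) (y r) - F (x t) (y t)) / (r - t) - (Fx (x t) (y t) * dx r + Fy (x t) (y t) * dy r)
      = (F (x r) (y r) - F (x t) (y t) - Fx (x t) (y t) * (dx r * (r - t)) - Fy (x t) (y t) * (dy r * (r - t))) / (r - t)"
      using that by (simp add: field_simps)
    ultimately show ?thesis by (simp add: abs_divide)
  qed
  have "((\<lambda>r. (F (x r) (y r) - F (x t) (y t)) / (r - t) - (Fx (x t) (y t) * dx r + Fy (x t) (y t) * dy r)) \<longlongrightarrow> 0) (at t within S)"
    by (rule Lim_null_comparison[OF _ z]) (use bound in \<open>auto simp: eventually_at_filter\<close>)
  from tendsto_add[OF this main]
  show "((\<lambda>r. (F (x r) (y r) - F (x t) (y t)) / (r - t)) \<longlongrightarrow> Fx (x t) (y t) * x' + Fy (x t) (y t) * y') (at t within S)"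
    by simp
qed

text \<open>The constant \<open>B\<close> will grow from step to step while the gradients stay
  bounded, so the uniform Lipschitz bound has to come from the gradient alone.\<close>

lemma quad_gradient_lipschitz:
  assumes q: "quad B F Fx Fy" and M: "\<And>x y. \<bar>Fx x y\<bar> \<le> M" "\<And>x y. \<bar>Fy x y\<bar> \<le> M"
  shows "\<bar>F x' y' - F x y\<bar> \<le> M * (\<bar>x' - x\<bar> + \<bar>y' - y\<bar>)"
proof -
  define g where "g t = F (x + t * (x' - x)) (y + t * (y' - y))" for t
  define D where "D t = Fx (x + t * (x' - x)) (y + t * (y' - y)) * (x' - x) + Fy (x + t * (x' - x)) (y + t * (y' - y)) * (y' - y)" for t
  have "(g has_real_derivative D t) (at t)" for t
    unfolding g_def D_def by (rule quad_derivative[OF q]) (auto intro!: derivative_eq_intros)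
  then obtain z where z: "g 1 - g 0 = (1 - 0) * D z" using MVT2[of 0 1 g D] by auto
  have "\<bar>D z\<bar> \<le> \<bar>Fx (x + z * (x' - x)) (y + z * (y' - y))\<bar> * \<bar>x' - x\<bar> + \<bar>Fy (x + z * (x' - x)) (y + z * (y' - y))\<bar> * \<bar>y' - y\<bar>"
    unfolding D_def abs_mult[symmetric] by (rule abs_triangle_ineq)
  also have "\<dots> \<le> M * \<bar>x' - x\<bar> + M * \<bar>y' - y\<bar>" using M by (intro add_mono mult_right_mono) auto
  finally show ?thesis using z by (simp add: g_def distrib_left)
qed

definition has_quad :: "(real \<Rightarrow> real \<Rightarrow> real) \<Rightarrow> bool" where
  "has_quad F \<longleftrightarrow> (\<exists>C Fx Fy. quad C F Fx Fy)"

lemma has_quad_const: "has_quad (\<lambda>x y. c)"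
  unfolding has_quad_def using quad_const by blast

lemma has_quad_add: "has_quad F \<Longrightarrow> has_quad G \<Longrightarrow> has_quad (\<lambda>x y. F x y + G x y)"
  unfolding has_quad_def using quad_add by blast

lemma has_quad_mult: "has_quad F \<Longrightarrow> has_quad G \<Longrightarrow> has_quad (\<lambda>x y. F x y * G x y)"
  unfolding has_quad_def using quad_mult by blast

lemma has_quad_diff: "has_quad F \<Longrightarrow> has_quad G \<Longrightarrow> has_quad (\<lambda>x y. F x y - G x y)"
  using has_quad_add[of F "\<lambda>x y. (-1) * G x y"] has_quad_mult[OF has_quad_const[of "-1"], of G] by simp

lemma has_quad_chi: "has_quad F \<Longrightarrow> has_quad (\<lambda>x y. chi (F x y))"
  unfolding has_quad_def using quad_chi by blast

section \<open>Waves across the rational lines\<close>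

definition tau :: "real \<Rightarrow> real \<Rightarrow> real \<Rightarrow> real \<Rightarrow> real \<Rightarrow> real" where
  "tau a b e x y = tanh ((y - a * x - b) / e)"

text \<open>The gradient of \<open>e * tau a b e\<close> is \<open>lam a b e\<close> times the
  normal \<open>(- a, 1)\<close> of the line.\<close>

definition lam :: "real \<Rightarrow> real \<Rightarrow> real \<Rightarrow> real \<Rightarrow> real \<Rightarrow> real" where
  "lam a b e x y = 1 - (tau a b e x y)\<^sup>2"

text \<open>The factor \<open>chi\<close> freezes the gradient where \<open>\<bar>p\<bar> \<ge> 2\<close>; elsewhere even steps drive \<open>q\<close> towards
  \<open>1\<close> and odd steps drive it towards \<open>0\<close>.\<close>

definition kappa :: "nat \<Rightarrow> (real \<Rightarrow> real \<Rightarrow> real) \<Rightarrow> (real \<Rightarrow> real \<Rightarrow> real) \<Rightarrow> real \<Rightarrow> real \<Rightarrow> real" where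
  "kappa n p q x y = chi (p x y) * ((if even n then 1 else 0) - q x y)"

lemma has_quad_kappa: "has_quad p \<Longrightarrow> has_quad q \<Longrightarrow> has_quad (kappa n p q)"
  using has_quad_mult[OF has_quad_chi has_quad_diff[OF has_quad_const], of p q "if even n then 1 else 0"]
  by (simp add: kappa_def[abs_def])

lemma has_quad_tau:
  assumes "e > 0" "\<bar>a\<bar> \<le> 1" shows "has_quad (tau a b e)"
  using quad_tanh_line[OF assms, of b] unfolding has_quad_def tau_def[abs_def] by blast

lemma has_quad_lam:
  assumes "e > 0" "\<bar>a\<bar> \<le> 1" shows "has_quad (lam a b e)"
  using has_quad_diff[OF has_quad_const[of 1] has_quad_mult[OF has_quad_tau[OF assms, of b] has_quad_tau[OF assms, of b]]]
  by (simp add: lam_def[abs_def] power2_eq_square)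

lemma lam_bounds: "0 \<le> lam a b e x y" "lam a b e x y \<le> 1"
  using tanh_square by (auto simp: lam_def tau_def)

text \<open>For every label \<open>j\<close>, the pair \<open>(p n j, q n j)\<close> is, up to errors with a small sum, the gradient of
  the function \<open>h n j\<close>. Step \<open>n\<close> only changes the functions with label \<open>lab n\<close>: it adds to \<open>h\<close> a wave of
  height \<open>e n\<close> across the line \<open>y = a n * x + b n\<close>, and hence to the gradient a multiple of the normal
  \<open>(- a n, 1)\<close>. All second-order data at step \<open>n\<close> are bounded by \<open>K n\<close>, which is known before the
  width \<open>e n\<close> is fixed.\<close>

locale waves =
  fixes a b K :: "nat \<Rightarrow> real" and lab :: "nat \<Rightarrow> nat"
    and p q h hx hy :: "nat \<Rightarrow> nat \<Rightarrow> real \<Rightarrow> real \<Rightarrow> real"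
    and e :: "nat \<Rightarrow> real" and kap :: "nat \<Rightarrow> real \<Rightarrow> real \<Rightarrow> real"
  defines "e \<equiv> \<lambda>n. 1 / (100 * 8 ^ n * K n)"
    and "kap \<equiv> \<lambda>n. kappa n (p n (lab n)) (q n (lab n))"
  assumes slope: "\<And>n. \<bar>a n\<bar> \<le> 1 / 4" and lab_le: "\<And>n. lab n \<le> n"
    and start: "\<And>j x y. p 0 j x y = 0" "\<And>j x y. q 0 j x y = 0" "\<And>j x y. h 0 j x y = 0"
      "\<And>j x y. hx 0 j x y = 0" "\<And>j x y. hy 0 j x y = 0"
    and p_step: "\<And>n j x y. p (Suc n) j x y = p n j x y - (if j = lab n then a n * lam (a n) (b n) (e n) x y * kap n x y else 0)"
    and q_step: "\<And>n j x y. q (Suc n) j x y = q n j x y + (if j = lab n then lam (a n) (b n) (e n) x y * kap n x y else 0)"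
    and h_step: "\<And>n j x y. h (Suc n) j x y = h n j x y + (if j = lab n then e n * (kap n x y * tau (a n) (b n) (e n) x y) else 0)"
    and hx_step: "\<And>n j x y. \<bar>(hx (Suc n) j x y - p (Suc n) j x y) - (hx n j x y - p n j x y)\<bar> \<le> e n * K n"
    and hy_step: "\<And>n j x y. \<bar>(hy (Suc n) j x y - q (Suc n) j x y) - (hy n j x y - q n j x y)\<bar> \<le> e n * K n"
    and K_ge: "\<And>n. 1 \<le> K n" and K_step: "\<And>n. K n + 1000 * 8 ^ Suc n / e n \<le> K (Suc n)"
    and quad_h: "\<And>n j. quad (K n) (h n j) (hx n j) (hy n j)"
    and quad_p: "\<And>n j. \<exists>px py. quad (K n) (p n j) px py"
    and quad_q: "\<And>n j. \<exists>qx qy. quad (K n) (q n j) qx qy"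
    and quad_kap: "\<And>n. \<exists>kx ky. quad (K n) (kap n) kx ky"

datatype wave_state = Wave_State (wave_p: "nat \<Rightarrow> real \<Rightarrow> real \<Rightarrow> real") (wave_q: "nat \<Rightarrow> real \<Rightarrow> real \<Rightarrow> real")
  (wave_h: "nat \<Rightarrow> real \<Rightarrow> real \<Rightarrow> real") (wave_hx: "nat \<Rightarrow> real \<Rightarrow> real \<Rightarrow> real") (wave_hy: "nat \<Rightarrow> real \<Rightarrow> real \<Rightarrow> real") (wave_K: real)

text \<open>\<open>M\<close> prescribes how fast the bounds grow and thereby how narrow the next
  wave becomes. The label \<open>l'\<close> of the next step enters because \<open>K'\<close> has to
  bound the next coefficient before the next width is fixed. The errors \<open>e * K\<close> stem
  from the derivative of \<open>\<kappa>\<close>, in contrast to that of \<open>tau\<close>.\<close>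

lemma wave_step:
  fixes p q h hx hy :: "nat \<Rightarrow> real \<Rightarrow> real \<Rightarrow> real" and a b e K M :: real and l l' n :: nat
  defines "\<kappa> \<equiv> kappa n (p l) (q l)"
  assumes a: "\<bar>a\<bar> \<le> 1" and e: "e > 0"
    and h: "\<And>j. quad K (h j) (hx j) (hy j)" and p: "\<And>j. \<exists>px py. quad K (p j) px py"
    and q: "\<And>j. \<exists>px py. quad K (q j) px py" and k: "\<exists>kx ky. quad K \<kappa> kx ky"
  shows "\<exists>p' q' h' hx' hy' K'. (\<forall>j. quad K' (h' j) (hx' j) (hy' j)) \<and> (\<forall>j. \<exists>px py. quad K' (p' j) px py) \<and>
     (\<forall>j. \<exists>px py. quad K' (q' j) px py) \<and> (\<exists>kx ky. quad K' (kappa (Suc n) (p' l') (q' l')) kx ky) \<and> M \<le> K' \<and>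
     (\<forall>j x y. p' j x y = p j x y - (if j = l then a * lam a b e x y * \<kappa> x y else 0) \<and>
      q' j x y = q j x y + (if j = l then lam a b e x y * \<kappa> x y else 0) \<and>
      h' j x y = h j x y + (if j = l then e * (\<kappa> x y * tau a b e x y) else 0) \<and>
      \<bar>(hx' j x y - p' j x y) - (hx j x y - p j x y)\<bar> \<le> e * K \<and>
      \<bar>(hy' j x y - q' j x y) - (hy j x y - q j x y)\<bar> \<le> e * K)"
proof -
  define p' where "p' j = (if j = l then (\<lambda>x y. p j x y - a * (lam a b e x y * \<kappa> x y)) else p j)" for j
  define q' where "q' j = (if j = l then (\<lambda>x y. q j x y + lam a b e x y * \<kappa> x y) else q j)" for j
  obtain kx ky where kq: "quad K \<kappa> kx ky" using k by blast
  have hqk: "has_quad \<kappa>" using kq unfolding has_quad_def by blast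
  have hqp: "has_quad (p j)" "has_quad (q j)" for j using p q unfolding has_quad_def by blast+
  have hqp': "has_quad (p' j)" "has_quad (q' j)" for j
    unfolding p'_def q'_def
    using has_quad_diff[OF hqp(1) has_quad_mult[OF has_quad_const has_quad_mult[OF has_quad_lam[OF e a] hqk]]]
      has_quad_add[OF hqp(2) has_quad_mult[OF has_quad_lam[OF e a] hqk]] hqp by auto
  obtain C1 where C1: "\<exists>px py. quad C1 (p' l) px py" using hqp' unfolding has_quad_def by blast
  obtain C2 where C2: "\<exists>px py. quad C2 (q' l) px py" using hqp' unfolding has_quad_def by blast
  obtain C3 where C3: "\<exists>px py. quad C3 (kappa (Suc n) (p' l') (q' l')) px py"
    using has_quad_kappa[OF hqp'] unfolding has_quad_def by blast
  obtain B where B: "quad B (tau a b e) (\<lambda>x y. - a * lam a b e x y / e) (\<lambda>x y. lam a b e x y / e)"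
    using quad_tanh_line[OF e a, of b] unfolding lam_def tau_def by blast
  define h' where "h' j = (if j = l then (\<lambda>x y. h j x y + e * (\<kappa> x y * tau a b e x y)) else h j)" for j
  \<comment> \<open>The summand with the factor 0 is the derivative of the constant
    \<open>e\<close>; it keeps the form delivered by \<open>quad_mult\<close>.\<close>
  define hx' where "hx' j = (if j = l then (\<lambda>x y. hx j x y + (0 * (\<kappa> x y * tau a b e x y) + e * (kx x y * tau a b e x y + \<kappa> x y * (- a * lam a b e x y / e)))) else hx j)" for j
  define hy' where "hy' j = (if j = l then (\<lambda>x y. hy j x y + (0 * (\<kappa> x y * tau a b e x y) + e * (ky x y * tau a b e x y + \<kappa> x y * (lam a b e x y / e)))) else hy j)" for j
  obtain C4 where C4: "quad C4 (h' l) (hx' l) (hy' l)"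
    using quad_add[OF h[of l] quad_mult[OF quad_const[of e] quad_mult[OF kq B]]] unfolding h'_def hx'_def hy'_def by auto
  define K' where "K' = Max {K, C1, C2, C3, C4, M}"
  have K': "K \<le> K'" "C1 \<le> K'" "C2 \<le> K'" "C3 \<le> K'" "C4 \<le> K'" "M \<le> K'" unfolding K'_def by auto
  have 1: "quad K' (h' j) (hx' j) (hy' j)" for j
    using quad_mono[OF C4 K'(5)] quad_mono[OF h K'(1)] by (cases "j = l") (auto simp: h'_def hx'_def hy'_def)
  have 2: "\<exists>px py. quad K' (p' j) px py" for j
    using C1 p[of j] quad_mono[OF _ K'(2)] quad_mono[OF _ K'(1)] by (cases "j = l") (auto simp: p'_def, blast+)
  have 3: "\<exists>px py. quad K' (q' j) px py" for j
    using C2 q[of j] quad_mono[OF _ K'(3)] quad_mono[OF _ K'(1)] by (cases "j = l") (auto simp: q'_def, blast+)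
  have 4: "\<exists>kx ky. quad K' (kappa (Suc n) (p' l') (q' l')) kx ky"
    using C3 quad_mono[OF _ K'(4)] by blast
  have tk: "\<bar>e * (kx x y * tau a b e x y)\<bar> \<le> e * K" "\<bar>e * (ky x y * tau a b e x y)\<bar> \<le> e * K" for x y
  proof -
    have "\<bar>kx x y * tau a b e x y\<bar> \<le> K * 1" "\<bar>ky x y * tau a b e x y\<bar> \<le> K * 1"
      unfolding abs_mult tau_def using quadD(2,3)[OF kq, of x y] quad_nonneg[OF kq]
      by (intro mult_mono tanh_abs(2); simp)+
    then show "\<bar>e * (kx x y * tau a b e x y)\<bar> \<le> e * K" "\<bar>e * (ky x y * tau a b e x y)\<bar> \<le> e * K"
      using e unfolding abs_mult[of e] by (auto intro!: mult_left_mono)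
  qed
  have eK: "0 \<le> e * K" using e quad_nonneg[OF kq] by simp
  have 5: "\<bar>(hx' j x y - p' j x y) - (hx j x y - p j x y)\<bar> \<le> e * K" for j x y
  proof (cases "j = l")
    case True
    then have "(hx' j x y - p' j x y) - (hx j x y - p j x y) = e * (kx x y * tau a b e x y)"
      using e by (simp add: hx'_def p'_def field_simps)
    then show ?thesis using tk by simp
  qed (simp add: hx'_def p'_def eK)
  have 6: "\<bar>(hy' j x y - q' j x y) - (hy j x y - q j x y)\<bar> \<le> e * K" for j x y
  proof (cases "j = l")
    case True
    then have "(hy' j x y - q' j x y) - (hy j x y - q j x y) = e * (ky x y * tau a b e x y)"
      using e by (simp add: hy'_def q'_def field_simps)
    then show ?thesis using tk by simp
  qed (simp add: hy'_def q'_def eK)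
  show ?thesis
    by (rule exI[of _ p'], rule exI[of _ q'], rule exI[of _ h'], rule exI[of _ hx'], rule exI[of _ hy'], rule exI[of _ K'])
      (use 1 2 3 4 5 6 K'(6) in \<open>auto simp: p'_def q'_def h'_def\<close>)
qed

lemma waves_exist:
  fixes a b :: "nat \<Rightarrow> real" and lab :: "nat \<Rightarrow> nat"
  assumes a: "\<And>n. \<bar>a n\<bar> \<le> 1 / 4" and lab: "\<And>n. lab n \<le> n"
  shows "\<exists>K p q h hx hy. waves a b K lab p q h hx hy"
proof -
  define e where "e n s = 1 / (100 * 8 ^ n * wave_K s)" for n s
  define kap where "kap n s = kappa n (wave_p s (lab n)) (wave_q s (lab n))" for n s
  define PP where "PP n s \<longleftrightarrow> (\<forall>j. quad (wave_K s) (wave_h s j) (wave_hx s j) (wave_hy s j)) \<and> (\<forall>j. \<exists>px py. quad (wave_K s) (wave_p s j) px py) \<and>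
     (\<forall>j. \<exists>px py. quad (wave_K s) (wave_q s j) px py) \<and> (\<exists>kx ky. quad (wave_K s) (kap n s) kx ky) \<and> 1 \<le> wave_K s \<and>
     (n = 0 \<longrightarrow> (\<forall>j x y. wave_p s j x y = 0 \<and> wave_q s j x y = 0 \<and> wave_h s j x y = 0 \<and> wave_hx s j x y = 0 \<and> wave_hy s j x y = 0))" for n s
  define QQ where "QQ n s s' \<longleftrightarrow> wave_K s + 1000 * 8 ^ Suc n / e n s \<le> wave_K s' \<and>
     (\<forall>j x y. wave_p s' j x y = wave_p s j x y - (if j = lab n then a n * lam (a n) (b n) (e n s) x y * kap n s x y else 0) \<and>
      wave_q s' j x y = wave_q s j x y + (if j = lab n then lam (a n) (b n) (e n s) x y * kap n s x y else 0) \<and>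
      wave_h s' j x y = wave_h s j x y + (if j = lab n then e n s * (kap n s x y * tau (a n) (b n) (e n s) x y) else 0) \<and>
      \<bar>(wave_hx s' j x y - wave_p s' j x y) - (wave_hx s j x y - wave_p s j x y)\<bar> \<le> e n s * wave_K s \<and>
      \<bar>(wave_hy s' j x y - wave_q s' j x y) - (wave_hy s j x y - wave_q s j x y)\<bar> \<le> e n s * wave_K s)" for n s s'
  have "\<exists>S. \<forall>n. PP n (S n) \<and> QQ n (S n) (S (Suc n))"
  proof (rule dependent_nat_choice)
    let ?z = "\<lambda>j x y. 0 :: real"
    have z: "quad 1 (\<lambda>x y. 0) (\<lambda>x y. 0) (\<lambda>x y. 0)" using quad_mono[OF quad_const[of 0], of 1] by simp
    have k0: "kappa 0 (\<lambda>x y. 0) (\<lambda>x y. 0) = (\<lambda>x y. chi 0)" by (intro ext) (simp add: kappa_def)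
    have "quad 1 (\<lambda>x y. chi 0) (\<lambda>x y. 0) (\<lambda>x y. 0)" using chi_bounds[of 0] by (intro quad_mono[OF quad_const]) auto
    then have "PP 0 (Wave_State ?z ?z ?z ?z ?z 1)" unfolding PP_def kap_def using z by (auto simp: k0)
    then show "\<exists>x. PP 0 x" ..
    fix s n assume P: "PP n s"
    then have K: "1 \<le> wave_K s" unfolding PP_def by blast
    then have e0: "e n s > 0" by (simp add: e_def)
    have a1: "\<bar>a n\<bar> \<le> 1" using a[of n] by simp
    obtain p' q' h' hx' hy' K' where
      *: "(\<forall>j. quad K' (h' j) (hx' j) (hy' j)) \<and> (\<forall>j. \<exists>px py. quad K' (p' j) px py) \<and>
     (\<forall>j. \<exists>px py. quad K' (q' j) px py) \<and> (\<exists>kx ky. quad K' (kappa (Suc n) (p' (lab (Suc n))) (q' (lab (Suc n)))) kx ky) \<and>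
     wave_K s + 1000 * 8 ^ Suc n / e n s \<le> K' \<and>
     (\<forall>j x y. p' j x y = wave_p s j x y - (if j = lab n then a n * lam (a n) (b n) (e n s) x y * kap n s x y else 0) \<and>
      q' j x y = wave_q s j x y + (if j = lab n then lam (a n) (b n) (e n s) x y * kap n s x y else 0) \<and>
      h' j x y = wave_h s j x y + (if j = lab n then e n s * (kap n s x y * tau (a n) (b n) (e n s) x y) else 0) \<and>
      \<bar>(hx' j x y - p' j x y) - (wave_hx s j x y - wave_p s j x y)\<bar> \<le> e n s * wave_K s \<and>
      \<bar>(hy' j x y - q' j x y) - (wave_hy s j x y - wave_q s j x y)\<bar> \<le> e n s * wave_K s)"
      using wave_step[OF a1 e0, of "wave_K s" "wave_h s" "wave_hx s" "wave_hy s" "wave_p s" "wave_q s" n "lab n" "lab (Suc n)" "wave_K s + 1000 * 8 ^ Suc n / e n s" "b n"] P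
      unfolding PP_def kap_def by blast
    have "1 \<le> K'"
    proof -
      have "0 \<le> 1000 * 8 ^ Suc n / e n s" using e0 by simp
      then show ?thesis using * K by linarith
    qed
    then have "PP (Suc n) (Wave_State p' q' h' hx' hy' K')"
      unfolding PP_def kap_def wave_state.sel using * nat.distinct(2)[of n] by blast
    moreover have "QQ n s (Wave_State p' q' h' hx' hy' K')"
      unfolding QQ_def wave_state.sel using * by blast
    ultimately have "PP (Suc n) (Wave_State p' q' h' hx' hy' K') \<and> QQ n s (Wave_State p' q' h' hx' hy' K')" ..
    then show "\<exists>y. PP (Suc n) y \<and> QQ n s y" ..
  qed
  then obtain S where S: "\<And>n. PP n (S n)" "\<And>n. QQ n (S n) (S (Suc n))" by blast
  have "waves a b (\<lambda>n. wave_K (S n)) lab (\<lambda>n. wave_p (S n)) (\<lambda>n. wave_q (S n)) (\<lambda>n. wave_h (S n)) (\<lambda>n. wave_hx (S n)) (\<lambda>n. wave_hy (S n))"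
  proof (unfold_locales, goal_cases)
    case 1 show ?case by (rule a)
  next
    case 2 show ?case by (rule lab)
  qed ((use S(2)[unfolded QQ_def e_def kap_def] in blast) | (use S(1)[unfolded PP_def kap_def] in blast))+
  then show ?thesis by blast
qed

section \<open>Bounds for the waves and for their sum\<close>

lemma power_2_8: "2 ^ n / 8 ^ n \<le> 1 / (2::real) ^ n"
proof -
  have "2 ^ n / 8 ^ n = (1 / 4 :: real) ^ n" by (simp add: power_divide[symmetric])
  also have "\<dots> \<le> (1 / 2) ^ n" by (intro power_mono) auto
  finally show ?thesis by (simp add: power_one_over)
qed

lemma abs_sum_le: "\<bar>t * v1\<bar> + \<bar>t * v2\<bar> \<le> 2 * t" if "0 \<le> t" "\<bar>v1\<bar> \<le> 1" "\<bar>v2\<bar> \<le> 1" for t v1 v2 :: real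
proof -
  have "\<bar>t * v1\<bar> = t * \<bar>v1\<bar>" "\<bar>t * v2\<bar> = t * \<bar>v2\<bar>" using that(1) by (simp_all add: abs_mult)
  then show ?thesis using mult_left_le[OF that(2,1)] mult_left_le[OF that(3,1)] by linarith
qed

context waves
begin

lemma K_pos: "0 < K n" using K_ge[of n] by linarith

lemma e_pos: "0 < e n" using K_pos[of n] by (simp add: e_def)

lemma e_K: "e n * K n = 1 / (100 * 8 ^ n)" using K_pos[of n] by (simp add: e_def)

lemma e_le: "e n \<le> 1 / (100 * 8 ^ n)"
  using mult_left_mono[OF K_ge[of n], of "e n"] e_pos[of n] e_K[of n] by simp

text \<open>Through \<open>K_step\<close> the widths decrease so fast that all waves after step
  \<open>n\<close> together are negligible at the scale \<open>e n\<close>.\<close>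

lemma e_Suc: "e (Suc n) \<le> e n / (1000 * 8 ^ Suc n)"
proof -
  have "1000 * 8 ^ Suc n / e n \<le> K (Suc n)" using K_step[of n] K_pos[of n] by linarith
  also have "\<dots> \<le> 100 * 8 ^ Suc n * K (Suc n)"
  proof -
    have "1 \<le> (8::real) ^ Suc n" by (rule one_le_power) simp
    then show ?thesis using mult_right_mono[of 1 "100 * 8 ^ Suc n" "K (Suc n)"] K_pos[of "Suc n"] by simp
  qed
  finally have "1 / (100 * 8 ^ Suc n * K (Suc n)) \<le> 1 / (1000 * 8 ^ Suc n / e n)"
    using e_pos[of n] by (intro divide_left_mono mult_pos_pos K_pos) auto
  then show ?thesis by (simp add: e_def ac_simps)
qed

lemma e_Suc_half: "e (Suc n) \<le> e n / 2"
proof -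
  have "1 \<le> (8::real) ^ Suc n" by (rule one_le_power) simp
  then have "e n / (1000 * 8 ^ Suc n) \<le> e n / 2" using e_pos[of n] by (intro divide_left_mono) auto
  then show ?thesis using e_Suc[of n] by linarith
qed

lemma e_add: "e (n + k) \<le> e n * (1 / 2) ^ k"
  by (induction k) (use e_Suc_half in \<open>auto intro: order_trans\<close>)

definition w :: "nat \<Rightarrow> real \<Rightarrow> real \<Rightarrow> real" where
  "w n x y = e n * (kap n x y * tau (a n) (b n) (e n) x y)"

text \<open>A step with label \<open>j\<close> replaces \<open>q\<close> by a convex combination of
  \<open>q\<close> and its target 0 or 1, with weight \<open>lam * chi\<close>.\<close>

lemma q_bounds: "0 \<le> q n j x y \<and> q n j x y \<le> 1"
proof (induction n)
  case (Suc n)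
  define l where "l = lam (a n) (b n) (e n) x y * chi (p n (lab n) x y)"
  have l: "0 \<le> l" "l \<le> 1" using lam_bounds chi_bounds by (auto simp: l_def intro: mult_le_one)
  show ?case
  proof (cases "j = lab n")
    case True
    define s :: real where "s = (if even n then 1 else 0)"
    have s: "0 \<le> s" "s \<le> 1" by (auto simp: s_def)
    have "q (Suc n) j x y = (1 - l) * q n j x y + l * s"
      using True by (simp add: q_step kap_def kappa_def l_def s_def algebra_simps)
    moreover have "(1 - l) * q n j x y + l * s \<le> (1 - l) * 1 + l * 1"
      using l s Suc.IH by (intro add_mono mult_left_mono) auto
    moreover have "0 \<le> (1 - l) * q n j x y + l * s" using l s Suc.IH by simp
    ultimately show ?thesis by simp
  qed (use Suc.IH in \<open>simp add: q_step\<close>)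
qed (simp add: start)

lemma kap_le: "\<bar>kap n x y\<bar> \<le> 1"
proof -
  have "\<bar>(if even n then 1 else 0) - q n (lab n) x y\<bar> \<le> 1" using q_bounds[of n "lab n" x y] by auto
  then show ?thesis unfolding kap_def kappa_def abs_mult using chi_bounds by (intro mult_le_one) auto
qed

lemma lam_kap_le: "\<bar>lam (a n) (b n) (e n) x y * kap n x y\<bar> \<le> 1"
  unfolding abs_mult using lam_bounds kap_le by (intro mult_le_one) auto

text \<open>A step changes \<open>p\<close> by at most \<open>1 / 4\<close>, and not at all once
  \<open>\<bar>p\<bar> \<ge> 2\<close>.\<close>

lemma p_bound: "\<bar>p n j x y\<bar> \<le> 9 / 4"
proof (induction n)
  case (Suc n)
  show ?case
  proof (cases "j = lab n")
    case True
    then have st: "p (Suc n) j x y = p n j x y - a n * (lam (a n) (b n) (e n) x y * kap n x y)" by (simp add: p_step)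
    have "\<bar>a n * (lam (a n) (b n) (e n) x y * kap n x y)\<bar> \<le> 1 / 4 * 1"
      unfolding abs_mult[of "a n"] using slope lam_kap_le by (intro mult_mono) auto
    moreover have "kap n x y = 0" if "\<bar>p n j x y\<bar> \<ge> 2"
      using that chi_zero True by (simp add: kap_def kappa_def)
    moreover note abs_triangle_ineq4[of "p n j x y" "a n * (lam (a n) (b n) (e n) x y * kap n x y)"]
    ultimately show ?thesis using Suc.IH unfolding st by (cases "\<bar>p n j x y\<bar> \<ge> 2") simp_all
  qed (use Suc.IH in \<open>simp add: p_step\<close>)
qed (simp add: start)

lemma tau_le: "\<bar>tau a' b' e' x y\<bar> \<le> 1" by (simp only: tau_def tanh_abs)

lemma w_le: "\<bar>w n x y\<bar> \<le> e n"
proof -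
  have "\<bar>kap n x y * tau (a n) (b n) (e n) x y\<bar> \<le> 1"
    unfolding abs_mult using kap_le tau_le by (intro mult_le_one) auto
  then show ?thesis unfolding w_def abs_mult[of "e n"] using e_pos[of n] mult_left_mono[of _ 1 "e n"] by auto
qed

text \<open>By \<open>lab n \<le> n\<close>, label \<open>j\<close> is touched only at steps
  \<open>n \<ge> j\<close>. So finitely many labels are active at each step, and the errors of label
  \<open>j\<close> in the energy estimate begin only at step \<open>j\<close>.\<close>

lemma h_zero: "n \<le> j \<Longrightarrow> h n j x y = 0"
proof (induction n)
  case (Suc n)
  then have "j \<noteq> lab n" using lab_le[of n] by auto
  then show ?case using Suc by (simp add: h_step)
qed (simp add: start)

lemma gradient_error: "\<bar>hx n j x y - p n j x y\<bar> \<le> 1 / 50 - 1 / (50 * 8 ^ n)" "\<bar>hy n j x y - q n j x y\<bar> \<le> 1 / 50 - 1 / (50 * 8 ^ n)"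
proof (induction n)
  case 0
  { case 1 show ?case by (simp add: start) next case 2 show ?case by (simp add: start) }
next
  case (Suc n)
  have "e n * K n + (1 / 50 - 1 / (50 * 8 ^ n)) \<le> 1 / 50 - 1 / (50 * 8 ^ Suc n)" unfolding e_K by (simp add: field_simps)
  then show "\<bar>hx (Suc n) j x y - p (Suc n) j x y\<bar> \<le> 1 / 50 - 1 / (50 * 8 ^ Suc n)"
    "\<bar>hy (Suc n) j x y - q (Suc n) j x y\<bar> \<le> 1 / 50 - 1 / (50 * 8 ^ Suc n)"
    using Suc.IH hx_step[of n j x y] hy_step[of n j x y] by linarith+
qed

lemma gradient_bound: "\<bar>hx n j x y\<bar> \<le> 4" "\<bar>hy n j x y\<bar> \<le> 4"
proof -
  have "0 \<le> 1 / (50 * (8::real) ^ n)" by simp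
  then show "\<bar>hx n j x y\<bar> \<le> 4" "\<bar>hy n j x y\<bar> \<le> 4"
    using gradient_error[of n j x y] p_bound[of n j x y] q_bounds[of n j x y] by linarith+
qed

lemma h_lipschitz: "\<bar>h n j x' y' - h n j x y\<bar> \<le> 4 * (\<bar>x' - x\<bar> + \<bar>y' - y\<bar>)"
  by (rule quad_gradient_lipschitz[OF quad_h gradient_bound])

lemma partial_sum: "(\<Sum>k<n. c (lab k) * w k x y) = (\<Sum>j<n. c j * h n j x y)" for c :: "nat \<Rightarrow> real"
proof (induction n)
  case (Suc n)
  have "(\<Sum>j<Suc n. c j * h (Suc n) j x y) = (\<Sum>j<Suc n. c j * h n j x y + (if j = lab n then c j * w n x y else 0))"
    by (rule sum.cong) (auto simp: h_step w_def algebra_simps)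
  also have "\<dots> = (\<Sum>j<Suc n. c j * h n j x y) + c (lab n) * w n x y"
    using lab_le[of n] by (simp only: sum.distrib) (simp add: sum.delta less_Suc_eq_le)
  also have "(\<Sum>j<Suc n. c j * h n j x y) = (\<Sum>j<n. c j * h n j x y)" by (simp add: h_zero)
  finally show ?case using Suc.IH by simp
qed simp

text \<open>Two kinds of weights occur: \<open>(1 / 2) ^ j\<close> yields the final function, in
  which every label is felt, and the indicator of one label yields the function that is studied
  along a curve.\<close>

definition wsum :: "(nat \<Rightarrow> real) \<Rightarrow> real \<Rightarrow> real \<Rightarrow> real" where
  "wsum c x y = (\<Sum>k. c (lab k) * w k x y)"

lemma cw_le: assumes "\<And>j. \<bar>c j\<bar> \<le> 1" shows "\<bar>c (lab k) * w k x y\<bar> \<le> e k"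
  unfolding abs_mult using mult_mono[OF assms w_le[of k x y]] by simp

lemma summable_w:
  assumes "\<And>j. \<bar>c j\<bar> \<le> 1" shows "summable (\<lambda>k. c (lab k) * w k x y)"
proof (rule summable_comparison_test)
  have "norm (c (lab k) * w k x y) \<le> e 0 * (1 / 2) ^ k" for k
    using cw_le[where c = c and k = k and x = x and y = y, OF assms] e_add[of 0 k] by simp
  then show "\<exists>N. \<forall>k\<ge>N. norm (c (lab k) * w k x y) \<le> e 0 * (1 / 2) ^ k" by blast
  show "summable (\<lambda>k. e 0 * (1 / 2) ^ k)" by (intro summable_mult summable_geometric) simp
qed

lemma wsum_tail:
  assumes c: "\<And>j. \<bar>c j\<bar> \<le> 1"
  shows "\<bar>wsum c x y - (\<Sum>k<n. c (lab k) * w k x y)\<bar> \<le> 2 * e n"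
proof -
  note s = summable_w[where c = c, OF c, of x y]
  have "wsum c x y - (\<Sum>k<n. c (lab k) * w k x y) = (\<Sum>k. c (lab (k + n)) * w (k + n) x y)"
    unfolding wsum_def by (rule suminf_minus_initial_segment[symmetric, OF s])
  moreover have "norm (\<Sum>k. c (lab (k + n)) * w (k + n) x y) \<le> (\<Sum>k. e n * (1 / 2) ^ k)"
  proof (rule norm_suminf_le)
    show "norm (c (lab (k + n)) * w (k + n) x y) \<le> e n * (1 / 2) ^ k" for k
      using cw_le[where c = c and k = "k + n" and x = x and y = y, OF c] e_add[of n k] by (simp add: add.commute)
    show "summable (\<lambda>k. e n * (1 / 2) ^ k)" by (intro summable_mult summable_geometric) simp
  qed
  moreover have "(\<Sum>k. e n * (1 / 2) ^ k) = 2 * e n"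
    by (subst suminf_mult) (auto simp: suminf_geometric intro: summable_geometric)
  ultimately show ?thesis by simp
qed

lemma wsum_lipschitz:
  assumes c: "\<And>j. \<bar>c j\<bar> \<le> 1" and c2: "\<And>n. (\<Sum>j<n. \<bar>c j\<bar>) \<le> 2"
  shows "\<bar>wsum c x' y' - wsum c x y\<bar> \<le> 8 * (\<bar>x' - x\<bar> + \<bar>y' - y\<bar>)"
proof -
  let ?d = "\<bar>x' - x\<bar> + \<bar>y' - y\<bar>"
  have lim: "(\<lambda>n. (\<Sum>k<n. c (lab k) * w k x y)) \<longlonglongrightarrow> wsum c x y" for x y
    unfolding wsum_def by (rule summable_LIMSEQ[OF summable_w[where c = c, OF c]])
  have "\<bar>(\<Sum>k<n. c (lab k) * w k x' y') - (\<Sum>k<n. c (lab k) * w k x y)\<bar> \<le> 8 * ?d" for n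
  proof -
    have "\<bar>(\<Sum>k<n. c (lab k) * w k x' y') - (\<Sum>k<n. c (lab k) * w k x y)\<bar> = \<bar>\<Sum>j<n. c j * (h n j x' y' - h n j x y)\<bar>"
      unfolding partial_sum by (simp add: sum_subtractf right_diff_distrib)
    also have "\<dots> \<le> (\<Sum>j<n. \<bar>c j\<bar> * (4 * ?d))"
      by (rule order_trans[OF sum_abs sum_mono]) (unfold abs_mult, rule mult_left_mono[OF h_lipschitz], simp)
    also have "\<dots> = (\<Sum>j<n. \<bar>c j\<bar>) * (4 * ?d)" by (simp only: sum_distrib_right)
    also have "\<dots> \<le> 2 * (4 * ?d)" using c2 by (intro mult_right_mono) auto
    finally show ?thesis by simp
  qed
  moreover have "(\<lambda>n. \<bar>(\<Sum>k<n. c (lab k) * w k x' y') - (\<Sum>k<n. c (lab k) * w k x y)\<bar>) \<longlonglongrightarrow> \<bar>wsum c x' y' - wsum c x y\<bar>"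
    by (intro tendsto_intros lim)
  ultimately show ?thesis by (intro LIMSEQ_le_const2) auto
qed

text \<open>At the scale \<open>e n / 16\<close> the difference quotient sees the wave of step \<open>n\<close>, at the scale
  \<open>2 ^ n * e n\<close> it does not, and neither sees any of the later waves.\<close>

lemma hit_gap:
  fixes x y v1 v2 :: real
  assumes c: "\<And>j. \<bar>c j\<bar> \<le> 1" and c2: "\<And>n. (\<Sum>j<n. \<bar>c j\<bar>) \<le> 2" and cj: "c (lab n) > 0"
    and v: "\<bar>v1\<bar> \<le> 1" "\<bar>v2\<bar> \<le> 1" and c1: "c1 \<le> \<bar>v2 - a n * v1\<bar>"
    and hit: "lam (a n) (b n) (e n) x y \<ge> 3 / 4" "\<bar>kap n x y\<bar> \<ge> 1 / 400"
  defines "Q \<equiv> \<lambda>t. (wsum c (x + t * v1) (y + t * v2) - wsum c x y) / t"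
  shows "c (lab n) * c1 / 800 - 4 / 2 ^ n \<le> \<bar>Q (e n / 16) - Q (2 ^ n * e n)\<bar>"
proof -
  define F where "F x y = (\<Sum>j<n. c j * h n j x y)" for x y
  define G where "G = (\<Sum>j<n. c j * (hx n j x y * v1 + hy n j x y * v2))"
  define W where "W t = c (lab n) * ((w n (x + t * v1) (y + t * v2) - w n x y) / t)" for t
  have e: "0 < e n" by (rule e_pos)
  have Kn: "0 < K n" by (rule K_pos)
  have cl: "c (lab n) \<le> 1" using c[of "lab n"] by linarith
  \<comment> \<open>The earlier waves contribute the linear part \<open>G\<close>, which is the same
    at all scales, and the second-order error; wave \<open>n\<close> contributes \<open>W t\<close>;
    the last error is the tail of the later waves.\<close>
  have est: "\<bar>Q t - G - W t\<bar> \<le> 8 * K n * t + 4 * e (Suc n) / t" if t: "t > 0" for t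
  proof -
    define \<Delta> where "\<Delta> = wsum c (x + t * v1) (y + t * v2) - wsum c x y"
    have 1: "\<bar>wsum c x' y' - (F x' y' + c (lab n) * w n x' y')\<bar> \<le> 2 * e (Suc n)" for x' y'
    proof -
      have "(\<Sum>k<Suc n. c (lab k) * w k x' y') = F x' y' + c (lab n) * w n x' y'"
        by (subst sum.lessThan_Suc) (simp add: partial_sum F_def)
      then show ?thesis using wsum_tail[where c = c, OF c, of x' y' "Suc n"] by simp
    qed
    have 2: "\<bar>F (x + t * v1) (y + t * v2) - F x y - t * G\<bar> \<le> 8 * K n * t\<^sup>2"
    proof -
      have eq: "F (x + t * v1) (y + t * v2) - F x y - t * G =
        (\<Sum>j<n. c j * (h n j (x + t * v1) (y + t * v2) - h n j x y - hx n j x y * (t * v1) - hy n j x y * (t * v2)))"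
        unfolding F_def G_def sum_distrib_left sum_subtractf[symmetric] by (rule sum.cong) (auto simp: algebra_simps)
      have "\<bar>F (x + t * v1) (y + t * v2) - F x y - t * G\<bar> \<le> (\<Sum>j<n. \<bar>c j\<bar> * (4 * K n * t\<^sup>2))"
        unfolding eq
      proof (rule order_trans[OF sum_abs sum_mono])
        fix j
        have "\<bar>t * v1\<bar> + \<bar>t * v2\<bar> \<le> 2 * t"
          by (rule abs_sum_le[OF less_imp_le[OF t] v])
        then have "(\<bar>t * v1\<bar> + \<bar>t * v2\<bar>)\<^sup>2 \<le> (2 * t)\<^sup>2" by (intro power_mono) auto
        then have "K n * (\<bar>t * v1\<bar> + \<bar>t * v2\<bar>)\<^sup>2 \<le> K n * (2 * t)\<^sup>2" using Kn by (intro mult_left_mono) auto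
        then have "\<bar>h n j (x + t * v1) (y + t * v2) - h n j x y - hx n j x y * (t * v1) - hy n j x y * (t * v2)\<bar> \<le> 4 * K n * t\<^sup>2"
          using quadD(4)[OF quad_h[of n j], of x "t * v1" y "t * v2"] by (simp add: power_mult_distrib)
        then show "\<bar>c j * (h n j (x + t * v1) (y + t * v2) - h n j x y - hx n j x y * (t * v1) - hy n j x y * (t * v2))\<bar>
          \<le> \<bar>c j\<bar> * (4 * K n * t\<^sup>2)"
          unfolding abs_mult[of "c j"] by (rule mult_left_mono) simp
      qed
      also have "\<dots> = (\<Sum>j<n. \<bar>c j\<bar>) * (4 * K n * t\<^sup>2)" by (simp only: sum_distrib_right)
      also have "\<dots> \<le> 2 * (4 * K n * t\<^sup>2)" using c2 Kn by (intro mult_right_mono) auto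
      finally show ?thesis by simp
    qed
    have "t * W t = c (lab n) * (w n (x + t * v1) (y + t * v2) - w n x y)" using t by (simp add: W_def)
    then have W: "t * W t = c (lab n) * w n (x + t * v1) (y + t * v2) - c (lab n) * w n x y"
      by (simp only: right_diff_distrib)
    have tQ: "t * Q t = \<Delta>" using t by (simp add: Q_def \<Delta>_def)
    have "\<bar>\<Delta> - t * G - t * W t\<bar> \<le> 8 * K n * t\<^sup>2 + 4 * e (Suc n)"
      unfolding \<Delta>_def W using 1[of "x + t * v1" "y + t * v2"] 1[of x y] 2 by linarith
    then have "\<bar>t * (Q t - G - W t)\<bar> \<le> 8 * K n * t\<^sup>2 + 4 * e (Suc n)" unfolding right_diff_distrib tQ .
    then have "t * \<bar>Q t - G - W t\<bar> \<le> 8 * K n * t\<^sup>2 + 4 * e (Suc n)" using t by (simp add: abs_mult)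
    also have "\<dots> = t * (8 * K n * t + 4 * e (Suc n) / t)" using t by (simp add: power2_eq_square distrib_left)
    finally show ?thesis using t by simp
  qed
  have es: "e (Suc n) / e n \<le> 1 / (1000 * 8 ^ Suc n)" using e_Suc[of n] e by (simp add: field_simps)
  have p8: "1 / (8::real) ^ n \<le> 1 / 2 ^ n" by (intro divide_left_mono power_mono) auto
  have A: "\<bar>Q (2 ^ n * e n) - G\<bar> \<le> 3 / 2 ^ n"
  proof -
    define t where "t = 2 ^ n * e n"
    have t: "t > 0" using e by (simp add: t_def)
    have "8 * K n * t = 8 * 2 ^ n * (e n * K n)" by (simp add: t_def)
    also have "\<dots> = 8 / 100 * (2 ^ n / 8 ^ n)" unfolding e_K by simp
    also have "\<dots> \<le> 8 / 100 * (1 / 2 ^ n)" by (rule mult_left_mono[OF power_2_8]) simp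
    finally have 1: "8 * K n * t \<le> 8 / 100 * (1 / 2 ^ n)" .
    have "4 * e (Suc n) / t = 4 * (e (Suc n) / e n) / 2 ^ n" by (simp add: t_def)
    also have "\<dots> \<le> 4 * (1 / (1000 * 8 ^ Suc n)) / 2 ^ n" using es by (intro divide_right_mono mult_left_mono) auto
    also have "\<dots> \<le> 4 * (1 / 1000) / 2 ^ n"
      using one_le_power[of "8::real" "Suc n"] by (intro divide_right_mono mult_left_mono divide_left_mono) auto
    finally have 2: "4 * e (Suc n) / t \<le> 4 / 1000 * (1 / 2 ^ n)" by simp
    have "\<bar>(w n (x + t * v1) (y + t * v2) - w n x y) / t\<bar> \<le> 2 * e n / t"
      unfolding abs_divide using w_le[of n "x + t * v1" "y + t * v2"] w_le[of n x y] t by (intro frac_le) auto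
    also have "2 * e n / t = 2 / 2 ^ n" using e by (simp add: t_def)
    finally have "\<bar>W t\<bar> \<le> 1 * (2 / 2 ^ n)" unfolding W_def abs_mult using c by (intro mult_mono) auto
    then have "\<bar>Q t - G\<bar> \<le> 3 * (1 / 2 ^ n)" using est[OF t] 1 2 by (simp only: times_divide_eq_right mult_1_right)
    then show ?thesis by (simp add: t_def)
  qed
  have B: "c (lab n) * c1 / 800 - 1 / 2 ^ n \<le> \<bar>Q (e n / 16) - G\<bar>"
  proof -
    define t where "t = e n / 16"
    have t: "t > 0" using e by (simp add: t_def)
    have 1: "8 * K n * t \<le> 1 / 100 * (1 / 2 ^ n)"

    proof -
      have "8 * K n * t = 1 / 2 * (e n * K n)" by (simp add: t_def)
      also have "\<dots> = 1 / 200 * (1 / 8 ^ n)" unfolding e_K by simp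
      also have "\<dots> \<le> 1 / 100 * (1 / 2 ^ n)" using p8 by (intro mult_mono) auto
      finally show ?thesis .
    qed
    have "4 * e (Suc n) / t = 64 * (e (Suc n) / e n)" by (simp add: t_def)
    also have "\<dots> \<le> 64 * (1 / (1000 * 8 ^ Suc n))" using es by (intro mult_left_mono) auto
    also have "\<dots> = 8 / 1000 * (1 / 8 ^ n)" by simp
    also have "\<dots> \<le> 8 / 1000 * (1 / 2 ^ n)" using p8 by (intro mult_left_mono) auto
    finally have 2: "4 * e (Suc n) / t \<le> 8 / 1000 * (1 / 2 ^ n)" .
    define \<beta> where "\<beta> = v2 - a n * v1"
    define s where "s = (y - a n * x - b n) / e n"
    define \<kappa> where "\<kappa> = kap n x y"
    define \<kappa>' where "\<kappa>' = kap n (x + t * v1) (y + t * v2)"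
    \<comment> \<open>The error of linearizing \<open>tanh\<close> over the step
      \<open>\<beta> / 16\<close>. With the scale \<open>e n / 16\<close> it is at most
      \<open>\<bar>\<beta>\<bar> / 4\<close>, against at least
      \<open>3 / 4 * \<bar>\<beta>\<bar>\<close> for the main term.\<close>
    define r where "r = 16 * (tanh (s + \<beta> / 16) - tanh s) - (1 - (tanh s)\<^sup>2) * \<beta>"
    have bb: "\<bar>\<beta>\<bar> \<le> 2"
    proof -
      have "\<bar>a n * v1\<bar> \<le> 1 / 4 * 1" unfolding abs_mult using slope v by (intro mult_mono) auto
      then show ?thesis using v unfolding \<beta>_def by linarith
    qed
    have s': "(y + t * v2 - a n * (x + t * v1) - b n) / e n = s + \<beta> / 16"
      using e by (simp add: s_def \<beta>_def t_def field_simps)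
    have ww: "(w n (x + t * v1) (y + t * v2) - w n x y) / t = 16 * ((\<kappa>' - \<kappa>) * tanh (s + \<beta> / 16)) + \<kappa> * ((1 - (tanh s)\<^sup>2) * \<beta> + r)"
    proof -
      have gen: "(e n * A - e n * B) / (e n / 16) = 16 * (A - B)" for A B using e by (simp add: field_simps)
      show ?thesis
        unfolding w_def tau_def s' s_def[symmetric] \<kappa>_def[symmetric] \<kappa>'_def[symmetric]
        unfolding t_def gen by (simp add: r_def algebra_simps)
    qed
    have r: "\<bar>r\<bar> \<le> \<bar>\<beta>\<bar> / 4"
    proof -
      have "\<bar>r\<bar> = 16 * \<bar>tanh (s + \<beta> / 16) - tanh s - (1 - (tanh s)\<^sup>2) * (\<beta> / 16)\<bar>"

      proof -
        have "r = 16 * (tanh (s + \<beta> / 16) - tanh s - (1 - (tanh s)\<^sup>2) * (\<beta> / 16))"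
          unfolding r_def right_diff_distrib[of 16] by simp
        then show ?thesis by (simp only: abs_mult abs_numeral)
      qed
      also have "\<dots> \<le> 16 * (2 * (\<beta> / 16)\<^sup>2)" using tanh_remainder[of s "\<beta> / 16"] by (intro mult_left_mono) auto
      also have "\<dots> = \<bar>\<beta>\<bar> * \<bar>\<beta>\<bar> / 8" by (simp add: power2_eq_square)
      also have "\<dots> \<le> \<bar>\<beta>\<bar> * 2 / 8" using bb by (intro divide_right_mono mult_left_mono) auto
      finally show ?thesis by simp
    qed
    have k': "\<bar>16 * ((\<kappa>' - \<kappa>) * tanh (s + \<beta> / 16))\<bar> \<le> 12 / 100 * (1 / 2 ^ n)"
    proof -
      obtain kx ky where kq: "quad (K n) (kap n) kx ky" using quad_kap by blast
      have tv: "\<bar>t * v1\<bar> + \<bar>t * v2\<bar> \<le> 2 * t"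
        by (rule abs_sum_le[OF less_imp_le[OF t] v])
      have "\<bar>\<kappa>' - \<kappa>\<bar> \<le> 3 * K n * (\<bar>t * v1\<bar> + \<bar>t * v2\<bar>)"
        unfolding \<kappa>_def \<kappa>'_def by (rule quad_lipschitz[OF kq])
      also have "\<dots> \<le> 3 * K n * (2 * t)" using tv Kn by (intro mult_left_mono) auto
      finally have "\<bar>(\<kappa>' - \<kappa>) * tanh (s + \<beta> / 16)\<bar> \<le> 3 * K n * (2 * t) * 1"
        unfolding abs_mult using tanh_abs(2) Kn t by (intro mult_mono) auto
      also have "\<dots> = 3 / 8 * (e n * K n)" by (simp add: t_def)
      also have "\<dots> \<le> 3 / 800 * (1 / 2 ^ n)" using p8 unfolding e_K by simp
      finally show ?thesis unfolding abs_mult[of 16] by simp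
    qed
    have "3 / 4 \<le> 1 - (tanh s)\<^sup>2" using hit(1) by (simp add: lam_def tau_def s_def)
    then have "3 / 4 * \<bar>\<beta>\<bar> \<le> \<bar>(1 - (tanh s)\<^sup>2) * \<beta>\<bar>" unfolding abs_mult by (intro mult_right_mono) auto
    then have bl: "\<bar>\<beta>\<bar> / 2 \<le> \<bar>(1 - (tanh s)\<^sup>2) * \<beta> + r\<bar>" using r by linarith
    have "1 / 400 * (c1 / 2) \<le> 1 / 400 * (\<bar>\<beta>\<bar> / 2)" using c1 by (simp add: \<beta>_def)
    also have "\<dots> \<le> \<bar>\<kappa>\<bar> * \<bar>(1 - (tanh s)\<^sup>2) * \<beta> + r\<bar>" using hit(2) bl by (intro mult_mono) (auto simp: \<kappa>_def)
    finally have "c1 / 800 - 12 / 100 * (1 / 2 ^ n) \<le> \<bar>(w n (x + t * v1) (y + t * v2) - w n x y) / t\<bar>"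
      using k' unfolding ww abs_mult[symmetric, of \<kappa>] by linarith
    then have "c (lab n) * (c1 / 800 - 12 / 100 * (1 / 2 ^ n)) \<le> \<bar>W t\<bar>"
      unfolding W_def abs_mult using cj by (simp only: abs_of_pos) (rule mult_left_mono, auto)
    moreover have "c (lab n) * (12 / 100 * (1 / 2 ^ n)) \<le> 1 * (12 / 100 * (1 / 2 ^ n))" using cl by (intro mult_right_mono) auto
    ultimately have "c (lab n) * (c1 / 800) - 12 / 100 * (1 / 2 ^ n) \<le> \<bar>W t\<bar>" unfolding right_diff_distrib by linarith
    moreover have "0 \<le> 1 / (2::real) ^ n" by simp
    ultimately have "c (lab n) * (c1 / 800) - 1 / 2 ^ n \<le> \<bar>Q t - G\<bar>" using est[OF t] 1 2 by linarith
    then show ?thesis by (simp add: t_def)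
  qed
  have "4 / (2::real) ^ n = 3 / 2 ^ n + 1 / 2 ^ n" by (simp add: add_divide_distrib[symmetric])
  then show ?thesis using A B by linarith
qed

lemma no_directional_derivative:
  fixes x y v1 v2 :: real
  assumes c: "\<And>j. \<bar>c j\<bar> \<le> 1" and c2: "\<And>n. (\<Sum>j<n. \<bar>c j\<bar>) \<le> 2" and cj: "c j > 0"
    and v: "\<bar>v1\<bar> \<le> 1" "\<bar>v2\<bar> \<le> 1" and c1: "c1 > 0" "\<And>n. c1 \<le> \<bar>v2 - a n * v1\<bar>"
    and hits: "\<And>N. \<exists>n\<ge>N. lab n = j \<and> lam (a n) (b n) (e n) x y \<ge> 3 / 4 \<and> \<bar>kap n x y\<bar> \<ge> 1 / 400"
  shows "\<not> ((\<lambda>t. (wsum c (x + t * v1) (y + t * v2) - wsum c x y) / t) \<longlongrightarrow> l) (at 0)"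
proof
  define Q where "Q t = (wsum c (x + t * v1) (y + t * v2) - wsum c x y) / t" for t
  assume "((\<lambda>t. (wsum c (x + t * v1) (y + t * v2) - wsum c x y) / t) \<longlongrightarrow> l) (at 0)"
  then have lim: "(Q \<longlongrightarrow> l) (at 0)" by (simp add: Q_def[abs_def])
  define \<eta> where "\<eta> = c j * c1 / 800"
  have eta: "\<eta> > 0" using cj c1 by (simp add: \<eta>_def)
  obtain d where d: "d > 0" "\<And>t. t \<noteq> 0 \<Longrightarrow> \<bar>t\<bar> < d \<Longrightarrow> \<bar>Q t - l\<bar> < \<eta> / 4"
    using LIM_D[OF lim, of "\<eta> / 4"] eta by auto
  obtain N where N: "max (8 / \<eta>) (1 / d) < 2 ^ N" using real_arch_pow[of 2 "max (8 / \<eta>) (1 / d)"] by auto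
  obtain n where n: "n \<ge> N" "lab n = j" "lam (a n) (b n) (e n) x y \<ge> 3 / 4" "\<bar>kap n x y\<bar> \<ge> 1 / 400" using hits by blast
  have "(2::real) ^ N \<le> 2 ^ n" using n(1) by (simp add: power_increasing)
  moreover have "8 / \<eta> < 2 ^ N" "1 / d < 2 ^ N" using N by auto
  ultimately have n2: "8 / \<eta> < 2 ^ n" "1 / d < 2 ^ n" by linarith+
  have en: "0 < e n" by (rule e_pos)
  have p2: "1 \<le> (2::real) ^ n" by simp
  have "2 ^ n * e n \<le> 2 ^ n * (1 / (100 * 8 ^ n))" using e_le[of n] by (intro mult_left_mono) auto
  also have "\<dots> = 1 / 100 * (2 ^ n / 8 ^ n)" by simp
  also have "\<dots> \<le> 1 * (1 / 2 ^ n)" by (rule mult_mono[OF _ power_2_8]) simp_all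
  also have "\<dots> = 1 / 2 ^ n" by simp
  also have "\<dots> < d" using n2(2) d(1) by (simp add: field_simps)
  finally have t2: "2 ^ n * e n < d" .
  moreover have "1 / 16 * e n \<le> 2 ^ n * e n"
  proof (rule mult_right_mono)
    show "1 / 16 \<le> (2::real) ^ n" using p2 by linarith
  qed (use en in simp)
  then have "e n / 16 \<le> 2 ^ n * e n" by simp
  moreover have "0 < e n / 16" using en by simp
  ultimately have "\<bar>Q (e n / 16) - l\<bar> < \<eta> / 4" "\<bar>Q (2 ^ n * e n) - l\<bar> < \<eta> / 4"
    by (intro d(2); linarith)+
  then have "\<bar>Q (e n / 16) - Q (2 ^ n * e n)\<bar> < \<eta> / 2" by linarith
  moreover have "\<eta> - 4 / 2 ^ n \<le> \<bar>Q (e n / 16) - Q (2 ^ n * e n)\<bar>"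
    using hit_gap[where c = c, OF c c2 _ v c1(2) n(3,4)] cj n(2) unfolding Q_def \<eta>_def by simp
  moreover have "4 / 2 ^ n < \<eta> / 2" using n2(1) eta by (simp add: field_simps)
  ultimately show False by linarith
qed

text \<open>The point lies so close to the line that both steps of a pair have
  \<open>lam \<ge> 3 / 4\<close>. If the coefficient of the even step is tiny, then \<open>q\<close>
  is near its target 1 and the even step does not lower it; the odd step, whose target is 0, then
  has a large coefficient.\<close>

lemma infinitely_many_hits:
  assumes pairs: "\<And>k. a (Suc (2 * k)) = a (2 * k)" "\<And>k. b (Suc (2 * k)) = b (2 * k)" "\<And>k. lab (Suc (2 * k)) = lab (2 * k)"
    and near: "\<And>N. \<exists>k\<ge>N. lab (2 * k) = j \<and> \<bar>y - a (2 * k) * x - b (2 * k)\<bar> < e (Suc (2 * k)) / 2"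
    and small: "\<And>n. n \<ge> N0 \<Longrightarrow> \<bar>p n j x y\<bar> \<le> 15 / 8"
  shows "\<exists>n\<ge>N. lab n = j \<and> lam (a n) (b n) (e n) x y \<ge> 3 / 4 \<and> \<bar>kap n x y\<bar> \<ge> 1 / 400"
proof -
  obtain k where k: "k \<ge> max N N0" "lab (2 * k) = j" "\<bar>y - a (2 * k) * x - b (2 * k)\<bar> < e (Suc (2 * k)) / 2" using near by blast
  define m where "m = 2 * k"
  have m: "m \<ge> N" "m \<ge> N0" "lab m = j" "\<bar>y - a m * x - b m\<bar> < e (Suc m) / 2" "even m" using k by (auto simp: m_def)
  have m': "a (Suc m) = a m" "b (Suc m) = b m" "lab (Suc m) = j" using pairs[of k] k(2) by (auto simp: m_def)
  have lamb: "lam a' b' e' x y \<ge> 3 / 4" if "\<bar>y - a' * x - b'\<bar> \<le> e' / 2" "e' > 0" for a' b' e'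
  proof -
    have "\<bar>tau a' b' e' x y\<bar> \<le> \<bar>(y - a' * x - b') / e'\<bar>" unfolding tau_def by (rule tanh_abs)
    also have "\<dots> \<le> 1 / 2" using that by (simp add: abs_divide field_simps)
    finally have "\<bar>tau a' b' e' x y\<bar>\<^sup>2 \<le> (1 / 2)\<^sup>2" by (intro power_mono) auto
    then show ?thesis by (simp add: lam_def power2_eq_square)
  qed
  have l1: "lam (a m) (b m) (e m) x y \<ge> 3 / 4" using m(4) e_Suc_half[of m] e_pos[of m] by (intro lamb) linarith+
  have l2: "lam (a (Suc m)) (b (Suc m)) (e (Suc m)) x y \<ge> 3 / 4" unfolding m' using m(4) e_pos by (intro lamb) auto
  have ch: "chi (p n j x y) \<ge> 1 / 100" if "n \<ge> N0" for n using chi_lower small[OF that] by blast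
  show ?thesis
  proof (cases "\<bar>kap m x y\<bar> \<ge> 1 / 400")
    case True
    then show ?thesis using m l1 by blast
  next
    case False
    have km: "kap m x y = chi (p m j x y) * (1 - q m j x y)" using m by (simp add: kap_def kappa_def)
    have k0: "0 \<le> kap m x y" unfolding km using chi_bounds q_bounds[of m j x y] by (intro mult_nonneg_nonneg) auto
    have "1 / 100 * (1 - q m j x y) \<le> kap m x y" unfolding km using ch[OF m(2)] q_bounds[of m j x y] by (intro mult_right_mono) auto
    then have "1 - q m j x y \<le> 100 * kap m x y" by simp
    moreover have "kap m x y < 1 / 400" using False k0 by auto
    ultimately have "q m j x y \<ge> 3 / 4" by linarith
    moreover have "0 \<le> lam (a m) (b m) (e m) x y * kap m x y" using lam_bounds k0 by (intro mult_nonneg_nonneg) auto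
    ultimately have q': "q (Suc m) j x y \<ge> 3 / 4" using m(3) by (simp add: q_step)
    have "1 / 400 \<le> 1 / 100 * (3 / 4 :: real)" by simp
    also have "\<dots> \<le> chi (p (Suc m) j x y) * q (Suc m) j x y" using q' ch[of "Suc m"] m(2) by (intro mult_mono) auto
    also have "\<dots> = \<bar>kap (Suc m) x y\<bar>"
      using m(5) m'(3) chi_bounds[of "p (Suc m) j x y"] q_bounds[of "Suc m" j x y] by (simp add: kap_def kappa_def abs_mult)
    finally show ?thesis using m(1) m'(3) l2 by (intro exI[of _ "Suc m"]) auto
  qed
qed

end

section \<open>Waves along a curve\<close>

definition bdiff :: "real set \<Rightarrow> real \<Rightarrow> real \<Rightarrow> (real \<Rightarrow> real) \<Rightarrow> bool" where
  "bdiff S B M f \<longleftrightarrow> (\<exists>f'. \<forall>t\<in>S. (f has_real_derivative f' t) (at t within S) \<and> \<bar>f t\<bar> \<le> B \<and> \<bar>f' t\<bar> \<le> M)"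

lemma bdiffI:
  assumes "\<And>t. t \<in> S \<Longrightarrow> (f has_real_derivative f' t) (at t within S)" "\<And>t. t \<in> S \<Longrightarrow> \<bar>f t\<bar> \<le> B" "\<And>t. t \<in> S \<Longrightarrow> \<bar>f' t\<bar> \<le> M"
  shows "bdiff S B M f"
  using assms unfolding bdiff_def by blast

lemma bdiff_const: "bdiff S \<bar>c\<bar> 0 (\<lambda>t. c)"
  by (rule bdiffI[where f' = "\<lambda>t. 0"]) auto

lemma bdiff_mono: "bdiff S B M f \<Longrightarrow> B \<le> B' \<Longrightarrow> M \<le> M' \<Longrightarrow> bdiff S B' M' f"
  unfolding bdiff_def by (meson order_trans)

lemma bdiff_add:
  assumes "bdiff S B M f" "bdiff S C N g" shows "bdiff S (B + C) (M + N) (\<lambda>t. f t + g t)"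
proof -
  obtain f' where f: "\<And>t. t \<in> S \<Longrightarrow> (f has_real_derivative f' t) (at t within S)" "\<And>t. t \<in> S \<Longrightarrow> \<bar>f t\<bar> \<le> B" "\<And>t. t \<in> S \<Longrightarrow> \<bar>f' t\<bar> \<le> M"
    using assms(1) unfolding bdiff_def by blast
  obtain g' where g: "\<And>t. t \<in> S \<Longrightarrow> (g has_real_derivative g' t) (at t within S)" "\<And>t. t \<in> S \<Longrightarrow> \<bar>g t\<bar> \<le> C" "\<And>t. t \<in> S \<Longrightarrow> \<bar>g' t\<bar> \<le> N"
    using assms(2) unfolding bdiff_def by blast
  show ?thesis
  proof (rule bdiffI)
    fix t assume t: "t \<in> S"
    show "((\<lambda>t. f t + g t) has_real_derivative f' t + g' t) (at t within S)" by (rule DERIV_add[OF f(1)[OF t] g(1)[OF t]])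
    show "\<bar>f t + g t\<bar> \<le> B + C" by (rule order_trans[OF abs_triangle_ineq add_mono[OF f(2)[OF t] g(2)[OF t]]])
    show "\<bar>f' t + g' t\<bar> \<le> M + N" by (rule order_trans[OF abs_triangle_ineq add_mono[OF f(3)[OF t] g(3)[OF t]]])
  qed
qed

lemma bdiff_mult:
  assumes "bdiff S B M f" "bdiff S C N g" shows "bdiff S (B * C) (M * C + B * N) (\<lambda>t. f t * g t)"
proof -
  obtain f' where f: "\<And>t. t \<in> S \<Longrightarrow> (f has_real_derivative f' t) (at t within S)" "\<And>t. t \<in> S \<Longrightarrow> \<bar>f t\<bar> \<le> B" "\<And>t. t \<in> S \<Longrightarrow> \<bar>f' t\<bar> \<le> M"
    using assms(1) unfolding bdiff_def by blast
  obtain g' where g: "\<And>t. t \<in> S \<Longrightarrow> (g has_real_derivative g' t) (at t within S)" "\<And>t. t \<in> S \<Longrightarrow> \<bar>g t\<bar> \<le> C" "\<And>t. t \<in> S \<Longrightarrow> \<bar>g' t\<bar> \<le> N"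
    using assms(2) unfolding bdiff_def by blast
  show ?thesis
  proof (rule bdiffI)
    fix t assume t: "t \<in> S"
    note f = f[OF t] and g = g[OF t]
    have m: "\<bar>X * Y\<bar> \<le> U * V" if "\<bar>X\<bar> \<le> U" "\<bar>Y\<bar> \<le> V" for X Y U V :: real
      unfolding abs_mult using that by (intro mult_mono) auto
    show "((\<lambda>t. f t * g t) has_real_derivative f' t * g t + f t * g' t) (at t within S)"
      using DERIV_mult[OF f(1) g(1)] by (simp add: mult.commute add.commute)
    show "\<bar>f t * g t\<bar> \<le> B * C" by (rule m[OF f(2) g(2)])
    show "\<bar>f' t * g t + f t * g' t\<bar> \<le> M * C + B * N"
      by (rule order_trans[OF abs_triangle_ineq add_mono[OF m[OF f(3) g(2)] m[OF f(2) g(3)]]])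
  qed
qed

lemma bdiff_cmult: "bdiff S B M f \<Longrightarrow> bdiff S (\<bar>c\<bar> * B) (\<bar>c\<bar> * M) (\<lambda>t. c * f t)"
  using bdiff_mult[OF bdiff_const, of S B M f c] by simp

lemma bdiff_continuous: "bdiff S B M f \<Longrightarrow> continuous_on S f"
  unfolding bdiff_def by (meson DERIV_continuous_on)

text \<open>Meant for a \<open>\<theta>\<close> that is not small but has a primitive bounded by a
  small \<open>C\<close>, against a factor \<open>V\<close> that varies slowly in
  comparison.\<close>

lemma integral_by_parts_bound:
  assumes s: "s0 \<le> s1" and V: "bdiff {s0..s1} B M V"
    and \<Theta>: "\<And>t. t \<in> {s0..s1} \<Longrightarrow> (\<Theta> has_real_derivative \<theta> t) (at t within {s0..s1})"
    and c: "continuous_on {s0..s1} \<theta>" and b: "\<And>t. t \<in> {s0..s1} \<Longrightarrow> \<bar>\<Theta> t\<bar> \<le> C"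
  shows "\<bar>integral {s0..s1} (\<lambda>t. V t * \<theta> t)\<bar> \<le> 2 * (B * C) + M * C * (s1 - s0)"
proof -
  obtain V' where V': "\<And>t. t \<in> {s0..s1} \<Longrightarrow> (V has_real_derivative V' t) (at t within {s0..s1})" "\<And>t. t \<in> {s0..s1} \<Longrightarrow> \<bar>V t\<bar> \<le> B" "\<And>t. t \<in> {s0..s1} \<Longrightarrow> \<bar>V' t\<bar> \<le> M"
    using V unfolding bdiff_def by blast
  have m: "\<bar>X * Y\<bar> \<le> U * V" if "\<bar>X\<bar> \<le> U" "\<bar>Y\<bar> \<le> V" for X Y U V :: real
    unfolding abs_mult using that by (intro mult_mono) auto
  have F: "((\<lambda>t. V' t * \<Theta> t + V t * \<theta> t) has_integral V s1 * \<Theta> s1 - V s0 * \<Theta> s0) {s0..s1}"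
  proof (rule fundamental_theorem_of_calculus[OF s], unfold has_real_derivative_iff_has_vector_derivative[symmetric])
    fix t assume t: "t \<in> {s0..s1}"
    show "((\<lambda>t. V t * \<Theta> t) has_real_derivative V' t * \<Theta> t + V t * \<theta> t) (at t within {s0..s1})"
      using DERIV_mult[OF V'(1)[OF t] \<Theta>[OF t]] by (simp add: mult.commute add.commute)
  qed
  have "(\<lambda>t. V t * \<theta> t) integrable_on {s0..s1}"
    by (intro integrable_continuous_real continuous_intros c bdiff_continuous[OF V])
  then have I: "((\<lambda>t. V t * \<theta> t) has_integral integral {s0..s1} (\<lambda>t. V t * \<theta> t)) {s0..s1}" by (rule integrable_integral)
  have "((\<lambda>t. V' t * \<Theta> t) has_integral (V s1 * \<Theta> s1 - V s0 * \<Theta> s0) - integral {s0..s1} (\<lambda>t. V t * \<theta> t)) {s0..s1}"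
    using has_integral_diff[OF F I] by simp
  then have "norm ((V s1 * \<Theta> s1 - V s0 * \<Theta> s0) - integral {s0..s1} (\<lambda>t. V t * \<theta> t)) \<le> M * C * measure lborel {s0..s1}"
  proof (rule has_integral_bound_real[rotated 2])
    have e: "s0 \<in> {s0..s1}" using s by simp
    show "0 \<le> M * C" using m[OF V'(3)[OF e] b[OF e]] by linarith
    show "norm (V' t * \<Theta> t) \<le> M * C" if "t \<in> {s0..s1} - {}" for t using m[OF V'(3) b] that by simp
  qed simp
  moreover have "\<bar>V s1 * \<Theta> s1\<bar> \<le> B * C" "\<bar>V s0 * \<Theta> s0\<bar> \<le> B * C" using s by (auto intro!: m V'(2) b)
  ultimately show ?thesis using s by simp
qed

lemma tau_derivative:
  assumes "(x has_real_derivative x') (at t within S)" "(y has_real_derivative y') (at t within S)"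
  shows "((\<lambda>t. tau a b e (x t) (y t)) has_real_derivative lam a b e (x t) (y t) * (y' - a * x') / e) (at t within S)"
proof -
  have 1: "((\<lambda>t. (y t - a * x t - b) / e) has_real_derivative (y' - a * x') / e) (at t within S)"
    by (rule DERIV_cdivide) (rule derivative_eq_intros assms refl | simp)+
  have 2: "(tanh has_real_derivative (1 - (tanh z)\<^sup>2)) (at z)" for z :: real
    by (rule derivative_eq_intros refl | simp)+
  show ?thesis using DERIV_chain'[OF 1 2] by (simp add: tau_def lam_def)
qed

context waves
begin

text \<open>The curve crosses every line with speed at least \<open>1 / 5\<close>. Two visits to the
  strip of half-width \<open>e k\<close> are therefore at most \<open>10 * e k\<close> apart, all
  visits lie in an interval of length \<open>20 * e k\<close>, and these lengths have a finite
  sum.\<close>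

lemma steep_null:
  assumes dx: "\<And>t. t \<in> {s0..s1} \<Longrightarrow> (x has_real_derivative x' t) (at t within {s0..s1})"
    and dy: "\<And>t. t \<in> {s0..s1} \<Longrightarrow> (y has_real_derivative y' t) (at t within {s0..s1})"
    and steep: "\<And>t n. t \<in> {s0..s1} \<Longrightarrow> \<bar>y' t - a n * x' t\<bar> \<ge> 1 / 5"
  shows "negligible {t \<in> {s0..s1}. \<forall>N. \<exists>k\<ge>N. \<bar>y t - a k * x t - b k\<bar> < e k}"
proof -
  define \<phi> where "\<phi> k t = y t - a k * x t - b k" for k t
  have far: "(t' - t) / 5 \<le> \<bar>\<phi> k t' - \<phi> k t\<bar>" if t: "t \<in> {s0..s1}" "t' \<in> {s0..s1}" "t < t'" for k t t'
  proof -
    have sub: "{t..t'} \<subseteq> {s0..s1}" using t by auto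
    have "(\<phi> k has_real_derivative (y' z - a k * x' z)) (at z within {t..t'})" if "z \<in> {t..t'}" for z
      unfolding \<phi>_def using dx[of z] dy[of z] that sub
      by (auto intro!: derivative_eq_intros DERIV_subset[OF _ sub])
    then have "\<exists>z\<in>{t..t'}. \<phi> k t' - \<phi> k t = (\<lambda>h. (y' z - a k * x' z) * h) (t' - t)"
      using t(3) by (intro mvt_very_simple) (auto simp: has_field_derivative_def)
    then obtain z where z: "z \<in> {t..t'}" "\<phi> k t' - \<phi> k t = (y' z - a k * x' z) * (t' - t)" by auto
    have "1 / 5 * (t' - t) \<le> \<bar>y' z - a k * x' z\<bar> * \<bar>t' - t\<bar>" using steep z(1) sub t(3) by (intro mult_mono) auto
    then show ?thesis unfolding z(2) abs_mult by simp
  qed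
  \<comment> \<open>An arbitrary visit. If there is none, \<open>A k\<close> is still an interval of
    the same length.\<close>
  define c where "c k = (SOME t. t \<in> {s0..s1} \<and> \<bar>\<phi> k t\<bar> < e k)" for k
  define A where "A k = {c k - 10 * e k..c k + 10 * e k}" for k
  have inA: "t \<in> A k" if t: "t \<in> {s0..s1}" "\<bar>\<phi> k t\<bar> < e k" for t k
  proof -
    have c: "c k \<in> {s0..s1}" "\<bar>\<phi> k (c k)\<bar> < e k" using someI[of "\<lambda>t. t \<in> {s0..s1} \<and> \<bar>\<phi> k t\<bar> < e k" t] t unfolding c_def by auto
    have "\<bar>t - c k\<bar> / 5 \<le> \<bar>\<phi> k t - \<phi> k (c k)\<bar>"
      using far[OF t(1) c(1), of k] far[OF c(1) t(1), of k] by (cases t "c k" rule: linorder_cases) (auto simp: abs_minus_commute)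
    also have "\<dots> \<le> 2 * e k" using t(2) c(2) by linarith
    finally show ?thesis unfolding A_def by (simp add: abs_le_iff)
  qed
  have "AE t in lebesgue. eventually (\<lambda>k. t \<in> space lebesgue - A k) sequentially"
  proof (rule borel_cantelli_AE1)
    show "A n \<in> sets lebesgue" for n unfolding A_def by simp
    show "emeasure lebesgue (A n) < \<infinity>" for n by (simp add: A_def emeasure_lborel_Icc_eq)
    have "measure lebesgue (A n) = 20 * e n" for n using e_pos[of n] by (simp add: A_def)
    moreover have "summable (\<lambda>n. 20 * e n)"
    proof (intro summable_mult summable_comparison_test[of e])
      show "\<exists>N. \<forall>n\<ge>N. norm (e n) \<le> e 0 * (1 / 2) ^ n" using e_add[of 0] e_pos by (simp add: abs_of_pos)
      show "summable (\<lambda>n. e 0 * (1 / 2) ^ n)" by (intro summable_mult summable_geometric) simp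
    qed
    ultimately show "summable (\<lambda>n. measure lebesgue (A n))" by simp
  qed
  then obtain N where N: "N \<in> null_sets lebesgue" "{t \<in> space lebesgue. \<not> eventually (\<lambda>k. t \<in> space lebesgue - A k) sequentially} \<subseteq> N"
    by (auto simp: eventually_ae_filter)
  show ?thesis
  proof (rule negligible_subset)
    show "negligible N" using N(1) by (simp add: negligible_iff_null_sets)
    show "{t \<in> {s0..s1}. \<forall>N. \<exists>k\<ge>N. \<bar>y t - a k * x t - b k\<bar> < e k} \<subseteq> N"
    proof
      fix t assume t: "t \<in> {t \<in> {s0..s1}. \<forall>N. \<exists>k\<ge>N. \<bar>y t - a k * x t - b k\<bar> < e k}"
      have "\<exists>k\<ge>N. t \<in> A k" for N using t inA[of t] unfolding \<phi>_def by blast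
      then have "\<not> eventually (\<lambda>k. t \<in> space lebesgue - A k) sequentially"
        unfolding eventually_sequentially by auto
      then show "t \<in> N" using N(2) by auto
    qed
  qed
qed

lemma convergent_of_small_steps:
  fixes f :: "nat \<Rightarrow> real"
  assumes "\<And>n. \<bar>f (Suc n) - f n\<bar> \<le> 1 / (100 * 8 ^ n)"
  shows "convergent f"
proof -
  have "summable (\<lambda>n. f (Suc n) - f n)"
  proof (rule summable_comparison_test)
    show "\<exists>N. \<forall>n\<ge>N. norm (f (Suc n) - f n) \<le> 1 / 100 * (1 / 8) ^ n" using assms by (simp add: power_one_over)
    show "summable (\<lambda>n. 1 / 100 * (1 / 8 :: real) ^ n)" by (intro summable_mult summable_geometric) simp
  qed
  then have "convergent (\<lambda>m. f m - f 0)" unfolding summable_iff_convergent sum_lessThan_telescope .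
  then have "convergent (\<lambda>m. (f m - f 0) + f 0)" by (intro convergent_add convergent_const)
  then show ?thesis by simp
qed

text \<open>Along the curve the sum of the waves with label \<open>j\<close> is a Lipschitz function. Where it is differentiable,
  its difference quotient at the scale \<open>2 ^ n * e n\<close> is the derivative of \<open>h n j\<close> up to a vanishing error.\<close>

lemma slope_convergent:
  assumes dx: "(x has_real_derivative x') (at t)" and dy: "(y has_real_derivative y') (at t)"
    and \<rho>: "\<rho> > 0" and lip: "\<And>r. 0 \<le> r \<Longrightarrow> r < \<rho> \<Longrightarrow> \<bar>x (t + r) - x t\<bar> \<le> r \<and> \<bar>y (t + r) - y t\<bar> \<le> r"
    and dg: "((\<lambda>s. wsum (\<lambda>i. if i = j then 1 else 0) (x s) (y s)) has_real_derivative G) (at t)"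
  shows "convergent (\<lambda>n. p n j (x t) (y t) * x' + q n j (x t) (y t) * y')"
proof -
  define c :: "nat \<Rightarrow> real" where "c = (\<lambda>i. if i = j then 1 else 0)"
  have c: "\<bar>c i\<bar> \<le> 1" for i by (simp add: c_def)
  define g where "g s = wsum c (x s) (y s)" for s
  define r where "r n = 2 ^ n * e n" for n
  have rpos: "r n > 0" for n using e_pos[of n] by (simp add: r_def)
  have half: "(\<lambda>n. C * (1 / 2) ^ n) \<longlonglongrightarrow> 0" for C :: real
    by (rule tendsto_mult_right_zero, rule LIMSEQ_power_zero) simp
  have rle: "K n * r n \<le> 1 / 100 * (1 / 2) ^ n" for n
  proof -
    have "K n * r n = 2 ^ n * (e n * K n)" by (simp add: r_def)
    also have "\<dots> = 1 / 100 * (2 ^ n / 8 ^ n)" unfolding e_K by simp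
    also have "\<dots> \<le> 1 / 100 * (1 / 2) ^ n" unfolding power_one_over by (rule mult_left_mono[OF power_2_8]) simp
    finally show ?thesis .
  qed
  have rle': "r n \<le> 1 / 100 * (1 / 2) ^ n" for n
    using mult_right_mono[OF K_ge[of n], of "r n"] rpos[of n] rle[of n] by linarith
  have r0: "r \<longlonglongrightarrow> 0"
    by (rule tendsto_sandwich[OF _ _ tendsto_const half[of "1 / 100"]]) (use rle' rpos in \<open>auto intro!: always_eventually less_imp_le\<close>)
  then have ra: "filterlim r (at 0) sequentially"
    by (intro filterlim_atI) (simp_all add: less_imp_neq[OF rpos, symmetric])
  have quo: "(\<lambda>n. (F (t + r n) - F t) / r n) \<longlonglongrightarrow> D" if "(F has_real_derivative D) (at t)" for F D
    using filterlim_compose[OF that[unfolded DERIV_def] ra] .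
  define u where "u n = (x (t + r n) - x t) / r n" for n
  define v where "v n = (y (t + r n) - y t) / r n" for n
  define Q where "Q n = (g (t + r n) - g t) / r n" for n
  have lims: "u \<longlonglongrightarrow> x'" "v \<longlonglongrightarrow> y'" "Q \<longlonglongrightarrow> G"
    unfolding u_def[abs_def] v_def[abs_def] Q_def[abs_def] using quo[OF dx] quo[OF dy] quo[OF dg] by (auto simp: g_def c_def)
  define X where "X n = hx n j (x t) (y t)" for n
  define Y where "Y n = hy n j (x t) (y t)" for n
  have XY: "\<bar>X n\<bar> \<le> 4" "\<bar>Y n\<bar> \<le> 4" for n unfolding X_def Y_def by (rule gradient_bound)+
  have hs: "(\<Sum>k<n. c (lab k) * w k x1 y1) = h n j x1 y1" for n x1 y1
  proof -
    have "(\<Sum>i<n. c i * h n i x1 y1) = (\<Sum>i<n. if i = j then h n j x1 y1 else 0)"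
      by (rule sum.cong) (auto simp: c_def)
    also have "\<dots> = h n j x1 y1" by (simp add: h_zero)
    finally show ?thesis unfolding partial_sum .
  qed
  have est: "\<bar>Q n - (X n * u n + Y n * v n)\<bar> \<le> 5 * (1 / 2) ^ n" if rn: "r n < \<rho>" for n
  proof -
    define du where "du = x (t + r n) - x t"
    define dv where "dv = y (t + r n) - y t"
    have d: "\<bar>du\<bar> + \<bar>dv\<bar> \<le> 2 * r n" using lip[of "r n"] rn rpos[of n] unfolding du_def dv_def by fastforce
    have 1: "\<bar>g s - h n j (x s) (y s)\<bar> \<le> 2 * e n" for s
      using wsum_tail[where c = c, OF c, of "x s" "y s" n] unfolding g_def hs .
    have "(\<bar>du\<bar> + \<bar>dv\<bar>)\<^sup>2 \<le> (2 * r n)\<^sup>2" using d by (intro power_mono) auto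
    then have "K n * (\<bar>du\<bar> + \<bar>dv\<bar>)\<^sup>2 \<le> K n * (2 * r n)\<^sup>2" using K_pos[of n] by (intro mult_left_mono) auto
    then have 2: "\<bar>h n j (x (t + r n)) (y (t + r n)) - h n j (x t) (y t) - X n * du - Y n * dv\<bar> \<le> K n * (2 * r n)\<^sup>2"
      using quadD(4)[OF quad_h[of n j], of "x t" du "y t" dv] by (simp add: du_def dv_def X_def Y_def)
    have "\<bar>g (t + r n) - g t - (X n * du + Y n * dv)\<bar> \<le> 4 * e n + K n * (2 * r n)\<^sup>2"
      using 1[of "t + r n"] 1[of t] 2 by linarith
    then have "\<bar>g (t + r n) - g t - (X n * du + Y n * dv)\<bar> / r n \<le> (4 * e n + K n * (2 * r n)\<^sup>2) / r n"
      using rpos[of n] by (intro divide_right_mono) auto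
    also have "(4 * e n + K n * (2 * r n)\<^sup>2) / r n = 4 * (1 / 2) ^ n + 4 * (K n * r n)"
      using e_pos[of n] by (simp add: r_def field_simps power2_eq_square power_one_over)
    also have "\<dots> \<le> 5 * (1 / 2) ^ n" using rle[of n] zero_le_power[of "1 / 2 :: real" n] by linarith
    finally have "\<bar>(g (t + r n) - g t - (X n * du + Y n * dv)) / r n\<bar> \<le> 5 * (1 / 2) ^ n"
      using rpos[of n] by (simp add: abs_divide)
    moreover have "(g (t + r n) - g t - (X n * du + Y n * dv)) / r n = Q n - (X n * u n + Y n * v n)"
      unfolding Q_def u_def v_def du_def[symmetric] dv_def[symmetric] by (simp add: diff_divide_distrib add_divide_distrib)
    ultimately show ?thesis by simp
  qed
  have "eventually (\<lambda>n. norm (Q n - (X n * u n + Y n * v n)) \<le> 5 * (1 / 2) ^ n) sequentially"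
    using order_tendstoD(2)[OF r0 \<rho>] by (rule eventually_mono) (use est in auto)
  then have z1: "(\<lambda>n. Q n - (X n * u n + Y n * v n)) \<longlonglongrightarrow> 0"
    by (rule Lim_null_comparison[OF _ half])
  have bz: "(\<lambda>n. Z n * \<eta> n) \<longlonglongrightarrow> 0" if "\<And>n. \<bar>Z n\<bar> \<le> 4" "\<eta> \<longlonglongrightarrow> 0" for Z \<eta> :: "nat \<Rightarrow> real"
  proof (rule Lim_null_comparison)
    show "eventually (\<lambda>n. norm (Z n * \<eta> n) \<le> 4 * \<bar>\<eta> n\<bar>) sequentially"
      unfolding real_norm_def abs_mult by (intro always_eventually allI mult_right_mono that(1)) simp
    show "(\<lambda>n. 4 * \<bar>\<eta> n\<bar>) \<longlonglongrightarrow> 0" using that(2) by (intro tendsto_mult_right_zero tendsto_rabs_zero)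
  qed
  have "(\<lambda>n. X n * (u n - x')) \<longlonglongrightarrow> 0" "(\<lambda>n. Y n * (v n - y')) \<longlonglongrightarrow> 0"
    using lims(1,2) by (auto intro!: bz XY simp: LIM_zero_iff)
  then have "(\<lambda>n. Q n - (Q n - (X n * u n + Y n * v n)) - X n * (u n - x') - Y n * (v n - y')) \<longlonglongrightarrow> G - 0 - 0 - 0"
    by (intro tendsto_diff lims z1)
  then have "(\<lambda>n. X n * x' + Y n * y') \<longlonglongrightarrow> G" by (simp add: algebra_simps)
  then have c1: "convergent (\<lambda>n. X n * x' + Y n * y')" by (rule convergentI)
  \<comment> \<open>Since \<open>hx - p\<close> and \<open>hy - q\<close> change by summable
    amounts, convergence passes from the true gradient to \<open>(p, q)\<close>.\<close>
  have "convergent (\<lambda>n. X n - p n j (x t) (y t))" "convergent (\<lambda>n. Y n - q n j (x t) (y t))"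
    unfolding X_def Y_def using hx_step hy_step by (auto intro!: convergent_of_small_steps simp: e_K)
  from convergent_diff[OF c1 convergent_add[OF convergent_mult[OF this(1) convergent_const] convergent_mult[OF this(2) convergent_const]]]
  have "convergent (\<lambda>n. (X n * x' + Y n * y') - ((X n - p n j (x t) (y t)) * x' + (Y n - q n j (x t) (y t)) * y'))" .
  then show ?thesis by (simp add: algebra_simps)
qed

end

section \<open>The energy estimate along a flat curve\<close>

lemma abs_mult_le: "\<bar>X\<bar> \<le> U \<Longrightarrow> \<bar>Y\<bar> \<le> V \<Longrightarrow> \<bar>X * Y\<bar> \<le> U * V" for X Y U V :: real
  unfolding abs_mult by (intro mult_mono) auto

context waves
begin

text \<open>A differentiable substitute for the slope of a curve that is only continuously differentiable: it starts
  near that slope and is moved towards \<open>a n\<close> whenever the gradient with label \<open>j\<close> is changed.\<close>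

primrec adapt :: "real \<Rightarrow> nat \<Rightarrow> nat \<Rightarrow> real \<Rightarrow> real \<Rightarrow> real" where
  "adapt m0 j 0 x y = m0"
| "adapt m0 j (Suc n) x y = adapt m0 j n x y + (if lab n = j then lam (a n) (b n) (e n) x y * (a n - adapt m0 j n x y) else 0)"

lemma adapt_bound: assumes "\<bar>m0\<bar> \<le> 1" shows "\<bar>adapt m0 j n x y\<bar> \<le> 1"
proof (induction n)
  case (Suc n)
  define l where "l = lam (a n) (b n) (e n) x y"
  have l: "0 \<le> l" "l \<le> 1" using lam_bounds by (auto simp: l_def)
  have "\<bar>adapt m0 j n x y + l * (a n - adapt m0 j n x y)\<bar> \<le> 1"
  proof -
    have "adapt m0 j n x y + l * (a n - adapt m0 j n x y) = (1 - l) * adapt m0 j n x y + l * a n" by (simp add: algebra_simps)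
    moreover have "\<bar>(1 - l) * adapt m0 j n x y\<bar> \<le> 1 - l" "\<bar>l * a n\<bar> \<le> l"
      using abs_mult_le[of "1 - l" "1 - l" "adapt m0 j n x y" 1] abs_mult_le[of l l "a n" 1] l Suc.IH slope[of n] by simp_all
    ultimately show ?thesis by linarith
  qed
  then show ?case using Suc.IH by (simp add: l_def)
qed (use assms in simp)

end

locale wave_curve = waves +
  fixes x y x' y' :: "real \<Rightarrow> real" and s0 s1 :: real
  assumes s01: "s0 \<le> s1" and len: "s1 - s0 \<le> 1"
    and dx: "\<And>t. t \<in> {s0..s1} \<Longrightarrow> (x has_real_derivative x' t) (at t within {s0..s1})"
    and dy: "\<And>t. t \<in> {s0..s1} \<Longrightarrow> (y has_real_derivative y' t) (at t within {s0..s1})"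
    and cx: "continuous_on {s0..s1} x'" and cy: "continuous_on {s0..s1} y'"
    and speed: "\<And>t. t \<in> {s0..s1} \<Longrightarrow> \<bar>x' t\<bar> \<le> 1" "\<And>t. t \<in> {s0..s1} \<Longrightarrow> \<bar>y' t\<bar> \<le> 1"
begin

lemma quad_bdiff:
  assumes q: "quad C F Fx Fy" and B: "\<And>x y. \<bar>F x y\<bar> \<le> B"
  shows "bdiff {s0..s1} B (2 * C) (\<lambda>t. F (x t) (y t))"
proof (rule bdiffI)
  fix t assume t: "t \<in> {s0..s1}"
  show "((\<lambda>t. F (x t) (y t)) has_real_derivative Fx (x t) (y t) * x' t + Fy (x t) (y t) * y' t) (at t within {s0..s1})"
    by (rule quad_derivative[OF q dx[OF t] dy[OF t]])
  have "\<bar>Fx (x t) (y t) * x' t\<bar> \<le> C" "\<bar>Fy (x t) (y t) * y' t\<bar> \<le> C"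
    using abs_mult_le[OF quadD(2)[OF q] speed(1)[OF t]] abs_mult_le[OF quadD(3)[OF q] speed(2)[OF t]] by simp_all
  then show "\<bar>Fx (x t) (y t) * x' t + Fy (x t) (y t) * y' t\<bar> \<le> 2 * C"
    using abs_triangle_ineq[of "Fx (x t) (y t) * x' t" "Fy (x t) (y t) * y' t"] by linarith
qed (rule B)

lemma normal_speed: "\<bar>y' t - a n * x' t\<bar> \<le> 2" if "t \<in> {s0..s1}" for t n
proof -
  have "\<bar>a n * x' t\<bar> \<le> 1 * 1" unfolding abs_mult using slope[of n] speed[OF that] by (intro mult_mono) auto
  then show ?thesis using speed[OF that] by linarith
qed

text \<open>A step multiplies the old derivative by \<open>1 - lam\<close> and adds a term of order
  \<open>1 / e n\<close> from the derivative of \<open>lam\<close>. The growth of \<open>K\<close>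
  forced by \<open>K_step\<close> absorbs that term.\<close>

lemma adapt_bdiff:
  assumes m0: "\<bar>m0\<bar> \<le> 1"
  shows "bdiff {s0..s1} 1 (2 * K n) (\<lambda>t. adapt m0 j n (x t) (y t))"
proof (induction n)
  case 0
  have "bdiff {s0..s1} \<bar>m0\<bar> 0 (\<lambda>t. m0)" by (rule bdiff_const)
  then show ?case using m0 K_pos[of 0] by (auto intro: bdiff_mono)
next
  case (Suc n)
  obtain A' where A': "\<And>t. t \<in> {s0..s1} \<Longrightarrow> ((\<lambda>t. adapt m0 j n (x t) (y t)) has_real_derivative A' t) (at t within {s0..s1})"
     "\<And>t. t \<in> {s0..s1} \<Longrightarrow> \<bar>A' t\<bar> \<le> 2 * K n" using Suc.IH unfolding bdiff_def by blast
  have step: "2 * K n + 12 / e n \<le> 2 * K (Suc n)"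
  proof -
    have "1 \<le> (8::real) ^ Suc n" by (rule one_le_power) simp
    then have "6 / e n \<le> 1000 * 8 ^ Suc n / e n" using e_pos[of n] by (intro divide_right_mono) auto
    then show ?thesis using K_step[of n] by simp
  qed
  define L where "L t = lam (a n) (b n) (e n) (x t) (y t)" for t
  define \<tau> where "\<tau> t = tau (a n) (b n) (e n) (x t) (y t)" for t
  define L' where "L' t = - 2 * \<tau> t * (L t * (y' t - a n * x' t) / e n)" for t
  have L01: "0 \<le> L t" "L t \<le> 1" for t unfolding L_def by (rule lam_bounds)+
  have LL: "L = (\<lambda>t. 1 - (\<tau> t)\<^sup>2)" by (simp add: L_def[abs_def] \<tau>_def lam_def)
  have dL: "(L has_real_derivative L' t) (at t within {s0..s1})" if t: "t \<in> {s0..s1}" for t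
  proof -
    define X where "X = L t * (y' t - a n * x' t) / e n"
    have "(\<tau> has_real_derivative X) (at t within {s0..s1})"
      unfolding \<tau>_def[abs_def] L_def X_def by (rule tau_derivative[OF dx[OF t] dy[OF t]])
    from DERIV_diff[OF DERIV_const[of 1] DERIV_mult[OF this this]]
    have "(L has_real_derivative 0 - (X * \<tau> t + X * \<tau> t)) (at t within {s0..s1})" unfolding LL power2_eq_square .
    moreover have "0 - (X * \<tau> t + X * \<tau> t) = L' t" unfolding L'_def X_def[symmetric] by simp
    ultimately show ?thesis by simp
  qed
  have L'b: "\<bar>L' t\<bar> \<le> 4 / e n" if t: "t \<in> {s0..s1}" for t
  proof -
    have "\<bar>L t * (y' t - a n * x' t)\<bar> \<le> 1 * 2" unfolding abs_mult using L01[of t] normal_speed[OF t] by (intro mult_mono) auto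
    then have "\<bar>L t * (y' t - a n * x' t) / e n\<bar> \<le> 2 / e n" using e_pos[of n] by (simp add: abs_divide divide_right_mono)
    moreover have "\<bar>- 2 * \<tau> t\<bar> \<le> 2" using tau_le by (simp add: abs_mult \<tau>_def)
    ultimately have "\<bar>L' t\<bar> \<le> 2 * (2 / e n)" unfolding L'_def abs_mult[of "- 2 * \<tau> t"] by (intro mult_mono) auto
    then show ?thesis by simp
  qed
  show ?case
  proof (cases "lab n = j")
    case True
    show ?thesis
    proof (rule bdiffI)
      fix t assume t: "t \<in> {s0..s1}"
      have "((\<lambda>t. adapt m0 j n (x t) (y t) + L t * (a n - adapt m0 j n (x t) (y t))) has_real_derivative
          A' t + (L' t * (a n - adapt m0 j n (x t) (y t)) + (0 - A' t) * L t)) (at t within {s0..s1})"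
        by (intro DERIV_add DERIV_mult DERIV_diff DERIV_const A'(1)[OF t] dL[OF t])
      then show "((\<lambda>t. adapt m0 j (Suc n) (x t) (y t)) has_real_derivative
          A' t + (L' t * (a n - adapt m0 j n (x t) (y t)) + (0 - A' t) * L t)) (at t within {s0..s1})"
        using True by (simp add: L_def)
      have "\<bar>L' t * (a n - adapt m0 j n (x t) (y t))\<bar> \<le> (4 / e n) * 2"
      proof -
        have "\<bar>a n - adapt m0 j n (x t) (y t)\<bar> \<le> 2" using slope[of n] adapt_bound[OF m0, of j n "x t" "y t"] by linarith
        then show ?thesis unfolding abs_mult using L'b[OF t] e_pos[of n] by (intro mult_mono) auto
      qed
      moreover have "\<bar>(1 - L t) * A' t\<bar> \<le> 1 * (2 * K n)"
        unfolding abs_mult using L01[of t] A'(2)[OF t] by (intro mult_mono) auto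
      moreover have "A' t + (L' t * (a n - adapt m0 j n (x t) (y t)) + (0 - A' t) * L t)
         = (1 - L t) * A' t + L' t * (a n - adapt m0 j n (x t) (y t))" by (simp add: algebra_simps)
      moreover have "4 / e n * 2 \<le> 12 / e n" using e_pos[of n] by (simp add: divide_right_mono)
      ultimately show "\<bar>A' t + (L' t * (a n - adapt m0 j n (x t) (y t)) + (0 - A' t) * L t)\<bar> \<le> 2 * K (Suc n)"
        using step abs_triangle_ineq[of "(1 - L t) * A' t" "L' t * (a n - adapt m0 j n (x t) (y t))"] by linarith
    qed (rule adapt_bound[OF m0])
  next
    case False
    have "0 \<le> 12 / e n" using e_pos[of n] by simp
    then have "2 * K n \<le> 2 * K (Suc n)" using step by linarith
    then show ?thesis using bdiff_mono[OF Suc.IH order_refl] False by simp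
  qed
qed

text \<open>Along the curve \<open>tau\<close> has derivative
  \<open>lam * (y' - a n * x') / e n\<close>, and \<open>lam = 1 - tau^2\<close>. Hence
  \<open>lam ^ k * (y' - a n * x')\<close> has the primitive \<open>e n\<close> times that of the
  polynomial \<open>(1 - tau^2) ^ (k - 1)\<close> in \<open>tau\<close>, which is of size
  \<open>e n\<close>, while \<open>V\<close> varies with speed of order \<open>K n\<close>
  only.\<close>

lemma wave_integral_bound:
  assumes V: "bdiff {s0..s1} 20 (100 * K n) V" and k: "k = 1 \<or> k = 2 \<or> k = (3::nat)"
  shows "\<bar>integral {s0..s1} (\<lambda>t. V t * (lam (a n) (b n) (e n) (x t) (y t) ^ k * (y' t - a n * x' t)))\<bar> \<le> 3 / 8 ^ n"
proof -
  define \<tau> where "\<tau> t = tau (a n) (b n) (e n) (x t) (y t)" for t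
  define L where "L t = lam (a n) (b n) (e n) (x t) (y t)" for t
  define \<Theta> where "\<Theta> t = e n * (if k = 1 then \<tau> t else if k = 2 then \<tau> t - \<tau> t ^ 3 / 3 else \<tau> t - 2 * \<tau> t ^ 3 / 3 + \<tau> t ^ 5 / 5)" for t
  have LL: "L t = 1 - (\<tau> t)\<^sup>2" for t by (simp add: L_def \<tau>_def lam_def)
  have dt: "(\<tau> has_real_derivative L t * (y' t - a n * x' t) / e n) (at t within {s0..s1})" if t: "t \<in> {s0..s1}" for t
    unfolding \<tau>_def[abs_def] L_def by (rule tau_derivative[OF dx[OF t] dy[OF t]])
  have dT: "(\<Theta> has_real_derivative L t ^ k * (y' t - a n * x' t)) (at t within {s0..s1})" if t: "t \<in> {s0..s1}" for t
  proof -
    define d where "d = L t * (y' t - a n * x' t) / e n"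
    have d: "e n * d = L t * (y' t - a n * x' t)" using e_pos[of n] by (simp add: d_def)
    note dt = dt[OF t, folded d_def]
    consider "k = 1" | "k = 2" | "k = 3" using k by blast
    then show ?thesis
    proof cases
      case 1
      have "(\<Theta> has_real_derivative e n * d) (at t within {s0..s1})"
        unfolding \<Theta>_def using 1 dt by (simp add: DERIV_cmult)
      then show ?thesis using 1 d by simp
    next
      case 2
      have "((\<lambda>t. e n * (\<tau> t - \<tau> t ^ 3 / 3)) has_real_derivative e n * (d - (\<tau> t)\<^sup>2 * d)) (at t within {s0..s1})"
        by (rule derivative_eq_intros dt refl | simp)+
      moreover have "e n * (d - (\<tau> t)\<^sup>2 * d) = (1 - (\<tau> t)\<^sup>2) * (e n * d)" by (simp add: algebra_simps)
      ultimately show ?thesis unfolding d LL[symmetric] \<Theta>_def using 2 by (simp add: power2_eq_square mult.assoc)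
    next
      case 3
      have "((\<lambda>t. e n * (\<tau> t - 2 * \<tau> t ^ 3 / 3 + \<tau> t ^ 5 / 5)) has_real_derivative e n * (d - 2 * (\<tau> t)\<^sup>2 * d + (\<tau> t) ^ 4 * d)) (at t within {s0..s1})"
        by (rule derivative_eq_intros dt refl | simp)+
      moreover have "e n * (d - 2 * (\<tau> t)\<^sup>2 * d + (\<tau> t) ^ 4 * d) = (1 - (\<tau> t)\<^sup>2)\<^sup>2 * (e n * d)"
        by (simp add: power2_eq_square power4_eq_xxxx algebra_simps)
      ultimately show ?thesis unfolding d LL[symmetric] \<Theta>_def using 3 by (simp add: power2_eq_square power3_eq_cube mult.assoc)
    qed
  qed
  have Tb: "\<bar>\<Theta> t\<bar> \<le> 2 * e n" for t
  proof -
    have t1: "\<bar>\<tau> t\<bar> \<le> 1" unfolding \<tau>_def by (rule tau_le)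
    have "\<bar>\<tau> t ^ 3\<bar> \<le> 1" "\<bar>\<tau> t ^ 5\<bar> \<le> 1" using t1 by (simp_all add: power_abs power_le_one)
    then have "\<bar>if k = 1 then \<tau> t else if k = 2 then \<tau> t - \<tau> t ^ 3 / 3 else \<tau> t - 2 * \<tau> t ^ 3 / 3 + \<tau> t ^ 5 / 5\<bar> \<le> 2"
      using t1 by (simp add: abs_le_iff)
    then show ?thesis unfolding \<Theta>_def abs_mult using e_pos[of n] by (simp add: mult.commute)
  qed
  have cc: "continuous_on {s0..s1} (\<lambda>t. L t ^ k * (y' t - a n * x' t))"
  proof -
    have "continuous_on {s0..s1} \<tau>" by (rule DERIV_continuous_on[OF dt])
    then show ?thesis unfolding LL by (intro continuous_intros cx cy)
  qed
  have "\<bar>integral {s0..s1} (\<lambda>t. V t * (L t ^ k * (y' t - a n * x' t)))\<bar> \<le> 2 * (20 * (2 * e n)) + 100 * K n * (2 * e n) * (s1 - s0)"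
    by (rule integral_by_parts_bound[OF s01 V dT cc Tb])
  also have "\<dots> = 80 * e n + 200 * (e n * K n) * (s1 - s0)" by simp
  also have "\<dots> \<le> 80 * (1 / (100 * 8 ^ n)) + 200 * (1 / (100 * 8 ^ n)) * 1"
    unfolding e_K using e_le[of n] len by (intro add_mono mult_left_mono) auto
  also have "\<dots> \<le> 3 / 8 ^ n" by (simp add: field_simps)
  finally show ?thesis unfolding L_def .
qed

end

text \<open>As a polynomial in \<open>m\<close> the energy has leading coefficient
  \<open>q^2 + (2 - q^2) = 2\<close> for every \<open>q\<close>, so its change is affine in
  \<open>m\<close>. At \<open>m = a\<close> the value \<open>p + q * a\<close> is not altered by the
  step, since \<open>(p, q)\<close> moves along the normal \<open>(- a, 1)\<close>; what is left
  there is the term with \<open>d^2\<close>.\<close>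

lemma energy_identity:
  fixes l k p q a A m :: real
  defines "d \<equiv> a - A" and "p1 \<equiv> p - a * l * k" and "q1 \<equiv> q + l * k"
  shows "((p1 + q1 * m)\<^sup>2 + (2 - q1\<^sup>2) * (m - (A + l * (a - A)))\<^sup>2) - ((p + q * m)\<^sup>2 + (2 - q\<^sup>2) * (m - A)\<^sup>2) =
     (m - a) * (l ^ 1 * (2 * ((p + a * q) * k) + (-2) * (d * (2 + (-1) * (q * q) + 2 * (q * k))))
       + l ^ 2 * (2 * (d * (2 * (q * k) + (-1) * (k * k)))) + l ^ 3 * (2 * (d * (k * k))))
     + d\<^sup>2 * ((2 - q1\<^sup>2) * (1 - l)\<^sup>2 - (2 - q\<^sup>2))"
proof -
  define D where "D = m - a"
  have A: "A = a - d" "m = D + a" by (simp_all add: d_def D_def)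
  show ?thesis unfolding A p1_def q1_def
    by (simp add: power2_eq_square power3_eq_cube) algebra
qed

text \<open>When \<open>q\<close> falls, the weight \<open>2 - q^2\<close> grows. But
  \<open>q\<close> falls at most by the factor \<open>1 - l\<close>, while the square of the
  distance to \<open>adapt\<close> shrinks by \<open>(1 - l)^2\<close>; because of
  \<open>q \<le> 1\<close> the second effect prevails.\<close>

lemma energy_coefficient:
  fixes l q q1 :: real
  assumes l: "0 \<le> l" "l \<le> 1" and q: "0 \<le> q" "q \<le> 1" and q1: "q * (1 - l) \<le> q1"
  shows "(2 - q1\<^sup>2) * (1 - l)\<^sup>2 - (2 - q\<^sup>2) \<le> 0"
proof -
  define s where "s = (1 - l)\<^sup>2"
  have s: "0 \<le> s" "s \<le> 1" using l by (auto simp: s_def power_le_one)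
  have "(q * (1 - l))\<^sup>2 \<le> q1\<^sup>2" using q1 q l by (intro power_mono) auto
  then have "(2 - q1\<^sup>2) * s \<le> (2 - q\<^sup>2 * s) * s" using s by (intro mult_right_mono) (auto simp: s_def power_mult_distrib)
  moreover have "q\<^sup>2 * (1 + s) \<le> 1 * 2" using q s by (intro mult_mono) (auto simp: power_le_one)
  then have "0 \<le> (1 - s) * (2 - q\<^sup>2 * (1 + s))" using s by (intro mult_nonneg_nonneg) auto
  moreover have "(1 - s) * (2 - q\<^sup>2 * (1 + s)) = 2 - q\<^sup>2 - (2 - q\<^sup>2 * s) * s" by algebra
  ultimately show ?thesis unfolding s_def[symmetric] by linarith
qed

context wave_curve
begin

text \<open>The energy \<open>(p + q * m)\<^sup>2 + (2 - q\<^sup>2) * (m - adapt)\<^sup>2\<close> is chosen such that its change at each step has,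
  apart from a nonpositive term, the factor \<open>m - a n\<close>. This turns the change into slowly varying multiples
  of powers of \<open>lam\<close> times the speed across the line, whose integral is of order \<open>e n\<close>.\<close>

lemma energy_bound:
  fixes m :: "real \<Rightarrow> real" and m0 \<omega> s :: real and j N :: nat
  assumes m: "continuous_on {s0..s1} m" "\<And>t. t \<in> {s0..s1} \<Longrightarrow> y' t = m t * x' t"
    and m0: "\<bar>m0\<bar> \<le> 1" "\<And>t. t \<in> {s0..s1} \<Longrightarrow> \<bar>m t - m0\<bar> \<le> \<omega>"
    and s: "\<bar>s\<bar> = 1" "\<And>t. t \<in> {s0..s1} \<Longrightarrow> 0 \<le> s * x' t"
  shows "integral {s0..s1} (\<lambda>t. (p N j (x t) (y t) + q N j (x t) (y t) * m t)\<^sup>2 * (s * x' t)) \<le> 2 * \<omega>\<^sup>2 * (s1 - s0) + 11 / 8 ^ j"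
proof -
  let ?J = "{s0..s1}"
  define P where "P n t = p n j (x t) (y t)" for n t
  define Q where "Q n t = q n j (x t) (y t)" for n t
  define A where "A n t = adapt m0 j n (x t) (y t)" for n t
  define U where "U n t = (P n t + Q n t * m t)\<^sup>2 + (2 - (Q n t)\<^sup>2) * (m t - A n t)\<^sup>2" for n t
  define I where "I n = integral ?J (\<lambda>t. U n t * (s * x' t))" for n
  have bP: "bdiff ?J (9 / 4) (2 * K n) (P n)" for n
    using quad_p[of n j] unfolding P_def by (auto intro: quad_bdiff p_bound)
  have bQ: "bdiff ?J 1 (2 * K n) (Q n)" for n
    using quad_q[of n j] q_bounds unfolding Q_def by (auto intro!: quad_bdiff)
  have bA: "bdiff ?J 1 (2 * K n) (A n)" for n unfolding A_def by (rule adapt_bdiff[OF m0(1)])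
  have cU: "continuous_on ?J (U n)" for n
    unfolding U_def by (intro continuous_intros m(1) bdiff_continuous[OF bP] bdiff_continuous[OF bQ] bdiff_continuous[OF bA])
  have iU: "(\<lambda>t. U n t * (s * x' t)) integrable_on ?J" for n
    by (intro integrable_continuous_real continuous_intros cU cx)
  have sx: "s * x' t \<le> 1" if "t \<in> ?J" for t
  proof -
    have "\<bar>s * x' t\<bar> \<le> 1 * 1" unfolding abs_mult using s(1) speed(1)[OF that] by (intro mult_mono) auto
    then show ?thesis by simp
  qed
  \<comment> \<open>A step with label \<open>j\<close> costs three oscillating integrals, one for
    each power of \<open>lam\<close>, of size at most \<open>3 / 8 ^ n\<close>.\<close>
  have step: "I (Suc n) \<le> I n + (if j \<le> n then 9 / 8 ^ n else 0)" for n
  proof (cases "lab n = j")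
    case False
    then have "U (Suc n) = U n" by (auto simp: U_def P_def Q_def A_def p_step q_step)
    then show ?thesis by (simp add: I_def)
  next
    case True
    then have jn: "j \<le> n" using lab_le[of n] by simp
    define \<kappa> where "\<kappa> t = kap n (x t) (y t)" for t
    define l where "l t = lam (a n) (b n) (e n) (x t) (y t)" for t
    define d where "d t = a n - A n t" for t
    define V0 where "V0 t = 2 * ((P n t + a n * Q n t) * \<kappa> t) + (-2) * (d t * (2 + (-1) * (Q n t * Q n t) + 2 * (Q n t * \<kappa> t)))" for t
    define V1 where "V1 t = 2 * (d t * (2 * (Q n t * \<kappa> t) + (-1) * (\<kappa> t * \<kappa> t)))" for t
    define V2 where "V2 t = 2 * (d t * (\<kappa> t * \<kappa> t))" for t
    \<comment> \<open>By \<open>y' = m * x'\<close> this is \<open>(m - a n) * x'\<close>: the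
      factor extracted by \<open>energy_identity\<close> times the weight \<open>x'\<close> is the
      speed across the line.\<close>
    define \<phi>' where "\<phi>' t = y' t - a n * x' t" for t
    have K0: "0 < K n" by (rule K_pos)
    have bk: "bdiff ?J 1 (2 * K n) \<kappa>" using quad_kap[of n] kap_le unfolding \<kappa>_def by (auto intro!: quad_bdiff)
    have bd: "bdiff ?J (5 / 4) (2 * K n) d"
    proof -
      have "bdiff ?J (\<bar>a n\<bar> + \<bar>-1\<bar> * 1) (0 + \<bar>-1\<bar> * (2 * K n)) (\<lambda>t. a n + (-1) * A n t)"
        by (intro bdiff_add bdiff_const bdiff_cmult bA)
      then show ?thesis using slope[of n] by (auto simp: d_def[abs_def] intro: bdiff_mono)
    qed
    have b0: "bdiff ?J (5 / 2) (3 * K n) (\<lambda>t. P n t + a n * Q n t)"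
    proof (rule bdiff_mono[OF bdiff_add[OF bP[of n] bdiff_cmult[OF bQ[of n]]]])
      show "9 / 4 + \<bar>a n\<bar> * 1 \<le> 5 / 2" using slope[of n] by simp
      have "\<bar>a n\<bar> * (2 * K n) \<le> 1 / 4 * (2 * K n)" using slope[of n] K0 by (intro mult_right_mono) auto
      then show "2 * K n + \<bar>a n\<bar> * (2 * K n) \<le> 3 * K n" using K0 by simp
    qed
    have V0: "bdiff ?J 20 (100 * K n) V0" unfolding V0_def[abs_def]
      by (rule bdiff_mono[OF bdiff_add[OF bdiff_cmult[OF bdiff_mult[OF b0 bk]]
        bdiff_cmult[OF bdiff_mult[OF bd bdiff_add[OF bdiff_add[OF bdiff_const bdiff_cmult[OF bdiff_mult[OF bQ bQ]]] bdiff_cmult[OF bdiff_mult[OF bQ bk]]]]]]])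
        (use K0 in simp_all)
    have V1: "bdiff ?J 20 (100 * K n) V1" unfolding V1_def[abs_def]
      by (rule bdiff_mono[OF bdiff_cmult[OF bdiff_mult[OF bd bdiff_add[OF bdiff_cmult[OF bdiff_mult[OF bQ bk]] bdiff_cmult[OF bdiff_mult[OF bk bk]]]]]])
        (use K0 in simp_all)
    have V2: "bdiff ?J 20 (100 * K n) V2" unfolding V2_def[abs_def]
      by (rule bdiff_mono[OF bdiff_cmult[OF bdiff_mult[OF bd bdiff_mult[OF bk bk]]]]) (use K0 in simp_all)
    define W0 where "W0 t = V0 t * (l t ^ 1 * \<phi>' t)" for t
    define W1 where "W1 t = V1 t * (l t ^ 2 * \<phi>' t)" for t
    define W2 where "W2 t = V2 t * (l t ^ 3 * \<phi>' t)" for t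
    have W: "\<bar>integral ?J W0\<bar> \<le> 3 / 8 ^ n" "\<bar>integral ?J W1\<bar> \<le> 3 / 8 ^ n" "\<bar>integral ?J W2\<bar> \<le> 3 / 8 ^ n"
      unfolding W0_def[abs_def] W1_def[abs_def] W2_def[abs_def] l_def \<phi>'_def
      by (rule wave_integral_bound[OF V0] wave_integral_bound[OF V1] wave_integral_bound[OF V2]; simp)+
    have cl: "continuous_on ?J l"
    proof -
      have "continuous_on ?J (\<lambda>t. tau (a n) (b n) (e n) (x t) (y t))"
        by (rule DERIV_continuous_on[OF tau_derivative[OF dx dy]])
      then show ?thesis unfolding l_def[abs_def] lam_def by (intro continuous_intros)
    qed
    have iW: "W0 integrable_on ?J" "W1 integrable_on ?J" "W2 integrable_on ?J"
      unfolding W0_def[abs_def] W1_def[abs_def] W2_def[abs_def] \<phi>'_def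
      by (intro integrable_continuous_real continuous_intros cl cx cy bdiff_continuous[OF V0] bdiff_continuous[OF V1] bdiff_continuous[OF V2])+
    have point: "U (Suc n) t * (s * x' t) \<le> U n t * (s * x' t) + s * (W0 t + W1 t + W2 t)" if t: "t \<in> ?J" for t
    proof -
      have P1: "P (Suc n) t = P n t - a n * l t * \<kappa> t" and Q1: "Q (Suc n) t = Q n t + l t * \<kappa> t"
        and A1: "A (Suc n) t = A n t + l t * (a n - A n t)"
        using True by (simp_all add: P_def Q_def A_def p_step q_step l_def \<kappa>_def)
      define c where "c = (2 - (Q n t + l t * \<kappa> t)\<^sup>2) * (1 - l t)\<^sup>2 - (2 - (Q n t)\<^sup>2)"
      have c0: "c \<le> 0" unfolding c_def
      proof (rule energy_coefficient)
        show "0 \<le> l t" "l t \<le> 1" unfolding l_def by (rule lam_bounds)+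
        show q01: "0 \<le> Q n t" "Q n t \<le> 1" using q_bounds by (auto simp: Q_def)
        have ch: "0 \<le> chi (p n j (x t) (y t))" "chi (p n j (x t) (y t)) \<le> 1" by (rule chi_bounds)+
        have "- Q n t \<le> \<kappa> t"
        proof -
          have "\<kappa> t = chi (p n j (x t) (y t)) * ((if even n then 1 else 0) - Q n t)" using True by (simp add: \<kappa>_def kap_def kappa_def Q_def)
          moreover have "chi (p n j (x t) (y t)) * (- Q n t) \<le> chi (p n j (x t) (y t)) * ((if even n then 1 else 0) - Q n t)"
            using ch by (intro mult_left_mono) auto
          moreover have "chi (p n j (x t) (y t)) * Q n t \<le> 1 * Q n t" using ch q01 by (intro mult_right_mono) auto
          ultimately show ?thesis by simp
        qed
        then have "l t * (- Q n t) \<le> l t * \<kappa> t" using lam_bounds by (intro mult_left_mono) (auto simp: l_def)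
        then show "Q n t * (1 - l t) \<le> Q n t + l t * \<kappa> t" by (simp add: algebra_simps)
      qed
      have id: "U (Suc n) t - U n t = (m t - a n) * (l t ^ 1 * V0 t + l t ^ 2 * V1 t + l t ^ 3 * V2 t) + (d t)\<^sup>2 * c"
        unfolding U_def P1 Q1 A1 V0_def V1_def V2_def c_def d_def by (rule energy_identity)
      have "(d t)\<^sup>2 * c * (s * x' t) \<le> 0" using c0 s(2)[OF t] by (intro mult_nonpos_nonneg mult_nonneg_nonpos) auto
      moreover have "(m t - a n) * (l t ^ 1 * V0 t + l t ^ 2 * V1 t + l t ^ 3 * V2 t) * (s * x' t) = s * (W0 t + W1 t + W2 t)"
        unfolding W0_def W1_def W2_def \<phi>'_def m(2)[OF t] by (simp add: algebra_simps)
      ultimately have "(U (Suc n) t - U n t) * (s * x' t) \<le> s * (W0 t + W1 t + W2 t)" unfolding id distrib_right by linarith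
      then show ?thesis by (simp add: left_diff_distrib)
    qed
    have iS: "(\<lambda>t. s * (W0 t + W1 t + W2 t)) integrable_on ?J" by (intro integrable_on_mult_right integrable_add iW)
    have "I (Suc n) \<le> integral ?J (\<lambda>t. U n t * (s * x' t) + s * (W0 t + W1 t + W2 t))"
      unfolding I_def by (rule integral_le[OF iU integrable_add[OF iU iS] point])
    also have "\<dots> = I n + integral ?J (\<lambda>t. s * (W0 t + W1 t + W2 t))"
      unfolding I_def by (rule integral_add[OF iU iS])
    also have "integral ?J (\<lambda>t. s * (W0 t + W1 t + W2 t)) = s * (integral ?J W0 + integral ?J W1 + integral ?J W2)"
      by (simp add: integral_add iW integrable_add)
    also have "\<dots> \<le> \<bar>s * (integral ?J W0 + integral ?J W1 + integral ?J W2)\<bar>" by (rule abs_ge_self)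
    also have "\<dots> = \<bar>integral ?J W0 + integral ?J W1 + integral ?J W2\<bar>" using s(1) by (simp add: abs_mult)
    also have "\<dots> \<le> 9 / 8 ^ n" using W by linarith
    finally show ?thesis using jn by simp
  qed
  have "I 0 \<le> integral ?J (\<lambda>t. 2 * \<omega>\<^sup>2)"
    unfolding I_def
  proof (rule integral_le[OF iU])
    fix t assume t: "t \<in> ?J"
    have "U 0 t = 2 * (m t - m0)\<^sup>2" by (simp add: U_def P_def Q_def A_def start)
    moreover have "(m t - m0)\<^sup>2 \<le> \<omega>\<^sup>2" using m0(2)[OF t] by (metis abs_ge_zero power2_abs power_mono)
    ultimately have "U 0 t * (s * x' t) \<le> (2 * \<omega>\<^sup>2) * 1" using s(2)[OF t] sx[OF t] by (intro mult_mono) auto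
    then show "U 0 t * (s * x' t) \<le> 2 * \<omega>\<^sup>2" by simp
  qed (rule integrable_const_ivl)
  then have I0: "I 0 \<le> 2 * \<omega>\<^sup>2 * (s1 - s0)" using s01 by (simp add: algebra_simps)
  \<comment> \<open>The errors \<open>9 / 8 ^ n\<close> from step \<open>j\<close> on sum to
    \<open>72 / 7 / 8 ^ j\<close>; the constant is rounded up to 11 and the sum is written in
    telescoped form.\<close>
  have "I n \<le> 2 * \<omega>\<^sup>2 * (s1 - s0) + (11 / 8 ^ j - 11 / 8 ^ max n j)" for n
  proof (induction n)
    case (Suc n)
    show ?case
    proof (cases "j \<le> n")
      case True
      have "11 / 8 ^ n - 11 / 8 ^ Suc n = (77 / 8) / (8::real) ^ n" by (simp add: field_simps)
      moreover have "9 / (8::real) ^ n \<le> (77 / 8) / 8 ^ n" by (intro divide_right_mono) auto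
      ultimately show ?thesis using Suc.IH step[of n] True by (simp add: max_absorb1)
    next
      case False
      then have "max n j = max (Suc n) j" by simp
      then show ?thesis using Suc.IH step[of n] False by simp
    qed
  qed (use I0 in simp)
  from this[of N] have IN: "I N \<le> 2 * \<omega>\<^sup>2 * (s1 - s0) + 11 / 8 ^ j"
  proof -
    have "0 \<le> 11 / (8::real) ^ max N j" by simp
    then show ?thesis using \<open>I N \<le> _\<close> by linarith
  qed
  have "integral ?J (\<lambda>t. (P N t + Q N t * m t)\<^sup>2 * (s * x' t)) \<le> I N"
    unfolding I_def
  proof (rule integral_le[OF _ iU])
    show "(\<lambda>t. (P N t + Q N t * m t)\<^sup>2 * (s * x' t)) integrable_on ?J"
      by (intro integrable_continuous_real continuous_intros m(1) cx bdiff_continuous[OF bP] bdiff_continuous[OF bQ])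
    fix t assume t: "t \<in> ?J"
    have "(Q N t)\<^sup>2 \<le> 1" using q_bounds[of N j "x t" "y t"] by (simp add: Q_def power_le_one)
    then have "0 \<le> (2 - (Q N t)\<^sup>2) * (m t - A N t)\<^sup>2" by (intro mult_nonneg_nonneg) auto
    then show "(P N t + Q N t * m t)\<^sup>2 * (s * x' t) \<le> U N t * (s * x' t)"
      unfolding U_def using s(2)[OF t] by (intro mult_right_mono) auto
  qed
  then show ?thesis using IN by (simp add: P_def Q_def)
qed

end

section \<open>From the energy estimate to null sets on curves\<close>

context wave_curve
begin

lemma curve_lipschitz:
  assumes "t \<in> {s0..s1}" "t' \<in> {s0..s1}"
  shows "\<bar>x t - x t'\<bar> \<le> \<bar>t - t'\<bar>" "\<bar>y t - y t'\<bar> \<le> \<bar>t - t'\<bar>"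
  using field_differentiable_bound[of "{s0..s1}" x x' 1 t t'] field_differentiable_bound[of "{s0..s1}" y y' 1 t t'] dx dy speed assms
  by auto

text \<open>Chebyshev's inequality at the single step \<open>N\<close>: where
  \<open>\<bar>p + q * m\<bar> \<ge> 3 / 4\<close>, the integrand of \<open>energy_bound\<close> is
  at least \<open>9 / 16 * (1 / 2)\<close>, and \<open>32 / 9\<close> is rounded up to 4. The sets
  \<open>B N\<close>, on which this holds at all steps from \<open>N\<close> on, increase with
  \<open>N\<close>, so the bound passes to their union.\<close>

lemma slope_set_measure:
  fixes m :: "real \<Rightarrow> real" and m0 \<omega> s :: real and j :: nat
  assumes m: "continuous_on {s0..s1} m" "\<And>t. t \<in> {s0..s1} \<Longrightarrow> y' t = m t * x' t"
    and m0: "\<bar>m0\<bar> \<le> 1" "\<And>t. t \<in> {s0..s1} \<Longrightarrow> \<bar>m t - m0\<bar> \<le> \<omega>"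
    and s: "\<bar>s\<bar> = 1" "\<And>t. t \<in> {s0..s1} \<Longrightarrow> 1 / 2 \<le> s * x' t"
    and S: "S \<subseteq> {s0..s1}" "\<And>t. t \<in> S \<Longrightarrow> \<exists>N. \<forall>n\<ge>N. 3 / 4 \<le> \<bar>p n j (x t) (y t) + q n j (x t) (y t) * m t\<bar>"
  shows "\<exists>T. S \<subseteq> T \<and> T \<in> lmeasurable \<and> measure lebesgue T \<le> 8 * \<omega>\<^sup>2 * (s1 - s0) + 44 / 8 ^ j"
proof -
  let ?J = "{s0..s1}"
  define F where "F n t = p n j (x t) (y t) + q n j (x t) (y t) * m t" for n t
  have cF: "continuous_on ?J (F n)" for n
  proof -
    have "bdiff ?J (9 / 4) (2 * K n) (\<lambda>t. p n j (x t) (y t))" using quad_p[of n j] by (auto intro: quad_bdiff p_bound)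
    moreover have "bdiff ?J 1 (2 * K n) (\<lambda>t. q n j (x t) (y t))" using quad_q[of n j] q_bounds by (auto intro!: quad_bdiff)
    ultimately show ?thesis unfolding F_def[abs_def] by (intro continuous_intros m(1) bdiff_continuous)
  qed
  define B where "B N = (\<Inter>n\<in>{N..}. ?J \<inter> (\<lambda>t. \<bar>F n t\<bar>) -` {3 / 4..})" for N
  have BJ: "B N \<subseteq> ?J" for N unfolding B_def by auto
  have Bcl: "closed (B N)" for N
    unfolding B_def by (intro closed_INT ballI continuous_closed_preimage continuous_intros cF)
  have "bounded (B N)" for N by (rule bounded_subset[OF _ BJ]) simp
  then have Bm: "B N \<in> lmeasurable" for N using Bcl by (intro lmeasurable_compact) (simp add: compact_eq_bounded_closed)
  define C where "C = 8 * \<omega>\<^sup>2 * (s1 - s0) + 44 / 8 ^ j"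
  have C0: "0 \<le> C" using s01 by (simp add: C_def)
  have mB: "measure lebesgue (B N) \<le> C" for N
  proof -
    have BNJ: "B N \<inter> ?J = B N" using BJ[of N] by blast
    have i1: "(indicat_real (B N)) integrable_on ?J" unfolding integrable_on_indicator BNJ by (rule Bm)
    have "9 / 32 * measure lebesgue (B N) = integral ?J (\<lambda>t. 9 / 32 * indicat_real (B N) t)"
      using integral_indicator[of "B N" ?J] Bm[of N] unfolding BNJ by simp
    also have "\<dots> \<le> integral ?J (\<lambda>t. (F N t)\<^sup>2 * (s * x' t))"
    proof (rule integral_le)
      show "(\<lambda>t. 9 / 32 * indicat_real (B N) t) integrable_on ?J" by (rule integrable_on_mult_right[OF i1])
      show "(\<lambda>t. (F N t)\<^sup>2 * (s * x' t)) integrable_on ?J"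
        by (intro integrable_continuous_real continuous_intros cF cx)
      fix t assume t: "t \<in> ?J"
      show "9 / 32 * indicat_real (B N) t \<le> (F N t)\<^sup>2 * (s * x' t)"
      proof (cases "t \<in> B N")
        case True
        then have "3 / 4 \<le> \<bar>F N t\<bar>" unfolding B_def by auto
        then have "(3 / 4)\<^sup>2 \<le> \<bar>F N t\<bar>\<^sup>2" by (intro power_mono) auto
        then have "9 / 16 \<le> (F N t)\<^sup>2" by (simp add: power2_eq_square)
        then have "9 / 16 * (1 / 2) \<le> (F N t)\<^sup>2 * (s * x' t)" using s(2)[OF t] by (intro mult_mono) auto
        then show ?thesis using True by simp
      next
        case False
        have "0 \<le> s * x' t" using s(2)[OF t] by linarith
        then have "0 \<le> (F N t)\<^sup>2 * (s * x' t)" by (rule mult_nonneg_nonneg[OF zero_le_power2])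
        then show ?thesis using False by simp
      qed
    qed
    also have "\<dots> \<le> 2 * \<omega>\<^sup>2 * (s1 - s0) + 11 / 8 ^ j"
      unfolding F_def by (rule energy_bound[OF m m0 s(1)]) (use s(2) in fastforce)+
    finally have "9 / 32 * measure lebesgue (B N) \<le> 2 * \<omega>\<^sup>2 * (s1 - s0) + 11 / 8 ^ j" .
    moreover have "0 \<le> \<omega>\<^sup>2 * (s1 - s0)" "0 \<le> 1 / (8::real) ^ j" using s01 by auto
    moreover have "2 * \<omega>\<^sup>2 * (s1 - s0) = 2 * (\<omega>\<^sup>2 * (s1 - s0))" "8 * \<omega>\<^sup>2 * (s1 - s0) = 8 * (\<omega>\<^sup>2 * (s1 - s0))"
      "11 / (8::real) ^ j = 11 * (1 / 8 ^ j)" "44 / (8::real) ^ j = 44 * (1 / 8 ^ j)" by simp_all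
    ultimately show ?thesis unfolding C_def by linarith
  qed
  have inc: "incseq B" unfolding B_def incseq_def by auto
  have "emeasure lebesgue (\<Union>N. B N) = (SUP N. emeasure lebesgue (B N))"
    using Bm inc by (intro SUP_emeasure_incseq[symmetric]) auto
  also have "\<dots> \<le> ennreal C"
    using Bm mB by (intro SUP_least) (simp add: emeasure_eq_measure2 ennreal_leI)
  finally have em: "emeasure lebesgue (\<Union>N. B N) \<le> ennreal C" .
  have "(\<Union>N. B N) \<in> lmeasurable"
  proof (rule fmeasurableI)
    show "(\<Union>N. B N) \<in> sets lebesgue" using Bm by (intro sets.countable_UN) auto
    show "emeasure lebesgue (\<Union>N. B N) < \<infinity>" using em by (simp add: le_less_trans)
  qed
  moreover have "measure lebesgue (\<Union>N. B N) \<le> C" unfolding measure_def using em C0 by (intro enn2real_leI)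
  moreover have "S \<subseteq> (\<Union>N. B N)"
  proof
    fix t assume t: "t \<in> S"
    then obtain N where "\<forall>n\<ge>N. 3 / 4 \<le> \<bar>F n t\<bar>" using S(2) unfolding F_def by blast
    then have "t \<in> B N" using t S(1) unfolding B_def by auto
    then show "t \<in> (\<Union>N. B N)" by blast
  qed
  ultimately show ?thesis unfolding C_def by blast
qed

text \<open>One label \<open>j\<close> with \<open>44 / 8 ^ j \<le> \<delta>\<close> is enough. At
  almost every time \<open>p + q * m\<close> converges, by \<open>slope_convergent\<close>. On
  \<open>S\<close> it is infinitely often at least \<open>15 / 8 - 3 / 4 = 9 / 8\<close> in absolute
  value, so the limit is too, and \<open>3 / 4\<close> is exceeded from some step on.\<close>

lemma flat_piece:
  fixes m :: "real \<Rightarrow> real" and \<omega> s :: real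
  assumes m: "continuous_on {s0..s1} m" "\<And>t. t \<in> {s0..s1} \<Longrightarrow> y' t = m t * x' t" "\<And>t. t \<in> {s0..s1} \<Longrightarrow> \<bar>m t\<bar> \<le> 3 / 4"
    and m0: "\<And>t. t \<in> {s0..s1} \<Longrightarrow> \<bar>m t - m s0\<bar> \<le> \<omega>"
    and s: "\<bar>s\<bar> = 1" "\<And>t. t \<in> {s0..s1} \<Longrightarrow> 1 / 2 \<le> s * x' t"
    and \<delta>: "\<delta> > 0"
    and S: "S \<subseteq> {s0..s1}" "\<And>t j N. t \<in> S \<Longrightarrow> \<exists>n\<ge>N. 15 / 8 \<le> \<bar>p n j (x t) (y t)\<bar>"
  shows "\<exists>T. S \<subseteq> T \<and> T \<in> lmeasurable \<and> measure lebesgue T \<le> 8 * \<omega>\<^sup>2 * (s1 - s0) + \<delta>"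
proof -
  obtain j where j: "44 / \<delta> < 8 ^ j" using real_arch_pow[of 8 "44 / \<delta>"] by auto
  have j': "44 / 8 ^ j \<le> \<delta>" using j \<delta> by (simp add: field_simps)
  define c :: "nat \<Rightarrow> real" where "c = (\<lambda>i. if i = j then 1 else 0)"
  have c1: "\<bar>c i\<bar> \<le> 1" for i by (simp add: c_def)
  have c2: "(\<Sum>i<n. \<bar>c i\<bar>) \<le> 2" for n
  proof -
    have "(\<Sum>i<n. \<bar>c i\<bar>) = (\<Sum>i<n. if i = j then 1 else 0)" by (rule sum.cong) (auto simp: c_def)
    also have "\<dots> \<le> 2" by simp
    finally show ?thesis .
  qed
  \<comment> \<open>Stopping the curve at its ends makes \<open>g\<close> Lipschitz on the whole
    line.\<close>
  define cl where "cl t = max s0 (min s1 t)" for t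
  have clJ: "cl t \<in> {s0..s1}" for t using s01 by (auto simp: cl_def)
  have clL: "\<bar>cl t - cl t'\<bar> \<le> \<bar>t - t'\<bar>" for t t' unfolding cl_def by (auto simp: max_def min_def)
  define g where "g t = wsum c (x (cl t)) (y (cl t))" for t
  have gL: "\<bar>g t - g t'\<bar> \<le> 16 * \<bar>t - t'\<bar>" for t t'
  proof -
    have "\<bar>g t - g t'\<bar> \<le> 8 * (\<bar>x (cl t) - x (cl t')\<bar> + \<bar>y (cl t) - y (cl t')\<bar>)"
      unfolding g_def by (rule wsum_lipschitz[where c = c, OF c1 c2])
    also have "\<dots> \<le> 8 * (\<bar>cl t - cl t'\<bar> + \<bar>cl t - cl t'\<bar>)"
      using curve_lipschitz[OF clJ clJ, of t t'] by (intro mult_left_mono add_mono) auto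
    also have "\<dots> \<le> 16 * \<bar>t - t'\<bar>" using clL[of t t'] by simp
    finally show ?thesis .
  qed
  obtain \<rho> Z where Z: "negligible Z" "\<And>t. t \<notin> Z \<Longrightarrow> (g has_real_derivative \<rho> t) (at t)"
    using lipschitz_real_derivative[of g 16] gL by metis
  define Z' where "Z' = Z \<union> {s0, s1}"
  have Z': "negligible Z'" using Z(1) unfolding Z'_def by (simp add: negligible_Un)
  define F where "F n t = p n j (x t) (y t) + q n j (x t) (y t) * m t" for n t
  have "\<exists>T. S - Z' \<subseteq> T \<and> T \<in> lmeasurable \<and> measure lebesgue T \<le> 8 * \<omega>\<^sup>2 * (s1 - s0) + 44 / 8 ^ j"
  proof (rule slope_set_measure[OF m(1,2) _ m0 s])
    show "\<bar>m s0\<bar> \<le> 1" using m(3)[of s0] s01 by simp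
    show "S - Z' \<subseteq> {s0..s1}" using S(1) by blast
    fix t assume t: "t \<in> S - Z'"
    then have ti: "t \<in> {s0<..<s1}" and tZ: "t \<notin> Z" using S(1) by (auto simp: Z'_def less_le)
    have tJ: "t \<in> {s0..s1}" using ti by auto
    have at: "at t within {s0..s1} = at t" using ti by (intro at_within_Icc_at) auto
    have dxt: "(x has_real_derivative x' t) (at t)" "(y has_real_derivative y' t) (at t)"
      using dx[OF tJ] dy[OF tJ] unfolding at by auto
    have "(g has_real_derivative \<rho> t) (at t)" by (rule Z(2)[OF tZ])
    then have dg: "((\<lambda>r. wsum c (x r) (y r)) has_real_derivative \<rho> t) (at t)"
      by (rule has_field_derivative_transform_within_open[of _ _ _ "{s0<..<s1}"]) (use ti in \<open>auto simp: g_def cl_def max_def min_def\<close>)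
    have "convergent (\<lambda>n. p n j (x t) (y t) * x' t + q n j (x t) (y t) * y' t)"
    proof (rule slope_convergent[OF dxt])
      show "0 < s1 - t" using ti by simp
      show "\<bar>x (t + r) - x t\<bar> \<le> r \<and> \<bar>y (t + r) - y t\<bar> \<le> r" if "0 \<le> r" "r < s1 - t" for r
        using curve_lipschitz[of "t + r" t] that ti by auto
      show "((\<lambda>r. wsum (\<lambda>i. if i = j then 1 else 0) (x r) (y r)) has_real_derivative \<rho> t) (at t)" using dg by (simp add: c_def)
    qed
    then have "convergent (\<lambda>n. (p n j (x t) (y t) * x' t + q n j (x t) (y t) * y' t) * (1 / x' t))"
      by (intro convergent_mult convergent_const)
    moreover have "(p n j (x t) (y t) * x' t + q n j (x t) (y t) * y' t) * (1 / x' t) = F n t" for n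
    proof -
      have "x' t \<noteq> 0" using s(2)[OF tJ] by auto
      then show ?thesis unfolding F_def m(2)[OF tJ] by (simp add: field_simps)
    qed
    ultimately have "convergent (\<lambda>n. F n t)" by (simp only:)
    then obtain L where "(\<lambda>n. F n t) \<longlonglongrightarrow> L" unfolding convergent_def by blast
    then have L: "(\<lambda>n. \<bar>F n t\<bar>) \<longlonglongrightarrow> \<bar>L\<bar>" by (rule tendsto_rabs)
    have big: "\<exists>n\<ge>N. 9 / 8 \<le> \<bar>F n t\<bar>" for N
    proof -
      obtain n where n: "n \<ge> N" "15 / 8 \<le> \<bar>p n j (x t) (y t)\<bar>" using S(2) t by blast
      have "\<bar>q n j (x t) (y t) * m t\<bar> \<le> 1 * (3 / 4)"
        unfolding abs_mult using q_bounds[of n j "x t" "y t"] m(3)[OF tJ] by (intro mult_mono) auto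
      then have "9 / 8 \<le> \<bar>F n t\<bar>" using n(2) unfolding F_def by linarith
      then show ?thesis using n(1) by blast
    qed
    have "\<not> \<bar>L\<bar> < 9 / 8"
    proof
      assume "\<bar>L\<bar> < 9 / 8"
      from order_tendstoD(2)[OF L this] obtain N where "\<And>n. n \<ge> N \<Longrightarrow> \<bar>F n t\<bar> < 9 / 8" unfolding eventually_sequentially by blast
      then show False using big[of N] by (meson not_less)
    qed
    then have "3 / 4 < \<bar>L\<bar>" by linarith
    from order_tendstoD(1)[OF L this] obtain N where "\<And>n. n \<ge> N \<Longrightarrow> 3 / 4 < \<bar>F n t\<bar>" unfolding eventually_sequentially by blast
    then show "\<exists>N. \<forall>n\<ge>N. 3 / 4 \<le> \<bar>p n j (x t) (y t) + q n j (x t) (y t) * m t\<bar>" unfolding F_def by (meson less_imp_le)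
  qed
  then obtain T where T: "S - Z' \<subseteq> T" "T \<in> lmeasurable" "measure lebesgue T \<le> 8 * \<omega>\<^sup>2 * (s1 - s0) + 44 / 8 ^ j" by blast
  have Zm: "Z' \<in> lmeasurable" "measure lebesgue Z' = 0" using Z' by (auto simp: negligible_imp_measurable negligible_imp_measure0)
  have "measure lebesgue (T \<union> Z') \<le> measure lebesgue T + measure lebesgue Z'"
    using T(2) Zm(1) by (intro measure_Un_le) auto
  then show ?thesis using T Zm j' by (intro exI[of _ "T \<union> Z'"]) (auto intro: fmeasurable.Un)
qed

end

context waves
begin

text \<open>If the initial tangent satisfies
  \<open>\<bar>y'\<bar> \<le> 5 / 8 * \<bar>x'\<bar>\<close>, the tolerance \<open>1 / 20\<close>
  leaves slopes of size at most \<open>3 / 4\<close> on the whole piece, and these oscillate by at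
  most \<open>6 * \<eta>\<close>. Otherwise \<open>\<bar>a n\<bar> \<le> 1 / 4\<close> leaves a
  speed of at least \<open>1 / 5\<close> across every line, and the piece of \<open>S\<close> is
  null by \<open>steep_null\<close>.\<close>

lemma curve_piece:
  fixes x y x' y' :: "real \<Rightarrow> real" and s0 s1 \<eta> \<delta> :: real
  assumes s01: "s0 \<le> s1" and len: "s1 - s0 \<le> 1"
    and dx: "\<And>t. t \<in> {s0..s1} \<Longrightarrow> (x has_real_derivative x' t) (at t within {s0..s1})"
    and dy: "\<And>t. t \<in> {s0..s1} \<Longrightarrow> (y has_real_derivative y' t) (at t within {s0..s1})"
    and cx: "continuous_on {s0..s1} x'" and cy: "continuous_on {s0..s1} y'"
    and unit: "\<And>t. t \<in> {s0..s1} \<Longrightarrow> (x' t)\<^sup>2 + (y' t)\<^sup>2 = 1"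
    and osc: "\<And>t. t \<in> {s0..s1} \<Longrightarrow> \<bar>x' t - x' s0\<bar> \<le> \<eta>" "\<And>t. t \<in> {s0..s1} \<Longrightarrow> \<bar>y' t - y' s0\<bar> \<le> \<eta>"
    and \<eta>: "\<eta> \<le> 1 / 20" and \<delta>: "\<delta> > 0"
    and S: "S \<subseteq> {s0..s1}" "\<And>t j N. t \<in> S \<Longrightarrow> \<exists>n\<ge>N. 15 / 8 \<le> \<bar>p n j (x t) (y t)\<bar>"
      "\<And>t N. t \<in> S \<Longrightarrow> \<exists>k\<ge>N. \<bar>y t - a k * x t - b k\<bar> < e k"
  shows "\<exists>T. S \<subseteq> T \<and> T \<in> lmeasurable \<and> measure lebesgue T \<le> 8 * (6 * \<eta>)\<^sup>2 * (s1 - s0) + \<delta>"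
proof -
  have s0J: "s0 \<in> {s0..s1}" using s01 by simp
  have speed: "\<bar>x' t\<bar> \<le> 1" "\<bar>y' t\<bar> \<le> 1" if "t \<in> {s0..s1}" for t
  proof -
    have "(x' t)\<^sup>2 \<le> 1" "(y' t)\<^sup>2 \<le> 1" using unit[OF that] zero_le_power2[of "x' t"] zero_le_power2[of "y' t"] by linarith+
    then show "\<bar>x' t\<bar> \<le> 1" "\<bar>y' t\<bar> \<le> 1" by (simp_all add: abs_square_le_1)
  qed
  have \<eta>0: "0 \<le> \<eta>" using osc(1)[OF s0J] by simp
  show ?thesis
  proof (cases "\<bar>y' s0\<bar> \<le> 5 / 8 * \<bar>x' s0\<bar>")
    case True
    have "4 / 5 \<le> \<bar>x' s0\<bar>"
    proof (rule ccontr)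
      assume "\<not> ?thesis"
      then have n: "\<bar>x' s0\<bar> < 4 / 5" by simp
      then have "\<bar>x' s0\<bar>\<^sup>2 < (4 / 5)\<^sup>2" by (intro power_strict_mono) auto
      moreover have "\<bar>y' s0\<bar>\<^sup>2 \<le> (5 / 8 * (4 / 5))\<^sup>2" using True n by (intro power_mono) auto
      ultimately show False using unit[OF s0J] by (simp add: power2_eq_square)
    qed
    note x0 = this
    define s where "s = sgn (x' s0)"
    have s: "\<bar>s\<bar> = 1" using x0 by (auto simp: s_def sgn_if)
    have sx: "3 / 4 \<le> s * x' t" if "t \<in> {s0..s1}" for t
      using osc(1)[OF that] x0 \<eta> by (auto simp: s_def sgn_if split: if_splits)
    have xa: "3 / 4 \<le> \<bar>x' t\<bar>" if "t \<in> {s0..s1}" for t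
      using sx[OF that] s by (metis abs_ge_self abs_mult mult_1 order_trans)
    have xn: "x' t \<noteq> 0" if "t \<in> {s0..s1}" for t using xa[OF that] by auto
    define m where "m t = y' t / x' t" for t
    interpret wave_curve a b K lab p q h hx hy e kap x y x' y' s0 s1
      by unfold_locales (use s01 len dx dy cx cy speed in auto)
    show ?thesis
    proof (rule flat_piece[of m "6 * \<eta>" s, OF _ _ _ _ s _ \<delta> S(1,2)])
      show "continuous_on {s0..s1} m" unfolding m_def by (intro continuous_intros cx cy) (use xn in auto)
      fix t assume t: "t \<in> {s0..s1}"
      show "y' t = m t * x' t" using xn[OF t] by (simp add: m_def)
      show "1 / 2 \<le> s * x' t" using sx[OF t] by linarith
      have "\<bar>y' t\<bar> \<le> \<bar>y' s0\<bar> + \<eta>" "\<bar>x' s0\<bar> \<le> \<bar>x' t\<bar> + \<eta>" using osc(1)[OF t] osc(2)[OF t] by linarith+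
      then have "\<bar>y' t\<bar> \<le> 3 / 4 * \<bar>x' t\<bar>" using True xa[OF t] \<eta> by linarith
      then show "\<bar>m t\<bar> \<le> 3 / 4" using xn[OF t] by (simp add: m_def abs_divide divide_le_eq)
      have "\<bar>m t - m s0\<bar> = \<bar>(y' t - y' s0) * x' s0 + y' s0 * (x' s0 - x' t)\<bar> / (\<bar>x' t\<bar> * \<bar>x' s0\<bar>)"
      proof -
        have "m t - m s0 = ((y' t - y' s0) * x' s0 + y' s0 * (x' s0 - x' t)) / (x' t * x' s0)"
          using xn[OF t] xn[OF s0J] by (simp add: m_def field_simps)
        then show ?thesis by (simp add: abs_divide abs_mult)
      qed
      also have "\<dots> \<le> (2 * \<eta>) / (3 / 4 * (3 / 4))"
      proof (rule frac_le)
        have "\<bar>(y' t - y' s0) * x' s0\<bar> \<le> \<eta> * 1" unfolding abs_mult using osc(2)[OF t] speed(1)[OF s0J] \<eta>0 by (intro mult_mono) auto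
        moreover have "\<bar>y' s0 * (x' s0 - x' t)\<bar> \<le> 1 * \<eta>"
          unfolding abs_mult using osc(1)[OF t] speed(2)[OF s0J] \<eta>0 by (intro mult_mono) (auto simp: abs_minus_commute)
        ultimately show "\<bar>(y' t - y' s0) * x' s0 + y' s0 * (x' s0 - x' t)\<bar> \<le> 2 * \<eta>" by simp
        show "3 / 4 * (3 / 4) \<le> \<bar>x' t\<bar> * \<bar>x' s0\<bar>" using xa[OF t] xa[OF s0J] by (intro mult_mono) auto
      qed (use \<eta>0 in auto)
      also have "\<dots> \<le> 6 * \<eta>" using \<eta>0 by simp
      finally show "\<bar>m t - m s0\<bar> \<le> 6 * \<eta>" .
    qed
  next
    case False
    have y0: "1 / 2 \<le> \<bar>y' s0\<bar>"
    proof (rule ccontr)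
      assume "\<not> ?thesis"
      then have n: "\<bar>y' s0\<bar> < 1 / 2" by simp
      then have "\<bar>y' s0\<bar>\<^sup>2 < (1 / 2)\<^sup>2" by (intro power_strict_mono) auto
      moreover have "\<bar>x' s0\<bar> \<le> 4 / 5" using False n by linarith
      then have "\<bar>x' s0\<bar>\<^sup>2 \<le> (4 / 5)\<^sup>2" by (intro power_mono) auto
      ultimately show False using unit[OF s0J] by (simp add: power2_eq_square)
    qed
    have steep: "1 / 5 \<le> \<bar>y' t - a n * x' t\<bar>" if t: "t \<in> {s0..s1}" for t n
    proof -
      have "\<bar>a n * x' t\<bar> \<le> 1 / 4 * \<bar>x' t\<bar>" unfolding abs_mult using slope[of n] by (intro mult_right_mono) auto
      moreover have "\<bar>x' t\<bar> \<le> \<bar>x' s0\<bar> + \<eta>" "\<bar>y' s0\<bar> \<le> \<bar>y' t\<bar> + \<eta>" using osc(1)[OF t] osc(2)[OF t] by linarith+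
      moreover have "\<bar>y' t\<bar> \<le> \<bar>y' t - a n * x' t\<bar> + \<bar>a n * x' t\<bar>" by linarith
      ultimately show ?thesis using False y0 \<eta> by linarith
    qed
    have "negligible {t \<in> {s0..s1}. \<forall>N. \<exists>k\<ge>N. \<bar>y t - a k * x t - b k\<bar> < e k}"
      by (rule steep_null[OF dx dy steep])
    moreover have "S \<subseteq> {t \<in> {s0..s1}. \<forall>N. \<exists>k\<ge>N. \<bar>y t - a k * x t - b k\<bar> < e k}" using S(1,3) by blast
    ultimately have "negligible S" by (rule negligible_subset)
    moreover have "0 \<le> 8 * (6 * \<eta>)\<^sup>2 * (s1 - s0)" using s01 by (intro mult_nonneg_nonneg) auto
    ultimately show ?thesis using \<delta>
      by (intro exI[of _ S]) (auto simp: negligible_imp_measurable negligible_imp_measure0)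
  qed
qed

text \<open>Summed over equal pieces, the bounds give \<open>8 * (6 * \<eta>)^2\<close> times the
  total length plus \<open>\<epsilon> / 2\<close>. Uniform continuity of the tangent allows pieces
  so short that its oscillation \<open>\<eta>\<close> on each of them is as small as
  desired.\<close>

lemma curve_null:
  fixes x y x' y' :: "real \<Rightarrow> real" and c0 c1 :: real
  assumes c01: "c0 < c1"
    and dx: "\<And>t. t \<in> {c0..c1} \<Longrightarrow> (x has_real_derivative x' t) (at t within {c0..c1})"
    and dy: "\<And>t. t \<in> {c0..c1} \<Longrightarrow> (y has_real_derivative y' t) (at t within {c0..c1})"
    and cx: "continuous_on {c0..c1} x'" and cy: "continuous_on {c0..c1} y'"
    and unit: "\<And>t. t \<in> {c0..c1} \<Longrightarrow> (x' t)\<^sup>2 + (y' t)\<^sup>2 = 1"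
    and S: "S \<subseteq> {c0..c1}" "\<And>t j N. t \<in> S \<Longrightarrow> \<exists>n\<ge>N. 15 / 8 \<le> \<bar>p n j (x t) (y t)\<bar>"
      "\<And>t N. t \<in> S \<Longrightarrow> \<exists>k\<ge>N. \<bar>y t - a k * x t - b k\<bar> < e k"
  shows "negligible S"
  unfolding negligible_outer_le
proof (intro allI impI)
  fix \<epsilon> :: real assume \<epsilon>: "\<epsilon> > 0"
  define \<eta> where "\<eta> = min (1 / 20) (\<epsilon> / (600 * (c1 - c0)))"
  have \<eta>: "0 < \<eta>" "\<eta> \<le> 1 / 20" "\<eta> \<le> \<epsilon> / (600 * (c1 - c0))"
  proof -
    show "0 < \<eta>" using \<epsilon> c01 by (simp add: \<eta>_def)
  qed (unfold \<eta>_def, rule min.cobounded1, rule min.cobounded2)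
  have small: "8 * (6 * \<eta>)\<^sup>2 * (c1 - c0) \<le> \<epsilon> / 2"
  proof -
    have "8 * (6 * \<eta>)\<^sup>2 * (c1 - c0) = 288 * \<eta> * (\<eta> * (c1 - c0))" by (simp add: power2_eq_square)
    also have "\<dots> \<le> 288 * 1 * (\<epsilon> / 600)"
    proof (rule mult_mono)
      have "\<eta> * (600 * (c1 - c0)) \<le> \<epsilon>" using \<eta>(3) c01 by (subst (asm) pos_le_divide_eq) simp_all
      then have "600 * (\<eta> * (c1 - c0)) \<le> \<epsilon>" unfolding mult.left_commute[of \<eta>] .
      then show "\<eta> * (c1 - c0) \<le> \<epsilon> / 600" by linarith
      show "288 * \<eta> \<le> 288 * 1" using \<eta>(2) by linarith
      show "0 \<le> \<eta> * (c1 - c0)" using \<eta>(1) c01 by (intro mult_nonneg_nonneg) linarith+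
    qed simp
    also have "288 * 1 * (\<epsilon> / 600) \<le> \<epsilon> / 2" using \<epsilon> by simp
    finally show ?thesis .
  qed
  have uc: "uniformly_continuous_on {c0..c1} x'" "uniformly_continuous_on {c0..c1} y'"
    using cx cy by (auto intro: compact_uniformly_continuous)
  obtain d1 where d1: "d1 > 0" "\<And>t t'. t \<in> {c0..c1} \<Longrightarrow> t' \<in> {c0..c1} \<Longrightarrow> dist t' t < d1 \<Longrightarrow> dist (x' t') (x' t) < \<eta>"
    using uniformly_continuous_onE[OF uc(1) \<eta>(1)] by blast
  obtain d2 where d2: "d2 > 0" "\<And>t t'. t \<in> {c0..c1} \<Longrightarrow> t' \<in> {c0..c1} \<Longrightarrow> dist t' t < d2 \<Longrightarrow> dist (y' t') (y' t) < \<eta>"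
    using uniformly_continuous_onE[OF uc(2) \<eta>(1)] by blast
  define D where "D = min (min d1 d2) 1"
  have D: "D > 0" "D \<le> d1" "D \<le> d2" "D \<le> 1" using d1(1) d2(1) by (auto simp: D_def)
  obtain M :: nat where M: "(c1 - c0) / D < M" using reals_Archimedean2 by blast
  have "0 < (c1 - c0) / D" using D(1) c01 by simp
  then have M0: "0 < real M" using M by linarith
  define \<tau> where "\<tau> = (c1 - c0) / M"
  have \<tau>: "0 < \<tau>" "\<tau> < D"
  proof -
    show "0 < \<tau>" using M0 c01 by (simp add: \<tau>_def)
    have "c1 - c0 < real M * D" using M D(1) by (simp add: pos_divide_less_eq)
    then show "\<tau> < D" using M0 by (simp add: \<tau>_def pos_divide_less_eq mult.commute)
  qed
  define J where "J i = {c0 + real i * \<tau>..c0 + real i * \<tau> + \<tau>}" for i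
  have MT: "real M * \<tau> = c1 - c0" using M0 by (simp add: \<tau>_def)
  have JJ: "J i \<subseteq> {c0..c1}" if "i < M" for i
  proof -
    have "real (Suc i) * \<tau> \<le> real M * \<tau>" using that \<tau> by (intro mult_right_mono) auto
    then have "real i * \<tau> + \<tau> \<le> c1 - c0" unfolding MT by (simp add: algebra_simps)
    moreover have "0 \<le> real i * \<tau>" using \<tau> by simp
    ultimately show ?thesis unfolding J_def by auto
  qed
  have "\<exists>T. S \<inter> J i \<subseteq> T \<and> T \<in> lmeasurable \<and> measure lebesgue T \<le> 8 * (6 * \<eta>)\<^sup>2 * \<tau> + \<epsilon> / (2 * M)" if i: "i < M" for i
  proof -
    define s0 where "s0 = c0 + real i * \<tau>"
    have Ji: "J i = {s0..s0 + \<tau>}" by (simp add: J_def s0_def)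
    have sub: "{s0..s0 + \<tau>} \<subseteq> {c0..c1}" using JJ[OF i] unfolding Ji .
    have "\<exists>T. S \<inter> J i \<subseteq> T \<and> T \<in> lmeasurable \<and> measure lebesgue T \<le> 8 * (6 * \<eta>)\<^sup>2 * ((s0 + \<tau>) - s0) + \<epsilon> / (2 * M)"
    proof (rule curve_piece)
      show "s0 \<le> s0 + \<tau>" "s0 + \<tau> - s0 \<le> 1" using \<tau> D by auto
      fix t assume t: "t \<in> {s0..s0 + \<tau>}"
      then have tc: "t \<in> {c0..c1}" using sub by blast
      show "(x has_real_derivative x' t) (at t within {s0..s0 + \<tau>})" by (rule DERIV_subset[OF dx[OF tc] sub])
      show "(y has_real_derivative y' t) (at t within {s0..s0 + \<tau>})" by (rule DERIV_subset[OF dy[OF tc] sub])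
      show "(x' t)\<^sup>2 + (y' t)\<^sup>2 = 1" by (rule unit[OF tc])
      have s0c: "s0 \<in> {c0..c1}" using sub \<tau> by auto
      have "dist t s0 < D" using t \<tau> by (auto simp: dist_real_def)
      then show "\<bar>x' t - x' s0\<bar> \<le> \<eta>" "\<bar>y' t - y' s0\<bar> \<le> \<eta>"
        using d1(2)[OF s0c tc] d2(2)[OF s0c tc] D(2,3) by (auto simp: dist_real_def)
    next
      show "continuous_on {s0..s0 + \<tau>} x'" "continuous_on {s0..s0 + \<tau>} y'"
        using continuous_on_subset[OF cx sub] continuous_on_subset[OF cy sub] by auto
      show "S \<inter> J i \<subseteq> {s0..s0 + \<tau>}" unfolding Ji by blast
    qed (use \<eta> \<epsilon> M0 S(2,3) in auto)
    then show ?thesis by simp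
  qed
  then obtain T where T: "\<And>i. i < M \<Longrightarrow> S \<inter> J i \<subseteq> T i" "\<And>i. i < M \<Longrightarrow> T i \<in> lmeasurable"
     "\<And>i. i < M \<Longrightarrow> measure lebesgue (T i) \<le> 8 * (6 * \<eta>)\<^sup>2 * \<tau> + \<epsilon> / (2 * M)" by metis
  have "S \<subseteq> (\<Union>i<M. T i)"
  proof
    fix t assume t: "t \<in> S"
    then have tc: "c0 \<le> t" "t \<le> c1" using S(1) by auto
    have "\<exists>i<M. t \<in> J i"
    proof (cases "t = c1")
      case True
      have "real (M - 1) * \<tau> + \<tau> = real M * \<tau>" using M0 by (simp add: of_nat_diff algebra_simps)
      then have "t \<in> J (M - 1)" using True \<tau> MT unfolding J_def by auto
      then show ?thesis using M0 by (intro exI[of _ "M - 1"]) auto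
    next
      case False
      define i where "i = nat \<lfloor>(t - c0) / \<tau>\<rfloor>"
      have fl: "real i \<le> (t - c0) / \<tau>" "(t - c0) / \<tau> < real i + 1"
        using tc \<tau> by (simp_all add: i_def of_nat_nat)
      have "(t - c0) / \<tau> < real M" using False tc \<tau> MT by (simp add: pos_divide_less_eq)
      then have "i < M" using fl by linarith
      moreover have "real i * \<tau> \<le> t - c0" "t - c0 < (real i + 1) * \<tau>"
        using fl \<tau>(1) by (simp_all add: pos_le_divide_eq pos_divide_less_eq)
      then have "t \<in> J i" unfolding J_def distrib_right by auto
      ultimately show ?thesis by blast
    qed
    then show "t \<in> (\<Union>i<M. T i)" using T(1) t by blast
  qed
  moreover have "(\<Union>i<M. T i) \<in> lmeasurable" using T(2) by (intro fmeasurable.finite_UN) auto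
  moreover have "measure lebesgue (\<Union>i<M. T i) \<le> \<epsilon>"
  proof -
    have "measure lebesgue (\<Union>i<M. T i) \<le> (\<Sum>i<M. measure lebesgue (T i))"
      using T(2) by (intro measure_UNION_le) auto
    also have "\<dots> \<le> (\<Sum>i<M. 8 * (6 * \<eta>)\<^sup>2 * \<tau> + \<epsilon> / (2 * M))" using T(3) by (intro sum_mono) auto
    also have "\<dots> = real M * (8 * (6 * \<eta>)\<^sup>2 * \<tau>) + \<epsilon> / 2" using M0 by (simp add: distrib_left)
    also have "real M * (8 * (6 * \<eta>)\<^sup>2 * \<tau>) = 8 * (6 * \<eta>)\<^sup>2 * (real M * \<tau>)" by (rule mult.left_commute)
    also have "8 * (6 * \<eta>)\<^sup>2 * (real M * \<tau>) + \<epsilon> / 2 \<le> \<epsilon>" using small unfolding MT by linarith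
    finally show ?thesis .
  qed
  ultimately show "\<exists>T. S \<subseteq> T \<and> T \<in> lmeasurable \<and> measure lebesgue T \<le> \<epsilon>" by blast
qed

end

section \<open>The universal differentiability set\<close>

lemma abs_components_le: "\<bar>z $ 1\<bar> + \<bar>z $ 2\<bar> \<le> 2 * norm z" for z :: "real^2"
  using component_le_norm_cart[of z 1] component_le_norm_cart[of z 2] by linarith

lemma lipschitz_on_components:
  fixes F :: "real \<Rightarrow> real \<Rightarrow> real"
  assumes M: "0 \<le> M" and F: "\<And>x y x' y'. \<bar>F x' y' - F x y\<bar> \<le> M * (\<bar>x' - x\<bar> + \<bar>y' - y\<bar>)"
  shows "(2 * M)-lipschitz_on UNIV (\<lambda>z :: real^2. F (z $ 1) (z $ 2))"
proof (rule lipschitz_onI)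
  fix z z' :: "real^2"
  have "\<bar>F (z $ 1) (z $ 2) - F (z' $ 1) (z' $ 2)\<bar> \<le> M * (\<bar>(z - z') $ 1\<bar> + \<bar>(z - z') $ 2\<bar>)"
    using F[of "z $ 1" "z $ 2" "z' $ 1" "z' $ 2"] by simp
  also have "\<dots> \<le> M * (2 * norm (z - z'))" using M by (intro mult_left_mono abs_components_le)
  finally show "dist (F (z $ 1) (z $ 2)) (F (z' $ 1) (z' $ 2)) \<le> 2 * M * dist z z'"
    by (simp add: dist_norm)
qed (use M in simp)

lemma continuous_on_components: "continuous_on UNIV (\<lambda>z :: real^2. (z $ 1, z $ 2))"
  by (intro continuous_intros)

lemma lipschitz_differentiability_point:
  fixes f :: "real^2 \<Rightarrow> real" and G :: "nat \<Rightarrow> (real \<times> real) set" and b0 :: real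
  assumes f: "C-lipschitz_on UNIV f" and b0: "0 < b0" "b0 \<le> 1" and G: "\<And>k. open (G k)"
    and GL: "\<And>a b k x. a \<in> \<rat> \<Longrightarrow> b \<in> \<rat> \<Longrightarrow> \<bar>a\<bar> < b0 \<Longrightarrow> (x, a * x + b) \<in> G k"
  shows "\<exists>z. (\<forall>k. (z $ 1, z $ 2) \<in> G k) \<and> f differentiable (at z)"
proof -
  have C: "0 \<le> C" by (rule lipschitz_on_nonneg[OF f])
  \<comment> \<open>The factor brings the Lipschitz constant to \<open>b0^2 / 16\<close>, the
    largest that \<open>preiss_setting\<close> admits; \<open>C + 1\<close> stands in for
    \<open>C\<close>, which may be 0.\<close>
  define c where "c = b0\<^sup>2 / (16 * (C + 1))"
  have c: "0 < c" using b0 C by (simp add: c_def)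
  define F where "F x y = c * f (vector [x, y])" for x y :: real
  have "preiss_setting F (c * (C + 1)) b0 G"
  proof
    fix x y x' y' :: real
    have "\<bar>f (vector [x, y]) - f (vector [x', y'])\<bar> \<le> C * norm (vector [x, y] - vector [x', y'] :: real^2)"
      using lipschitz_onD[OF f, of "vector [x, y]" "vector [x', y']"] by (simp add: dist_norm)
    also have "\<dots> \<le> (C + 1) * (\<bar>x - x'\<bar> + \<bar>y - y'\<bar>)"
    proof (rule mult_mono)
      show "norm (vector [x, y] - vector [x', y'] :: real^2) \<le> \<bar>x - x'\<bar> + \<bar>y - y'\<bar>"
        using norm_le_l1_cart[of "vector [x, y] - vector [x', y'] :: real^2"] by (simp add: sum_2)
    qed (use C in auto)
    finally have "c * \<bar>f (vector [x, y]) - f (vector [x', y'])\<bar> \<le> c * ((C + 1) * (\<bar>x - x'\<bar> + \<bar>y - y'\<bar>))"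
      using c by (intro mult_left_mono) auto
    moreover have "c * \<bar>f (vector [x, y]) - f (vector [x', y'])\<bar> = \<bar>F x y - F x' y'\<bar>"
      unfolding F_def right_diff_distrib[symmetric] abs_mult using c by simp
    ultimately show "\<bar>F x y - F x' y'\<bar> \<le> c * (C + 1) * (\<bar>x - x'\<bar> + \<bar>y - y'\<bar>)" by (simp only: mult.assoc)
  next
    show "0 < c * (C + 1)" using c C by simp
    have "X / (16 * l) * l = X / 16" if "l > 0" for X l :: real using that by simp
    from this[of "C + 1" "b0\<^sup>2"] have "c * (C + 1) = b0\<^sup>2 / 16" using C by (simp only: c_def)
    then show "16 * (c * (C + 1)) \<le> b0\<^sup>2" by simp
  qed (use b0 G GL in auto)
  from preiss_setting.differentiability_point[OF this] obtain x y P Q where xy: "\<And>n. (x, y) \<in> G n"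
    and d: "\<And>\<epsilon>. \<epsilon> > 0 \<Longrightarrow> \<exists>\<rho>>0. \<forall>u v. \<bar>u\<bar> + \<bar>v\<bar> < \<rho> \<longrightarrow> \<bar>F (x + u) (y + v) - F x y - P * u - Q * v\<bar> \<le> \<epsilon> * (\<bar>u\<bar> + \<bar>v\<bar>)" by blast
  define z :: "real^2" where "z = vector [x, y]"
  have z: "z $ 1 = x" "z $ 2 = y" by (simp_all add: z_def)
  have Fv: "F (r $ 1) (r $ 2) = c * f r" for r
  proof -
    have "vector [r $ 1, r $ 2] = r" by (simp add: vec_eq_iff forall_2)
    then show ?thesis by (simp add: F_def)
  qed
  have "(f has_derivative (\<lambda>v. P / c * v $ 1 + Q / c * v $ 2)) (at z)"
    unfolding has_derivative_at_alt
  proof (intro conjI allI impI)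
    show "bounded_linear (\<lambda>v :: real^2. P / c * v $ 1 + Q / c * v $ 2)"
      by (intro bounded_linear_add bounded_linear_const_mult bounded_linear_vec_nth)
    fix \<epsilon> :: real assume e: "0 < \<epsilon>"
    obtain \<rho> where \<rho>: "\<rho> > 0" "\<And>u v. \<bar>u\<bar> + \<bar>v\<bar> < \<rho> \<Longrightarrow> \<bar>F (x + u) (y + v) - F x y - P * u - Q * v\<bar> \<le> (\<epsilon> * c / 2) * (\<bar>u\<bar> + \<bar>v\<bar>)"
      using d[of "\<epsilon> * c / 2"] e c by auto
    show "\<exists>d>0. \<forall>r. norm (r - z) < d \<longrightarrow> norm (f r - f z - (P / c * (r - z) $ 1 + Q / c * (r - z) $ 2)) \<le> \<epsilon> * norm (r - z)"
    proof (intro exI[of _ "\<rho> / 2"] conjI allI impI)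
      fix r assume r: "norm (r - z) < \<rho> / 2"
      define u where "u = (r - z) $ 1"
      define v where "v = (r - z) $ 2"
      have uv: "\<bar>u\<bar> + \<bar>v\<bar> \<le> 2 * norm (r - z)" unfolding u_def v_def by (rule abs_components_le)
      then have "\<bar>F (x + u) (y + v) - F x y - P * u - Q * v\<bar> \<le> (\<epsilon> * c / 2) * (\<bar>u\<bar> + \<bar>v\<bar>)" using r by (intro \<rho>(2)) linarith
      also have "\<dots> \<le> (\<epsilon> * c / 2) * (2 * norm (r - z))" using uv e c by (intro mult_left_mono) auto
      finally have "\<bar>F (x + u) (y + v) - F x y - P * u - Q * v\<bar> \<le> c * (\<epsilon> * norm (r - z))" by (simp add: mult.commute mult.left_commute)
      moreover have "F (x + u) (y + v) = c * f r" "F x y = c * f z"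
        using Fv[of r] Fv[of z] by (simp_all add: u_def v_def z)
      then have "F (x + u) (y + v) - F x y - P * u - Q * v = c * (f r - f z - (P / c * u + Q / c * v))"
        using c by (simp add: right_diff_distrib distrib_left)
      ultimately have "c * \<bar>f r - f z - (P / c * u + Q / c * v)\<bar> \<le> c * (\<epsilon> * norm (r - z))"
        using c by (simp only: abs_mult abs_of_pos)
      then show "norm (f r - f z - (P / c * (r - z) $ 1 + Q / c * (r - z) $ 2)) \<le> \<epsilon> * norm (r - z)"
        using c unfolding u_def v_def real_norm_def by (simp only: mult_le_cancel_left_pos)
    qed (use \<rho> in auto)
  qed
  then show ?thesis using xy z unfolding differentiable_def by (intro exI[of _ z]) auto
qed

text \<open>Every step occurs twice in a row, since a hit is felt only at one of two consecutive steps of opposite parity.\<close>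

lemma line_enumeration:
  fixes b0 :: real
  assumes b0: "0 < b0"
  obtains a b :: "nat \<Rightarrow> real" and lab :: "nat \<Rightarrow> nat" where "\<And>n. \<bar>a n\<bar> < b0" "\<And>n. lab n \<le> n"
    "\<And>k. a (Suc (2 * k)) = a (2 * k)" "\<And>k. b (Suc (2 * k)) = b (2 * k)" "\<And>k. lab (Suc (2 * k)) = lab (2 * k)"
    "\<And>q r j N. q \<in> \<rat> \<Longrightarrow> r \<in> \<rat> \<Longrightarrow> \<bar>q\<bar> < b0 \<Longrightarrow> \<exists>k\<ge>N. a (2 * k) = q \<and> b (2 * k) = r \<and> lab (2 * k) = j"
proof -
  define D :: "nat \<Rightarrow> rat \<times> rat \<times> nat" where "D k = from_nat (fst (prod_decode k))" for k
  define a where "a n = (let q = of_rat (fst (D (n div 2))) in if \<bar>q\<bar> < b0 then q else 0)" for n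
  define b :: "nat \<Rightarrow> real" where "b n = of_rat (fst (snd (D (n div 2))))" for n
  \<comment> \<open>The default 0 enforces \<open>lab n \<le> n\<close>. As every triple recurs at
    arbitrarily late \<open>k\<close>, the label \<open>j\<close> is still attached infinitely often
    to each line.\<close>
  define lab where "lab n = (let j = snd (snd (D (n div 2))) in if j \<le> n div 2 then j else 0)" for n
  show ?thesis
  proof
    show "\<bar>a n\<bar> < b0" for n using b0 by (simp add: a_def Let_def)
    show "lab n \<le> n" for n using div_le_dividend[of n 2] by (simp add: lab_def Let_def del: div_le_dividend)
    show "a (Suc (2 * k)) = a (2 * k)" "b (Suc (2 * k)) = b (2 * k)" "lab (Suc (2 * k)) = lab (2 * k)" for k
      by (simp_all add: a_def b_def lab_def)
    fix q r :: real and j N assume q: "q \<in> \<rat>" "r \<in> \<rat>" "\<bar>q\<bar> < b0"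
    obtain q' r' where qr: "q = of_rat q'" "r = of_rat r'" using q by (auto elim!: Rats_cases)
    define k where "k = prod_encode (to_nat (q', r', j), max j N)"
    have k: "max j N \<le> k" unfolding k_def by (rule le_prod_encode_2)
    have "D k = (q', r', j)" by (simp add: D_def k_def)
    then have "a (2 * k) = q \<and> b (2 * k) = r \<and> lab (2 * k) = j" using k q(3) qr by (simp add: a_def b_def lab_def)
    then show "\<exists>k\<ge>N. a (2 * k) = q \<and> b (2 * k) = r \<and> lab (2 * k) = j" using k by auto
  qed
qed

theorem theorem1p2:
  fixes \<alpha> :: real
  assumes "\<alpha> > 0"
  shows "\<exists>E. universal_differentiability_set E \<and>
    (\<exists>h w \<beta>. lipschitz_function h \<and> w \<in> sphere 0 1 \<and> 0 \<le> \<beta> \<and> \<beta> \<le> 1 \<and> \<beta> \<le> \<alpha> \<and>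
      (\<exists>P. purely_unrectifiable P \<and>
        {z \<in> E. \<exists>v \<in> sphere 0 1 - double_cone w \<beta>. has_directional_derivative h z v} \<subseteq> P))"
proof -
  define \<beta> where "\<beta> = min \<alpha> 1"
  have \<beta>: "0 < \<beta>" "\<beta> \<le> 1" "\<beta> \<le> \<alpha>" using assms by (auto simp: \<beta>_def)
  \<comment> \<open>A unit vector outside the cone has
    \<open>\<bar>v $ 2\<bar> \<ge> \<beta>\<close>. With slopes below \<open>\<beta> / 4\<close> it
    is then transversal to all lines, with
    \<open>\<bar>v $ 2 - a n * v $ 1\<bar> \<ge> \<beta> / 2\<close>.\<close>
  define b0 where "b0 = \<beta> / 4"
  have b0: "0 < b0" "b0 \<le> 1 / 4" using \<beta> by (auto simp: b0_def)
  obtain a b :: "nat \<Rightarrow> real" and lab :: "nat \<Rightarrow> nat" where an: "\<And>n. \<bar>a n\<bar> < b0" and labn: "\<And>n. lab n \<le> n"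
    and pairs: "\<And>k. a (Suc (2 * k)) = a (2 * k)" "\<And>k. b (Suc (2 * k)) = b (2 * k)" "\<And>k. lab (Suc (2 * k)) = lab (2 * k)"
    and enum: "\<And>q r j N. q \<in> \<rat> \<Longrightarrow> r \<in> \<rat> \<Longrightarrow> \<bar>q\<bar> < b0 \<Longrightarrow> \<exists>k\<ge>N. a (2 * k) = q \<and> b (2 * k) = r \<and> lab (2 * k) = j"
    by (rule line_enumeration[OF b0(1)], rule that)
  have a4: "\<bar>a n\<bar> \<le> 1 / 4" for n using an[of n] b0 by linarith
  obtain K p q h hx hy where "waves a b K lab p q h hx hy" using waves_exist[where a = a and b = b and lab = lab, OF a4 labn] by blast
  then interpret waves a b K lab p q h hx hy "\<lambda>n. 1 / (100 * 8 ^ n * K n)" "\<lambda>n. kappa n (p n (lab n)) (q n (lab n))" .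
  define e where "e n = 1 / (100 * 8 ^ n * K n)" for n
  note epos = e_pos[folded e_def] and ehalf = e_Suc_half[folded e_def]
  \<comment> \<open>The width is that of the odd, narrower step of a pair, so that a point of the
    strip is hit by both waves of the pair. Asking for all \<open>j\<close> and \<open>N\<close>
    makes every label hit each point of \<open>E\<close> infinitely often.\<close>
  define G0 where "G0 j N = (\<Union>k\<in>{k. N \<le> k \<and> lab (2 * k) = j}. {(x, y). \<bar>y - a (2 * k) * x - b (2 * k)\<bar> < e (Suc (2 * k)) / 2})" for j N
  define G where "G i = G0 (fst (prod_decode i)) (snd (prod_decode i))" for i
  have openG0: "open (G0 j N)" for j N
    unfolding G0_def case_prod_beta by (intro open_UN ballI open_Collect_less continuous_intros)
  define E :: "(real^2) set" where "E = {z. \<forall>j N. (z $ 1, z $ 2) \<in> G0 j N}"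
  have G0_iff: "(x, y) \<in> G0 j N \<longleftrightarrow> (\<exists>k\<ge>N. lab (2 * k) = j \<and> \<bar>y - a (2 * k) * x - b (2 * k)\<bar> < e (Suc (2 * k)) / 2)" for x y j N
    unfolding G0_def by auto
  have hit: "\<exists>k\<ge>N. lab (2 * k) = j \<and> \<bar>z $ 2 - a (2 * k) * z $ 1 - b (2 * k)\<bar> < e (Suc (2 * k)) / 2" if "z \<in> E" for z j N
    using that unfolding E_def mem_Collect_eq G0_iff by blast
  have uds: "universal_differentiability_set E"
    unfolding universal_differentiability_set_def lipschitz_function_def
  proof (intro allI impI)
    fix f :: "real^2 \<Rightarrow> real" assume "\<exists>L. L-lipschitz_on UNIV f"
    then obtain L where L: "L-lipschitz_on UNIV f" ..
    have "\<exists>z. (\<forall>k. (z $ 1, z $ 2) \<in> G k) \<and> f differentiable (at z)"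
    proof (rule lipschitz_differentiability_point[OF L b0(1)])
      show "open (G k)" for k unfolding G_def by (rule openG0)
      fix q r x :: real and i assume q: "q \<in> \<rat>" "r \<in> \<rat>" "\<bar>q\<bar> < b0"
      obtain k where k: "k \<ge> snd (prod_decode i)" "a (2 * k) = q" "b (2 * k) = r" "lab (2 * k) = fst (prod_decode i)" using enum[OF q] by blast
      show "(x, q * x + r) \<in> G i"
        unfolding G_def G0_iff using k epos[of "Suc (2 * k)"] by (intro exI[of _ k]) simp_all
    qed (use b0 in simp)
    then obtain z where z: "\<And>k. (z $ 1, z $ 2) \<in> G k" "f differentiable (at z)" by blast
    have "(z $ 1, z $ 2) \<in> G0 j N" for j N using z(1)[of "prod_encode (j, N)"] by (simp add: G_def)
    then have "z \<in> E" by (simp add: E_def)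
    then show "\<exists>x\<in>E. f differentiable (at x)" using z(2) by blast
  qed
  \<comment> \<open>Every weight is positive, so that any single label can prevent a directional
    derivative, and the sum is at most 2, which keeps \<open>H\<close> Lipschitz.\<close>
  define c :: "nat \<Rightarrow> real" where "c j = (1 / 2) ^ j" for j
  have c1: "\<bar>c j\<bar> \<le> 1" for j by (simp add: c_def power_le_one)
  have c2: "(\<Sum>j<n. \<bar>c j\<bar>) \<le> 2" for n
  proof -
    have "(\<Sum>j<n. \<bar>c j\<bar>) = 2 - 2 * (1 / 2) ^ n" by (induction n) (auto simp: c_def)
    then show ?thesis by simp
  qed
  define H :: "real^2 \<Rightarrow> real" where "H z = wsum c (z $ 1) (z $ 2)" for z
  have lipH: "lipschitz_function H"
    unfolding lipschitz_function_def H_def[abs_def]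
    using lipschitz_on_components[of 8 "wsum c"] wsum_lipschitz[where c = c, OF c1 c2] by auto
  \<comment> \<open>A point of \<open>E\<close> outside \<open>P\<close> has a label
    \<open>j\<close> with \<open>\<bar>p\<bar> < 15 / 8\<close> from some step on. There
    \<open>chi\<close> stays above \<open>1 / 100\<close>, and the hits of label \<open>j\<close>
    have a lasting effect.\<close>
  define P where "P = E \<inter> {z. \<forall>j N. \<exists>n\<ge>N. 15 / 8 \<le> \<bar>p n j (z $ 1) (z $ 2)\<bar>}"
  have unrect: "purely_unrectifiable P"
    unfolding purely_unrectifiable_def
  proof (intro conjI allI impI)
    have "open ((\<lambda>z :: real^2. (z $ 1, z $ 2)) -` G0 j N)" for j N
      by (rule open_vimage[OF openG0 continuous_on_components])
    note E_open = borel_open[OF this]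
    have "(\<Inter>j. \<Inter>N. (\<lambda>z :: real^2. (z $ 1, z $ 2)) -` G0 j N) \<in> sets borel"
      by (rule sets.countable_INT'', simp, simp, rule sets.countable_INT'', simp, simp, rule E_open)
    moreover have "E = (\<Inter>j. \<Inter>N. (\<lambda>z. (z $ 1, z $ 2)) -` G0 j N)" unfolding E_def by (rule set_eqI) simp
    ultimately have "E \<in> sets borel" by (simp only:)
    moreover have "{z :: real^2. \<forall>j N. \<exists>n\<ge>N. 15 / 8 \<le> \<bar>p n j (z $ 1) (z $ 2)\<bar>} \<in> sets borel"
    proof -
      have cl: "{z :: real^2. 15 / 8 \<le> \<bar>p n j (z $ 1) (z $ 2)\<bar>} \<in> sets borel" for n j
      proof -
        obtain px py where pq: "quad (K n) (p n j) px py" using quad_p[of n j] by blast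
        have "(2 * (3 * K n))-lipschitz_on UNIV (\<lambda>z :: real^2. p n j (z $ 1) (z $ 2))"
        proof (rule lipschitz_on_components)
          show "\<bar>p n j x' y' - p n j x y\<bar> \<le> 3 * K n * (\<bar>x' - x\<bar> + \<bar>y' - y\<bar>)" for x y x' y'
            using quad_lipschitz[OF pq, of x "x' - x" y "y' - y"] by simp
        qed (use K_pos[of n] in simp)
        then have "continuous_on UNIV (\<lambda>z :: real^2. p n j (z $ 1) (z $ 2))" by (rule lipschitz_on_continuous_on)
        then show ?thesis by (intro borel_closed closed_Collect_le continuous_on_const continuous_on_rabs)
      qed
      have un: "(\<Union>n\<in>{N..}. {z :: real^2. 15 / 8 \<le> \<bar>p n j (z $ 1) (z $ 2)\<bar>}) \<in> sets borel" for j N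
        by (rule sets.countable_UN''[OF _ cl]) simp
      have "(\<Inter>j. \<Inter>N. \<Union>n\<in>{N..}. {z :: real^2. 15 / 8 \<le> \<bar>p n j (z $ 1) (z $ 2)\<bar>}) \<in> sets borel"
        by (rule sets.countable_INT'', simp, simp, rule sets.countable_INT'', simp, simp, rule un)
      moreover have "{z. \<forall>j N. \<exists>n\<ge>N. 15 / 8 \<le> \<bar>p n j (z $ 1) (z $ 2)\<bar>} =
         (\<Inter>j. \<Inter>N. \<Union>n\<in>{N..}. {z :: real^2. 15 / 8 \<le> \<bar>p n j (z $ 1) (z $ 2)\<bar>})"
        by (rule set_eqI) (simp add: Bex_def)
      ultimately show ?thesis by (simp only:)
    qed
    ultimately show "P \<in> sets borel" unfolding P_def by (rule sets.Int)
    fix c0 c1 :: real and \<gamma> :: "real \<Rightarrow> real^2" assume "C1_curve c0 c1 \<gamma>"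
    then obtain \<gamma>' where g: "c0 < c1" "\<And>t. t \<in> {c0..c1} \<Longrightarrow> (\<gamma> has_vector_derivative \<gamma>' t) (at t within {c0..c1})"
      "continuous_on {c0..c1} \<gamma>'" "\<And>t. t \<in> {c0..c1} \<Longrightarrow> norm (\<gamma>' t) = 1" unfolding C1_curve_def by blast
    have dg: "((\<lambda>t. \<gamma> t $ i) has_real_derivative \<gamma>' t $ i) (at t within {c0..c1})" if "t \<in> {c0..c1}" for t i
      unfolding has_real_derivative_iff_has_vector_derivative
      by (rule bounded_linear.has_vector_derivative[OF bounded_linear_vec_nth g(2)[OF that]])
    have "negligible {t \<in> {c0..c1}. \<gamma> t \<in> P}"
    proof (rule curve_null[where x = "\<lambda>t. \<gamma> t $ 1" and y = "\<lambda>t. \<gamma> t $ 2" and x' = "\<lambda>t. \<gamma>' t $ 1" and y' = "\<lambda>t. \<gamma>' t $ 2", OF g(1) dg dg])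
      show "continuous_on {c0..c1} (\<lambda>t. \<gamma>' t $ 1)" "continuous_on {c0..c1} (\<lambda>t. \<gamma>' t $ 2)"
        by (intro continuous_intros g(3))+
      show "(\<gamma>' t $ 1)\<^sup>2 + (\<gamma>' t $ 2)\<^sup>2 = 1" if "t \<in> {c0..c1}" for t
        using g(4)[OF that] by (simp add: norm_eq_1 inner_vec_def sum_2 power2_eq_square)
      show "{t \<in> {c0..c1}. \<gamma> t \<in> P} \<subseteq> {c0..c1}" by blast
      fix t j N assume t: "t \<in> {t \<in> {c0..c1}. \<gamma> t \<in> P}"
      then show "\<exists>n\<ge>N. 15 / 8 \<le> \<bar>p n j (\<gamma> t $ 1) (\<gamma> t $ 2)\<bar>" unfolding P_def by blast
      from t have "\<gamma> t \<in> E" unfolding P_def by blast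
      from hit[OF this, of N 0] obtain k where k: "k \<ge> N" "\<bar>\<gamma> t $ 2 - a (2 * k) * \<gamma> t $ 1 - b (2 * k)\<bar> < e (Suc (2 * k)) / 2" by blast
      then have "\<bar>\<gamma> t $ 2 - a (2 * k) * \<gamma> t $ 1 - b (2 * k)\<bar> < e (2 * k)"
        using ehalf[of "2 * k"] epos[of "2 * k"] by linarith
      then show "\<exists>k\<ge>N. \<bar>\<gamma> t $ 2 - a k * \<gamma> t $ 1 - b k\<bar> < 1 / (100 * 8 ^ k * K k)"
        using k(1) unfolding e_def by (intro exI[of _ "2 * k"] conjI) simp_all
    qed
    then show "{t \<in> {c0..c1}. \<gamma> t \<in> P} \<in> null_sets lebesgue" by (simp add: negligible_iff_null_sets)
  qed
  have sub: "{z \<in> E. \<exists>v \<in> sphere 0 1 - double_cone (axis 1 1) \<beta>. has_directional_derivative H z v} \<subseteq> P"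
  proof
    fix z assume "z \<in> {z \<in> E. \<exists>v \<in> sphere 0 1 - double_cone (axis 1 1) \<beta>. has_directional_derivative H z v}"
    then obtain v where z: "z \<in> E" and vs: "v \<in> sphere 0 1 - double_cone (axis 1 1) \<beta>" and dd: "has_directional_derivative H z v"
      by blast
    have v: "norm v = 1" "\<bar>v $ 1\<bar> < 1 - \<beta>" using vs by (auto simp: double_cone_def inner_axis)
    have v12: "\<bar>v $ 1\<bar> \<le> 1" "\<bar>v $ 2\<bar> \<le> 1" using component_le_norm_cart[of v] v(1) by metis+
    have v2: "\<beta> \<le> \<bar>v $ 2\<bar>"
    proof -
      have "\<bar>v $ 1\<bar>\<^sup>2 + \<bar>v $ 2\<bar>\<^sup>2 = 1" using v(1) by (simp add: norm_eq_1 inner_vec_def sum_2 power2_eq_square)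
      moreover have "\<bar>v $ 1\<bar>\<^sup>2 \<le> (1 - \<beta>)\<^sup>2" using v(2) by (intro power_mono) auto
      moreover have "\<beta> * \<beta> \<le> 1 * \<beta>" using \<beta> by (intro mult_right_mono) auto
      moreover have "(1 - \<beta>)\<^sup>2 = 1 - 2 * \<beta> + \<beta> * \<beta>" "\<beta>\<^sup>2 = \<beta> * \<beta>" by (simp_all add: power2_eq_square algebra_simps)
      ultimately have "\<beta>\<^sup>2 \<le> \<bar>v $ 2\<bar>\<^sup>2" by linarith
      then show ?thesis by (rule power2_le_imp_le) simp
    qed
    have c1n: "\<beta> / 2 \<le> \<bar>v $ 2 - a n * v $ 1\<bar>" for n
    proof -
      have "\<bar>a n * v $ 1\<bar> \<le> b0 * 1" using an[of n] v12(1) by (intro abs_mult_le) auto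
      then show ?thesis using v2 \<beta> unfolding b0_def by linarith
    qed
    show "z \<in> P"
    proof (rule ccontr)
      assume "z \<notin> P"
      then obtain j N0 where "\<And>n. n \<ge> N0 \<Longrightarrow> \<not> 15 / 8 \<le> \<bar>p n j (z $ 1) (z $ 2)\<bar>" using z unfolding P_def by blast
      then have small: "\<And>n. n \<ge> N0 \<Longrightarrow> \<bar>p n j (z $ 1) (z $ 2)\<bar> \<le> 15 / 8" by fastforce
      note inf = infinitely_many_hits[OF pairs hit[OF z, unfolded e_def] small]
      obtain l where l: "((\<lambda>t. (H (z + t *\<^sub>R v) - H z) / t) \<longlongrightarrow> l) (at 0)"
        using dd unfolding has_directional_derivative_def by blast
      have "\<not> ((\<lambda>t. (wsum c (z $ 1 + t * v $ 1) (z $ 2 + t * v $ 2) - wsum c (z $ 1) (z $ 2)) / t) \<longlongrightarrow> l) (at 0)"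
        by (rule no_directional_derivative[where c = c, OF c1 c2 _ v12 _ c1n inf]) (use \<beta> in \<open>auto simp: c_def\<close>)
      then show False using l by (simp add: H_def)
    qed
  qed
  have ax: "axis 1 1 \<in> sphere (0 :: real^2) 1" by (simp add: norm_axis_1)
  show ?thesis
    by (rule exI[of _ E], rule conjI[OF uds], rule exI[of _ H], rule exI[of _ "axis 1 1"], rule exI[of _ \<beta>])
      (intro conjI lipH ax less_imp_le[OF \<beta>(1)] \<beta>(2) \<beta>(3) exI[of _ P] unrect sub)
qed

end
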